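(* Assume $I$ is finite and the $A_i$, $i\in I$, are nearly compact. Let the kernel $\kappa$ be regular, and let the restrictions $\kappa(\cdot,\xi^i)|_{\breve A_i}$, $i\in I_0$, as well as the restrictions $\kappa|_{\breve A_i\times\breve A_i}$, $i\in I\setminus I_0$, be continuous. Then in either Case I or Case II and for any $\mathbf a$ and $\mathbf g$, the class $\mathfrak S^{\boldsymbol\sigma}_{\kappa,\mathbf f}(\mathbf A,\mathbf a,\mathbf g)$ of solutions of the constrained problem is nonempty, vaguely compact, and given by $$\mathfrak S^{\boldsymbol\sigma}_{\kappa,\mathbf f}(\mathbf A,\mathbf a,\mathbf g)=\bigcup_{(\boldsymbol\nu_t)_{t\in T}\in\mathbb M^{\boldsymbol\sigma}_{\kappa,\mathbf f}(\mathbf A,\mathbf a,\mathbf g)}(\boldsymbol\nu_t)'_{t\in T}.$$ Furthermore, for every $(\boldsymbol\nu_t)_{t\in T}\in\mathbb M^{\boldsymbol\sigma}_{\kappa,\mathbf f}(\mathbf A,\mathbf a,\mathbf g)$ and every $\boldsymbol\lambda\in\mathfrak S^{\boldsymbol\sigma}_{\kappa,\mathbf f}(\mathbf A,\mathbf a,\mathbf g)$, $$\lim_{t\in T}\|\boldsymbol\nu_t-\boldsymbol\lambda\|_{\mathcal E^+_\kappa(\mathbf A)}=0.$$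
   Context: **Measures and kernels.** $X$ is a locally compact Hausdorff space, $\mathfrak M(X)$ the space of real-valued (signed) Radon measures on $X$ with the vague topology (pointwise convergence on the class $C_0(X)$ of continuous functions with compact support), $\mathfrak M^+(X)$ its positive elements. Continuous functions are finite-valued. $\nu\in\mathfrak M^+(X)$ is carried by $Q\subset X$ if $X\setminus Q$ is locally $\nu$-negligible (equivalently, $Q$ is $\nu$-measurable and $\nu=\nu|_Q$); $\mathfrak M^+(Q)$ is the set of such $\nu$. $\langle\psi,\nu\rangle:=\int\psi\,d\nu$. For a topological space $Y$, $\Psi(Y)$ is the set of l.s.c. functions $Y\to(-\infty,\infty]$, required to be nonnegative unless $Y$ is compact. A kernel is a symmetric $\kappa\in\Psi(X\times X)$. Write $\kappa(\mu,\nu):=\int\kappa\,d(\mu\otimes\nu)$ and $\kappa(x,\nu):=\int\kappa(x,y)\,d\nu(y)$. The kernel is assumed positive definite: $\kappa(\nu,\nu)\geqslant0$ for every $\nu\in\mathfrak M(X)$ for which it is defined (i.e. $\kappa(\nu^+,\nu^+)+\kappa(\nu^-,\nu^-)$ or $\kappa(\nu^+,\nu^-)$ is finite). $\mathcal E_\kappa(X):=\{\nu\in\mathfrak M(X):\kappa(\nu,\nu)\text{ finite}\}$ is a pre-Hilbert space with inner product $\kappa(\mu,\nu)$; $\mathcal E^+_\kappa(Q):=\mathcal E_\kappa(X)\cap\mathfrak M^+(Q)$. The inner capacity is $c_\kappa(Q):=\bigl[\inf\{\kappa(\nu,\nu):\nu\in\mathcal E_\kappa^+(Q),\ \nu(Q)=1\}\bigr]^{-1}$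 ($\inf\varnothing=+\infty$, $1/(+\infty)=0$, $1/0=+\infty$). Potentials of measures in $\mathcal E_\kappa(X)$ are well defined and finite off a set of zero $c_\kappa$-capacity. The kernel is regular (satisfies the continuity principle) if for any $\mu\in\mathfrak M^+(X)$ with compact support $S(\mu)$, $\kappa(\cdot,\mu)$ is continuous on $X$ whenever its restriction to $S(\mu)$ is continuous. **Condenser.** $I=I^+\cup I^-$ is a countable index set, $I^+\cap I^-=\varnothing$ ($I^-$ may be empty), $s_i:=+1$ for $i\in I^+$, $s_i:=-1$ for $i\in I^-$. $\mathbf A=(A_i)_{i\in I}$ is a generalized condenser: nonempty Borel sets $A_i\subset X$ such that every compact set meets at most finitely many $A_i$, and $A_i\cap A_j=\varnothing$ for $i\in I^+$, $j\in I^-$. A set $Q\subset X$ is nearly compact if there is a compact set $\breve Q$ with $c_\kappa(Q\bigtriangleup\breve Q)=0$. For nearly compact $A_i$, $\breve A_i$ denotes such a compact set. **Vector measures.** $\mathfrak M^+(\mathbf A):=\prod_{i\in I}\mathfrak M^+(A_i)$ carries the vague topology induced by the product of vague topologies on $\mathfrak M^+(X)^{\mathrm{Card}\,I}$. A numerical series over $I$ is finite iff it has finite terms and converges absolutely. The energy of $\boldsymbol\mu=(\mu^i)_{i\in I}\in\mathfrak M^+(\mathbf A)$ is $\kappa(\boldsymbol\mu,\boldsymbol\mu):=\sum_{i,j\in I}s_is_j\kappa(\mu^i,\mu^j)$; $\mathcal E^+_\kappa(\mathbf A)$ is the set of $\boldsymbol\mu$ with finite energy. It is a semimetric space with $\|\boldsymbol\mu_1-\boldsymbol\mu_2\|_{\mathcal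 E^+_\kappa(\mathbf A)}:=\bigl[\sum_{i,j\in I}s_is_j\kappa(\mu_1^i-\mu_2^i,\mu_1^j-\mu_2^j)\bigr]^{1/2}$. **The problem.** Given: $\mathbf a=(a_i)_{i\in I}$, $a_i>0$; $\mathbf g=(g_i)_{i\in I}$ with continuous $g_i:X\to(0,\infty)$; an external field $\mathbf f=(f_i)_{i\in I}$, $f_i:X\to[-\infty,\infty]$ universally measurable; $I_0\subset I$ (possibly empty); constraints $\xi^i\in\mathfrak M^+(A_i)$, $i\in I_0$, with $\langle g_i,\xi^i\rangle>a_i$. Put $\sigma^i=\xi^i$ for $i\in I_0$, $\sigma^i=\infty$ (no constraint) for $i\in I\setminus I_0$, $\boldsymbol\sigma=(\sigma^i)_{i\in I}$. $\mathcal E^{\boldsymbol\sigma}_{\kappa,\mathbf f}(\mathbf A,\mathbf a,\mathbf g)$ is the set of $\boldsymbol\mu\in\mathcal E_\kappa^+(\mathbf A)$ with $\langle g_i,\mu^i\rangle=a_i$ for all $i\in I$, $\mu^i\leqslant\xi^i$ for all $i\in I_0$, and $\langle\mathbf f,\boldsymbol\mu\rangle:=\sum_{i\in I}\langle f_i,\mu^i\rangle$ finite. $G_{\kappa,\mathbf f}(\boldsymbol\mu):=\kappa(\boldsymbol\mu,\boldsymbol\mu)+2\langle\mathbf f,\boldsymbol\mu\rangle$; $G^{\boldsymbol\sigma}_{\kappa,\mathbf f}(\mathbf A,\mathbf a,\mathbf g):=\inf G_{\kappa,\mathbf f}$ over $\mathcal E^{\boldsymbol\sigma}_{\kappa,\mathbf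 f}(\mathbf A,\mathbf a,\mathbf g)$. The constrained problem asks for $\boldsymbol\lambda\in\mathcal E^{\boldsymbol\sigma}_{\kappa,\mathbf f}(\mathbf A,\mathbf a,\mathbf g)$ attaining this infimum; $\mathfrak S^{\boldsymbol\sigma}_{\kappa,\mathbf f}(\mathbf A,\mathbf a,\mathbf g)$ is the class of all such $\boldsymbol\lambda$. $\mathbb M^{\boldsymbol\sigma}_{\kappa,\mathbf f}(\mathbf A,\mathbf a,\mathbf g)$ is the class of minimizing nets: nets $(\boldsymbol\mu_s)_{s\in S}\subset\mathcal E^{\boldsymbol\sigma}_{\kappa,\mathbf f}(\mathbf A,\mathbf a,\mathbf g)$ with $\lim_{s\in S}G_{\kappa,\mathbf f}(\boldsymbol\mu_s)=G^{\boldsymbol\sigma}_{\kappa,\mathbf f}(\mathbf A,\mathbf a,\mathbf g)$. $(\boldsymbol\mu_s)'_{s\in S}$ is the set of vague cluster points of the net in $\mathfrak M^+(X)^{\mathrm{Card}\,I}$. **Permanent assumptions.** $\mathcal E^{\boldsymbol\sigma}_{\kappa,\mathbf f}(\mathbf A,\mathbf a,\mathbf g)\ne\varnothing$, i.e. $G^{\boldsymbol\sigma}_{\kappa,\mathbf f}(\mathbf A,\mathbf a,\mathbf g)<\infty$. Either $X$ is countable at infinity (a countable union of compact sets), or $\inf_{A_i}g_i>0$ for all $i\in I$. One of the following holds: Case I: $f_i\in\Psi(X)$ for all $i\in I$; Case II: $f_i=s_i\kappa(\cdot,\zeta)$ for all $i\in I$, where $\zeta\in\mathcal E_\kappa(X)$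 is a given signed measure. *)

theory Defs
  imports "HOL-Analysis.Analysis"
begin

section \<open>Radon measures\<close>

text \<open>Continuous real functions with compact support (written \<open>C_0(X)\<close> in the source).\<close>

definition Cc :: "('a::topological_space \<Rightarrow> real) set" where
  "Cc = {\<phi>. continuous_on UNIV \<phi> \<and> compact (closure {x. \<phi> x \<noteq> 0})}"

text \<open>Positive Radon measures on a locally compact Hausdorff space are represented by Borel
  measures that are finite on compact sets and inner regular on all Borel sets. These correspond
  one-to-one to the positive linear functionals on \<^const>\<open>Cc\<close>. On spaces that are not countable at
  infinity this is the essential measure of Bourbaki, so a Borel set is null iff it is locally
  negligible.\<close>

definition radon :: "'a::t2_space measure set" where
  "radon = {\<mu>. sets \<mu> = sets borel \<and>
      (\<forall>K. compact K \<longrightarrow> emeasure \<mu> K < \<infinity>) \<and>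
      (\<forall>B\<in>sets borel. emeasure \<mu> B = (SUP K\<in>{K. compact K \<and> K \<subseteq> B}. emeasure \<mu> K))}"

definition msupport :: "'a::t2_space measure \<Rightarrow> 'a set" where
  "msupport \<mu> = {x. \<forall>U. open U \<and> x \<in> U \<longrightarrow> emeasure \<mu> U > 0}"

text \<open>The set \<open>Q\<close> is arbitrary; its complement is locally negligible.\<close>

definition carried :: "'a::t2_space measure \<Rightarrow> 'a set \<Rightarrow> bool" where
  "carried \<mu> Q \<longleftrightarrow> (\<forall>K. compact K \<longrightarrow> K - Q \<in> null_sets (completion \<mu>))"

definition radon_on :: "'a::t2_space set \<Rightarrow> 'a measure set" where
  "radon_on Q = {\<mu> \<in> radon. carried \<mu> Q}"

definition vague_topology :: "'a::t2_space measure topology" where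
  "vague_topology =
     pullback_topology radon (\<lambda>\<mu>. restrict (\<lambda>\<phi>. \<integral>x. \<phi> x \<partial>\<mu>) Cc)
       (product_topology (\<lambda>_. euclideanreal) Cc)"

text \<open>Signed Radon measures are the linear functionals on \<^const>\<open>Cc\<close> that are bounded on the
  functions supported in any given compact set. Values outside \<^const>\<open>Cc\<close> are irrelevant.\<close>

definition signed_radon :: "(('a::t2_space \<Rightarrow> real) \<Rightarrow> real) set" where
  "signed_radon = {\<nu>.
      (\<forall>\<phi>\<in>Cc. \<forall>\<psi>\<in>Cc. \<forall>b c. \<nu> (\<lambda>x. b * \<phi> x + c * \<psi> x) = b * \<nu> \<phi> + c * \<nu> \<psi>) \<and>
      (\<forall>K. compact K \<longrightarrow>
         (\<exists>C. \<forall>\<phi>\<in>Cc. (\<forall>x. x \<notin> K \<longrightarrow> \<phi> x = 0) \<longrightarrow> \<bar>\<nu> \<phi>\<bar> \<le> C * (SUP x. \<bar>\<phi> x\<bar>)))}"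

text \<open>Jordan decomposition: \<open>\<nu>\<^sup>+\<close> is the positive Radon measure with
  \<open>\<nu>\<^sup>+(\<phi>) = sup {\<nu>(\<psi>) | 0 \<le> \<psi> \<le> \<phi>}\<close> for \<open>0 \<le> \<phi> \<in> Cc\<close>.\<close>

definition pos_part :: "(('a::t2_space \<Rightarrow> real) \<Rightarrow> real) \<Rightarrow> 'a measure" where
  "pos_part \<nu> = (THE \<mu>. \<mu> \<in> radon \<and>
      (\<forall>\<phi>\<in>Cc. (\<forall>x. 0 \<le> \<phi> x) \<longrightarrow>
         (\<integral>x. \<phi> x \<partial>\<mu>) = Sup (\<nu> ` {\<psi>\<in>Cc. \<forall>x. 0 \<le> \<psi> x \<and> \<psi> x \<le> \<phi> x})))"

definition neg_part :: "(('a::t2_space \<Rightarrow> real) \<Rightarrow> real) \<Rightarrow> 'a measure" where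
  "neg_part \<nu> = pos_part (\<lambda>\<phi>. - \<nu> \<phi>)"

text \<open>The difference \<open>\<mu> - \<nu>\<close> of two positive Radon measures, as an element of
  \<^const>\<open>signed_radon\<close>.\<close>

definition radon_diff :: "'a::t2_space measure \<Rightarrow> 'a measure \<Rightarrow> (('a \<Rightarrow> real) \<Rightarrow> real)" where
  "radon_diff \<mu> \<nu> = (\<lambda>\<phi>. (\<integral>x. \<phi> x \<partial>\<mu>) - (\<integral>x. \<phi> x \<partial>\<nu>))"

text \<open>The tensor product of Radon measures lives on the Borel sets of the product space, in general
  a larger \<open>\<sigma>\<close>-algebra than the one carried by \<^const>\<open>pair_measure\<close>.\<close>

definition radon_prod :: "'a::t2_space measure \<Rightarrow> 'a measure \<Rightarrow> ('a \<times> 'a) measure" where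
  "radon_prod \<mu> \<nu> = (THE \<rho>. \<rho> \<in> radon \<and>
      (\<forall>\<phi>\<in>Cc. \<forall>\<psi>\<in>Cc.
         (\<integral>z. \<phi> (fst z) * \<psi> (snd z) \<partial>\<rho>) = (\<integral>x. \<phi> x \<partial>\<mu>) * (\<integral>y. \<psi> y \<partial>\<nu>)))"

text \<open>Integral of an extended real function. It is meaningful if the positive or the negative part
  has a finite integral, and by the convention \<open>\<infinity> - \<infinity> = \<infinity>\<close> of type \<^typ>\<open>ereal\<close> its value is
  finite iff both parts have finite integrals.\<close>

definition eint :: "'b measure \<Rightarrow> ('b \<Rightarrow> ereal) \<Rightarrow> ereal" where
  "eint M \<psi> = enn2ereal (\<integral>\<^sup>+x. e2ennreal (\<psi> x) \<partial>M) - enn2ereal (\<integral>\<^sup>+x. e2ennreal (- \<psi> x) \<partial>M)"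

text \<open>Measurability with respect to every Radon measure, which is a local notion.\<close>

definition universally_measurable :: "('a::t2_space \<Rightarrow> ereal) \<Rightarrow> bool" where
  "universally_measurable \<psi> \<longleftrightarrow>
     (\<forall>\<mu>\<in>radon. \<forall>K. compact K \<longrightarrow> \<psi> \<in> borel_measurable (completion (density \<mu> (indicator K))))"


section \<open>Kernels, energy and capacity\<close>

text \<open>The class \<open>\<Psi>(Y)\<close>.\<close>

definition Psi :: "('b::topological_space \<Rightarrow> ereal) set" where
  "Psi = {\<psi>. (\<forall>c. open {y. c < \<psi> y}) \<and> (\<forall>y. \<psi> y \<noteq> -\<infinity>) \<and>
             (compact (UNIV :: 'b set) \<or> (\<forall>y. 0 \<le> \<psi> y))}"

definition fin_continuous_on :: "'b::topological_space set \<Rightarrow> ('b \<Rightarrow> ereal) \<Rightarrow> bool" where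
  "fin_continuous_on S \<psi> \<longleftrightarrow> continuous_on S \<psi> \<and> (\<forall>x\<in>S. \<bar>\<psi> x\<bar> \<noteq> \<infinity>)"

definition is_kernel :: "('a::t2_space \<times> 'a \<Rightarrow> ereal) \<Rightarrow> bool" where
  "is_kernel \<kappa> \<longleftrightarrow> \<kappa> \<in> Psi \<and> (\<forall>x y. \<kappa> (x, y) = \<kappa> (y, x))"

definition energy :: "('a::t2_space \<times> 'a \<Rightarrow> ereal) \<Rightarrow> 'a measure \<Rightarrow> 'a measure \<Rightarrow> ereal" where
  "energy \<kappa> \<mu> \<nu> = eint (radon_prod \<mu> \<nu>) \<kappa>"

definition potential :: "('a::t2_space \<times> 'a \<Rightarrow> ereal) \<Rightarrow> 'a measure \<Rightarrow> 'a \<Rightarrow> ereal" where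
  "potential \<kappa> \<nu> x = eint \<nu> (\<lambda>y. \<kappa> (x, y))"

text \<open>The integral of \<open>\<kappa>\<close> against the signed measure \<open>\<mu> \<otimes> \<nu>\<close>, whose positive and negative parts are
  \<open>\<mu>\<^sup>+ \<otimes> \<nu>\<^sup>+ + \<mu>\<^sup>- \<otimes> \<nu>\<^sup>-\<close> and \<open>\<mu>\<^sup>+ \<otimes> \<nu>\<^sup>- + \<mu>\<^sup>- \<otimes> \<nu>\<^sup>+\<close>.\<close>

definition senergy ::
  "('a::t2_space \<times> 'a \<Rightarrow> ereal) \<Rightarrow> (('a \<Rightarrow> real) \<Rightarrow> real) \<Rightarrow> (('a \<Rightarrow> real) \<Rightarrow> real) \<Rightarrow> ereal" where
  "senergy \<kappa> \<mu> \<nu> =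
     (energy \<kappa> (pos_part \<mu>) (pos_part \<nu>) + energy \<kappa> (neg_part \<mu>) (neg_part \<nu>)) -
     (energy \<kappa> (pos_part \<mu>) (neg_part \<nu>) + energy \<kappa> (neg_part \<mu>) (pos_part \<nu>))"

definition senergy_defined :: "('a::t2_space \<times> 'a \<Rightarrow> ereal) \<Rightarrow> (('a \<Rightarrow> real) \<Rightarrow> real) \<Rightarrow> bool" where
  "senergy_defined \<kappa> \<nu> \<longleftrightarrow>
     \<bar>energy \<kappa> (pos_part \<nu>) (pos_part \<nu>) + energy \<kappa> (neg_part \<nu>) (neg_part \<nu>)\<bar> \<noteq> \<infinity> \<or>
     \<bar>energy \<kappa> (pos_part \<nu>) (neg_part \<nu>)\<bar> \<noteq> \<infinity>"

definition positive_definite :: "('a::t2_space \<times> 'a \<Rightarrow> ereal) \<Rightarrow> bool" where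
  "positive_definite \<kappa> \<longleftrightarrow>
     (\<forall>\<nu>\<in>signed_radon. senergy_defined \<kappa> \<nu> \<longrightarrow> 0 \<le> senergy \<kappa> \<nu> \<nu>)"

definition finite_energy :: "('a::t2_space \<times> 'a \<Rightarrow> ereal) \<Rightarrow> (('a \<Rightarrow> real) \<Rightarrow> real) set" where
  "finite_energy \<kappa> =
     {\<nu> \<in> signed_radon. senergy_defined \<kappa> \<nu> \<and> \<bar>senergy \<kappa> \<nu> \<nu>\<bar> \<noteq> \<infinity>}"

definition regular_kernel :: "('a::t2_space \<times> 'a \<Rightarrow> ereal) \<Rightarrow> bool" where
  "regular_kernel \<kappa> \<longleftrightarrow>
     (\<forall>\<mu>\<in>radon. compact (msupport \<mu>) \<and> fin_continuous_on (msupport \<mu>) (potential \<kappa> \<mu>)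
        \<longrightarrow> fin_continuous_on UNIV (potential \<kappa> \<mu>))"

text \<open>Type \<^typ>\<open>ereal\<close> has \<open>Inf {} = \<infinity>\<close>, \<open>1 / \<infinity> = 0\<close> and \<open>1 / 0 = \<infinity>\<close>, as required.\<close>

definition inner_capacity :: "('a::t2_space \<times> 'a \<Rightarrow> ereal) \<Rightarrow> 'a set \<Rightarrow> ereal" where
  "inner_capacity \<kappa> Q =
     1 / (INF \<nu>\<in>{\<nu> \<in> radon_on Q. \<bar>energy \<kappa> \<nu> \<nu>\<bar> \<noteq> \<infinity> \<and> emeasure (completion \<nu>) Q = 1}. energy \<kappa> \<nu> \<nu>)"

text \<open>\<open>Q\<close> is nearly compact iff such a compact \<open>Q'\<close> exists.\<close>

definition nearly_compact_via ::
  "('a::t2_space \<times> 'a \<Rightarrow> ereal) \<Rightarrow> 'a set \<Rightarrow> 'a set \<Rightarrow> bool" where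
  "nearly_compact_via \<kappa> Q Q' \<longleftrightarrow> compact Q' \<and> inner_capacity \<kappa> ((Q - Q') \<union> (Q' - Q)) = 0"


section \<open>Condensers and vector measures\<close>

text \<open>\<open>I1\<close> and \<open>I2\<close> are the sets of indices of positive and of negative sign.\<close>

definition generalized_condenser :: "'i set \<Rightarrow> 'i set \<Rightarrow> ('i \<Rightarrow> 'a::t2_space set) \<Rightarrow> bool" where
  "generalized_condenser I1 I2 A \<longleftrightarrow>
     countable (I1 \<union> I2) \<and> I1 \<inter> I2 = {} \<and>
     (\<forall>i\<in>I1 \<union> I2. A i \<in> sets borel \<and> A i \<noteq> {}) \<and>
     (\<forall>K. compact K \<longrightarrow> finite {i \<in> I1 \<union> I2. A i \<inter> K \<noteq> {}}) \<and>
     (\<forall>i\<in>I1. \<forall>j\<in>I2. A i \<inter> A j = {})"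

definition isign :: "'i set \<Rightarrow> 'i \<Rightarrow> real" where
  "isign I1 i = (if i \<in> I1 then 1 else -1)"

text \<open>A numerical series is finite iff its terms are finite and it converges absolutely.\<close>

definition series_finite :: "('j \<Rightarrow> ereal) \<Rightarrow> 'j set \<Rightarrow> bool" where
  "series_finite u J \<longleftrightarrow> (\<forall>j\<in>J. \<bar>u j\<bar> \<noteq> \<infinity>) \<and> (\<lambda>j. \<bar>real_of_ereal (u j)\<bar>) summable_on J"

definition series_sum :: "('j \<Rightarrow> ereal) \<Rightarrow> 'j set \<Rightarrow> real" where
  "series_sum u J = infsum (\<lambda>j. real_of_ereal (u j)) J"

text \<open>Vector measures are functions on the index set, extended by \<^const>\<open>undefined\<close> outside it.\<close>

definition vec_measures :: "'i set \<Rightarrow> ('i \<Rightarrow> 'a::t2_space set) \<Rightarrow> ('i \<Rightarrow> 'a measure) set" where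
  "vec_measures I A = (\<Pi>\<^sub>E i\<in>I. radon_on (A i))"

definition vec_vague :: "'i set \<Rightarrow> ('i \<Rightarrow> 'a::t2_space measure) topology" where
  "vec_vague I = product_topology (\<lambda>_. vague_topology) I"

definition energy_term :: "('a::t2_space \<times> 'a \<Rightarrow> ereal) \<Rightarrow> 'i set \<Rightarrow> ('i \<Rightarrow> 'a measure) \<Rightarrow>
    'i \<times> 'i \<Rightarrow> ereal" where
  "energy_term \<kappa> I1 \<mu> = (\<lambda>(i, j). ereal (isign I1 i * isign I1 j) * energy \<kappa> (\<mu> i) (\<mu> j))"

definition vec_energy ::
  "('a::t2_space \<times> 'a \<Rightarrow> ereal) \<Rightarrow> 'i set \<Rightarrow> 'i set \<Rightarrow> ('i \<Rightarrow> 'a measure) \<Rightarrow> real" where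
  "vec_energy \<kappa> I1 I2 \<mu> = series_sum (energy_term \<kappa> I1 \<mu>) ((I1 \<union> I2) \<times> (I1 \<union> I2))"

definition vec_finite_energy ::
  "('a::t2_space \<times> 'a \<Rightarrow> ereal) \<Rightarrow> 'i set \<Rightarrow> 'i set \<Rightarrow> ('i \<Rightarrow> 'a set) \<Rightarrow> ('i \<Rightarrow> 'a measure) set" where
  "vec_finite_energy \<kappa> I1 I2 A =
     {\<mu> \<in> vec_measures (I1 \<union> I2) A.
        series_finite (energy_term \<kappa> I1 \<mu>) ((I1 \<union> I2) \<times> (I1 \<union> I2))}"

definition vec_dist :: "('a::t2_space \<times> 'a \<Rightarrow> ereal) \<Rightarrow> 'i set \<Rightarrow> 'i set \<Rightarrow>
    ('i \<Rightarrow> 'a measure) \<Rightarrow> ('i \<Rightarrow> 'a measure) \<Rightarrow> real" where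
  "vec_dist \<kappa> I1 I2 \<mu> \<nu> =
     sqrt (series_sum
       (\<lambda>(i, j). ereal (isign I1 i * isign I1 j) *
          senergy \<kappa> (radon_diff (\<mu> i) (\<nu> i)) (radon_diff (\<mu> j) (\<nu> j)))
       ((I1 \<union> I2) \<times> (I1 \<union> I2)))"


section \<open>The constrained problem\<close>

definition admissible :: "('a::t2_space \<times> 'a \<Rightarrow> ereal) \<Rightarrow> 'i set \<Rightarrow> 'i set \<Rightarrow> ('i \<Rightarrow> 'a set) \<Rightarrow>
    ('i \<Rightarrow> real) \<Rightarrow> ('i \<Rightarrow> 'a \<Rightarrow> real) \<Rightarrow> ('i \<Rightarrow> 'a \<Rightarrow> ereal) \<Rightarrow> 'i set \<Rightarrow> ('i \<Rightarrow> 'a measure) \<Rightarrow>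
    ('i \<Rightarrow> 'a measure) set" where
  "admissible \<kappa> I1 I2 A a g f I0 \<xi> =
     {\<mu> \<in> vec_finite_energy \<kappa> I1 I2 A.
        (\<forall>i\<in>I1 \<union> I2. eint (\<mu> i) (\<lambda>x. ereal (g i x)) = ereal (a i)) \<and>
        (\<forall>i\<in>I0. \<mu> i \<le> \<xi> i) \<and>
        series_finite (\<lambda>i. eint (\<mu> i) (f i)) (I1 \<union> I2)}"

definition Gauss :: "('a::t2_space \<times> 'a \<Rightarrow> ereal) \<Rightarrow> 'i set \<Rightarrow> 'i set \<Rightarrow> ('i \<Rightarrow> 'a \<Rightarrow> ereal) \<Rightarrow>
    ('i \<Rightarrow> 'a measure) \<Rightarrow> real" where
  "Gauss \<kappa> I1 I2 f \<mu> =
     vec_energy \<kappa> I1 I2 \<mu> + 2 * series_sum (\<lambda>i. eint (\<mu> i) (f i)) (I1 \<union> I2)"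

definition Gauss_inf :: "('a::t2_space \<times> 'a \<Rightarrow> ereal) \<Rightarrow> 'i set \<Rightarrow> 'i set \<Rightarrow> ('i \<Rightarrow> 'a set) \<Rightarrow>
    ('i \<Rightarrow> real) \<Rightarrow> ('i \<Rightarrow> 'a \<Rightarrow> real) \<Rightarrow> ('i \<Rightarrow> 'a \<Rightarrow> ereal) \<Rightarrow> 'i set \<Rightarrow> ('i \<Rightarrow> 'a measure) \<Rightarrow> ereal" where
  "Gauss_inf \<kappa> I1 I2 A a g f I0 \<xi> =
     (INF \<mu>\<in>admissible \<kappa> I1 I2 A a g f I0 \<xi>. ereal (Gauss \<kappa> I1 I2 f \<mu>))"

definition solutions :: "('a::t2_space \<times> 'a \<Rightarrow> ereal) \<Rightarrow> 'i set \<Rightarrow> 'i set \<Rightarrow> ('i \<Rightarrow> 'a set) \<Rightarrow>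
    ('i \<Rightarrow> real) \<Rightarrow> ('i \<Rightarrow> 'a \<Rightarrow> real) \<Rightarrow> ('i \<Rightarrow> 'a \<Rightarrow> ereal) \<Rightarrow> 'i set \<Rightarrow> ('i \<Rightarrow> 'a measure) \<Rightarrow>
    ('i \<Rightarrow> 'a measure) set" where
  "solutions \<kappa> I1 I2 A a g f I0 \<xi> =
     {\<mu> \<in> admissible \<kappa> I1 I2 A a g f I0 \<xi>.
        ereal (Gauss \<kappa> I1 I2 f \<mu>) = Gauss_inf \<kappa> I1 I2 A a g f I0 \<xi>}"

text \<open>A net is a triple of a directed index set, its preorder, and the indexed family.\<close>

definition directed_set :: "'t set \<Rightarrow> ('t \<Rightarrow> 't \<Rightarrow> bool) \<Rightarrow> bool" where
  "directed_set T le \<longleftrightarrow> T \<noteq> {} \<and> (\<forall>t\<in>T. le t t) \<and>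
     (\<forall>r\<in>T. \<forall>s\<in>T. \<forall>t\<in>T. le r s \<longrightarrow> le s t \<longrightarrow> le r t) \<and>
     (\<forall>r\<in>T. \<forall>s\<in>T. \<exists>t\<in>T. le r t \<and> le s t)"

definition net_filter :: "'t set \<Rightarrow> ('t \<Rightarrow> 't \<Rightarrow> bool) \<Rightarrow> 't filter" where
  "net_filter T le = (INF t\<in>T. principal {s \<in> T. le t s})"

definition net_cluster_points ::
  "'b topology \<Rightarrow> 't set \<Rightarrow> ('t \<Rightarrow> 't \<Rightarrow> bool) \<Rightarrow> ('t \<Rightarrow> 'b) \<Rightarrow> 'b set" where
  "net_cluster_points V T le \<nu> =
     {y \<in> topspace V. \<forall>U. openin V U \<and> y \<in> U \<longrightarrow> (\<forall>t\<in>T. \<exists>s\<in>T. le t s \<and> \<nu> s \<in> U)}"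

text \<open>The type \<open>'t\<close> of indices is arbitrary.\<close>

definition minimizing_nets :: "('a::t2_space \<times> 'a \<Rightarrow> ereal) \<Rightarrow> 'i set \<Rightarrow> 'i set \<Rightarrow>
    ('i \<Rightarrow> 'a set) \<Rightarrow> ('i \<Rightarrow> real) \<Rightarrow> ('i \<Rightarrow> 'a \<Rightarrow> real) \<Rightarrow> ('i \<Rightarrow> 'a \<Rightarrow> ereal) \<Rightarrow> 'i set \<Rightarrow>
    ('i \<Rightarrow> 'a measure) \<Rightarrow> ('t set \<times> ('t \<Rightarrow> 't \<Rightarrow> bool) \<times> ('t \<Rightarrow> 'i \<Rightarrow> 'a measure)) set" where
  "minimizing_nets \<kappa> I1 I2 A a g f I0 \<xi> =
     {(T, le, \<nu>). directed_set T le \<and>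
        (\<forall>t\<in>T. \<nu> t \<in> admissible \<kappa> I1 I2 A a g f I0 \<xi>) \<and>
        ((\<lambda>t. ereal (Gauss \<kappa> I1 I2 f (\<nu> t))) \<longlongrightarrow> Gauss_inf \<kappa> I1 I2 A a g f I0 \<xi>)
          (net_filter T le)}"

definition case_I :: "'i set \<Rightarrow> ('i \<Rightarrow> 'a::t2_space \<Rightarrow> ereal) \<Rightarrow> bool" where
  "case_I I f \<longleftrightarrow> (\<forall>i\<in>I. f i \<in> Psi)"

text \<open>The potential of \<open>\<zeta>\<close> is defined only off a set of zero capacity, so \<open>f i\<close> is prescribed only
  where the two potentials are not both infinite.\<close>

definition case_II :: "('a::t2_space \<times> 'a \<Rightarrow> ereal) \<Rightarrow> 'i set \<Rightarrow> 'i set \<Rightarrow>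
    ('i \<Rightarrow> 'a \<Rightarrow> ereal) \<Rightarrow> bool" where
  "case_II \<kappa> I1 I2 f \<longleftrightarrow>
     (\<exists>\<zeta>\<in>finite_energy \<kappa>. \<forall>i\<in>I1 \<union> I2. \<forall>x.
        \<bar>potential \<kappa> (pos_part \<zeta>) x\<bar> \<noteq> \<infinity> \<or> \<bar>potential \<kappa> (neg_part \<zeta>) x\<bar> \<noteq> \<infinity> \<longrightarrow>
        f i x = ereal (isign I1 i) *
          (potential \<kappa> (pos_part \<zeta>) x - potential \<kappa> (neg_part \<zeta>) x))"

definition countable_at_infinity :: "'a::topological_space itself \<Rightarrow> bool" where
  "countable_at_infinity _ \<longleftrightarrow> (\<exists>\<K>. countable \<K> \<and> (\<forall>K\<in>\<K>. compact K) \<and> \<Union>\<K> = (UNIV :: 'a set))"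

end

theory Submission
  imports Defs
begin

text \<open>On each compact set \<open>Ac i\<close> consider the measures \<open>\<theta>\<close> with \<open>\<integral>g d\<theta> = a\<close> (and \<open>\<theta> \<le> \<xi>\<close> if the
  index is constrained). Since \<open>g\<close> is bounded below on \<open>Ac i\<close>, their masses are bounded and the class
  is vaguely compact. A measure of finite energy does not charge sets of zero capacity, so up to the
  vector structure the admissible measures are exactly the products of these classes with
  finite external energy.

  The energy is a supremum of the integrals of the continuous minorants \<open>h\<close> of the (shifted,
  nonnegative) kernel. By Dini's theorem the continuity of \<open>\<kappa>(\<cdot>, \<xi>)\<close>, respectively of \<open>\<kappa>\<close>, on the
  compact sets makes this supremum uniform on the class; since integrals of \<open>h\<close> are vaguely
  continuous, vague convergence inside the class implies convergence in the energy seminorm. Hence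
  the Gauss functional is vaguely lower semicontinuous on a compact convex set, and its minimizers
  are the vague cluster points of minimizing nets. The parallelogram law gives
  strong convergence.\<close>

section \<open>The Riesz representation theorem\<close>

text \<open>The space may fail to be countable at infinity, so Radon measures may fail to be
  sigma-finite, and the kernel lives on the Borel sets of the product, in general a larger
  sigma-algebra than the product one. Product measures and Fubini-type statements are therefore
  obtained from functionals: Riesz representation, approximation of \<open>Cc\<close> functions on
  the product by sums of tensors, and tau-smoothness, which writes the integral of a lower
  semicontinuous function as a supremum over its \<open>Ccp\<close> minorants. Positive definiteness
  enters twice. It excludes an infinite mutual energy of two measures of finite energy, so that the
  energy is a real bilinear form there; and it yields the Cauchy-Schwarz inequality, which carries
  energy convergence of the single components over to all mixed terms. Strong convergence rests on
  convexity: the midpoint of an admissible vector measure and a minimizer is admissible, so its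
  Gauss value is at least the infimum, and this bounds the distance of the two.\<close>

definition Ccp :: "('a::topological_space \<Rightarrow> real) set" where
  "Ccp = {\<phi>\<in>Cc. \<forall>x. 0 \<le> \<phi> x}"

lemma ennreal_less_add_pos: "x < top \<Longrightarrow> 0 < e \<Longrightarrow> x < x + ennreal e"
  by (cases x) (auto simp flip: ennreal_plus simp: ennreal_less_iff)

lemma Hausdorff_t2 [simp]: "Hausdorff_space (euclidean :: 'a::t2_space topology)"
  by (simp add: Hausdorff_space_def disjnt_def separation_t2)

section \<open>Continuous functions with compact support\<close>

lemma CcI:
  fixes \<phi> :: "'a::t2_space \<Rightarrow> real"
  assumes "continuous_on UNIV \<phi>" "compact K" "\<And>x. x \<notin> K \<Longrightarrow> \<phi> x = 0"
  shows "\<phi> \<in> Cc"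
proof -
  have "closure {x. \<phi> x \<noteq> 0} \<subseteq> K"
    using assms by (intro closure_minimal compact_imp_closed) auto
  then have "compact (closure {x. \<phi> x \<noteq> 0})"
    using assms(2) by (metis closed_closure compact_Int_closed inf.absorb2)
  then show ?thesis using assms(1) by (simp add: Cc_def)
qed

lemma CcD_cont: "\<phi> \<in> Cc \<Longrightarrow> continuous_on UNIV \<phi>"
  by (simp add: Cc_def)

lemma CcE:
  assumes "\<phi> \<in> Cc"
  obtains K where "compact K" "\<And>x. x \<notin> K \<Longrightarrow> \<phi> x = 0"
  using assms closure_subset[of "{x. \<phi> x \<noteq> 0}"] by (fastforce simp: Cc_def)

lemma CcpD: "\<phi> \<in> Ccp \<Longrightarrow> \<phi> \<in> Cc" "\<phi> \<in> Ccp \<Longrightarrow> 0 \<le> \<phi> x"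
  by (auto simp: Ccp_def)

lemma CcpI: "\<phi> \<in> Cc \<Longrightarrow> (\<And>x. 0 \<le> \<phi> x) \<Longrightarrow> \<phi> \<in> Ccp"
  by (auto simp: Ccp_def)

lemma Cc_zero: "(\<lambda>_. 0) \<in> Cc" by (simp add: Cc_def)

lemma Ccp_zero: "(\<lambda>_. 0) \<in> Ccp" by (simp add: Ccp_def Cc_zero)

lemma Cc_comb:
  fixes \<phi> \<psi> :: "'a::t2_space \<Rightarrow> real"
  assumes "\<phi> \<in> Cc" "\<psi> \<in> Cc" "F 0 0 = 0"
    and "\<And>T. continuous_on T (\<lambda>x. F (\<phi> x) (\<psi> x))"
  shows "(\<lambda>x. F (\<phi> x) (\<psi> x)) \<in> Cc"
proof -
  obtain K where K: "compact K" "\<And>x. x \<notin> K \<Longrightarrow> \<phi> x = 0" using assms CcE by blast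
  obtain L where L: "compact L" "\<And>x. x \<notin> L \<Longrightarrow> \<psi> x = 0" using assms CcE by blast
  show ?thesis
    using assms K L by (intro CcI[of _ "K \<union> L"]) auto
qed

lemma
  fixes \<phi> \<psi> :: "'a::t2_space \<Rightarrow> real"
  assumes "\<phi> \<in> Cc" "\<psi> \<in> Cc"
  shows Cc_add: "(\<lambda>x. \<phi> x + \<psi> x) \<in> Cc"
    and Cc_diff: "(\<lambda>x. \<phi> x - \<psi> x) \<in> Cc"
    and Cc_max: "(\<lambda>x. max (\<phi> x) (\<psi> x)) \<in> Cc"
    and Cc_min: "(\<lambda>x. min (\<phi> x) (\<psi> x)) \<in> Cc"
proof -
  have c: "continuous_on T \<phi>" "continuous_on T \<psi>" for T
    using assms by (auto dest!: CcD_cont intro: continuous_on_subset)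
  show "(\<lambda>x. \<phi> x + \<psi> x) \<in> Cc"
    by (rule Cc_comb[OF assms]) (auto intro!: continuous_intros c)
  show "(\<lambda>x. \<phi> x - \<psi> x) \<in> Cc"
    by (rule Cc_comb[OF assms]) (auto intro!: continuous_intros c)
  show "(\<lambda>x. max (\<phi> x) (\<psi> x)) \<in> Cc"
    by (rule Cc_comb[OF assms]) (auto intro!: continuous_intros c)
  show "(\<lambda>x. min (\<phi> x) (\<psi> x)) \<in> Cc"
    by (rule Cc_comb[OF assms]) (auto intro!: continuous_intros c)
qed

lemma Cc_mult:
  fixes \<phi> \<psi> :: "'a::t2_space \<Rightarrow> real"
  assumes "\<phi> \<in> Cc" "continuous_on UNIV \<psi>"
  shows "(\<lambda>x. \<phi> x * \<psi> x) \<in> Cc"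
proof -
  obtain K where K: "compact K" "\<And>x. x \<notin> K \<Longrightarrow> \<phi> x = 0" using assms CcE by blast
  then show ?thesis using assms
    by (intro CcI[of _ K]) (auto intro!: continuous_intros dest: CcD_cont)
qed

lemma Cc_scale:
  fixes \<phi> :: "'a::t2_space \<Rightarrow> real"
  assumes "\<phi> \<in> Cc" shows "(\<lambda>x. c * \<phi> x) \<in> Cc"
  using Cc_mult[OF assms, of "\<lambda>_. c"] by (simp add: mult.commute)

lemma Ccp_add:
  fixes \<phi> \<psi> :: "'a::t2_space \<Rightarrow> real"
  shows "\<phi> \<in> Ccp \<Longrightarrow> \<psi> \<in> Ccp \<Longrightarrow> (\<lambda>x. \<phi> x + \<psi> x) \<in> Ccp"
  by (auto simp: Ccp_def Cc_add)

lemma Ccp_scale: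
  fixes \<phi> :: "'a::t2_space \<Rightarrow> real"
  shows "\<phi> \<in> Ccp \<Longrightarrow> 0 \<le> c \<Longrightarrow> (\<lambda>x. c * \<phi> x) \<in> Ccp"
  by (auto simp: Ccp_def Cc_scale)

lemma Cc_bounded:
  fixes \<phi> :: "'a::t2_space \<Rightarrow> real"
  assumes "\<phi> \<in> Cc" obtains M where "0 < M" "\<And>x. \<bar>\<phi> x\<bar> \<le> M"
proof -
  obtain K where K: "compact K" "\<And>x. x \<notin> K \<Longrightarrow> \<phi> x = 0" using assms CcE by blast
  have "compact (\<phi> ` K)"
    using K assms by (intro compact_continuous_image) (auto dest!: CcD_cont intro: continuous_on_subset)
  then obtain B where "0 < B" "\<forall>x\<in>\<phi> ` K. norm x \<le> B"
    using compact_imp_bounded bounded_pos by blast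
  then have "\<bar>\<phi> x\<bar> \<le> B" for x
    using K by (cases "x \<in> K") auto
  then show ?thesis using that \<open>0 < B\<close> by blast
qed

section \<open>Separation in locally compact Hausdorff spaces\<close>

text \<open>The token \<open>T\<close> carries only the type, so that the locale can be instantiated
  at \<open>'b\<close> and, through \<open>prod_lch\<close>, at
  \<open>'b \<times> 'b\<close>.\<close>

locale lch =
  fixes T :: "'b::t2_space itself"
  assumes lc: "locally_compact_space (euclidean :: 'b topology)"
begin

text \<open>An open subspace of a locally compact Hausdorff space is again locally compact and
  Hausdorff. Taking the compact neighbourhood inside the subspace \<open>U\<close> keeps it in
  \<open>U\<close>.\<close>

lemma between:
  fixes K U :: "'b set"
  assumes "compact K" "open U" "K \<subseteq> U"
  obtains V S where "open V" "compact S" "K \<subseteq> V" "V \<subseteq> S" "S \<subseteq> U"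
proof -
  have "locally_compact_space (subtopology euclidean U)"
    using assms lc by (intro locally_compact_space_open_subset) auto
  moreover have "compactin (subtopology euclidean U) K"
    using assms by (simp add: compactin_subtopology)
  moreover have "Hausdorff_space (subtopology euclidean U)"
    by (simp add: Hausdorff_space_subtopology)
  ultimately obtain V S where "openin (subtopology euclidean U) V" "compactin (subtopology euclidean U) S" "K \<subseteq> V" "V \<subseteq> S"
    using locally_compact_space_compact_closed_compact[of "subtopology euclidean U"] by blast
  then show ?thesis using assms that
    by (metis compactin_euclidean_iff compactin_subtopology openin_open_eq)
qed

text \<open>Complete regularity separates \<open>K\<close> from the complement of an open
  \<open>V\<close> whose compact superset \<open>S\<close> still lies in \<open>U\<close>. Returning
  \<open>S\<close> records that the function vanishes off a compact subset of \<open>U\<close>,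
  which is more than vanishing off \<open>U\<close>.\<close>

lemma urysohn:
  fixes K U :: "'b set"
  assumes "compact K" "open U" "K \<subseteq> U"
  obtains \<phi> S where "\<phi> \<in> Ccp" "\<And>x. \<phi> x \<le> 1" "\<And>x. x \<in> K \<Longrightarrow> \<phi> x = 1"
    "compact S" "S \<subseteq> U" "\<And>x. x \<notin> S \<Longrightarrow> \<phi> x = 0"
proof -
  obtain V S where VS: "open V" "compact S" "K \<subseteq> V" "V \<subseteq> S" "S \<subseteq> U"
    using between[OF assms] .
  have "completely_regular_space (euclidean :: 'b topology)"
    using lc by (intro locally_compact_regular_imp_completely_regular_space) auto
  moreover have "disjnt K (-V)" using VS by (auto simp: disjnt_def)
  ultimately obtain f where f: "continuous_map euclidean (subtopology euclidean {0..1}) f"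
      "f ` (-V) \<subseteq> {0::real}" "f ` K \<subseteq> {1}"
    using Urysohn_completely_regular_compact_closed[of 0 1 "euclidean::'b topology" K "-V"] assms VS
    by (auto simp: closed_Compl)
  have fc: "continuous_on UNIV f" and f01: "\<And>x. 0 \<le> f x \<and> f x \<le> 1"
    using f(1) by (auto simp: continuous_map_in_subtopology Pi_iff)
  show ?thesis
  proof (rule that[of f S])
    have "f x = 0" if "x \<notin> S" for x using that f(2) VS by blast
    then show "f \<in> Ccp" using VS fc f01 by (intro CcpI CcI[of _ S]) auto
    show "x \<notin> S \<Longrightarrow> f x = 0" for x using f(2) VS by blast
  qed (use f VS f01 in auto)
qed

end

section \<open>From a positive functional to a Caratheodory outer measure\<close>

text \<open>The axioms concern the cone \<open>Ccp\<close> only: the supremum formula for positive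
  parts and the functionals in \<open>kclass_compact\<close> are checked on that cone.\<close>

locale pos_functional = lch T for T :: "'b::t2_space itself" +
  fixes L :: "('b \<Rightarrow> real) \<Rightarrow> real"
  assumes L_nonneg: "\<phi> \<in> Ccp \<Longrightarrow> 0 \<le> L \<phi>"
    and L_add: "\<phi> \<in> Ccp \<Longrightarrow> \<psi> \<in> Ccp \<Longrightarrow> L (\<lambda>x. \<phi> x + \<psi> x) = L \<phi> + L \<psi>"
    and L_scale: "\<phi> \<in> Ccp \<Longrightarrow> 0 \<le> c \<Longrightarrow> L (\<lambda>x. c * \<phi> x) = c * L \<phi>"
begin

lemma L_mono:
  assumes "\<phi> \<in> Ccp" "\<psi> \<in> Ccp" "\<And>x. \<phi> x \<le> \<psi> x" shows "L \<phi> \<le> L \<psi>"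
proof -
  have d: "(\<lambda>x. \<psi> x - \<phi> x) \<in> Ccp"
    using assms by (intro CcpI Cc_diff) (auto dest: CcpD)
  have "L \<psi> = L (\<lambda>x. \<phi> x + (\<psi> x - \<phi> x))" by simp
  also have "\<dots> = L \<phi> + L (\<lambda>x. \<psi> x - \<phi> x)" using assms d by (intro L_add) auto
  finally show ?thesis using L_nonneg[OF d] by simp
qed

lemma L_zero: "L (\<lambda>_. 0) = 0"
  using L_scale[OF Ccp_zero, of 0] by simp

text \<open>The relation usually written \<phi> \<prec> U in proofs of the Riesz theorem.\<close>

definition subordinate :: "'b set \<Rightarrow> ('b \<Rightarrow> real) set" where
  "subordinate U = {\<phi>\<in>Ccp. (\<forall>x. \<phi> x \<le> 1) \<and> (\<exists>S. compact S \<and> S \<subseteq> U \<and> (\<forall>x. x \<notin> S \<longrightarrow> \<phi> x = 0))}"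

definition open_content :: "'b set \<Rightarrow> ennreal" where
  "open_content U = (SUP \<phi>\<in>subordinate U. ennreal (L \<phi>))"

definition outer_content :: "'b set \<Rightarrow> ennreal" where
  "outer_content B = (INF U\<in>{U. open U \<and> B \<subseteq> U}. open_content U)"

lemma subordinate_mono: "U \<subseteq> V \<Longrightarrow> subordinate U \<subseteq> subordinate V"
  unfolding subordinate_def by blast

lemma open_content_mono: "U \<subseteq> V \<Longrightarrow> open_content U \<le> open_content V"
  unfolding open_content_def by (intro SUP_subset_mono subordinate_mono) auto

lemma outer_content_open: "open U \<Longrightarrow> outer_content U = open_content U"
  unfolding outer_content_def by (intro antisym INF_lower2[of U] INF_greatest open_content_mono) auto

lemma outer_content_mono: "A \<subseteq> B \<Longrightarrow> outer_content A \<le> outer_content B"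
  unfolding outer_content_def by (intro INF_superset_mono) auto

text \<open>A partition of unity is built one set at a time: a Urysohn function \<open>u\<close>,
  equal to 1 near the part of \<open>S\<close> that the first \<open>n\<close> sets miss, splits
  \<open>\<phi>\<close> into \<open>u * \<phi>\<close>, subordinate to \<open>U n\<close>, and
  \<open>\<phi> * (1 - u)\<close>, left to the induction hypothesis.\<close>

lemma open_content_finite_subadd:
  assumes "\<phi> \<in> Ccp" "\<And>x. \<phi> x \<le> 1" "compact S" "S \<subseteq> (\<Union>k<n. U k)"
    "\<And>x. x \<notin> S \<Longrightarrow> \<phi> x = 0" "\<And>k::nat. open (U k)"
  shows "ennreal (L \<phi>) \<le> (\<Sum>k<n. open_content (U k))"
  using assms(1-5)
proof (induction n arbitrary: \<phi> S)
  case 0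
  then have "\<phi> = (\<lambda>_. 0)" by auto
  then show ?case using L_zero by simp
next
  case (Suc n)
  define W where "W = (\<Union>k<n. U k)"
  have "open W" using assms by (auto simp: W_def)
  then have "compact (S - W)" using Suc by (simp add: compact_diff)
  moreover have "S - W \<subseteq> U n"
    using Suc.prems(4) by (auto simp: W_def lessThan_Suc)
  ultimately obtain V R where VR: "open V" "compact R" "S - W \<subseteq> V" "V \<subseteq> R" "R \<subseteq> U n"
    using between assms(6) by metis
  obtain u Q where u: "u \<in> Ccp" "\<And>x. u x \<le> 1" "\<And>x. x \<in> R \<Longrightarrow> u x = 1"
      "compact Q" "Q \<subseteq> U n" "\<And>x. x \<notin> Q \<Longrightarrow> u x = 0"
    using urysohn[OF VR(2) assms(6) VR(5)] by metis
  have cc: "continuous_on UNIV \<phi>" "continuous_on UNIV u"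
    using Suc.prems(1) u(1) by (auto dest!: CcpD(1) CcD_cont)
  have u0: "0 \<le> u x" "0 \<le> \<phi> x" for x using u(1) Suc.prems(1) by (auto dest: CcpD)
  have 1: "(\<lambda>x. u x * \<phi> x) \<in> Ccp"
    using u u0 cc by (intro CcpI Cc_mult) (auto dest: CcpD)
  have 2: "(\<lambda>x. \<phi> x * (1 - u x)) \<in> Ccp"
    using u u0 cc Suc.prems by (intro CcpI Cc_mult) (auto dest: CcpD intro!: continuous_intros)
  have "L \<phi> = L (\<lambda>x. u x * \<phi> x + \<phi> x * (1 - u x))"
    by (simp add: algebra_simps)
  also have "\<dots> = L (\<lambda>x. u x * \<phi> x) + L (\<lambda>x. \<phi> x * (1 - u x))"
    using 1 2 by (rule L_add)
  finally have "ennreal (L \<phi>) = ennreal (L (\<lambda>x. u x * \<phi> x)) + ennreal (L (\<lambda>x. \<phi> x * (1 - u x)))"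
    using 1 2 L_nonneg by (metis ennreal_plus)
  \<comment> \<open>Since \<open>u\<close> is 1 on \<open>V\<close>, this part vanishes off
    \<open>S - V\<close>, and what remains of \<open>S\<close> after removing \<open>V\<close> lies
    in the first \<open>n\<close> sets.\<close>
  moreover have "ennreal (L (\<lambda>x. \<phi> x * (1 - u x))) \<le> (\<Sum>k<n. open_content (U k))"
  proof (rule Suc.IH[OF 2])
    show "\<phi> x * (1 - u x) \<le> 1" for x
      using u u0 Suc.prems(2) by (intro mult_le_one) auto
    show "compact (S - V)" using VR Suc by (simp add: compact_diff)
    show "S - V \<subseteq> (\<Union>k<n. U k)" using VR W_def by auto
    show "x \<notin> S - V \<Longrightarrow> \<phi> x * (1 - u x) = 0" for x
      using VR u Suc.prems by (cases "x \<in> S") auto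
  qed
  moreover have "ennreal (L (\<lambda>x. u x * \<phi> x)) \<le> open_content (U n)"
    unfolding open_content_def subordinate_def using 1 u u0 Suc.prems(2)
    by (intro SUP_upper CollectI conjI exI[of _ Q]) (auto intro!: mult_le_one)
  ultimately show ?case by (simp add: add.commute add_mono)
qed

text \<open>A competitor in the supremum has compact support, which is covered by finitely many of
  the sets.\<close>

lemma open_content_countable_subadd:
  fixes U :: "nat \<Rightarrow> 'b set"
  assumes "\<And>k. open (U k)" shows "open_content (\<Union>k. U k) \<le> (\<Sum>k. open_content (U k))"
proof -
  have "ennreal (L \<phi>) \<le> (\<Sum>k. open_content (U k))" if \<phi>: "\<phi> \<in> subordinate (\<Union>k. U k)" for \<phi>
  proof -
    from \<phi> obtain S where S: "\<phi> \<in> Ccp" "\<And>x. \<phi> x \<le> 1" "compact S" "S \<subseteq> (\<Union>k. U k)" "\<And>x. x \<notin> S \<Longrightarrow> \<phi> x = 0"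
      by (auto simp: subordinate_def)
    then obtain C where C: "finite C" "S \<subseteq> (\<Union>k\<in>C. U k)"
      using assms by (metis compactE_image)
    obtain n where "C \<subseteq> {..<n}" using C finite_nat_iff_bounded by blast
    then have "S \<subseteq> (\<Union>k<n. U k)" using C by blast
    then have "ennreal (L \<phi>) \<le> (\<Sum>k<n. open_content (U k))"
      using S assms by (intro open_content_finite_subadd) auto
    also have "\<dots> \<le> (\<Sum>k. open_content (U k))" by (intro sum_le_suminf) auto
    finally show ?thesis .
  qed
  then show ?thesis unfolding open_content_def[of "\<Union>k. U k"] by (intro SUP_least) auto
qed

lemma outer_content_outer: "outer_measure_space (Pow UNIV) outer_content"
  unfolding outer_measure_space_def
proof (intro conjI)
  have "ennreal (L \<phi>) \<le> 0" if "\<phi> \<in> subordinate {}" for \<phi>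
  proof -
    have "\<phi> = (\<lambda>_. 0)" using that by (auto simp: subordinate_def)
    then show ?thesis by (simp add: L_zero)
  qed
  then have "open_content {} = 0" unfolding open_content_def by (metis SUP_least le_zero_eq)
  then show "positive (Pow UNIV) outer_content" by (simp add: positive_def outer_content_open)
  show "increasing (Pow UNIV) outer_content" by (simp add: increasing_def outer_content_mono)
  show "countably_subadditive (Pow UNIV) outer_content"
    unfolding countably_subadditive_def
  proof safe
    fix A :: "nat \<Rightarrow> 'b set"
    show "outer_content (\<Union>i. A i) \<le> (\<Sum>i. outer_content (A i))"
    proof (rule ennreal_le_epsilon)
      fix e :: real assume "0 < e" and fin: "(\<Sum>i. outer_content (A i)) < top"
      have f1: "outer_content (A i) < top" for i
        using fin by (metis ennreal_suminf_lessD)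
      \<comment> \<open>The tolerances \<open>e * (1/2)^Suc i\<close> add up to
        \<open>e\<close>.\<close>
      have "\<exists>U. open U \<and> A i \<subseteq> U \<and> open_content U \<le> outer_content (A i) + ennreal (e * (1/2)^Suc i)" for i
      proof -
        have "outer_content (A i) < outer_content (A i) + ennreal (e * (1/2)^Suc i)"
          using f1[of i] \<open>0 < e\<close> by (intro ennreal_less_add_pos) auto
        then show ?thesis unfolding outer_content_def[of "A i"] INF_less_iff by (auto intro: less_imp_le)
      qed
      then obtain U where U: "\<And>i. open (U i)" "\<And>i. A i \<subseteq> U i" "\<And>i. open_content (U i) \<le> outer_content (A i) + ennreal (e * (1/2)^Suc i)"
        by metis
      have "outer_content (\<Union>i. A i) \<le> outer_content (\<Union>i. U i)" using U by (intro outer_content_mono) auto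
      also have "\<dots> \<le> (\<Sum>i. open_content (U i))" using U by (subst outer_content_open) (auto intro!: open_content_countable_subadd)
      also have "\<dots> \<le> (\<Sum>i. outer_content (A i) + ennreal (e * (1/2)^Suc i))"
        using U by (intro suminf_le) auto
      also have "\<dots> = (\<Sum>i. outer_content (A i)) + (\<Sum>i. ennreal e * ennreal ((1/2)^Suc i))"
        using \<open>0 < e\<close> by (subst suminf_add[symmetric]) (auto simp del: power_Suc simp: ennreal_mult)
      also have "\<dots> = (\<Sum>i. outer_content (A i)) + ennreal e"
        unfolding ennreal_suminf_cmult
        by (subst suminf_ennreal_eq[OF zero_le_power power_half_series]) auto
      finally show "outer_content (\<Union>i. A i) \<le> (\<Sum>i. outer_content (A i)) + ennreal e" .
    qed
  qed
qed

text \<open>Caratheodory's condition. For an open \<open>V\<close> containing \<open>E\<close>, a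
  function \<open>\<phi>\<close> subordinate to \<open>U \<inter> V\<close> that vanishes off
  \<open>S\<close> and a function \<open>\<psi>\<close> subordinate to \<open>V - S\<close> are
  never nonzero together, so their sum is subordinate to \<open>V\<close>. Since
  \<open>V - S\<close> contains \<open>V - U\<close>, suprema over \<open>\<psi>\<close> and then
  over \<open>\<phi>\<close> bound both pieces of \<open>E\<close>.\<close>

lemma outer_content_open_split: "open U \<Longrightarrow> U \<in> lambda_system UNIV (Pow UNIV) outer_content"
proof -
  assume U: "open U"
  have "outer_content (U \<inter> E) + outer_content ((UNIV - U) \<inter> E) = outer_content E" for E
  proof (rule antisym)
    have "subadditive (Pow UNIV) outer_content" 
      using outer_content_outer ring_of_sets.countably_subadditive_subadditive[of UNIV "Pow UNIV" outer_content]
      by (simp add: outer_measure_space_def ring_of_sets_Pow del: Pow_UNIV)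
    from subadditiveD[OF this, of "U \<inter> E" "(UNIV - U) \<inter> E"]
    have "outer_content ((U \<inter> E) \<union> ((UNIV - U) \<inter> E)) \<le> outer_content (U \<inter> E) + outer_content ((UNIV - U) \<inter> E)" by auto
    moreover have "(U \<inter> E) \<union> ((UNIV - U) \<inter> E) = E" by auto
    ultimately show "outer_content E \<le> outer_content (U \<inter> E) + outer_content ((UNIV - U) \<inter> E)" by simp
    have "outer_content (U \<inter> E) + outer_content ((UNIV - U) \<inter> E) \<le> open_content V" if V: "open V" "E \<subseteq> V" for V
    proof -
      have "outer_content (U \<inter> E) + outer_content ((UNIV - U) \<inter> E) \<le> open_content (U \<inter> V) + outer_content (V - U)"
        using V U by (intro add_mono order_trans[OF outer_content_mono[of "U \<inter> E" "U \<inter> V"]] outer_content_mono) (auto simp: outer_content_open open_Int)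
      also have "open_content (U \<inter> V) + outer_content (V - U) = (SUP \<phi>\<in>subordinate (U \<inter> V). ennreal (L \<phi>) + outer_content (V - U))"
      proof -
        have "(\<lambda>_. 0) \<in> subordinate (U \<inter> V)" by (auto simp: subordinate_def Ccp_zero intro!: exI[of _ "{}"])
        then show ?thesis unfolding open_content_def by (subst ennreal_SUP_add_left) auto
      qed
      also have "\<dots> \<le> open_content V"
      proof (rule SUP_least)
        fix \<phi> assume "\<phi> \<in> subordinate (U \<inter> V)"
        then obtain S where S: "\<phi> \<in> Ccp" "\<And>x. \<phi> x \<le> 1" "compact S" "S \<subseteq> U \<inter> V" "\<And>x. x \<notin> S \<Longrightarrow> \<phi> x = 0"
          by (auto simp: subordinate_def)
        have oS: "open (V - S)" using S V by (auto intro: compact_imp_closed)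
        have "ennreal (L \<phi>) + outer_content (V - U) \<le> ennreal (L \<phi>) + open_content (V - S)"
          using S oS by (intro add_mono order_trans[OF outer_content_mono[of "V - U" "V - S"]]) (auto simp: outer_content_open)
        also have "\<dots> = (SUP \<psi>\<in>subordinate (V - S). ennreal (L \<phi>) + ennreal (L \<psi>))"
        proof -
          have "(\<lambda>_. 0) \<in> subordinate (V - S)" by (auto simp: subordinate_def Ccp_zero intro!: exI[of _ "{}"])
          then show ?thesis unfolding open_content_def by (subst ennreal_SUP_add_right) auto
        qed
        also have "\<dots> \<le> open_content V"
        proof (rule SUP_least)
          fix \<psi> assume "\<psi> \<in> subordinate (V - S)"
          then obtain R where R: "\<psi> \<in> Ccp" "\<And>x. \<psi> x \<le> 1" "compact R" "R \<subseteq> V - S" "\<And>x. x \<notin> R \<Longrightarrow> \<psi> x = 0"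
            by (auto simp: subordinate_def)
          have "\<phi> x + \<psi> x \<le> 1" for x 
          proof (cases "x \<in> S")
            case True
            then have "x \<notin> R" using R by blast
            then show ?thesis using S R by simp
          qed (use S R in simp)
          then have "(\<lambda>x. \<phi> x + \<psi> x) \<in> subordinate V"
            using S R unfolding subordinate_def
            by (intro CollectI conjI exI[of _ "S \<union> R"]) (auto intro!: Ccp_add)
          then have "ennreal (L (\<lambda>x. \<phi> x + \<psi> x)) \<le> open_content V" unfolding open_content_def by (rule SUP_upper)
          then show "ennreal (L \<phi>) + ennreal (L \<psi>) \<le> open_content V"
            using S R L_nonneg by (simp add: L_add ennreal_plus)
        qed
        finally show "ennreal (L \<phi>) + outer_content (V - U) \<le> open_content V" .
      qed
      finally show ?thesis .
    qed
    then show "outer_content (U \<inter> E) + outer_content ((UNIV - U) \<inter> E) \<le> outer_content E"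
      unfolding outer_content_def[of E] by (intro INF_greatest) auto
  qed
  then show ?thesis by (auto simp: lambda_system_def)
qed

definition M :: "'b measure" where "M = measure_of UNIV (sets borel) outer_content"

lemma sets_M [simp]: "sets M = sets borel" "space M = UNIV"
  unfolding M_def by (auto simp: sets.sets_measure_of_eq[of borel, simplified])

text \<open>By \<open>outer_content_open_split\<close> the Caratheodory sigma-algebra contains the
  open sets, hence the Borel sets, and the measure property restricts to them.\<close>

lemma emeasure_M: "B \<in> sets borel \<Longrightarrow> emeasure M B = outer_content B"
proof -
  assume B: "B \<in> sets borel"
  have ms: "measure_space UNIV (lambda_system UNIV (Pow UNIV) outer_content) outer_content"
    by (intro sigma_algebra.caratheodory_lemma sigma_algebra_Pow outer_content_outer)
  then have "sigma_algebra UNIV (lambda_system UNIV (Pow UNIV) outer_content)" by (simp add: measure_space_def)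
  then have "sigma_sets UNIV {S :: 'b set. open S} \<subseteq> lambda_system UNIV (Pow UNIV) outer_content"
    by (intro sigma_algebra.sigma_sets_subset subsetI outer_content_open_split) auto
  then have sub: "sets borel \<subseteq> lambda_system UNIV (Pow UNIV) outer_content"
    by (simp add: borel_def)
  have "measure_space UNIV (sets borel) outer_content"
    using ms sub sets.sigma_algebra_axioms[of "borel :: 'b measure"]
    by (auto simp: measure_space_def positive_def countably_additive_def
        intro!: sets.countable_UN dest: subset_trans)
  then show ?thesis using B unfolding M_def
    by (intro emeasure_measure_of_sigma) (auto simp: measure_space_def)
qed

text \<open>For \<open>\<alpha>\<close> below 1 the open set where \<open>\<psi>\<close> exceeds
  \<open>\<alpha>\<close> contains \<open>K\<close>, and every function subordinate to it is at most
  \<open>\<psi> / \<alpha>\<close>. Letting \<open>\<alpha>\<close> tend to 1 removes the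
  factor.\<close>

lemma outer_content_le:
  assumes "\<psi> \<in> Ccp" "\<And>x. x \<in> K \<Longrightarrow> 1 \<le> \<psi> x" shows "outer_content K \<le> ennreal (L \<psi>)"
proof -
  have le: "outer_content K \<le> ennreal (L \<psi> / \<alpha>)" if \<alpha>: "0 < \<alpha>" "\<alpha> < 1" for \<alpha>
  proof -
    have o: "open {x. \<alpha> < \<psi> x}"
      using assms(1) by (intro open_Collect_less) (auto dest!: CcpD(1) CcD_cont)
    have "outer_content K \<le> open_content {x. \<alpha> < \<psi> x}"
      using assms \<alpha> o by (subst outer_content_open[symmetric]) (auto intro!: outer_content_mono dest: order.strict_trans2)
    also have "\<dots> \<le> ennreal (L \<psi> / \<alpha>)"
      unfolding open_content_def
    proof (intro SUP_least ennreal_leI)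
      fix \<phi> assume "\<phi> \<in> subordinate {x. \<alpha> < \<psi> x}"
      then obtain S where S: "\<phi> \<in> Ccp" "\<And>x. \<phi> x \<le> 1" "S \<subseteq> {x. \<alpha> < \<psi> x}" "\<And>x. x \<notin> S \<Longrightarrow> \<phi> x = 0"
        by (auto simp: subordinate_def)
      have "\<alpha> * \<phi> x \<le> \<psi> x" for x
      proof (cases "x \<in> S")
        case True
        have "\<alpha> * \<phi> x \<le> \<alpha>" using S(2)[of x] \<alpha> by (simp add: mult_left_le)
        then show ?thesis using S True by force
      qed (use S assms in \<open>auto dest: CcpD\<close>)
      then have "L (\<lambda>x. \<alpha> * \<phi> x) \<le> L \<psi>" using S assms \<alpha> by (intro L_mono Ccp_scale) auto
      then show "L \<phi> \<le> L \<psi> / \<alpha>" using \<alpha> S by (simp add: L_scale field_simps)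
    qed
    finally show ?thesis .
  qed
  \<comment> \<open>The double successor keeps \<open>\<alpha>\<close> = 1 - 1 / (n + 2) strictly
    between 0 and 1 from the first index on.\<close>
  have "((\<lambda>n. ennreal (L \<psi> / (1 - 1 / real (Suc (Suc n))))) \<longlongrightarrow> ennreal (L \<psi> / (1 - 0))) sequentially"
    by (intro tendsto_ennrealI tendsto_intros LIMSEQ_Suc lim_1_over_n) auto
  then have "outer_content K \<le> ennreal (L \<psi> / (1 - 0))"
    by (rule LIMSEQ_le_const) (intro exI[of _ 0] allI impI le, auto simp: field_simps)
  then show ?thesis by simp
qed

lemma outer_content_ge:
  assumes "\<psi> \<in> Ccp" "\<And>x. \<psi> x \<le> 1" "compact K" "\<And>x. x \<notin> K \<Longrightarrow> \<psi> x = 0"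
  shows "ennreal (L \<psi>) \<le> outer_content K"
  unfolding outer_content_def open_content_def using assms
  by (intro INF_greatest SUP_upper) (auto simp: subordinate_def)

lemma outer_content_compact: "compact K \<Longrightarrow> outer_content K < top"
proof -
  assume "compact K"
  then obtain \<phi> where "\<phi> \<in> Ccp" "\<And>x. x \<in> K \<Longrightarrow> \<phi> x = 1" using urysohn[of K UNIV] by (metis open_UNIV subset_UNIV)
  then have "outer_content K \<le> ennreal (L \<phi>)" by (intro outer_content_le) auto
  then show ?thesis using ennreal_less_top le_less_trans by blast
qed

text \<open>On spaces that are not countable at infinity the Caratheodory measure need not be inner
  regular; the representing measure is its essential modification.\<close>

definition essential_content :: "'b set \<Rightarrow> ennreal" where
  "essential_content B = (SUP K\<in>{K. compact K \<and> K \<subseteq> B}. outer_content K)"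

lemma essential_content_compact: "compact K \<Longrightarrow> essential_content K = outer_content K"
  unfolding essential_content_def by (intro antisym SUP_least SUP_upper) (auto intro: outer_content_mono)

text \<open>Outer approximation of \<open>K - B\<close> by an open \<open>U\<close> yields the
  compact subset \<open>K - U\<close> of \<open>B\<close>, and this is the inner approximation of
  \<open>B\<close>. The common term \<open>outer_content (K - B)\<close> is finite and can be
  cancelled.\<close>

lemma essential_content_sub_compact:
  assumes B: "B \<in> sets borel" "B \<subseteq> K" and K: "compact K" shows "essential_content B = outer_content B"
proof (rule antisym)
  show "essential_content B \<le> outer_content B" unfolding essential_content_def by (intro SUP_least outer_content_mono) auto
  show "outer_content B \<le> essential_content B"
  proof (rule ennreal_le_epsilon)
    fix e :: real assume "0 < e"
    have [measurable]: "K \<in> sets borel" using K by (simp add: borel_compact)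
    have KB: "K - B \<in> sets borel" using B by measurable
    have fin: "outer_content (K - B) < top" using outer_content_mono[of "K - B" K] outer_content_compact[OF K] by auto
    have "outer_content (K - B) < outer_content (K - B) + ennreal e"
      using fin \<open>0 < e\<close> by (rule ennreal_less_add_pos)
    then obtain U where U: "open U" "K - B \<subseteq> U" "open_content U \<le> outer_content (K - B) + ennreal e"
      unfolding outer_content_def[of "K - B"] INF_less_iff by (auto intro: less_imp_le)
    have "compact (K - U)" using K U by (simp add: compact_diff)
    have [measurable]: "U \<in> sets borel" using U by simp
    have "outer_content B + outer_content (K - B) = outer_content K"
      using B KB by (simp flip: emeasure_M add: plus_emeasure Un_absorb1)
    also have "outer_content K \<le> outer_content (K - U) + outer_content U"
    proof -
      have "outer_content K \<le> outer_content ((K - U) \<union> U)" by (intro outer_content_mono) auto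
      also have "\<dots> = outer_content (K - U) + outer_content U"
      proof -
        have "K - U \<in> sets M" "U \<in> sets M" "(K - U) \<inter> U = {}" by auto
        then have "emeasure M (K - U) + emeasure M U = emeasure M ((K - U) \<union> U)"
          by (rule plus_emeasure)
        then show ?thesis by (subst (1 2 3) emeasure_M[symmetric]) (auto simp del: Un_Diff_cancel2)
      qed
      finally show ?thesis .
    qed
    also have "\<dots> \<le> essential_content B + (outer_content (K - B) + ennreal e)"
    proof (rule add_mono)
      show "outer_content (K - U) \<le> essential_content B" unfolding essential_content_def using \<open>compact (K - U)\<close> U by (intro SUP_upper) auto
    qed (use U in \<open>simp add: outer_content_open\<close>)
    finally have "outer_content B + outer_content (K - B) \<le> (essential_content B + ennreal e) + outer_content (K - B)" by (simp add: ac_simps)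
    then show "outer_content B \<le> essential_content B + ennreal e"
      using fin by (auto simp: ennreal_add_left_cancel_le add.commute[of _ "outer_content (K - B)"])
  qed
qed

text \<open>Compact sets chosen in disjoint \<open>A i\<close> are disjoint, which gives one
  inequality. For the other, a compact subset of the union is cut by the \<open>A i\<close> into
  pieces on which both contents agree, and the Caratheodory measure is countably additive.\<close>

lemma essential_content_countably_additive: "countably_additive (sets borel) essential_content"
  unfolding countably_additive_def
proof safe
  fix A :: "nat \<Rightarrow> 'b set" assume A: "range A \<subseteq> sets borel" "disjoint_family A"
  show "(\<Sum>i. essential_content (A i)) = essential_content (\<Union>i. A i)"
  proof (rule antisym)
    \<comment> \<open>The extra compact set \<open>K\<close> makes the induction work: it collects
      the compact subsets already selected from the sets with larger index.\<close>
    have fin: "(\<Sum>i<n. essential_content (A i)) + outer_content K \<le> essential_content ((\<Union>i<n. A i) \<union> K)"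
      if "compact K" "\<forall>i<n. K \<inter> A i = {}" for n K
      using that
    proof (induction n arbitrary: K)
      case 0 then show ?case by (simp add: essential_content_compact)
    next
      case (Suc n)
      have ne: "{Q. compact Q \<and> Q \<subseteq> A n} \<noteq> {}" by auto
      have "(\<Sum>i<Suc n. essential_content (A i)) + outer_content K = essential_content (A n) + ((\<Sum>i<n. essential_content (A i)) + outer_content K)"
        by (simp add: ac_simps)
      also have "\<dots> = (SUP Q\<in>{Q. compact Q \<and> Q \<subseteq> A n}. outer_content Q + ((\<Sum>i<n. essential_content (A i)) + outer_content K))"
        unfolding essential_content_def[of "A n"] by (rule ennreal_SUP_add_left[OF ne, symmetric])
      also have "\<dots> \<le> essential_content ((\<Union>i<Suc n. A i) \<union> K)"
      proof (rule SUP_least)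
        fix Q assume "Q \<in> {Q. compact Q \<and> Q \<subseteq> A n}"
        then have Q: "compact Q" "Q \<subseteq> A n" by auto
        have "outer_content Q + outer_content K = outer_content (Q \<union> K)"
          using Q Suc.prems
          by (subst (1 2 3) emeasure_M[symmetric]) (auto intro!: plus_emeasure simp: borel_compact)
        then have "outer_content Q + ((\<Sum>i<n. essential_content (A i)) + outer_content K) = (\<Sum>i<n. essential_content (A i)) + outer_content (Q \<union> K)"
          by (metis add.left_commute)
        also have "\<dots> \<le> essential_content ((\<Union>i<n. A i) \<union> (Q \<union> K))"
        proof (rule Suc.IH)
          show "\<forall>i<n. (Q \<union> K) \<inter> A i = {}"
          proof (intro allI impI)
            fix i assume "i < n"
            then have "A i \<inter> A n = {}" "K \<inter> A i = {}"
              using A Suc.prems by (auto simp: disjoint_family_on_def)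
            then show "(Q \<union> K) \<inter> A i = {}" using Q by blast
          qed
        qed (use Q Suc.prems in auto)
        also have "\<dots> \<le> essential_content ((\<Union>i<Suc n. A i) \<union> K)"
          unfolding essential_content_def using Q by (intro SUP_subset_mono) (auto simp: lessThan_Suc)
        finally show "outer_content Q + ((\<Sum>i<n. essential_content (A i)) + outer_content K) \<le> essential_content ((\<Union>i<Suc n. A i) \<union> K)" .
      qed
      finally show ?case .
    qed
    show "(\<Sum>i. essential_content (A i)) \<le> essential_content (\<Union>i. A i)"
    proof (rule suminf_le_const)
      fix n
      have "(\<Sum>i<n. essential_content (A i)) \<le> (\<Sum>i<n. essential_content (A i)) + outer_content {}" by simp
      also have "\<dots> \<le> essential_content ((\<Union>i<n. A i) \<union> {})" by (rule fin) auto
      also have "\<dots> \<le> essential_content (\<Union>i. A i)" unfolding essential_content_def by (intro SUP_subset_mono) auto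
      finally show "(\<Sum>i<n. essential_content (A i)) \<le> essential_content (\<Union>i. A i)" .
    qed auto
    show "essential_content (\<Union>i. A i) \<le> (\<Sum>i. essential_content (A i))"
      unfolding essential_content_def[of "\<Union>i. A i"]
    proof (rule SUP_least)
      fix K assume "K \<in> {K. compact K \<and> K \<subseteq> (\<Union>i. A i)}"
      then have K: "compact K" "K \<subseteq> (\<Union>i. A i)" by auto
      have Ks: "K \<in> sets borel" using K by (simp add: borel_compact)
      have "outer_content K = emeasure M (\<Union>i. K \<inter> A i)"
        using K Ks by (simp add: emeasure_M Int_absorb2 flip: Int_UN_distrib)
      also have "\<dots> = (\<Sum>i. emeasure M (K \<inter> A i))"
        using A Ks by (intro suminf_emeasure[symmetric]) (auto simp: disjoint_family_on_def)
      also have "\<dots> = (\<Sum>i. essential_content (K \<inter> A i))"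
        using A Ks K by (intro suminf_cong) (subst essential_content_sub_compact[of _ K], auto intro!: emeasure_M)
      also have "\<dots> \<le> (\<Sum>i. essential_content (A i))"
        unfolding essential_content_def by (intro suminf_le SUP_subset_mono) auto
      finally show "outer_content K \<le> (\<Sum>i. essential_content (A i))" .
    qed
  qed
qed

definition R :: "'b measure" where "R = measure_of UNIV (sets borel) essential_content"

lemma sets_R [simp]: "sets R = sets borel" "space R = UNIV"
  unfolding R_def by (auto simp: sets.sets_measure_of_eq[of borel, simplified])

lemma emeasure_R: "B \<in> sets borel \<Longrightarrow> emeasure R B = essential_content B"
proof -
  assume "B \<in> sets borel"
  moreover have "positive (sets borel) essential_content"
    using outer_content_outer by (auto simp: positive_def essential_content_compact outer_measure_space_def)
  ultimately show ?thesis unfolding R_def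
    using essential_content_countably_additive sets.sigma_algebra_axioms[of "borel :: 'b measure"]
    by (intro emeasure_measure_of_sigma) auto
qed

lemma R_radon: "R \<in> radon"
  unfolding radon_def
proof (intro CollectI conjI allI impI ballI)
  show "emeasure R K < \<infinity>" if "compact K" for K
    using that by (simp add: emeasure_R essential_content_compact outer_content_compact borel_compact)
  show "emeasure R B = (SUP K\<in>{K. compact K \<and> K \<subseteq> B}. emeasure R K)" if "B \<in> sets borel" for B
    using that by (subst emeasure_R) (auto simp: essential_content_def[of B] emeasure_R essential_content_compact borel_compact intro!: SUP_cong)
qed simp

end

section \<open>Radon measures and lower semicontinuous functions\<close>

lemma radon_sets [simp]: "\<mu> \<in> radon \<Longrightarrow> sets \<mu> = sets borel"
  unfolding radon_def by (elim CollectE conjE)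

lemma radon_space [simp]: "\<mu> \<in> radon \<Longrightarrow> space \<mu> = UNIV"
  using sets_eq_imp_space_eq[of \<mu> borel] by simp

lemma radon_compact: "\<mu> \<in> radon \<Longrightarrow> compact K \<Longrightarrow> emeasure \<mu> K < top"
  unfolding radon_def infinity_ennreal_def by (elim CollectE conjE allE impE)

lemma radon_inner:
  "\<mu> \<in> radon \<Longrightarrow> B \<in> sets borel \<Longrightarrow> emeasure \<mu> B = (SUP K\<in>{K. compact K \<and> K \<subseteq> B}. emeasure \<mu> K)"
  unfolding radon_def by (elim CollectE conjE) (rule bspec)

lemma radon_borel_measurable:
  "\<mu> \<in> radon \<Longrightarrow> borel_measurable \<mu> = borel_measurable borel"
  by (intro measurable_cong_sets) auto

lemma Cc_integrable:
  fixes \<phi> :: "'a::t2_space \<Rightarrow> real"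
  assumes "\<mu> \<in> radon" "\<phi> \<in> Cc" shows "integrable \<mu> \<phi>"
proof -
  obtain K where K: "compact K" "\<And>x. x \<notin> K \<Longrightarrow> \<phi> x = 0" using assms CcE by blast
  obtain M where M: "\<And>x. \<bar>\<phi> x\<bar> \<le> M" using assms Cc_bounded by metis
  show ?thesis
  proof (rule integrableI_bounded_set[of K _ _ M])
    show "K \<in> sets \<mu>" using K assms by (simp add: borel_compact)
    show "\<phi> \<in> borel_measurable \<mu>"
      using assms by (simp add: radon_borel_measurable borel_measurable_continuous_onI CcD_cont)
    show "emeasure \<mu> K < \<infinity>" using radon_compact assms K by auto
  qed (use K M in auto)
qed

lemma Ccp_nn_integral:
  fixes \<phi> :: "'a::t2_space \<Rightarrow> real"
  assumes "\<mu> \<in> radon" "\<phi> \<in> Ccp" shows "(\<integral>\<^sup>+x. ennreal (\<phi> x) \<partial>\<mu>) = ennreal (\<integral>x. \<phi> x \<partial>\<mu>)"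
  using assms by (intro nn_integral_eq_integral Cc_integrable) (auto dest: CcpD)

lemma Ccp_integral_nonneg:
  fixes \<phi> :: "'a::t2_space \<Rightarrow> real"
  shows "\<phi> \<in> Ccp \<Longrightarrow> 0 \<le> (\<integral>x. \<phi> x \<partial>\<mu>)"
  by (auto dest: CcpD intro: integral_nonneg_AE)

lemma Ccp_integral_le:
  fixes \<phi> :: "'a::t2_space \<Rightarrow> real"
  assumes "\<mu> \<in> radon" "\<phi> \<in> Ccp" "compact K" "\<And>x. x \<notin> K \<Longrightarrow> \<phi> x = 0" "\<And>x. \<phi> x \<le> d"
  shows "(\<integral>x. \<phi> x \<partial>\<mu>) \<le> d * measure \<mu> K"
proof -
  have [measurable]: "K \<in> sets \<mu>" using assms by (simp add: borel_compact)
  have i: "integrable \<mu> (\<lambda>x. d * indicator K x)"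
    using radon_compact[OF assms(1,3)] by (intro integrable_mult_right integrable_real_indicator) auto
  have "(\<integral>x. \<phi> x \<partial>\<mu>) \<le> (\<integral>x. d * indicator K x \<partial>\<mu>)"
    using assms by (intro integral_mono Cc_integrable i) (auto dest: CcpD simp: indicator_def)
  then show ?thesis using radon_compact[OF assms(1,3)] by simp
qed

lemma Ccp_integral_ge:
  fixes \<phi> :: "'a::t2_space \<Rightarrow> real"
  assumes "\<mu> \<in> radon" "\<phi> \<in> Ccp" "compact K" "\<And>x. x \<in> K \<Longrightarrow> d \<le> \<phi> x"
  shows "d * measure \<mu> K \<le> (\<integral>x. \<phi> x \<partial>\<mu>)"
proof -
  have [measurable]: "K \<in> sets \<mu>" using assms by (simp add: borel_compact)
  have i: "integrable \<mu> (\<lambda>x. d * indicator K x)"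
    using radon_compact[OF assms(1,3)] by (intro integrable_mult_right integrable_real_indicator) auto
  have "(\<integral>x. d * indicator K x \<partial>\<mu>) \<le> (\<integral>x. \<phi> x \<partial>\<mu>)"
    using assms by (intro integral_mono Cc_integrable i) (auto dest: CcpD simp: indicator_def)
  then show ?thesis using radon_compact[OF assms(1,3)] by simp
qed

lemma radon_emeasure_compact:
  "\<mu> \<in> radon \<Longrightarrow> compact K \<Longrightarrow> emeasure \<mu> K = ennreal (measure \<mu> K)"
  using radon_compact[of \<mu> K] by (intro emeasure_eq_ennreal_measure) auto

text \<open>\<open>\<phi>\<close> is cut into horizontal slices of height \<open>d\<close>. The
  slice \<open>\<psi> k\<close> lies between \<open>d\<close> times the indicators of
  \<open>K (Suc k)\<close> and of \<open>K k\<close>, so its value under \<open>L\<close> and its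
  integral both lie between \<open>d\<close> times the measures of these sets. The discrepancies
  telescope to at most \<open>d * measure R S\<close>, with \<open>d\<close> arbitrary.\<close>

lemma (in pos_functional) riesz_integral:
  assumes \<phi>: "\<phi> \<in> Ccp"
  shows "(\<integral>x. \<phi> x \<partial>R) = L \<phi>"
proof -
  obtain S where S: "compact S" "\<And>x. x \<notin> S \<Longrightarrow> \<phi> x = 0" using \<phi> CcE CcpD by metis
  obtain M where M: "0 < M" "\<And>x. \<bar>\<phi> x\<bar> \<le> M" using \<phi> Cc_bounded CcpD by metis
  have cont: "continuous_on UNIV \<phi>" using \<phi> by (auto dest: CcpD CcD_cont)
  have mR: "measure R K = enn2real (outer_content K)" if "compact K" for K
    using that by (simp add: measure_def emeasure_R borel_compact essential_content_compact)
  have le: "\<bar>L \<phi> - (\<integral>x. \<phi> x \<partial>R)\<bar> \<le> d * measure R S" if d: "0 < d" for d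
  proof -
    \<comment> \<open>\<open>N\<close> slices of height \<open>d\<close> reach beyond the bound
      \<open>M\<close>, so they add up to \<open>\<phi>\<close>.\<close>
    obtain N :: nat where N: "M < real N * d" using reals_Archimedean3[OF d] by blast
    define \<psi> where "\<psi> k x = min (\<phi> x) (real (Suc k) * d) - min (\<phi> x) (real k * d)" for k x
    \<comment> \<open>The intersection with \<open>S\<close> makes the level set for
      \<open>k = 0\<close> compact too; the level condition alone would give the whole
      space.\<close>
    define K where "K k = {x\<in>S. real k * d \<le> \<phi> x}" for k :: nat
    have KC: "compact (K k)" for k
    proof -
      have "closed {x. real k * d \<le> \<phi> x}" using cont by (intro closed_Collect_le) auto
      moreover have "K k = S \<inter> {x. real k * d \<le> \<phi> x}" by (auto simp: K_def)
      ultimately show ?thesis using S by (simp add: compact_Int_closed)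
    qed
    have p1: "\<psi> k x \<le> d" "0 \<le> \<psi> k x" for k x
      using d CcpD(2)[OF \<phi>, of x] by (auto simp: \<psi>_def min_def algebra_simps)
    have p0: "\<psi> k x = 0" if "x \<notin> K k" for k x
    proof (cases "x \<in> S")
      case True
      then show ?thesis using that d by (auto simp: K_def \<psi>_def min_def algebra_simps)
    next
      case False
      then show ?thesis using S(2)[OF False] d by (simp add: \<psi>_def min_def)
    qed
    have pd: "d \<le> \<psi> k x" if "x \<in> K (Suc k)" for k x
      using that d by (auto simp: K_def \<psi>_def min_def algebra_simps)
    have pC: "\<psi> k \<in> Ccp" for k
    proof (rule CcpI)
      have "continuous_on UNIV (\<lambda>x. min (\<phi> x) (real (Suc k) * d) - min (\<phi> x) (real k * d))"
        by (intro continuous_intros cont)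
      then show "\<psi> k \<in> Cc" using KC p0 by (intro CcI[of _ "K k"]) (auto simp: \<psi>_def[abs_def])
    qed (use p1 in auto)
    have K0: "K 0 = S" using CcpD(2)[OF \<phi>] by (auto simp: K_def)
    have sum: "(\<Sum>k<n. \<psi> k x) = min (\<phi> x) (real n * d)" for n x
      using CcpD(2)[OF \<phi>, of x] by (induction n) (auto simp: \<psi>_def algebra_simps)
    have phi: "\<phi> = (\<lambda>x. \<Sum>k<N. \<psi> k x)"
    proof
      fix x show "\<phi> x = (\<Sum>k<N. \<psi> k x)" unfolding sum using M(2)[of x] N by linarith
    qed
    have Lsum: "L (\<lambda>x. \<Sum>k<n. \<psi> k x) = (\<Sum>k<n. L (\<psi> k)) \<and> (\<lambda>x. \<Sum>k<n. \<psi> k x) \<in> Ccp" for n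
      by (induction n) (auto simp: L_zero Ccp_zero L_add pC Ccp_add)
    have Isum: "(\<integral>x. (\<Sum>k<n. \<psi> k x) \<partial>R) = (\<Sum>k<n. (\<integral>x. \<psi> k x \<partial>R))" for n
      using pC R_radon by (intro Bochner_Integration.integral_sum) (auto intro!: Cc_integrable dest: CcpD)
    have b1: "L (\<psi> k) \<le> d * measure R (K k)" for k
    proof -
      have "ennreal (L (\<lambda>x. (1/d) * \<psi> k x)) \<le> outer_content (K k)"
        using p1 p0 d KC pC by (intro outer_content_ge Ccp_scale) (auto simp: field_simps)
      then have "ennreal (L (\<psi> k) / d) \<le> ennreal (measure R (K k))"
        using d outer_content_compact[OF KC] L_scale[OF pC, of "1/d"] by (simp add: mR[OF KC] less_top)
      then show ?thesis using d by (subst (asm) ennreal_le_iff) (auto simp: field_simps)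
    qed
    have b2: "d * measure R (K (Suc k)) \<le> L (\<psi> k)" for k
    proof -
      have "outer_content (K (Suc k)) \<le> ennreal (L (\<lambda>x. (1/d) * \<psi> k x))"
        using p1 pd d KC pC by (intro outer_content_le Ccp_scale) (auto simp: field_simps)
      then have "ennreal (measure R (K (Suc k))) \<le> ennreal (L (\<psi> k) / d)"
        using d outer_content_compact[OF KC] L_scale[OF pC, of "1/d"] by (simp add: mR[OF KC] less_top)
      then show ?thesis using d L_nonneg[OF pC] by (subst (asm) ennreal_le_iff) (auto simp: field_simps)
    qed
    have b3: "(\<integral>x. \<psi> k x \<partial>R) \<le> d * measure R (K k)" for k
      using p0 p1 by (intro Ccp_integral_le R_radon pC KC)
    have b4: "d * measure R (K (Suc k)) \<le> (\<integral>x. \<psi> k x \<partial>R)" for k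
      using pd by (intro Ccp_integral_ge R_radon pC KC)
    have "\<bar>L \<phi> - (\<integral>x. \<phi> x \<partial>R)\<bar> = \<bar>\<Sum>k<N. (L (\<psi> k) - (\<integral>x. \<psi> k x \<partial>R))\<bar>"
      unfolding phi using Lsum Isum by (simp add: sum_subtractf)
    also have "\<dots> \<le> (\<Sum>k<N. \<bar>L (\<psi> k) - (\<integral>x. \<psi> k x \<partial>R)\<bar>)" by (rule sum_abs)
    also have "\<dots> \<le> (\<Sum>k<N. d * measure R (K k) - d * measure R (K (Suc k)))"
      using b1 b2 b3 b4 by (intro sum_mono) (smt (verit))
    also have "\<dots> = d * measure R (K 0) - d * measure R (K N)"
      by (rule sum_lessThan_telescope')
    also have "\<dots> \<le> d * measure R S" using d by (simp add: K0)
    finally show ?thesis .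
  qed
  have "\<bar>L \<phi> - (\<integral>x. \<phi> x \<partial>R)\<bar> \<le> 0 + e" if "0 < e" for e
  proof -
    \<comment> \<open>Adding 1 avoids a division by zero when \<open>S\<close> is a null
      set.\<close>
    have "0 < e / (measure R S + 1)" using that by (simp add: add_nonneg_pos)
    from le[OF this] have "\<bar>L \<phi> - (\<integral>x. \<phi> x \<partial>R)\<bar> \<le> e / (measure R S + 1) * measure R S" .
    also have "\<dots> \<le> e / (measure R S + 1) * (measure R S + 1)"
      using that by (intro mult_left_mono) auto
    also have "\<dots> = e" using add_nonneg_pos[of "measure R S" 1] by simp
    finally show ?thesis by simp
  qed
  then have "\<bar>L \<phi> - (\<integral>x. \<phi> x \<partial>R)\<bar> \<le> 0" by (rule field_le_epsilon)
  then show ?thesis by simp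
qed

lemma (in lch) riesz:
  fixes L :: "('b \<Rightarrow> real) \<Rightarrow> real"
  assumes "\<And>\<phi>. \<phi> \<in> Ccp \<Longrightarrow> 0 \<le> L \<phi>"
    and "\<And>\<phi> \<psi>. \<phi> \<in> Ccp \<Longrightarrow> \<psi> \<in> Ccp \<Longrightarrow> L (\<lambda>x. \<phi> x + \<psi> x) = L \<phi> + L \<psi>"
    and "\<And>\<phi> c. \<phi> \<in> Ccp \<Longrightarrow> 0 \<le> c \<Longrightarrow> L (\<lambda>x. c * \<phi> x) = c * L \<phi>"
  obtains \<mu> where "\<mu> \<in> radon" "\<And>\<phi>. \<phi> \<in> Ccp \<Longrightarrow> (\<integral>x. \<phi> x \<partial>\<mu>) = L \<phi>"
proof -
  interpret pos_functional T L using assms by unfold_locales auto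
  show ?thesis using that R_radon riesz_integral by blast
qed

section \<open>Outer regularity on compact sets and comparison by test functions\<close>

context lch
begin

text \<open>Inner regularity is applied to a complement: inside a compact neighbourhood
  \<open>S\<close> of \<open>K\<close>, a compact \<open>Q\<close> that nearly exhausts
  \<open>S - K\<close> is removed from the open set \<open>V\<close> between \<open>K\<close> and
  \<open>S\<close>.\<close>

lemma radon_outer:
  fixes \<nu> :: "'b measure"
  assumes "\<nu> \<in> radon" "compact K" "0 < e"
  obtains U where "open U" "K \<subseteq> U" "emeasure \<nu> U \<le> emeasure \<nu> K + ennreal e"
proof -
  obtain V S where VS: "open V" "compact S" "K \<subseteq> V" "V \<subseteq> S"
    using between[OF assms(2) open_UNIV subset_UNIV] by metis
  have [measurable]: "K \<in> sets \<nu>" "S \<in> sets \<nu>" "V \<in> sets \<nu>"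
    using VS assms by (auto simp: borel_compact)
  have SK: "S - K \<in> sets borel" using VS assms by (auto simp: borel_compact)
  have fin: "emeasure \<nu> (S - K) < top"
    using emeasure_mono[of "S - K" S \<nu>] radon_compact[OF assms(1) VS(2)] by auto
  have "\<exists>Q. compact Q \<and> Q \<subseteq> S - K \<and> emeasure \<nu> (S - K) \<le> emeasure \<nu> Q + ennreal e"
  proof (rule ccontr)
    assume "\<not> ?thesis"
    then have c: "\<And>Q. compact Q \<and> Q \<subseteq> S - K \<Longrightarrow> emeasure \<nu> Q + ennreal e < emeasure \<nu> (S - K)"
      by (auto simp: not_le)
    have "emeasure \<nu> (S - K) + ennreal e = (SUP Q\<in>{Q. compact Q \<and> Q \<subseteq> S - K}. emeasure \<nu> Q + ennreal e)"
      by (subst radon_inner[OF assms(1) SK]) (rule ennreal_SUP_add_left[symmetric], auto)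
    also have "\<dots> \<le> emeasure \<nu> (S - K)" using c by (intro SUP_least) (auto intro: less_imp_le)
    finally show False using ennreal_less_add_pos[OF fin assms(3)] by auto
  qed
  then obtain Q where Q: "compact Q" "Q \<subseteq> S - K" "emeasure \<nu> (S - K) \<le> emeasure \<nu> Q + ennreal e" by blast
  have [measurable]: "Q \<in> sets \<nu>" using Q assms by (auto simp: borel_compact)
  have eq: "emeasure \<nu> (S - K) = emeasure \<nu> Q + emeasure \<nu> (S - K - Q)"
    using Q by (subst plus_emeasure) (auto simp: Un_absorb1)
  have "emeasure \<nu> Q < top" using Q assms radon_compact by auto
  then have le: "emeasure \<nu> (S - K - Q) \<le> ennreal e"
    using Q(3) unfolding eq by (auto simp: ennreal_add_left_cancel_le)
  show ?thesis
  proof (rule that[of "V - Q"])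
    show "open (V - Q)" using VS Q by (auto intro: compact_imp_closed)
    show "K \<subseteq> V - Q" using VS Q by auto
    have "emeasure \<nu> (V - Q) \<le> emeasure \<nu> (K \<union> (S - K - Q))" using VS by (intro emeasure_mono) auto
    also have "\<dots> \<le> emeasure \<nu> K + emeasure \<nu> (S - K - Q)" by (intro emeasure_subadditive) auto
    also have "\<dots> \<le> emeasure \<nu> K + ennreal e" using le by (intro add_mono) auto
    finally show "emeasure \<nu> (V - Q) \<le> emeasure \<nu> K + ennreal e" .
  qed
qed

text \<open>On a compact set the inequality is transferred by a Urysohn function lying between the
  indicator of \<open>K\<close> and that of an open set of almost the same
  \<open>\<nu>\<close>-measure. Inner regularity extends it to Borel sets.\<close>

lemma radon_leI:
  fixes \<mu> \<nu> :: "'b measure"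
  assumes "\<mu> \<in> radon" "\<nu> \<in> radon" "\<And>\<phi>. \<phi> \<in> Ccp \<Longrightarrow> (\<integral>x. \<phi> x \<partial>\<mu>) \<le> (\<integral>x. \<phi> x \<partial>\<nu>)"
  shows "\<mu> \<le> \<nu>"
proof -
  have K: "emeasure \<mu> K \<le> emeasure \<nu> K" if K: "compact K" for K
  proof (rule ennreal_le_epsilon)
    fix e :: real assume "0 < e"
    then obtain U where U: "open U" "K \<subseteq> U" "emeasure \<nu> U \<le> emeasure \<nu> K + ennreal e"
      using radon_outer assms K by blast
    obtain \<phi> S where u: "\<phi> \<in> Ccp" "\<And>x. \<phi> x \<le> 1" "\<And>x. x \<in> K \<Longrightarrow> \<phi> x = 1" "compact S" "S \<subseteq> U" "\<And>x. x \<notin> S \<Longrightarrow> \<phi> x = 0"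
      using urysohn[OF K U(1,2)] by metis
    have "ennreal (1 * measure \<mu> K) \<le> ennreal (\<integral>x. \<phi> x \<partial>\<mu>)" using u assms K by (intro ennreal_leI Ccp_integral_ge) auto
    also have "\<dots> \<le> ennreal (\<integral>x. \<phi> x \<partial>\<nu>)" using u assms by (intro ennreal_leI) auto
    also have "\<dots> \<le> ennreal (1 * measure \<nu> S)" using u assms K by (intro ennreal_leI Ccp_integral_le) auto
    also have "\<dots> \<le> emeasure \<nu> U"
      using u U assms by (simp add: radon_emeasure_compact[symmetric] emeasure_mono)
    finally show "emeasure \<mu> K \<le> emeasure \<nu> K + ennreal e"
      using U K assms by (simp add: radon_emeasure_compact)
  qed
  show ?thesis
  proof (subst le_measure)
    show "\<forall>A\<in>sets \<mu>. emeasure \<mu> A \<le> emeasure \<nu> A"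
    proof
      fix A assume "A \<in> sets \<mu>"
      then have A: "A \<in> sets borel" using assms by simp
      show "emeasure \<mu> A \<le> emeasure \<nu> A"
        unfolding radon_inner[OF assms(1) A] radon_inner[OF assms(2) A]
        using K by (intro SUP_mono) blast
    qed
  qed (use assms in simp)
qed

lemma radon_eqI:
  fixes \<mu> \<nu> :: "'b measure"
  assumes "\<mu> \<in> radon" "\<nu> \<in> radon" "\<And>\<phi>. \<phi> \<in> Ccp \<Longrightarrow> (\<integral>x. \<phi> x \<partial>\<mu>) = (\<integral>x. \<phi> x \<partial>\<nu>)"
  shows "\<mu> = \<nu>"
  using assms by (intro antisym radon_leI) auto

end

lemma radon_emeasure_mono: "\<mu> \<in> radon \<Longrightarrow> \<nu> \<in> radon \<Longrightarrow> \<mu> \<le> \<nu> \<Longrightarrow> emeasure \<mu> B \<le> emeasure \<nu> B"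
  by (cases "B \<in> sets borel") (auto simp: le_measure emeasure_notin_sets)

text \<open>Both measures live on the Borel sets, so they have the same simple functions below
  \<open>f\<close>, and it is enough to compare the integrals of these.\<close>

lemma radon_nn_integral_mono:
  assumes "\<mu> \<in> radon" "\<nu> \<in> radon" "\<mu> \<le> \<nu>"
  shows "(\<integral>\<^sup>+x. f x \<partial>\<mu>) \<le> (\<integral>\<^sup>+x. f x \<partial>\<nu>)"
  unfolding nn_integral_def
proof (rule SUP_mono)
  fix s assume "s \<in> {g. simple_function \<mu> g \<and> g \<le> (\<lambda>x. f x)}"
  moreover have "simple_function \<mu> s = simple_function \<nu> s"
    using assms by (simp add: simple_function_def)
  moreover have "integral\<^sup>S \<mu> s \<le> integral\<^sup>S \<nu> s"
    using assms by (auto simp: simple_integral_def intro!: sum_mono mult_left_mono radon_emeasure_mono)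
  ultimately show "\<exists>m\<in>{g. simple_function \<nu> g \<and> g \<le> (\<lambda>x. f x)}. integral\<^sup>S \<mu> s \<le> integral\<^sup>S \<nu> m"
    by auto
qed

section \<open>Lower semicontinuous functions and tau-smoothness\<close>

definition lsc :: "('a::topological_space \<Rightarrow> ennreal) \<Rightarrow> bool" where
  "lsc u \<longleftrightarrow> (\<forall>c. open {x. c < u x})"

lemma lsc_measurable: "lsc u \<Longrightarrow> u \<in> borel_measurable borel"
  by (intro borel_measurableI_greater) (auto simp: lsc_def)

lemma lsc_cont:
  assumes "continuous_on UNIV \<phi>" shows "lsc (\<lambda>x. ennreal (\<phi> x))"
  unfolding lsc_def
proof
  fix c
  have "continuous_on UNIV (\<lambda>x. ennreal (\<phi> x))" using assms by (rule continuous_on_ennreal)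
  then show "open {x. c < ennreal (\<phi> x)}" by (intro open_Collect_less) auto
qed

lemma lsc_SUP: "(\<And>h. h \<in> D \<Longrightarrow> lsc h) \<Longrightarrow> lsc (\<lambda>x. SUP h\<in>D. h x)"
proof -
  assume a: "\<And>h. h \<in> D \<Longrightarrow> lsc h"
  have "{x. c < (SUP h\<in>D. h x)} = (\<Union>h\<in>D. {x. c < h x})" for c by (auto simp: less_SUP_iff)
  then show ?thesis using a by (auto simp: lsc_def)
qed

definition directed_fn :: "('a \<Rightarrow> 'c::order) set \<Rightarrow> bool" where
  "directed_fn D \<longleftrightarrow> D \<noteq> {} \<and> (\<forall>h1\<in>D. \<forall>h2\<in>D. \<exists>h3\<in>D. h1 \<le> h3 \<and> h2 \<le> h3)"

lemma directed_fn_finite: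
  assumes "directed_fn D" "finite C" "C \<subseteq> D" shows "\<exists>h\<in>D. \<forall>h'\<in>C. h' \<le> h"
  using assms(2,3)
proof (induction C)
  case empty then show ?case using assms(1) by (auto simp: directed_fn_def)
next
  case (insert c C)
  then obtain h where h: "h \<in> D" "\<forall>h'\<in>C. h' \<le> h" by auto
  then obtain h3 where "h3 \<in> D" "h \<le> h3" "c \<le> h3"
    using assms(1) insert.prems unfolding directed_fn_def by (meson insert_subset)
  then show ?case using h by (intro bexI[of _ h3]) (auto intro: order_trans)
qed

text \<open>Induction over the summands, exchanging one sum and one supremum at a time by
  directedness. The common upper bound \<open>h3\<close> has to serve all \<open>j\<close> at
  once.\<close>

lemma sum_SUP_directed:
  fixes f :: "'j \<Rightarrow> 'd \<Rightarrow> ennreal"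
  assumes "finite J" "D \<noteq> {}" "\<And>h1 h2. h1 \<in> D \<Longrightarrow> h2 \<in> D \<Longrightarrow> \<exists>h3\<in>D. \<forall>j\<in>J. f j h1 \<le> f j h3 \<and> f j h2 \<le> f j h3"
  shows "(\<Sum>j\<in>J. SUP h\<in>D. f j h) = (SUP h\<in>D. \<Sum>j\<in>J. f j h)"
  using assms(1,3)
proof (induction J)
  case empty then show ?case using assms(2) by simp
next
  case (insert k J)
  have "(\<Sum>j\<in>insert k J. SUP h\<in>D. f j h) = (SUP h\<in>D. f k h) + (SUP h\<in>D. \<Sum>j\<in>J. f j h)"
    using insert by (simp, subst insert.IH) (metis insertCI)+
  also have "\<dots> = (SUP h\<in>D. f k h + (\<Sum>j\<in>J. f j h))"
  proof (rule SUP_add_directed_ennreal[symmetric])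
    fix h1 h2 assume "h1 \<in> D" "h2 \<in> D"
    then obtain h3 where "h3 \<in> D" "\<forall>j\<in>insert k J. f j h1 \<le> f j h3 \<and> f j h2 \<le> f j h3"
      using insert.prems by blast
    then show "\<exists>h3\<in>D. f k h1 + (\<Sum>j\<in>J. f j h2) \<le> f k h3 + (\<Sum>j\<in>J. f j h3)"
      by (intro bexI[of _ h3] add_mono sum_mono) auto
  qed
  finally show ?case using insert by simp
qed

text \<open>A step function with steps of height 1 / n up to level n, written with indicators of
  open half-lines. Composed with a lower semicontinuous function it is a finite combination of
  indicators of open sets.\<close>

definition staircase :: "nat \<Rightarrow> ennreal \<Rightarrow> ennreal" where
  "staircase n y = (\<Sum>k\<in>{1..n*n}. ennreal (1 / real n) * indicator {ennreal (real k / real n)<..} y)"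

lemma staircase_le: "staircase n y \<le> y"
proof -
  \<comment> \<open>The bound by \<open>N / n\<close> strengthens the induction: when the next level
    still lies below \<open>y\<close>, it gives the bound by \<open>y\<close>.\<close>
  have "(\<Sum>k\<in>{1..N}. ennreal (1 / real n) * indicator {ennreal (real k / real n)<..} y) \<le> min y (ennreal (real N / real n))" for N
  proof (induction N)
    case (Suc N)
    show ?case
    proof (cases "ennreal (real (Suc N) / real n) < y")
      case True
      have "(\<Sum>k\<in>{1..Suc N}. ennreal (1 / real n) * indicator {ennreal (real k / real n)<..} y)
        \<le> ennreal (real N / real n) + ennreal (1 / real n)"
        using Suc True by (simp add: add_mono)
      also have "\<dots> = ennreal (real (Suc N) / real n)"
        by (simp flip: ennreal_plus add: add_divide_distrib)
      finally show ?thesis using True by simp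
    next
      case False
      have "ennreal (real N / real n) \<le> ennreal (real (Suc N) / real n)"
        by (intro ennreal_leI divide_right_mono) auto
      then show ?thesis using Suc False by (auto simp: min_le_iff_disj intro: order_trans)
    qed
  qed simp
  then show ?thesis unfolding staircase_def by (meson min.boundedE)
qed

text \<open>With \<open>j\<close> the floor of \<open>r * n\<close>, the levels up to
  \<open>j / n\<close> are at most \<open>r\<close>, hence below \<open>y\<close>, and contribute
  \<open>j / n\<close>, which is at least \<open>r - 1 / n\<close>. That \<open>r\<close> is at most
  \<open>n\<close> places these levels among the \<open>n * n\<close> summands.\<close>

lemma staircase_ge:
  assumes "ennreal r < y" "0 < n" "0 \<le> r" "r \<le> real n" shows "ennreal (r - 1 / real n) \<le> staircase n y"
proof -
  define j where "j = nat \<lfloor>r * real n\<rfloor>"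
  have j1: "real j \<le> r * real n" using assms by (simp add: j_def)
  have j2: "r * real n - 1 \<le> real j" using assms unfolding j_def by linarith
  have "real j \<le> real (n * n)" using j1 assms(4) by simp (meson mult_right_mono of_nat_0_le_iff order_trans)
  then have jn: "j \<le> n * n" by linarith
  have "ennreal (r - 1 / real n) \<le> ennreal (real j * (1 / real n))"
  proof (rule ennreal_leI)
    have "(r * real n - 1) / real n \<le> real j / real n" using j2 by (intro divide_right_mono) auto
    then show "r - 1 / real n \<le> real j * (1 / real n)" using assms(2) by (simp add: diff_divide_distrib)
  qed
  also have "\<dots> = (\<Sum>k\<in>{1..j}. ennreal (1 / real n))" 
    by (subst ennreal_mult) (auto simp: ennreal_of_nat_eq_real_of_nat)
  also have "\<dots> = (\<Sum>k\<in>{1..j}. ennreal (1 / real n) * indicator {ennreal (real k / real n)<..} y)"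
  proof (rule sum.cong)
    fix k assume k: "k \<in> {1..j}"
    have "real k / real n \<le> r" using k j1 assms(2) by (simp add: field_simps)
    then have "ennreal (real k / real n) < y" using assms(1) ennreal_leI le_less_trans by blast
    then show "ennreal (1 / real n) = ennreal (1 / real n) * indicator {ennreal (real k / real n)<..} y" by simp
  qed simp
  also have "\<dots> \<le> staircase n y" unfolding staircase_def using jn by (intro sum_mono2) auto
  finally show ?thesis .
qed

lemma staircase_liminf: "y \<le> liminf (\<lambda>n. staircase n y)"
  unfolding le_Liminf_iff
proof (intro allI impI)
  fix z assume "z < y"
  then obtain w where w: "z < w" "w < y" using dense by blast
  then obtain r where r: "w = ennreal r" "0 \<le> r" by (metis ennreal_cases not_less top_greatest)
  then have "z < top" using w by (meson less_le_trans top_greatest)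
  then obtain q where q: "z = ennreal q" "0 \<le> q" using w by (metis ennreal_cases less_irrefl)
  have qr: "q < r" using w q r by (simp add: ennreal_less_iff)
  have "\<forall>\<^sub>F n in sequentially. 1 / real n < r - q"
    using qr by (intro order_tendstoD[OF lim_1_over_n]) auto
  moreover have "\<forall>\<^sub>F n in sequentially. r \<le> real n"
    using filterlim_real_sequentially by (simp add: filterlim_at_top)
  ultimately show "\<forall>\<^sub>F n in sequentially. z < staircase n y"
    using eventually_gt_at_top[of 0]
  proof eventually_elim
    case (elim n)
    have "z < ennreal (r - 1 / real n)" using elim q by (simp add: ennreal_less_iff)
    also have "\<dots> \<le> staircase n y" using elim w r by (intro staircase_ge) auto
    finally show ?case .
  qed
qed

text \<open>Radon measures are tau-smooth: by inner regularity and compactness this holds for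
  indicators of open sets, and \<^const>\<open>staircase\<close> reduces the general case to these.\<close>

lemma radon_SUP_directed:
  fixes D :: "('a::t2_space \<Rightarrow> ennreal) set"
  assumes \<mu>: "\<mu> \<in> radon" and D: "directed_fn D" and l: "\<And>h. h \<in> D \<Longrightarrow> lsc h"
  shows "(\<integral>\<^sup>+x. (SUP h\<in>D. h x) \<partial>\<mu>) = (SUP h\<in>D. \<integral>\<^sup>+x. h x \<partial>\<mu>)"
proof (rule antisym)
  have ne: "D \<noteq> {}" using D by (simp add: directed_fn_def)
  define u where "u x = (SUP h\<in>D. h x)" for x
  have lu: "lsc u" using lsc_SUP[OF l] by (simp add: u_def[abs_def])
  have op: "emeasure \<mu> {x. c < u x} \<le> (SUP h\<in>D. emeasure \<mu> {x. c < h x})" for c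
  proof -
    have "emeasure \<mu> K \<le> (SUP h\<in>D. emeasure \<mu> {x. c < h x})" if K: "compact K" "K \<subseteq> {x. c < u x}" for K
    proof -
      have "K \<subseteq> (\<Union>h\<in>D. {x. c < h x})" using K by (auto simp: u_def less_SUP_iff)
      then obtain C where C: "C \<subseteq> D" "finite C" "K \<subseteq> (\<Union>h\<in>C. {x. c < h x})"
        using compactE_image[OF K(1), of D "\<lambda>h. {x. c < h x}"] l by (auto simp: lsc_def)
      obtain h where h: "h \<in> D" "\<forall>h'\<in>C. h' \<le> h" using directed_fn_finite[OF D C(2,1)] by blast
      have "emeasure \<mu> K \<le> emeasure \<mu> {x. c < h x}"
      proof (rule emeasure_mono)
        show "K \<subseteq> {x. c < h x}"
        proof
          fix x assume "x \<in> K"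
          then obtain h' where "h' \<in> C" "c < h' x" using C by auto
          then show "x \<in> {x. c < h x}" using h by (auto simp: le_fun_def intro: less_le_trans)
        qed
      qed (use l[OF h(1)] \<mu> in \<open>simp add: lsc_def\<close>)
      then show ?thesis using h by (meson SUP_upper2)
    qed
    then show ?thesis using lu by (subst radon_inner[OF \<mu>]) (auto simp: lsc_def intro!: SUP_least)
  qed
  have meas: "{x. c < h x} \<in> sets \<mu>" if "lsc h" for c h using that \<mu> by (auto simp: lsc_def)
  have int: "(\<integral>\<^sup>+x. staircase n (h x) \<partial>\<mu>) = (\<Sum>k\<in>{1..n*n}. ennreal (1 / real n) * emeasure \<mu> {x. ennreal (real k / real n) < h x})"
    if "lsc h" for n h
  proof -
    have "indicator {ennreal (real k / real n)<..} (h x) = (indicator {x. ennreal (real k / real n) < h x} x :: ennreal)" for k x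
      by (simp add: indicator_def)
    then have "(\<integral>\<^sup>+x. staircase n (h x) \<partial>\<mu>) = (\<integral>\<^sup>+x. (\<Sum>k\<in>{1..n*n}. ennreal (1 / real n) * indicator {x. ennreal (real k / real n) < h x} x) \<partial>\<mu>)"
      by (simp add: staircase_def)
    also have "\<dots> = (\<Sum>k\<in>{1..n*n}. \<integral>\<^sup>+x. ennreal (1 / real n) * indicator {x. ennreal (real k / real n) < h x} x \<partial>\<mu>)"
      using meas[OF that] by (intro nn_integral_sum borel_measurable_times_ennreal borel_measurable_const borel_measurable_indicator)
    also have "\<dots> = (\<Sum>k\<in>{1..n*n}. ennreal (1 / real n) * emeasure \<mu> {x. ennreal (real k / real n) < h x})"
      by (intro sum.cong refl nn_integral_cmult_indicator meas that)
    finally show ?thesis .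
  qed
  have "(\<integral>\<^sup>+x. u x \<partial>\<mu>) \<le> (\<integral>\<^sup>+x. liminf (\<lambda>n. staircase n (u x)) \<partial>\<mu>)"
    by (intro nn_integral_mono staircase_liminf)
  \<comment> \<open>By Fatou's lemma it is enough that each staircase of \<open>u\<close> has
    integral at most the supremum on the right.\<close>
  also have "\<dots> \<le> liminf (\<lambda>n. \<integral>\<^sup>+x. staircase n (u x) \<partial>\<mu>)"
    using lsc_measurable[OF lu] \<mu> by (intro nn_integral_liminf) (auto simp: staircase_def radon_borel_measurable)
  also have "\<dots> \<le> (SUP h\<in>D. \<integral>\<^sup>+x. h x \<partial>\<mu>)"
  proof -
    have "(\<integral>\<^sup>+x. staircase n (u x) \<partial>\<mu>) \<le> (SUP h\<in>D. \<integral>\<^sup>+x. h x \<partial>\<mu>)" for n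
    proof -
      have "(\<integral>\<^sup>+x. staircase n (u x) \<partial>\<mu>) \<le> (\<Sum>k\<in>{1..n*n}. ennreal (1 / real n) * (SUP h\<in>D. emeasure \<mu> {x. ennreal (real k / real n) < h x}))"
        unfolding int[OF lu] by (intro sum_mono mult_left_mono op) auto
      also have "\<dots> = (\<Sum>k\<in>{1..n*n}. (SUP h\<in>D. ennreal (1 / real n) * emeasure \<mu> {x. ennreal (real k / real n) < h x}))"
        by (simp add: SUP_mult_left_ennreal)
      also have "\<dots> = (SUP h\<in>D. \<Sum>k\<in>{1..n*n}. ennreal (1 / real n) * emeasure \<mu> {x. ennreal (real k / real n) < h x})"
      proof (rule sum_SUP_directed)
        fix h1 h2 assume h: "h1 \<in> D" "h2 \<in> D"
        then obtain h3 where h3: "h3 \<in> D" "h1 \<le> h3" "h2 \<le> h3" using D by (auto simp: directed_fn_def)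
        then show "\<exists>h3\<in>D. \<forall>j\<in>{1..n * n}. ennreal (1 / real n) * emeasure \<mu> {x. ennreal (real j / real n) < h1 x}
             \<le> ennreal (1 / real n) * emeasure \<mu> {x. ennreal (real j / real n) < h3 x} \<and>
             ennreal (1 / real n) * emeasure \<mu> {x. ennreal (real j / real n) < h2 x}
             \<le> ennreal (1 / real n) * emeasure \<mu> {x. ennreal (real j / real n) < h3 x}"
          using h by (intro bexI[of _ h3] ballI conjI mult_left_mono emeasure_mono meas l)
            (auto simp: le_fun_def intro: less_le_trans)
      qed (use ne in auto)
      also have "\<dots> = (SUP h\<in>D. \<integral>\<^sup>+x. staircase n (h x) \<partial>\<mu>)" using l by (intro SUP_cong) (auto simp: int)
      also have "\<dots> \<le> (SUP h\<in>D. \<integral>\<^sup>+x. h x \<partial>\<mu>)" by (intro SUP_mono) (auto intro!: nn_integral_mono staircase_le)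
      finally show ?thesis .
    qed
    then have "liminf (\<lambda>n. \<integral>\<^sup>+x. staircase n (u x) \<partial>\<mu>) \<le> liminf (\<lambda>n. SUP h\<in>D. \<integral>\<^sup>+x. h x \<partial>\<mu>)"
      by (intro Liminf_mono) auto
    then show ?thesis by (simp add: Liminf_const)
  qed
  finally show "(\<integral>\<^sup>+x. (SUP h\<in>D. h x) \<partial>\<mu>) \<le> (SUP h\<in>D. \<integral>\<^sup>+x. h x \<partial>\<mu>)" by (simp add: u_def)
  show "(SUP h\<in>D. \<integral>\<^sup>+x. h x \<partial>\<mu>) \<le> (\<integral>\<^sup>+x. (SUP h\<in>D. h x) \<partial>\<mu>)"
    by (intro SUP_least nn_integral_mono) (auto intro: SUP_upper)
qed

definition minorants :: "('a::topological_space \<Rightarrow> ennreal) \<Rightarrow> ('a \<Rightarrow> real) set" where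
  "minorants u = {\<phi>\<in>Ccp. \<forall>x. ennreal (\<phi> x) \<le> u x}"

lemma minorants_max:
  fixes u :: "'a::t2_space \<Rightarrow> ennreal"
  shows "\<phi> \<in> minorants u \<Longrightarrow> \<psi> \<in> minorants u \<Longrightarrow> (\<lambda>x. max (\<phi> x) (\<psi> x)) \<in> minorants u"
  using Cc_max[of \<phi> \<psi>] by (auto simp: minorants_def Ccp_def max_def)

lemma minorants_zero: "(\<lambda>_. 0) \<in> minorants u"
  by (simp add: minorants_def Ccp_zero)

text \<open>For \<open>r\<close> less than \<open>u x\<close> there is a bump of height
  \<open>r\<close> at \<open>x\<close> supported where \<open>u\<close> exceeds \<open>r\<close>,
  and such bumps are minorants of \<open>u\<close>.\<close>

lemma (in lch) lsc_eq_SUP: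
  fixes u :: "'b \<Rightarrow> ennreal"
  assumes "lsc u" shows "u x = (SUP \<phi>\<in>minorants u. ennreal (\<phi> x))"
proof (rule antisym)
  show "u x \<le> (SUP \<phi>\<in>minorants u. ennreal (\<phi> x))"
  proof (rule dense_le)
    fix z assume "z < u x"
    then obtain w where w: "z < w" "w < u x" using dense by blast
    then obtain r where r: "w = ennreal r" "0 \<le> r" by (metis ennreal_cases not_less top_greatest)
    have "open {x. w < u x}" using assms by (simp add: lsc_def)
    then obtain \<phi> S where \<phi>: "\<phi> \<in> Ccp" "\<And>x. \<phi> x \<le> 1" "\<And>y. y \<in> {x} \<Longrightarrow> \<phi> y = 1" "compact S" "S \<subseteq> {x. w < u x}" "\<And>x. x \<notin> S \<Longrightarrow> \<phi> x = 0"
      using urysohn[of "{x}" "{x. w < u x}"] w by (smt (verit) compact_sing mem_Collect_eq singletonD subsetI)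
    have "ennreal (r * \<phi> y) \<le> u y" for y
    proof (cases "y \<in> S")
      case True
      have "ennreal (r * \<phi> y) \<le> ennreal r" using \<phi>(2)[of y] r by (intro ennreal_leI) (simp add: mult_left_le)
      moreover have "ennreal r < u y" using True \<phi>(5) r by auto
      ultimately show ?thesis by auto
    qed (simp add: \<phi>)
    then have "(\<lambda>y. r * \<phi> y) \<in> minorants u" using \<phi> r by (simp add: minorants_def Ccp_scale)
    then have "ennreal (r * \<phi> x) \<le> (SUP \<phi>\<in>minorants u. ennreal (\<phi> x))" by (rule SUP_upper)
    then show "z \<le> (SUP \<phi>\<in>minorants u. ennreal (\<phi> x))" using w r \<phi> by simp
  qed
qed (auto simp: minorants_def intro!: SUP_least)

lemma minorants_directed:
  fixes u :: "'a::t2_space \<Rightarrow> ennreal"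
  shows "directed_fn ((\<lambda>\<phi> x. ennreal (\<phi> x)) ` minorants u)"
  unfolding directed_fn_def
proof (intro conjI ballI)
  show "(\<lambda>\<phi> x. ennreal (\<phi> x)) ` minorants u \<noteq> {}" using minorants_zero[of u] by blast
  fix h1 h2 assume "h1 \<in> (\<lambda>\<phi> x. ennreal (\<phi> x)) ` minorants u" "h2 \<in> (\<lambda>\<phi> x. ennreal (\<phi> x)) ` minorants u"
  then obtain \<phi> \<psi> where p: "\<phi> \<in> minorants u" "\<psi> \<in> minorants u" "h1 = (\<lambda>x. ennreal (\<phi> x))" "h2 = (\<lambda>x. ennreal (\<psi> x))" by auto
  then show "\<exists>h3\<in>(\<lambda>\<phi> x. ennreal (\<phi> x)) ` minorants u. h1 \<le> h3 \<and> h2 \<le> h3"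
    by (intro bexI[of _ "\<lambda>x. ennreal (max (\<phi> x) (\<psi> x))"] imageI minorants_max)
      (auto simp: le_fun_def intro!: ennreal_leI)
qed

lemma Ccp_lsc: "\<phi> \<in> Ccp \<Longrightarrow> lsc (\<lambda>x. ennreal (\<phi> x))"
  by (auto intro!: lsc_cont dest: CcpD CcD_cont)

text \<open>Tau-smoothness applied to the minorants, which are directed under maxima. In this form
  the integral is a supremum of vaguely continuous functions of \<open>\<mu>\<close>.\<close>

lemma (in lch) radon_lsc_integral:
  fixes u :: "'b \<Rightarrow> ennreal"
  assumes "\<mu> \<in> radon" "lsc u"
  shows "(\<integral>\<^sup>+x. u x \<partial>\<mu>) = (SUP \<phi>\<in>minorants u. ennreal (\<integral>x. \<phi> x \<partial>\<mu>))"
proof -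
  have "(\<integral>\<^sup>+x. u x \<partial>\<mu>) = (\<integral>\<^sup>+x. (SUP h\<in>(\<lambda>\<phi> x. ennreal (\<phi> x)) ` minorants u. h x) \<partial>\<mu>)"
    using lsc_eq_SUP[OF assms(2)] by (simp add: image_image)
  also have "\<dots> = (SUP h\<in>(\<lambda>\<phi> x. ennreal (\<phi> x)) ` minorants u. (\<integral>\<^sup>+x. h x \<partial>\<mu>))"
    using assms by (intro radon_SUP_directed minorants_directed) (auto simp: minorants_def Ccp_lsc)
  also have "\<dots> = (SUP \<phi>\<in>minorants u. ennreal (\<integral>x. \<phi> x \<partial>\<mu>))"
    unfolding image_image using assms(1) by (intro SUP_cong refl Ccp_nn_integral) (auto simp: minorants_def)
  finally show ?thesis .
qed

section \<open>Finite combinations and restrictions of Radon measures\<close>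

text \<open>Sums, multiples and midpoints of measures are all instances of this one construction.
  Negative coefficients are read as 0 by \<open>ennreal\<close>.\<close>

definition radon_lincomb :: "'j set \<Rightarrow> ('j \<Rightarrow> real) \<Rightarrow> ('j \<Rightarrow> 'a::t2_space measure) \<Rightarrow> 'a measure" where
  "radon_lincomb J c \<mu> = measure_of UNIV (sets borel) (\<lambda>B. \<Sum>j\<in>J. ennreal (c j) * emeasure (\<mu> j) B)"

lemma sets_radon_lincomb [simp]: "sets (radon_lincomb J c \<mu>) = sets borel" "space (radon_lincomb J c \<mu>) = UNIV"
  unfolding radon_lincomb_def by (auto simp: sets.sets_measure_of_eq[of borel, simplified])

lemma emeasure_radon_lincomb:
  fixes \<mu> :: "'j \<Rightarrow> 'a::t2_space measure"
  assumes "\<And>j. j \<in> J \<Longrightarrow> \<mu> j \<in> radon" "B \<in> sets borel"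
  shows "emeasure (radon_lincomb J c \<mu>) B = (\<Sum>j\<in>J. ennreal (c j) * emeasure (\<mu> j) B)"
proof -
  have "countably_additive (sets borel) (\<lambda>B. \<Sum>j\<in>J. ennreal (c j) * emeasure (\<mu> j) B)"
    unfolding countably_additive_def
  proof safe
    fix A :: "nat \<Rightarrow> 'a set" assume A: "range A \<subseteq> sets borel" "disjoint_family A"
    have "(\<Sum>i. \<Sum>j\<in>J. ennreal (c j) * emeasure (\<mu> j) (A i)) = (\<Sum>j\<in>J. \<Sum>i. ennreal (c j) * emeasure (\<mu> j) (A i))"
      by (intro suminf_sum) auto
    also have "\<dots> = (\<Sum>j\<in>J. ennreal (c j) * emeasure (\<mu> j) (\<Union>i. A i))"
      using A assms(1) by (intro sum.cong) (auto simp: suminf_emeasure)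
    finally show "(\<Sum>i. \<Sum>j\<in>J. ennreal (c j) * emeasure (\<mu> j) (A i)) = (\<Sum>j\<in>J. ennreal (c j) * emeasure (\<mu> j) (\<Union> (range A)))" .
  qed
  moreover have "positive (sets borel) (\<lambda>B. \<Sum>j\<in>J. ennreal (c j) * emeasure (\<mu> j) B)"
    by (simp add: positive_def)
  ultimately show ?thesis unfolding radon_lincomb_def
    using sets.sigma_algebra_axioms[of "borel :: 'a measure"] assms(2)
    by (intro emeasure_measure_of_sigma) auto
qed

text \<open>Inner regularity survives finite sums because two compact subsets of \<open>B\<close>
  lie in their compact union, so the suprema of the summands can be taken simultaneously.\<close>

lemma radon_lincomb_radon:
  fixes \<mu> :: "'j \<Rightarrow> 'a::t2_space measure"
  assumes "finite J" "\<And>j. j \<in> J \<Longrightarrow> \<mu> j \<in> radon"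
  shows "radon_lincomb J c \<mu> \<in> radon"
  unfolding radon_def
proof (intro CollectI conjI allI impI ballI)
  fix K :: "'a set" assume "compact K"
  then show "emeasure (radon_lincomb J c \<mu>) K < \<infinity>"
    using assms radon_compact by (subst emeasure_radon_lincomb) (auto simp: borel_compact ennreal_mult_less_top)
next
  fix B :: "'a set" assume B: "B \<in> sets borel"
  have "emeasure (radon_lincomb J c \<mu>) B = (\<Sum>j\<in>J. ennreal (c j) * (SUP K\<in>{K. compact K \<and> K \<subseteq> B}. emeasure (\<mu> j) K))"
    by (subst emeasure_radon_lincomb[OF assms(2) B]) (auto intro!: sum.cong arg_cong2[where f="(*)"] radon_inner assms(2) B)
  also have "\<dots> = (\<Sum>j\<in>J. (SUP K\<in>{K. compact K \<and> K \<subseteq> B}. ennreal (c j) * emeasure (\<mu> j) K))"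
    by (simp add: SUP_mult_left_ennreal)
  also have "\<dots> = (SUP K\<in>{K. compact K \<and> K \<subseteq> B}. \<Sum>j\<in>J. ennreal (c j) * emeasure (\<mu> j) K)"
  proof (rule sum_SUP_directed[OF assms(1)])
    fix K L assume "K \<in> {K. compact K \<and> K \<subseteq> B}" "L \<in> {K. compact K \<and> K \<subseteq> B}"
    then show "\<exists>h3\<in>{K. compact K \<and> K \<subseteq> B}. \<forall>j\<in>J. ennreal (c j) * emeasure (\<mu> j) K \<le> ennreal (c j) * emeasure (\<mu> j) h3 \<and>
        ennreal (c j) * emeasure (\<mu> j) L \<le> ennreal (c j) * emeasure (\<mu> j) h3"
      using assms by (intro bexI[of _ "K \<union> L"] ballI conjI mult_left_mono emeasure_mono) (auto simp: borel_compact)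
  qed auto
  also have "\<dots> = (SUP K\<in>{K. compact K \<and> K \<subseteq> B}. emeasure (radon_lincomb J c \<mu>) K)"
    using assms by (intro SUP_cong) (auto simp: emeasure_radon_lincomb borel_compact)
  finally show "emeasure (radon_lincomb J c \<mu>) B = (SUP K\<in>{K. compact K \<and> K \<subseteq> B}. emeasure (radon_lincomb J c \<mu>) K)" .
qed simp

lemma nn_integral_radon_lincomb:
  fixes \<mu> :: "'j \<Rightarrow> 'a::t2_space measure"
  assumes "finite J" "\<And>j. j \<in> J \<Longrightarrow> \<mu> j \<in> radon" "f \<in> borel_measurable borel"
  shows "(\<integral>\<^sup>+x. f x \<partial>radon_lincomb J c \<mu>) = (\<Sum>j\<in>J. ennreal (c j) * (\<integral>\<^sup>+x. f x \<partial>\<mu> j))"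
  using assms(3)
proof (induction rule: borel_measurable_induct)
  case (cong f g)
  then have "f = g" by (auto simp: fun_eq_iff)
  then show ?case using cong by simp
next
  case (set A)
  then show ?case using assms by (simp add: emeasure_radon_lincomb)
next
  case (mult u a)
  then show ?case using assms
    by (subst nn_integral_cmult) (auto simp: radon_borel_measurable nn_integral_cmult sum_distrib_left ac_simps
      borel_measurable_subalgebra intro!: sum.cong cong: measurable_cong_sets)
next
  case (add u v)
  then show ?case using assms
    by (subst nn_integral_add) (auto simp: radon_borel_measurable nn_integral_add sum.distrib distrib_left
      intro!: sum.cong cong: measurable_cong_sets)
next
  case (seq U)
  have m: "U i \<in> borel_measurable (radon_lincomb J c \<mu>)" "j \<in> J \<Longrightarrow> U i \<in> borel_measurable (\<mu> j)" for i j
    using seq(1) assms(2) by (auto simp: radon_borel_measurable cong: measurable_cong_sets)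
  have "(\<integral>\<^sup>+x. (SUP i. U i) x \<partial>radon_lincomb J c \<mu>) = (SUP i. \<integral>\<^sup>+x. U i x \<partial>radon_lincomb J c \<mu>)"
    using seq m by (simp add: nn_integral_monotone_convergence_SUP image_comp)
  also have "\<dots> = (SUP i. \<Sum>j\<in>J. ennreal (c j) * (\<integral>\<^sup>+x. U i x \<partial>\<mu> j))"
    using seq by simp
  also have "\<dots> = (\<Sum>j\<in>J. SUP i. ennreal (c j) * (\<integral>\<^sup>+x. U i x \<partial>\<mu> j))"
  proof (rule sum_SUP_directed[symmetric, OF assms(1)])
    fix h1 h2 :: nat
    show "\<exists>h3\<in>UNIV. \<forall>j\<in>J. ennreal (c j) * integral\<^sup>N (\<mu> j) (U h1) \<le> ennreal (c j) * integral\<^sup>N (\<mu> j) (U h3) \<and>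
        ennreal (c j) * integral\<^sup>N (\<mu> j) (U h2) \<le> ennreal (c j) * integral\<^sup>N (\<mu> j) (U h3)"
      using incseqD[OF seq(3), of h1 "max h1 h2"] incseqD[OF seq(3), of h2 "max h1 h2"]
      by (intro bexI[of _ "max h1 h2"] ballI conjI mult_left_mono nn_integral_mono) (auto simp: le_fun_def)
  qed simp
  also have "\<dots> = (\<Sum>j\<in>J. ennreal (c j) * (\<integral>\<^sup>+x. (SUP i. U i) x \<partial>\<mu> j))"
    using seq m by (intro sum.cong) (auto simp: nn_integral_monotone_convergence_SUP image_comp SUP_mult_left_ennreal)
  finally show ?case .
qed

lemma Ccp_integral_radon_lincomb:
  fixes \<phi> :: "'a::t2_space \<Rightarrow> real"
  assumes "finite J" "\<And>j. j \<in> J \<Longrightarrow> \<mu> j \<in> radon" "\<And>j. j \<in> J \<Longrightarrow> 0 \<le> c j" "\<phi> \<in> Ccp"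
  shows "(\<integral>x. \<phi> x \<partial>radon_lincomb J c \<mu>) = (\<Sum>j\<in>J. c j * (\<integral>x. \<phi> x \<partial>\<mu> j))"
proof -
  have "ennreal (\<integral>x. \<phi> x \<partial>radon_lincomb J c \<mu>) = (\<Sum>j\<in>J. ennreal (c j) * ennreal (\<integral>x. \<phi> x \<partial>\<mu> j))"
    using assms by (simp flip: Ccp_nn_integral add: radon_lincomb_radon nn_integral_radon_lincomb lsc_measurable Ccp_lsc)
  also have "\<dots> = ennreal (\<Sum>j\<in>J. c j * (\<integral>x. \<phi> x \<partial>\<mu> j))"
    using assms by (simp flip: ennreal_mult add: Ccp_integral_nonneg sum_ennreal)
  finally show ?thesis
    using assms by (subst (asm) ennreal_inj) (auto intro!: Ccp_integral_nonneg sum_nonneg mult_nonneg_nonneg)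
qed

lemma radon_restrict:
  fixes \<mu> :: "'a::t2_space measure"
  assumes "\<mu> \<in> radon" "A \<in> sets borel" shows "density \<mu> (indicator A) \<in> radon"
proof -
  have em: "emeasure (density \<mu> (indicator A)) B = emeasure \<mu> (A \<inter> B)" if "B \<in> sets borel" for B
    using that assms by (subst emeasure_density) (auto simp: radon_borel_measurable nn_integral_indicator simp flip: indicator_inter_arith)
  show ?thesis unfolding radon_def
  proof (intro CollectI conjI allI impI ballI)
    fix K :: "'a set" assume "compact K"
    then show "emeasure (density \<mu> (indicator A)) K < \<infinity>"
      using assms radon_compact[of \<mu> K] emeasure_mono[of "A \<inter> K" K \<mu>] by (auto simp: em borel_compact)
  next
    fix B :: "'a set" assume B: "B \<in> sets borel"
    have "emeasure \<mu> (A \<inter> B) = (SUP K\<in>{K. compact K \<and> K \<subseteq> B}. emeasure \<mu> (A \<inter> K))"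
    proof (rule antisym)
      show "emeasure \<mu> (A \<inter> B) \<le> (SUP K\<in>{K. compact K \<and> K \<subseteq> B}. emeasure \<mu> (A \<inter> K))"
        using assms B by (subst radon_inner) (auto intro!: SUP_mono simp: Int_absorb1, metis Int_absorb1 order.refl)
      show "(SUP K\<in>{K. compact K \<and> K \<subseteq> B}. emeasure \<mu> (A \<inter> K)) \<le> emeasure \<mu> (A \<inter> B)"
        using assms B by (intro SUP_least emeasure_mono) auto
    qed
    then show "emeasure (density \<mu> (indicator A)) B = (SUP K\<in>{K. compact K \<and> K \<subseteq> B}. emeasure (density \<mu> (indicator A)) K)"
      using B by (subst em) (auto simp: em borel_compact intro!: SUP_cong)
  qed (use assms in simp)
qed

section \<open>Products of Radon measures\<close>

lemma Cc_tensor: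
  fixes \<phi> :: "'a::t2_space \<Rightarrow> real" and \<psi> :: "'c::t2_space \<Rightarrow> real"
  assumes "\<phi> \<in> Cc" "\<psi> \<in> Cc" shows "(\<lambda>z. \<phi> (fst z) * \<psi> (snd z)) \<in> Cc"
proof -
  obtain K where K: "compact K" "\<And>x. x \<notin> K \<Longrightarrow> \<phi> x = 0" using assms CcE by blast
  obtain L where L: "compact L" "\<And>x. x \<notin> L \<Longrightarrow> \<psi> x = 0" using assms CcE by blast
  have c: "continuous_on UNIV \<phi>" "continuous_on UNIV \<psi>" using assms by (auto dest: CcD_cont)
  have "\<phi> (fst z) * \<psi> (snd z) = 0" if "z \<notin> K \<times> L" for z
    using that K(2)[of "fst z"] L(2)[of "snd z"] by (auto simp: mem_Times_iff)
  then show ?thesis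
    using K(1) L(1) by (intro CcI[of _ "K \<times> L"] compact_Times)
      (auto intro!: continuous_intros continuous_on_compose2[OF c(1)] continuous_on_compose2[OF c(2)])
qed

text \<open>The factors carry no support condition, so that constants belong and the sums form an
  algebra, as the Stone-Weierstrass theorem requires. Compact support is restored afterwards by a
  cutoff.\<close>

definition tensor_sum :: "('a::t2_space \<times> 'a \<Rightarrow> real) \<Rightarrow> bool" where
  "tensor_sum p \<longleftrightarrow> (\<exists>(n::nat) \<phi> \<psi>. (\<forall>k<n. continuous_on UNIV (\<phi> k) \<and> continuous_on UNIV (\<psi> k)) \<and>
     p = (\<lambda>z. \<Sum>k<n. \<phi> k (fst z) * \<psi> k (snd z)))"

lemma tensor_sum1: "continuous_on UNIV \<phi> \<Longrightarrow> continuous_on UNIV \<psi> \<Longrightarrow> tensor_sum (\<lambda>z. \<phi> (fst z) * \<psi> (snd z))"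
  unfolding tensor_sum_def by (intro exI[of _ 1] exI[of _ "\<lambda>_. \<phi>"] exI[of _ "\<lambda>_. \<psi>"]) auto

lemma tensor_sum_add:
  assumes "tensor_sum p" "tensor_sum q" shows "tensor_sum (\<lambda>z. p z + q z)"
proof -
  obtain n :: nat and \<phi> \<psi> where p: "\<forall>k<n. continuous_on UNIV (\<phi> k) \<and> continuous_on UNIV (\<psi> k)"
     "p = (\<lambda>z. \<Sum>k<n. \<phi> k (fst z) * \<psi> k (snd z))" using assms(1) unfolding tensor_sum_def by blast
  obtain m :: nat and \<phi>' \<psi>' where q: "\<forall>k<m. continuous_on UNIV (\<phi>' k) \<and> continuous_on UNIV (\<psi>' k)"
     "q = (\<lambda>z. \<Sum>k<m. \<phi>' k (fst z) * \<psi>' k (snd z))" using assms(2) unfolding tensor_sum_def by blast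
  define \<phi>'' where "\<phi>'' k = (if k < n then \<phi> k else \<phi>' (k - n))" for k
  define \<psi>'' where "\<psi>'' k = (if k < n then \<psi> k else \<psi>' (k - n))" for k
  have "(\<Sum>k<n + m'. \<phi>'' k x * \<psi>'' k y) = (\<Sum>k<n. \<phi> k x * \<psi> k y) + (\<Sum>k<m'. \<phi>' k x * \<psi>' k y)" for x y m'
    by (induction m') (auto simp: \<phi>''_def \<psi>''_def)
  then have "(\<lambda>z. p z + q z) = (\<lambda>z. \<Sum>k<n + m. \<phi>'' k (fst z) * \<psi>'' k (snd z))"
    by (simp add: p q)
  moreover have "\<forall>k<n + m. continuous_on UNIV (\<phi>'' k) \<and> continuous_on UNIV (\<psi>'' k)"
    using p q by (auto simp: \<phi>''_def \<psi>''_def)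
  ultimately show ?thesis unfolding tensor_sum_def by blast
qed

lemma tensor_sum_sum: "finite J \<Longrightarrow> (\<And>j. j \<in> J \<Longrightarrow> tensor_sum (p j)) \<Longrightarrow> tensor_sum (\<lambda>z. \<Sum>j\<in>J. p j z)"
proof (induction J rule: finite_induct)
  case empty
  show ?case using tensor_sum1[of "\<lambda>_. 0" "\<lambda>_. 0"] by simp
next
  case (insert x F)
  then show ?case by (simp add: tensor_sum_add)
qed

lemma tensor_sum_mult:
  assumes "tensor_sum p" "tensor_sum q" shows "tensor_sum (\<lambda>z. p z * q z)"
proof -
  obtain n :: nat and \<phi> \<psi> where p: "\<forall>k<n. continuous_on UNIV (\<phi> k) \<and> continuous_on UNIV (\<psi> k)"
     "p = (\<lambda>z. \<Sum>k<n. \<phi> k (fst z) * \<psi> k (snd z))" using assms(1) unfolding tensor_sum_def by blast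
  obtain m :: nat and \<phi>' \<psi>' where q: "\<forall>k<m. continuous_on UNIV (\<phi>' k) \<and> continuous_on UNIV (\<psi>' k)"
     "q = (\<lambda>z. \<Sum>k<m. \<phi>' k (fst z) * \<psi>' k (snd z))" using assms(2) unfolding tensor_sum_def by blast
  have "tensor_sum (\<lambda>z. \<Sum>k<n. \<Sum>l<m. (\<phi> k (fst z) * \<phi>' l (fst z)) * (\<psi> k (snd z) * \<psi>' l (snd z)))"
    using p q by (intro tensor_sum_sum tensor_sum1) (auto intro!: continuous_intros)
  moreover have "(\<lambda>z. p z * q z) = (\<lambda>z. \<Sum>k<n. \<Sum>l<m. (\<phi> k (fst z) * \<phi>' l (fst z)) * (\<psi> k (snd z) * \<psi>' l (snd z)))"
    by (auto simp: p q sum_product intro!: sum.cong)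
  ultimately show ?thesis by simp
qed

lemma tensor_sum_cont: "tensor_sum p \<Longrightarrow> continuous_on S p"
  unfolding tensor_sum_def
  by (auto intro!: continuous_intros continuous_on_compose2[of UNIV _ _ fst] continuous_on_compose2[of UNIV _ _ snd])

lemma prod_lch:
  assumes "lch TYPE('b::t2_space)" shows "lch TYPE('b \<times> 'b)"
proof
  interpret lch "TYPE('b)" by fact
  have "locally_compact_space (prod_topology (euclidean :: 'b topology) (euclidean :: 'b topology))"
    using lc locally_compact_space_prod_topology[of "euclidean :: 'b topology" "euclidean :: 'b topology"] by blast
  then show "locally_compact_space (euclidean :: ('b \<times> 'b) topology)"
    by simp
qed

text \<open>The error is weighted by \<open>w x * w y\<close> instead of being merely uniform:
  integrated against two measures of possibly infinite mass it stays below \<open>e\<close> times a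
  product of two finite integrals.\<close>

definition tensor_sum_approx :: "('a::t2_space \<times> 'a \<Rightarrow> real) \<Rightarrow> ('a \<Rightarrow> real) \<Rightarrow> nat \<Rightarrow> (nat \<Rightarrow> 'a \<Rightarrow> real) \<Rightarrow> (nat \<Rightarrow> 'a \<Rightarrow> real) \<Rightarrow> real \<Rightarrow> bool" where
  "tensor_sum_approx h w n \<phi> \<psi> e \<longleftrightarrow> (\<forall>k<n. \<phi> k \<in> Cc \<and> \<psi> k \<in> Cc) \<and>
     (\<forall>x y. \<bar>h (x, y) - (\<Sum>k<n. \<phi> k x * \<psi> k y)\<bar> \<le> e * (w x * w y))"

context lch
begin

text \<open>\<open>w\<close> is 1 on the projections of a compact set off which \<open>h\<close>
  vanishes, and it is chosen before \<open>e\<close>, so one weight serves all tolerances.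
  Stone-Weierstrass approximates \<open>h\<close> on \<open>S \<times> S\<close>, where
  \<open>w\<close> vanishes off \<open>S\<close>; multiplication by \<open>w x * w y\<close> leaves
  \<open>h\<close> unchanged and gives the factors compact support.\<close>

lemma tensor_approx:
  fixes h :: "'b \<times> 'b \<Rightarrow> real"
  assumes h: "h \<in> Cc"
  obtains w where "w \<in> Ccp" "\<And>e. 0 < e \<Longrightarrow> \<exists>n \<phi> \<psi>. tensor_sum_approx h w n \<phi> \<psi> e"
proof -
  obtain K where K: "compact K" "\<And>z. z \<notin> K \<Longrightarrow> h z = 0" using h CcE by blast
  define Q where "Q = fst ` K \<union> snd ` K"
  have Q: "compact Q" unfolding Q_def using K
    by (intro compact_Un compact_continuous_image continuous_intros)
  obtain w S where w: "w \<in> Ccp" "\<And>x. w x \<le> 1" "\<And>x. x \<in> Q \<Longrightarrow> w x = 1" "compact S" "S \<subseteq> UNIV" "\<And>x. x \<notin> S \<Longrightarrow> w x = 0"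
    using urysohn[OF Q open_UNIV] by auto
  have wc: "continuous_on UNIV w" "w \<in> Cc" using w by (auto dest: CcpD CcD_cont)
  have w0: "0 \<le> w x" for x using w by (auto dest: CcpD)
  show ?thesis
  proof (rule that[OF w(1)])
    fix e :: real assume e: "0 < e"
    have "\<exists>g. tensor_sum g \<and> (\<forall>z\<in>S \<times> S. \<bar>h z - g z\<bar> < e)"
    proof (rule Stone_Weierstrass_HOL[where P = tensor_sum])
      show "compact (S \<times> S)" using w by (intro compact_Times)
      show "tensor_sum (\<lambda>x. c)" for c using tensor_sum1[of "\<lambda>_. c" "\<lambda>_. 1"] by simp
      show "continuous_on (S \<times> S) h" using h by (auto dest: CcD_cont intro: continuous_on_subset)
      show "tensor_sum f \<and> tensor_sum g \<Longrightarrow> tensor_sum (\<lambda>z. f z + g z)" "tensor_sum f \<and> tensor_sum g \<Longrightarrow> tensor_sum (\<lambda>z. f z * g z)"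
        for f g :: "'b \<times> 'b \<Rightarrow> real"
        by (auto intro: tensor_sum_add tensor_sum_mult)
      fix x y :: "'b \<times> 'b" assume xy: "x \<in> S \<times> S \<and> y \<in> S \<times> S \<and> x \<noteq> y"
      \<comment> \<open>Functions of a single coordinate separate points of the product, so it is
        enough to separate two points of the factor.\<close>
      have sep: "\<exists>f :: 'b \<Rightarrow> real. continuous_on UNIV f \<and> f a \<noteq> f b" if ab: "a \<noteq> b" for a b :: 'b
      proof -
        have "open (- {b})" "{a} \<subseteq> - {b}" using ab by auto
        then obtain \<phi> S where "\<phi> \<in> Ccp" "\<And>x. \<phi> x \<le> 1" "\<And>x. x \<in> {a} \<Longrightarrow> \<phi> x = 1" "compact S" "S \<subseteq> - {b}" "\<And>x. x \<notin> S \<Longrightarrow> \<phi> x = 0"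
          using urysohn[of "{a}" "- {b}"] by (metis compact_sing)
        then have "continuous_on UNIV \<phi>" "\<phi> a = 1" "\<phi> b = 0" by (auto dest: CcpD CcD_cont)
        then show ?thesis by (intro exI[of _ \<phi>]) auto
      qed
      show "\<exists>f. tensor_sum f \<and> f x \<noteq> f y"
      proof (cases "fst x = fst y")
        case True
        then have "snd x \<noteq> snd y" using xy by (auto simp: prod_eq_iff)
        then obtain f :: "'b \<Rightarrow> real" where "continuous_on UNIV f" "f (snd x) \<noteq> f (snd y)" using sep by blast
        then show ?thesis using tensor_sum1[of "\<lambda>_. 1" f] by (intro exI[of _ "\<lambda>z. f (snd z)"]) auto
      next
        case False
        then obtain f :: "'b \<Rightarrow> real" where "continuous_on UNIV f" "f (fst x) \<noteq> f (fst y)" using sep by blast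
        then show ?thesis using tensor_sum1[of f "\<lambda>_. 1"] by (intro exI[of _ "\<lambda>z. f (fst z)"]) auto
      qed
    qed (use e in \<open>auto intro: tensor_sum_cont\<close>)
    then obtain g where g: "tensor_sum g" "\<And>z. z \<in> S \<times> S \<Longrightarrow> \<bar>h z - g z\<bar> < e" by blast
    obtain n :: nat and \<phi> \<psi> where p: "\<forall>k<n. continuous_on UNIV (\<phi> k) \<and> continuous_on UNIV (\<psi> k)"
     "g = (\<lambda>z. \<Sum>k<n. \<phi> k (fst z) * \<psi> k (snd z))" using g(1) unfolding tensor_sum_def by blast
    have "tensor_sum_approx h w n (\<lambda>k x. w x * \<phi> k x) (\<lambda>k x. w x * \<psi> k x) e"
      unfolding tensor_sum_approx_def
    proof (intro conjI allI impI)
      show "k < n \<Longrightarrow> (\<lambda>x. w x * \<phi> k x) \<in> Cc" "k < n \<Longrightarrow> (\<lambda>x. w x * \<psi> k x) \<in> Cc" for k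
        using p wc by (auto intro: Cc_mult)
      fix x y
      have hw: "h (x, y) = h (x, y) * (w x * w y)"
      proof (cases "(x, y) \<in> K")
        case True
        then have "x \<in> Q" "y \<in> Q" by (force simp: Q_def)+
        then show ?thesis by (simp add: w)
      qed (simp add: K)
      have "(\<Sum>k<n. w x * \<phi> k x * (w y * \<psi> k y)) = g (x, y) * (w x * w y)"
        by (auto simp: p sum_distrib_right intro!: sum.cong)
      then have eq: "h (x, y) - (\<Sum>k<n. w x * \<phi> k x * (w y * \<psi> k y)) = (h (x, y) - g (x, y)) * (w x * w y)"
        using hw by (simp add: algebra_simps)
      show "\<bar>h (x, y) - (\<Sum>k<n. w x * \<phi> k x * (w y * \<psi> k y))\<bar> \<le> e * (w x * w y)"
      proof (cases "x \<in> S \<and> y \<in> S")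
        case True
        then have "\<bar>h (x, y) - g (x, y)\<bar> \<le> e" using g(2)[of "(x, y)"] by simp
        then show ?thesis unfolding eq using w0 by (simp add: abs_mult mult_right_mono)
      next
        case False
        then have "w x * w y = 0" using w by auto
        then show ?thesis unfolding eq by auto
      qed
    qed
    then show "\<exists>n \<phi> \<psi>. tensor_sum_approx h w n \<phi> \<psi> e" by blast
  qed
qed

end

lemma approx_eq:
  fixes a b C :: real
  assumes "\<And>e. 0 < e \<Longrightarrow> \<bar>a - b\<bar> \<le> e * C" shows "a = b"
proof -
  have "\<bar>a - b\<bar> \<le> 0"
  proof (cases "0 < C")
    case True
    show ?thesis
    proof (rule field_le_epsilon)
      fix d :: real assume "0 < d"
      then show "\<bar>a - b\<bar> \<le> 0 + d" using assms[of "d / C"] True by simp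
    qed
  qed (use assms[of 1] in simp)
  then show ?thesis by simp
qed

lemma Cc_uminus: "\<phi> \<in> Cc \<Longrightarrow> (\<lambda>x. - \<phi> x) \<in> Cc" for \<phi> :: "'a::t2_space \<Rightarrow> real"
  using Cc_scale[of \<phi> "-1"] by simp

lemma Cc_section:
  fixes h :: "'a::t2_space \<times> 'a \<Rightarrow> real"
  assumes "h \<in> Cc" shows "(\<lambda>y. h (x, y)) \<in> Cc"
proof -
  obtain K where K: "compact K" "\<And>z. z \<notin> K \<Longrightarrow> h z = 0" using assms CcE by blast
  have "h (x, y) = 0" if "y \<notin> snd ` K" for y using that K(2)[of "(x, y)"] by force
  moreover have "continuous_on UNIV (\<lambda>y. h (x, y))"
    using assms by (intro continuous_on_compose2[OF CcD_cont[OF assms]] continuous_intros) auto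
  moreover have "compact (snd ` K)" using K by (intro compact_continuous_image continuous_intros)
  ultimately show ?thesis by (intro CcI) auto
qed

lemma Ccp_section:
  fixes h :: "'a::t2_space \<times> 'a \<Rightarrow> real"
  assumes "h \<in> Ccp" shows "(\<lambda>y. h (x, y)) \<in> Ccp"
  using assms by (intro CcpI Cc_section) (auto dest: CcpD)

lemma Cc_swap:
  fixes h :: "'a::t2_space \<times> 'a \<Rightarrow> real"
  assumes "h \<in> Cc" shows "(\<lambda>z. h (snd z, fst z)) \<in> Cc"
proof -
  obtain K where K: "compact K" "\<And>z. z \<notin> K \<Longrightarrow> h z = 0" using assms CcE by blast
  have "h (snd z, fst z) = 0" if "z \<notin> (\<lambda>z. (snd z, fst z)) ` K" for z
  proof (rule K(2), rule notI)
    assume "(snd z, fst z) \<in> K"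
    then have "z \<in> (\<lambda>z. (snd z, fst z)) ` K" by (rule rev_image_eqI) simp
    then show False using that by blast
  qed
  moreover have "continuous_on UNIV (\<lambda>z. h (snd z, fst z))"
    using assms by (intro continuous_on_compose2[OF CcD_cont[OF assms]] continuous_intros) auto
  moreover have "compact ((\<lambda>z. (snd z, fst z)) ` K)" using K by (intro compact_continuous_image continuous_intros)
  ultimately show ?thesis by (intro CcI) auto
qed

lemma integral_diff_sum:
  fixes f :: "'a \<Rightarrow> real"
  assumes "integrable M f" "\<And>k. k < n \<Longrightarrow> integrable M (g k)"
  shows "(\<integral>x. f x - (\<Sum>k<n. c k * g k x) \<partial>M) = (\<integral>x. f x \<partial>M) - (\<Sum>k<(n::nat). c k * (\<integral>x. g k x \<partial>M))"
proof -
  have i: "integrable M (\<lambda>x. c k * g k x)" if "k < n" for k using assms(2)[OF that] by simp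
  have "(\<integral>x. f x - (\<Sum>k<n. c k * g k x) \<partial>M) = (\<integral>x. f x \<partial>M) - (\<integral>x. (\<Sum>k<n. c k * g k x) \<partial>M)"
    using i by (intro Bochner_Integration.integral_diff assms(1) Bochner_Integration.integrable_sum) auto
  also have "(\<integral>x. (\<Sum>k<n. c k * g k x) \<partial>M) = (\<Sum>k<n. \<integral>x. c k * g k x \<partial>M)"
    using i by (intro Bochner_Integration.integral_sum) auto
  finally show ?thesis by simp
qed

lemma integral_diff_sum_bound:
  fixes f :: "'a \<Rightarrow> real"
  assumes "integrable M f" "\<And>k. k < n \<Longrightarrow> integrable M (g k)" "integrable M W"
    and "\<And>x. \<bar>f x - (\<Sum>k<(n::nat). c k * g k x)\<bar> \<le> W x"
  shows "\<bar>(\<integral>x. f x \<partial>M) - (\<Sum>k<n. c k * (\<integral>x. g k x \<partial>M))\<bar> \<le> (\<integral>x. W x \<partial>M)"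
proof -
  have "integrable M (\<lambda>x. c k * g k x)" if "k < n" for k using assms(2)[OF that] by simp
  then have i: "integrable M (\<lambda>x. \<bar>f x - (\<Sum>k<n. c k * g k x)\<bar>)"
    by (intro integrable_abs Bochner_Integration.integrable_diff assms(1) Bochner_Integration.integrable_sum) auto
  have "\<bar>\<integral>x. f x - (\<Sum>k<n. c k * g k x) \<partial>M\<bar> \<le> (\<integral>x. \<bar>f x - (\<Sum>k<n. c k * g k x)\<bar> \<partial>M)"
    by (rule integral_abs_bound)
  also have "\<dots> \<le> (\<integral>x. W x \<partial>M)" by (rule integral_mono[OF i assms(3)]) (rule assms(4))
  finally show ?thesis using integral_diff_sum[OF assms(1,2)] by simp
qed

section \<open>Iterated integrals of compactly supported functions\<close>

definition section_int :: "'a::t2_space measure \<Rightarrow> ('a \<times> 'a \<Rightarrow> real) \<Rightarrow> 'a \<Rightarrow> real" where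
  "section_int \<nu> h x = (\<integral>y. h (x, y) \<partial>\<nu>)"

definition double_int :: "'a::t2_space measure \<Rightarrow> 'a measure \<Rightarrow> ('a \<times> 'a \<Rightarrow> real) \<Rightarrow> real" where
  "double_int \<mu> \<nu> h = (\<integral>x. section_int \<nu> h x \<partial>\<mu>)"

lemma tensor_sum_approx_section_int:
  fixes h :: "'a::t2_space \<times> 'a \<Rightarrow> real"
  assumes "tensor_sum_approx h w n \<phi> \<psi> e" "h \<in> Cc" "w \<in> Cc" "\<nu> \<in> radon"
  shows "\<bar>section_int \<nu> h x - (\<Sum>k<n. \<phi> k x * (\<integral>y. \<psi> k y \<partial>\<nu>))\<bar> \<le> e * (\<integral>y. w y \<partial>\<nu>) * w x"
proof -
  have i: "integrable \<nu> (\<lambda>y. h (x, y))" "integrable \<nu> w" "\<And>k. k < n \<Longrightarrow> integrable \<nu> (\<psi> k)"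
    using assms by (auto intro!: Cc_integrable Cc_section simp: tensor_sum_approx_def)
  have "\<bar>section_int \<nu> h x - (\<Sum>k<n. \<phi> k x * (\<integral>y. \<psi> k y \<partial>\<nu>))\<bar> \<le> (\<integral>y. e * (w x * w y) \<partial>\<nu>)"
    unfolding section_int_def using i assms(1) by (intro integral_diff_sum_bound) (auto simp: tensor_sum_approx_def)
  then show ?thesis by (simp add: ac_simps)
qed

context lch
begin

text \<open>Integrating the second factors of tensor approximations gives continuous functions of
  \<open>x\<close>, which converge uniformly because \<open>w\<close> is bounded by
  \<open>M\<close>. The support is confined to the projection \<open>fst\<close> of that of
  \<open>h\<close>.\<close>

lemma section_int_Cc:
  fixes h :: "'b \<times> 'b \<Rightarrow> real"
  assumes h: "h \<in> Cc" and \<nu>: "\<nu> \<in> radon" shows "section_int \<nu> h \<in> Cc"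
proof -
  obtain w where w: "w \<in> Ccp" "\<And>e. 0 < e \<Longrightarrow> \<exists>n \<phi> \<psi>. tensor_sum_approx h w n \<phi> \<psi> e"
    using tensor_approx[OF h] by blast
  obtain K where K: "compact K" "\<And>z. z \<notin> K \<Longrightarrow> h z = 0" using h CcE by blast
  obtain M where M: "0 < M" "\<And>x. \<bar>w x\<bar> \<le> M" using w Cc_bounded CcpD by metis
  have wC: "w \<in> Cc" using w CcpD by auto
  define W where "W = (\<integral>y. w y \<partial>\<nu>)"
  have W: "0 \<le> W" using w by (simp add: W_def Ccp_integral_nonneg)
  have ex: "\<exists>F. continuous_on UNIV F \<and> (\<forall>x. \<bar>section_int \<nu> h x - F x\<bar> \<le> e * W * M)" if e: "0 < e" for e
  proof -
    obtain n \<phi> \<psi> where t: "tensor_sum_approx h w n \<phi> \<psi> e" using w e by blast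
    have "continuous_on UNIV (\<lambda>x. \<Sum>k<n. \<phi> k x * (\<integral>y. \<psi> k y \<partial>\<nu>))"
      using t by (intro continuous_intros) (auto simp: tensor_sum_approx_def dest: CcD_cont)
    moreover have "\<bar>section_int \<nu> h x - (\<Sum>k<n. \<phi> k x * (\<integral>y. \<psi> k y \<partial>\<nu>))\<bar> \<le> e * W * M" for x
    proof -
      have "e * W * w x \<le> e * W * M" using M(2)[of x] W e by (intro mult_left_mono) auto
      then show ?thesis using tensor_sum_approx_section_int[OF t h wC \<nu>, of x] by (simp add: W_def)
    qed
    ultimately show ?thesis by blast
  qed
  have "\<exists>F. continuous_on UNIV F \<and> (\<forall>x. \<bar>section_int \<nu> h x - F x\<bar> \<le> (1 / real (Suc n)) * W * M)" for n
    by (rule ex) simp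
  then obtain F where F: "\<And>n. continuous_on UNIV (F n)" "\<And>n x. \<bar>section_int \<nu> h x - F n x\<bar> \<le> (1 / real (Suc n)) * W * M"
    by metis
  have "uniform_limit UNIV F (section_int \<nu> h) sequentially"
  proof (rule uniform_limitI)
    fix e :: real assume "0 < e"
    have "(\<lambda>n. (1 / real (Suc n)) * W * M) \<longlonglongrightarrow> 0 * W * M"
      by (intro tendsto_intros LIMSEQ_Suc lim_1_over_n)
    then have "\<forall>\<^sub>F n in sequentially. (1 / real (Suc n)) * W * M < e"
      using \<open>0 < e\<close> by (intro order_tendstoD) auto
    then show "\<forall>\<^sub>F n in sequentially. \<forall>x\<in>UNIV. dist (F n x) (section_int \<nu> h x) < e"
    proof eventually_elim
      case (elim n)
      then show ?case using F(2)[of _ n] by (auto simp: dist_real_def abs_minus_commute intro: le_less_trans)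
    qed
  qed
  then have "continuous_on UNIV (section_int \<nu> h)"
    using F by (intro uniform_limit_theorem) auto
  moreover have "section_int \<nu> h x = 0" if "x \<notin> fst ` K" for x
  proof -
    have "h (x, y) = 0" for y using that K(2)[of "(x, y)"] by force
    then show ?thesis by (simp add: section_int_def)
  qed
  moreover have "compact (fst ` K)" using K by (intro compact_continuous_image continuous_intros)
  ultimately show ?thesis by (intro CcI)
qed

lemma section_int_Ccp: "h \<in> Ccp \<Longrightarrow> \<nu> \<in> radon \<Longrightarrow> section_int \<nu> h \<in> Ccp" for h :: "'b \<times> 'b \<Rightarrow> real"
  by (intro CcpI section_int_Cc) (auto simp: section_int_def dest: CcpD intro: Ccp_integral_nonneg Ccp_section)

text \<open>Symmetry in the two measures, uniqueness of the product measure and joint vague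
  continuity are visible on sums of products of one-variable integrals; the error term carries them
  over to general \<open>h\<close>.\<close>

lemma double_int_approx:
  fixes h :: "'b \<times> 'b \<Rightarrow> real"
  assumes t: "tensor_sum_approx h w n \<phi> \<psi> e" and h: "h \<in> Cc" and w: "w \<in> Cc" and r: "\<mu> \<in> radon" "\<nu> \<in> radon"
  shows "\<bar>double_int \<mu> \<nu> h - (\<Sum>k<n. (\<integral>x. \<phi> k x \<partial>\<mu>) * (\<integral>y. \<psi> k y \<partial>\<nu>))\<bar> \<le> e * ((\<integral>x. w x \<partial>\<mu>) * (\<integral>y. w y \<partial>\<nu>))"
proof -
  have i: "integrable \<mu> (section_int \<nu> h)" "integrable \<mu> w" "\<And>k. k < n \<Longrightarrow> integrable \<mu> (\<phi> k)"
    using assms by (auto intro!: Cc_integrable section_int_Cc simp: tensor_sum_approx_def)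
  have "\<bar>double_int \<mu> \<nu> h - (\<Sum>k<n. (\<integral>y. \<psi> k y \<partial>\<nu>) * (\<integral>x. \<phi> k x \<partial>\<mu>))\<bar> \<le> (\<integral>x. e * (\<integral>y. w y \<partial>\<nu>) * w x \<partial>\<mu>)"
    unfolding double_int_def using i tensor_sum_approx_section_int[OF t h w r(2)]
    by (intro integral_diff_sum_bound) (auto simp: mult.commute)
  then show ?thesis by (simp add: ac_simps)
qed

text \<open>Fubini's theorem for \<open>Cc\<close> functions: transposing a tensor approximation of
  \<open>h\<close> exchanges its factors and leaves the sum of products of integrals
  unchanged.\<close>

lemma double_int_swap:
  fixes h :: "'b \<times> 'b \<Rightarrow> real"
  assumes h: "h \<in> Cc" and r: "\<mu> \<in> radon" "\<nu> \<in> radon"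
  shows "double_int \<mu> \<nu> h = double_int \<nu> \<mu> (\<lambda>z. h (snd z, fst z))"
proof -
  obtain w where w: "w \<in> Ccp" "\<And>e. 0 < e \<Longrightarrow> \<exists>n \<phi> \<psi>. tensor_sum_approx h w n \<phi> \<psi> e"
    using tensor_approx[OF h] by blast
  have wC: "w \<in> Cc" using w CcpD by auto
  show ?thesis
  proof (rule approx_eq[where C = "2 * ((\<integral>x. w x \<partial>\<mu>) * (\<integral>y. w y \<partial>\<nu>))"])
    fix e :: real assume "0 < e"
    then obtain n \<phi> \<psi> where t: "tensor_sum_approx h w n \<phi> \<psi> e" using w by blast
    then have t': "tensor_sum_approx (\<lambda>z. h (snd z, fst z)) w n \<psi> \<phi> e"
    proof -
      have "(\<Sum>k<n. \<psi> k x * \<phi> k y) = (\<Sum>k<n. \<phi> k y * \<psi> k x)" for x y by (simp add: mult.commute)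
      moreover have "w x * w y = w y * w x" for x y by simp
      moreover have "\<bar>h (y, x) - (\<Sum>k<n. \<phi> k y * \<psi> k x)\<bar> \<le> e * (w y * w x)" for x y
        using t by (simp add: tensor_sum_approx_def)
      ultimately show ?thesis using t unfolding tensor_sum_approx_def by (metis fst_conv snd_conv)
    qed
    show "\<bar>double_int \<mu> \<nu> h - double_int \<nu> \<mu> (\<lambda>z. h (snd z, fst z))\<bar> \<le> e * (2 * ((\<integral>x. w x \<partial>\<mu>) * (\<integral>y. w y \<partial>\<nu>)))"
      using double_int_approx[OF t h wC r] double_int_approx[OF t' Cc_swap[OF h] wC r(2,1)]
      by (simp add: mult.commute[of "\<integral>x. \<psi> _ x \<partial>\<nu>"] mult.commute[of "\<integral>x. w x \<partial>\<nu>"])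
  qed
qed

lemma is_lch: "lch TYPE('b)" by unfold_locales (rule lc)

text \<open>Existence comes from the Riesz theorem applied to the iterated integral, uniqueness from
  tensor approximation. Together they make the definite description behind \<open>radon_prod\<close>
  meaningful.\<close>

lemma radon_prod:
  fixes \<mu> \<nu> :: "'b measure"
  assumes r: "\<mu> \<in> radon" "\<nu> \<in> radon"
  shows "radon_prod \<mu> \<nu> \<in> radon" "\<And>h. h \<in> Cc \<Longrightarrow> (\<integral>z. h z \<partial>radon_prod \<mu> \<nu>) = double_int \<mu> \<nu> h"
proof -
  interpret P: lch "TYPE('b \<times> 'b)" by (rule prod_lch[OF is_lch])
  have ex: "\<exists>\<rho>\<in>radon. \<forall>h\<in>Ccp. (\<integral>z. h z \<partial>\<rho>) = double_int \<mu> \<nu> h"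
  proof (rule P.riesz[of "double_int \<mu> \<nu>"])
    fix h :: "'b \<times> 'b \<Rightarrow> real" assume h: "h \<in> Ccp"
    have hs: "integrable \<nu> (\<lambda>y. h (x, y))" for x using h r by (auto intro!: Cc_integrable Cc_section dest: CcpD)
    show "0 \<le> double_int \<mu> \<nu> h" unfolding double_int_def using h r by (intro Ccp_integral_nonneg section_int_Ccp)
    show "double_int \<mu> \<nu> (\<lambda>x. c * h x) = c * double_int \<mu> \<nu> h" for c by (simp add: double_int_def section_int_def)
    fix k :: "'b \<times> 'b \<Rightarrow> real" assume k: "k \<in> Ccp"
    have ks: "integrable \<nu> (\<lambda>y. k (x, y))" for x using k r by (auto intro!: Cc_integrable Cc_section dest: CcpD)
    have "section_int \<nu> (\<lambda>z. h z + k z) = (\<lambda>x. section_int \<nu> h x + section_int \<nu> k x)"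
      using hs ks by (auto simp: section_int_def fun_eq_iff)
    then show "double_int \<mu> \<nu> (\<lambda>z. h z + k z) = double_int \<mu> \<nu> h + double_int \<mu> \<nu> k"
      unfolding double_int_def using h k r by (simp add: Bochner_Integration.integral_add Cc_integrable section_int_Cc CcpD)
  qed blast
  let ?P = "\<lambda>\<rho>. \<rho> \<in> radon \<and> (\<forall>\<phi>\<in>Cc. \<forall>\<psi>\<in>Cc. (\<integral>z. \<phi> (fst z) * \<psi> (snd z) \<partial>\<rho>) = (\<integral>x. \<phi> x \<partial>\<mu>) * (\<integral>y. \<psi> y \<partial>\<nu>))"
  \<comment> \<open>The uniqueness half: a Radon measure that is multiplicative on tensors agrees
    with the iterated integral on all of \<open>Cc\<close>.\<close>
  have dblI: "(\<integral>z. h z \<partial>\<rho>) = double_int \<mu> \<nu> h" if \<rho>: "?P \<rho>" and h: "h \<in> Cc" for \<rho> h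
  proof -
    obtain w where w: "w \<in> Ccp" "\<And>e. 0 < e \<Longrightarrow> \<exists>n \<phi> \<psi>. tensor_sum_approx h w n \<phi> \<psi> e"
      using tensor_approx[OF h] by blast
    have wC: "w \<in> Cc" using w CcpD by auto
    show ?thesis
    proof (rule approx_eq[where C = "2 * ((\<integral>x. w x \<partial>\<mu>) * (\<integral>y. w y \<partial>\<nu>))"])
      fix e :: real assume "0 < e"
      then obtain n \<phi> \<psi> where t: "tensor_sum_approx h w n \<phi> \<psi> e" using w by blast
      have i: "integrable \<rho> h" "integrable \<rho> (\<lambda>z. w (fst z) * w (snd z))"
        "\<And>k. k < n \<Longrightarrow> integrable \<rho> (\<lambda>z. \<phi> k (fst z) * \<psi> k (snd z))"
        using \<rho> h wC t by (auto intro!: Cc_integrable Cc_tensor simp: tensor_sum_approx_def)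
      have "\<bar>(\<integral>z. h z \<partial>\<rho>) - (\<Sum>k<n. 1 * (\<integral>z. \<phi> k (fst z) * \<psi> k (snd z) \<partial>\<rho>))\<bar>
          \<le> (\<integral>z. e * (w (fst z) * w (snd z)) \<partial>\<rho>)"
        using i t by (intro integral_diff_sum_bound) (auto simp: tensor_sum_approx_def)
      also have "(\<Sum>k<n. 1 * (\<integral>z. \<phi> k (fst z) * \<psi> k (snd z) \<partial>\<rho>)) = (\<Sum>k<n. (\<integral>x. \<phi> k x \<partial>\<mu>) * (\<integral>y. \<psi> k y \<partial>\<nu>))"
        using \<rho> t by (simp add: tensor_sum_approx_def)
      also have "(\<integral>z. e * (w (fst z) * w (snd z)) \<partial>\<rho>) = e * ((\<integral>x. w x \<partial>\<mu>) * (\<integral>y. w y \<partial>\<nu>))" using \<rho> wC by simp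
      finally show "\<bar>(\<integral>z. h z \<partial>\<rho>) - double_int \<mu> \<nu> h\<bar> \<le> e * (2 * ((\<integral>x. w x \<partial>\<mu>) * (\<integral>y. w y \<partial>\<nu>)))"
        using double_int_approx[OF t h wC r] by linarith
    qed
  qed
  obtain \<rho> where \<rho>: "\<rho> \<in> radon" "\<And>h. h \<in> Ccp \<Longrightarrow> (\<integral>z. h z \<partial>\<rho>) = double_int \<mu> \<nu> h" using ex by blast
  \<comment> \<open>The Riesz theorem describes the measure on \<open>Ccp\<close>; a general
    \<open>h\<close> is split into its positive and negative parts.\<close>
  have dens: "(\<integral>z. h z \<partial>\<rho>) = double_int \<mu> \<nu> h" if h: "h \<in> Cc" for h
  proof -
    have p: "(\<lambda>z. max (h z) 0) \<in> Ccp" "(\<lambda>z. max (- h z) 0) \<in> Ccp"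
      using h by (auto intro!: CcpI Cc_max Cc_uminus Cc_zero)
    have e: "h = (\<lambda>z. max (h z) 0 - max (- h z) 0)" by (auto simp: max_def)
    have "(\<integral>z. h z \<partial>\<rho>) = (\<integral>z. max (h z) 0 \<partial>\<rho>) - (\<integral>z. max (- h z) 0 \<partial>\<rho>)"
      by (subst e, rule Bochner_Integration.integral_diff) (intro Cc_integrable \<rho> p[THEN CcpD(1)])+
    also have "\<dots> = double_int \<mu> \<nu> (\<lambda>z. max (h z) 0) - double_int \<mu> \<nu> (\<lambda>z. max (- h z) 0)"
      using p by (simp only: \<rho>)
    also have "\<dots> = (\<integral>x. section_int \<nu> (\<lambda>z. max (h z) 0) x - section_int \<nu> (\<lambda>z. max (- h z) 0) x \<partial>\<mu>)"
      unfolding double_int_def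
      by (rule Bochner_Integration.integral_diff[symmetric]) (intro Cc_integrable r section_int_Cc p[THEN CcpD(1)])+
    also have "\<dots> = double_int \<mu> \<nu> h"
    proof -
      have "section_int \<nu> h x = section_int \<nu> (\<lambda>z. max (h z) 0) x - section_int \<nu> (\<lambda>z. max (- h z) 0) x" for x
        unfolding section_int_def
        by (subst e, rule Bochner_Integration.integral_diff) (intro Cc_integrable r Cc_section p[THEN CcpD(1)])+
      then show ?thesis by (simp add: double_int_def)
    qed
    finally show ?thesis .
  qed
  have P: "?P \<rho>"
    using \<rho>(1) by (auto simp: dens Cc_tensor) (simp add: double_int_def section_int_def)
  have "\<exists>!\<rho>. ?P \<rho>"
  proof (rule ex1I)
    show "?P \<rho>" by (rule P)
  next
    fix \<rho>' assume P': "?P \<rho>'"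
    show "\<rho>' = \<rho>"
      using P P' by (intro P.radon_eqI) (auto simp: dblI CcpD)
  qed
  then have "?P (radon_prod \<mu> \<nu>)" unfolding radon_prod_def by (rule theI')
  then show "radon_prod \<mu> \<nu> \<in> radon" "\<And>h. h \<in> Cc \<Longrightarrow> (\<integral>z. h z \<partial>radon_prod \<mu> \<nu>) = double_int \<mu> \<nu> h"
    using dblI by auto
qed

section \<open>Iterated integrals of lower semicontinuous kernels\<close>

lemma directed_minorants_image:
  fixes u :: "'c::t2_space \<Rightarrow> ennreal"
  assumes "\<And>\<phi> \<psi>. \<phi> \<in> minorants u \<Longrightarrow> \<psi> \<in> minorants u \<Longrightarrow> \<phi> \<le> \<psi> \<Longrightarrow> G \<phi> \<le> G \<psi>"
  shows "directed_fn (G ` minorants u)"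
  unfolding directed_fn_def
proof (intro conjI ballI)
  show "G ` minorants u \<noteq> {}" using minorants_zero[of u] by blast
  fix h1 h2 assume "h1 \<in> G ` minorants u" "h2 \<in> G ` minorants u"
  then obtain \<phi> \<psi> where p: "\<phi> \<in> minorants u" "\<psi> \<in> minorants u" "h1 = G \<phi>" "h2 = G \<psi>" by auto
  then show "\<exists>h3\<in>G ` minorants u. h1 \<le> h3 \<and> h2 \<le> h3"
    using minorants_max[OF p(1,2)] assms[OF p(1) minorants_max[OF p(1,2)]] assms[OF p(2) minorants_max[OF p(1,2)]]
    by (intro bexI[of _ "G (\<lambda>x. max (\<phi> x) (\<psi> x))"] imageI conjI) (simp_all add: le_funI)
qed

text \<open>The sections of the minorants of \<open>K\<close> form a directed family whose supremum
  is the section of \<open>K\<close>, so tau-smoothness of \<open>\<nu>\<close> applies.\<close>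

lemma lsc_section_integral:
  fixes K :: "'b \<times> 'b \<Rightarrow> ennreal"
  assumes K: "lsc K" and \<nu>: "\<nu> \<in> radon"
  shows "(\<integral>\<^sup>+y. K (x, y) \<partial>\<nu>) = (SUP h\<in>minorants K. ennreal (section_int \<nu> h x))"
proof -
  interpret P: lch "TYPE('b \<times> 'b)" by (rule prod_lch[OF is_lch])
  have "(\<integral>\<^sup>+y. K (x, y) \<partial>\<nu>) = (\<integral>\<^sup>+y. (SUP h\<in>(\<lambda>h y. ennreal (h (x, y))) ` minorants K. h y) \<partial>\<nu>)"
    by (simp add: P.lsc_eq_SUP[OF K, of "(x, _)"] image_image)
  also have "\<dots> = (SUP h\<in>(\<lambda>h y. ennreal (h (x, y))) ` minorants K. \<integral>\<^sup>+y. h y \<partial>\<nu>)"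
    using \<nu> by (intro radon_SUP_directed directed_minorants_image)
      (auto simp: le_fun_def minorants_def intro!: ennreal_leI Ccp_lsc Ccp_section)
  also have "\<dots> = (SUP h\<in>minorants K. ennreal (section_int \<nu> h x))"
    unfolding image_image section_int_def using \<nu>
    by (intro SUP_cong refl Ccp_nn_integral Ccp_section) (auto simp: minorants_def)
  finally show ?thesis .
qed

lemma lsc_potential:
  fixes K :: "'b \<times> 'b \<Rightarrow> ennreal"
  assumes K: "lsc K" and \<nu>: "\<nu> \<in> radon"
  shows "lsc (\<lambda>x. \<integral>\<^sup>+y. K (x, y) \<partial>\<nu>)"
proof -
  have "(\<lambda>x. \<integral>\<^sup>+y. K (x, y) \<partial>\<nu>) = (\<lambda>x. SUP h\<in>(\<lambda>h x. ennreal (section_int \<nu> h x)) ` minorants K. h x)"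
    by (simp add: lsc_section_integral[OF assms] image_image)
  moreover have "lsc (\<lambda>x. SUP h\<in>(\<lambda>h x. ennreal (section_int \<nu> h x)) ` minorants K. h x)"
    using \<nu> by (intro lsc_SUP) (auto simp: minorants_def intro!: Ccp_lsc section_int_Ccp)
  ultimately show ?thesis by simp
qed

text \<open>Tau-smoothness is used twice: for \<open>\<nu>\<close> on the sections, and for
  \<open>\<mu>\<close> on the resulting family, whose members are again in \<open>Ccp\<close> by
  \<open>section_int_Ccp\<close>.\<close>

lemma double_int_SUP:
  fixes K :: "'b \<times> 'b \<Rightarrow> ennreal"
  assumes K: "lsc K" and r: "\<mu> \<in> radon" "\<nu> \<in> radon"
  shows "(\<integral>\<^sup>+x. \<integral>\<^sup>+y. K (x, y) \<partial>\<nu> \<partial>\<mu>) = (SUP h\<in>minorants K. ennreal (double_int \<mu> \<nu> h))"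
proof -
  have "(\<integral>\<^sup>+x. \<integral>\<^sup>+y. K (x, y) \<partial>\<nu> \<partial>\<mu>) = (\<integral>\<^sup>+x. (SUP h\<in>(\<lambda>h x. ennreal (section_int \<nu> h x)) ` minorants K. h x) \<partial>\<mu>)"
    by (simp add: lsc_section_integral[OF K r(2)] image_image)
  also have "\<dots> = (SUP h\<in>(\<lambda>h x. ennreal (section_int \<nu> h x)) ` minorants K. \<integral>\<^sup>+x. h x \<partial>\<mu>)"
  proof (intro radon_SUP_directed directed_minorants_image r(1))
    fix \<phi> \<psi> assume "\<phi> \<in> minorants K" "\<psi> \<in> minorants K" "\<phi> \<le> \<psi>"
    then show "(\<lambda>x. ennreal (section_int \<nu> \<phi> x)) \<le> (\<lambda>x. ennreal (section_int \<nu> \<psi> x))"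
      unfolding section_int_def using r
      by (auto simp: le_fun_def minorants_def intro!: ennreal_leI integral_mono Cc_integrable Cc_section dest: CcpD)
  qed (use r in \<open>auto simp: minorants_def intro!: Ccp_lsc section_int_Ccp\<close>)
  also have "\<dots> = (SUP h\<in>minorants K. ennreal (double_int \<mu> \<nu> h))"
    unfolding image_image double_int_def using r
    by (intro SUP_cong refl Ccp_nn_integral section_int_Ccp) (auto simp: minorants_def)
  finally show ?thesis .
qed

text \<open>Tonelli's theorem for lower semicontinuous integrands: both sides are the supremum of
  the same numbers over the minorants of \<open>K\<close>.\<close>

lemma nn_integral_radon_prod:
  fixes K :: "'b \<times> 'b \<Rightarrow> ennreal"
  assumes K: "lsc K" and r: "\<mu> \<in> radon" "\<nu> \<in> radon"
  shows "(\<integral>\<^sup>+z. K z \<partial>radon_prod \<mu> \<nu>) = (\<integral>\<^sup>+x. \<integral>\<^sup>+y. K (x, y) \<partial>\<nu> \<partial>\<mu>)"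
proof -
  interpret P: lch "TYPE('b \<times> 'b)" by (rule prod_lch[OF is_lch])
  show ?thesis
    unfolding double_int_SUP[OF assms] P.radon_lsc_integral[OF radon_prod(1)[OF r] K]
    by (intro SUP_cong refl arg_cong[of _ _ ennreal] radon_prod(2)[OF r]) (auto simp: minorants_def dest: CcpD)
qed

text \<open>Transposition maps minorants of a symmetric \<open>K\<close> to minorants, so
  \<open>double_int_swap\<close> matches the two suprema.\<close>

lemma double_int_integral_swap:
  fixes K :: "'b \<times> 'b \<Rightarrow> ennreal"
  assumes K: "lsc K" "\<And>x y. K (x, y) = K (y, x)" and r: "\<mu> \<in> radon" "\<nu> \<in> radon"
  shows "(\<integral>\<^sup>+x. \<integral>\<^sup>+y. K (x, y) \<partial>\<nu> \<partial>\<mu>) = (\<integral>\<^sup>+x. \<integral>\<^sup>+y. K (x, y) \<partial>\<mu> \<partial>\<nu>)"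
proof -
  have sw: "(\<lambda>z. h (snd z, fst z)) \<in> minorants K" if "h \<in> minorants K" for h
  proof -
    have "ennreal (h (snd z, fst z)) \<le> K z" for z
      using that K(2)[of "fst z" "snd z"] unfolding minorants_def by (metis (no_types, lifting) mem_Collect_eq prod.collapse)
    then show ?thesis using that unfolding minorants_def Ccp_def by (auto intro: Cc_swap)
  qed
  have le: "(\<integral>\<^sup>+x. \<integral>\<^sup>+y. K (x, y) \<partial>\<nu> \<partial>\<mu>) \<le> (\<integral>\<^sup>+x. \<integral>\<^sup>+y. K (x, y) \<partial>\<mu> \<partial>\<nu>)"
    if r: "\<mu> \<in> radon" "\<nu> \<in> radon" for \<mu> \<nu>
    unfolding double_int_SUP[OF K(1) r] double_int_SUP[OF K(1) r(2,1)]
  proof (rule SUP_mono)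
    fix h assume h: "h \<in> minorants K"
    then have "double_int \<mu> \<nu> h = double_int \<nu> \<mu> (\<lambda>z. h (snd z, fst z))"
      using r by (intro double_int_swap) (auto simp: minorants_def dest: CcpD)
    then show "\<exists>m\<in>minorants K. ennreal (double_int \<mu> \<nu> h) \<le> ennreal (double_int \<nu> \<mu> m)" using sw[OF h] by auto
  qed
  show ?thesis using le r by (intro antisym) auto
qed

end

section \<open>Jordan decomposition\<close>

definition minor_set :: "('a::t2_space \<Rightarrow> real) \<Rightarrow> ('a \<Rightarrow> real) set" where
  "minor_set \<phi> = {\<psi>\<in>Cc. \<forall>x. 0 \<le> \<psi> x \<and> \<psi> x \<le> \<phi> x}"

lemma minor_setD: "\<psi> \<in> minor_set \<phi> \<Longrightarrow> \<psi> \<in> Cc" "\<psi> \<in> minor_set \<phi> \<Longrightarrow> 0 \<le> \<psi> x" "\<psi> \<in> minor_set \<phi> \<Longrightarrow> \<psi> x \<le> \<phi> x"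
  by (auto simp: minor_set_def)

lemma minor_setI: "\<psi> \<in> Cc \<Longrightarrow> (\<And>x. 0 \<le> \<psi> x) \<Longrightarrow> (\<And>x. \<psi> x \<le> \<phi> x) \<Longrightarrow> \<psi> \<in> minor_set \<phi>"
  by (auto simp: minor_set_def)

lemma zero_minor_set: "\<phi> \<in> Ccp \<Longrightarrow> (\<lambda>_. 0) \<in> minor_set \<phi>"
  by (auto intro!: minor_setI Cc_zero dest: CcpD)

text \<open>The supremum formula defines an additive functional on \<open>Ccp\<close> by Riesz
  decomposition, and the bound on functions supported in a compact set keeps the suprema finite. The
  Riesz theorem then supplies the measure that the definite description asks for.\<close>

lemma (in lch) pos_part:
  fixes \<nu> :: "('b \<Rightarrow> real) \<Rightarrow> real"
  assumes \<nu>: "\<nu> \<in> signed_radon"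
  shows "pos_part \<nu> \<in> radon"
    and "\<And>\<phi>. \<phi> \<in> Ccp \<Longrightarrow> (\<integral>x. \<phi> x \<partial>pos_part \<nu>) = Sup (\<nu> ` minor_set \<phi>)"
    and "\<And>\<phi>. \<phi> \<in> Ccp \<Longrightarrow> bdd_above (\<nu> ` minor_set \<phi>)"
proof -
  have lin: "\<nu> (\<lambda>x. b * \<phi> x + c * \<psi> x) = b * \<nu> \<phi> + c * \<nu> \<psi>" if "\<phi> \<in> Cc" "\<psi> \<in> Cc" for b c \<phi> \<psi>
    using \<nu> that unfolding signed_radon_def by blast
  have sc: "\<nu> (\<lambda>x. b * \<phi> x) = b * \<nu> \<phi>" if "\<phi> \<in> Cc" for b \<phi> using lin[OF that that, of b 0] by simp
  have ad: "\<nu> (\<lambda>x. \<phi> x + \<psi> x) = \<nu> \<phi> + \<nu> \<psi>" if "\<phi> \<in> Cc" "\<psi> \<in> Cc" for \<phi> \<psi> using lin[OF that, of 1 1] by simp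
  have z: "\<nu> (\<lambda>_. 0) = 0" using sc[OF Cc_zero, of 0] by simp
  show bdd: "bdd_above (\<nu> ` minor_set \<phi>)" if \<phi>: "\<phi> \<in> Ccp" for \<phi>
  proof -
    obtain K where K: "compact K" "\<And>x. x \<notin> K \<Longrightarrow> \<phi> x = 0" using \<phi> CcE CcpD by metis
    obtain M where M: "0 < M" "\<And>x. \<bar>\<phi> x\<bar> \<le> M" using \<phi> Cc_bounded CcpD by metis
    obtain C where C: "\<forall>\<phi>\<in>Cc. (\<forall>x. x \<notin> K \<longrightarrow> \<phi> x = 0) \<longrightarrow> \<bar>\<nu> \<phi>\<bar> \<le> C * (SUP x. \<bar>\<phi> x\<bar>)"
      using \<nu> K(1) unfolding signed_radon_def by blast
    \<comment> \<open>The sign of the constant \<open>C\<close> is unknown, hence its absolute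
      value.\<close>
    have "\<nu> \<psi> \<le> \<bar>C\<bar> * M" if "\<psi> \<in> minor_set \<phi>" for \<psi>
    proof -
      have b: "0 \<le> \<psi> x" "\<psi> x \<le> \<phi> x" "\<psi> \<in> Cc" for x using that by (auto dest: minor_setD)
      have b2: "\<bar>\<psi> x\<bar> \<le> M" for x using b(1,2)[of x] M(2)[of x] by linarith
      have "\<psi> x = 0" if "x \<notin> K" for x using b(1,2)[of x] K(2)[OF that] by simp
      then have "\<bar>\<nu> \<psi>\<bar> \<le> C * (SUP x. \<bar>\<psi> x\<bar>)" using C b(3) by blast
      also have "\<dots> \<le> \<bar>C\<bar> * (SUP x. \<bar>\<psi> x\<bar>)"
      proof (rule mult_right_mono)
        have "0 \<le> \<bar>\<psi> undefined\<bar>" by simp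
        also have "\<dots> \<le> (SUP x. \<bar>\<psi> x\<bar>)" using b2 by (intro cSUP_upper bdd_aboveI2) auto
        finally show "0 \<le> (SUP x. \<bar>\<psi> x\<bar>)" .
      qed simp
      also have "\<dots> \<le> \<bar>C\<bar> * M" using b2 by (intro mult_left_mono cSUP_least) auto
      finally show ?thesis by linarith
    qed
    then show ?thesis by (intro bdd_aboveI2)
  qed
  define L where "L \<phi> = Sup (\<nu> ` minor_set \<phi>)" for \<phi>
  have up: "\<nu> \<psi> \<le> L \<phi>" if "\<phi> \<in> Ccp" "\<psi> \<in> minor_set \<phi>" for \<phi> \<psi>
    unfolding L_def using that bdd by (intro cSUP_upper)
  have least: "L \<phi> \<le> d" if "\<phi> \<in> Ccp" "\<And>\<psi>. \<psi> \<in> minor_set \<phi> \<Longrightarrow> \<nu> \<psi> \<le> d" for \<phi> d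
    unfolding L_def using that zero_minor_set by (intro cSUP_least) auto
  \<comment> \<open>One inequality is enough: applied to \<open>c * \<phi>\<close> with the factor
    \<open>1 / c\<close> it gives the reverse one.\<close>
  have sc1: "c * L \<phi> \<le> L (\<lambda>x. c * \<phi> x)" if "\<phi> \<in> Ccp" "0 < c" for c \<phi>
  proof -
    have "L \<phi> \<le> L (\<lambda>x. c * \<phi> x) / c"
    proof (rule least[OF that(1)])
      fix \<psi> assume "\<psi> \<in> minor_set \<phi>"
      then have "(\<lambda>x. c * \<psi> x) \<in> minor_set (\<lambda>x. c * \<phi> x)" "\<psi> \<in> Cc"
        using that by (auto simp: minor_set_def Cc_scale)
      then have "c * \<nu> \<psi> \<le> L (\<lambda>x. c * \<phi> x)" using up[of "\<lambda>x. c * \<phi> x" "\<lambda>x. c * \<psi> x"] that by (simp add: sc Ccp_scale)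
      then show "\<nu> \<psi> \<le> L (\<lambda>x. c * \<phi> x) / c" using that by (simp add: field_simps)
    qed
    then show ?thesis using that by (simp add: field_simps)
  qed
  have "\<exists>\<mu>\<in>radon. \<forall>\<phi>\<in>Ccp. (\<integral>x. \<phi> x \<partial>\<mu>) = L \<phi>"
  proof (rule riesz[of L])
    fix \<phi> :: "'b \<Rightarrow> real" assume \<phi>: "\<phi> \<in> Ccp"
    show "0 \<le> L \<phi>" using up[OF \<phi> zero_minor_set[OF \<phi>]] z by simp
    show "L (\<lambda>x. c * \<phi> x) = c * L \<phi>" if c: "0 \<le> c" for c
    proof (cases "c = 0")
      case True
      have "L (\<lambda>_. 0) \<le> 0"
      proof (rule least[OF Ccp_zero])
        fix \<psi> :: "'b \<Rightarrow> real" assume "\<psi> \<in> minor_set (\<lambda>_. 0)"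
        then have "\<psi> = (\<lambda>_. 0)" by (auto simp: minor_set_def fun_eq_iff intro: antisym)
        then show "\<nu> \<psi> \<le> 0" using z by simp
      qed
      then show ?thesis using True up[OF Ccp_zero zero_minor_set[OF Ccp_zero]] z by simp
    next
      case False
      then have c: "0 < c" using c by simp
      have "(1/c) * L (\<lambda>x. c * \<phi> x) \<le> L (\<lambda>x. (1/c) * (c * \<phi> x))" using c \<phi> by (intro sc1 Ccp_scale) auto
      then have "L (\<lambda>x. c * \<phi> x) \<le> c * L \<phi>" using c by (simp add: field_simps)
      then show ?thesis using sc1[OF \<phi> c] by simp
    qed
    fix \<psi> :: "'b \<Rightarrow> real" assume \<psi>: "\<psi> \<in> Ccp"
    have s: "(\<lambda>x. \<phi> x + \<psi> x) \<in> Ccp" using \<phi> \<psi> by (rule Ccp_add)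
    show "L (\<lambda>x. \<phi> x + \<psi> x) = L \<phi> + L \<psi>"
    proof (rule antisym)
      show "L (\<lambda>x. \<phi> x + \<psi> x) \<le> L \<phi> + L \<psi>"
      proof (rule least[OF s])
        fix \<theta> assume \<theta>: "\<theta> \<in> minor_set (\<lambda>x. \<phi> x + \<psi> x)"
        \<comment> \<open>Riesz decomposition: a function below \<open>\<phi> + \<psi>\<close> is
          split into its minimum with \<open>\<phi>\<close> and a remainder below
          \<open>\<psi>\<close>.\<close>
        have 1: "(\<lambda>x. min (\<theta> x) (\<phi> x)) \<in> minor_set \<phi>"
          using \<theta> \<phi> by (intro minor_setI Cc_min) (auto dest: minor_setD CcpD)
        have 2: "(\<lambda>x. \<theta> x - min (\<theta> x) (\<phi> x)) \<in> minor_set \<psi>"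
        proof (rule minor_setI)
          show "(\<lambda>x. \<theta> x - min (\<theta> x) (\<phi> x)) \<in> Cc"
            using \<theta> \<phi> by (intro Cc_diff Cc_min) (auto dest: minor_setD CcpD)
          show "0 \<le> \<theta> x - min (\<theta> x) (\<phi> x)" for x by simp
          show "\<theta> x - min (\<theta> x) (\<phi> x) \<le> \<psi> x" for x
            using minor_setD(3)[OF \<theta>, of x] CcpD(2)[OF \<psi>, of x] by linarith
        qed
        have "\<nu> \<theta> = \<nu> (\<lambda>x. min (\<theta> x) (\<phi> x) + (\<theta> x - min (\<theta> x) (\<phi> x)))" by simp
        also have "\<dots> = \<nu> (\<lambda>x. min (\<theta> x) (\<phi> x)) + \<nu> (\<lambda>x. \<theta> x - min (\<theta> x) (\<phi> x))"
          using 1 2 by (intro ad) (auto dest: minor_setD)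
        also have "\<dots> \<le> L \<phi> + L \<psi>" using up[OF \<phi> 1] up[OF \<psi> 2] by simp
        finally show "\<nu> \<theta> \<le> L \<phi> + L \<psi>" .
      qed
      have "L \<phi> \<le> L (\<lambda>x. \<phi> x + \<psi> x) - L \<psi>"
      proof (rule least[OF \<phi>])
        fix \<alpha> assume \<alpha>: "\<alpha> \<in> minor_set \<phi>"
        have "L \<psi> \<le> L (\<lambda>x. \<phi> x + \<psi> x) - \<nu> \<alpha>"
        proof (rule least[OF \<psi>])
          fix \<beta> assume \<beta>: "\<beta> \<in> minor_set \<psi>"
          have "(\<lambda>x. \<alpha> x + \<beta> x) \<in> minor_set (\<lambda>x. \<phi> x + \<psi> x)"
            using \<alpha> \<beta> by (intro minor_setI Cc_add add_nonneg_nonneg add_mono) (auto dest: minor_setD)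
          then have "\<nu> (\<lambda>x. \<alpha> x + \<beta> x) \<le> L (\<lambda>x. \<phi> x + \<psi> x)" using up s by blast
          then show "\<nu> \<beta> \<le> L (\<lambda>x. \<phi> x + \<psi> x) - \<nu> \<alpha>" using ad[of \<alpha> \<beta>] \<alpha> \<beta> by (simp add: minor_setD)
        qed
        then show "\<nu> \<alpha> \<le> L (\<lambda>x. \<phi> x + \<psi> x) - L \<psi>" by simp
      qed
      then show "L \<phi> + L \<psi> \<le> L (\<lambda>x. \<phi> x + \<psi> x)" by simp
    qed
  qed blast
  then obtain \<mu> where \<mu>: "\<mu> \<in> radon" "\<And>\<phi>. \<phi> \<in> Ccp \<Longrightarrow> (\<integral>x. \<phi> x \<partial>\<mu>) = L \<phi>" by blast
  let ?P = "\<lambda>\<mu>. \<mu> \<in> radon \<and> (\<forall>\<phi>\<in>Cc. (\<forall>x. 0 \<le> \<phi> x) \<longrightarrow>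
         (\<integral>x. \<phi> x \<partial>\<mu>) = Sup (\<nu> ` {\<psi>\<in>Cc. \<forall>x. 0 \<le> \<psi> x \<and> \<psi> x \<le> \<phi> x}))"
  have iff: "?P \<mu> \<longleftrightarrow> \<mu> \<in> radon \<and> (\<forall>\<phi>\<in>Ccp. (\<integral>x. \<phi> x \<partial>\<mu>) = L \<phi>)" for \<mu>
    unfolding L_def minor_set_def Ccp_def by blast
  have "\<exists>!\<mu>. ?P \<mu>"
    unfolding iff
  proof (rule ex1I)
    show "\<mu> \<in> radon \<and> (\<forall>\<phi>\<in>Ccp. (\<integral>x. \<phi> x \<partial>\<mu>) = L \<phi>)" using \<mu> by blast
    show "\<mu>' \<in> radon \<and> (\<forall>\<phi>\<in>Ccp. (\<integral>x. \<phi> x \<partial>\<mu>') = L \<phi>) \<Longrightarrow> \<mu>' = \<mu>" for \<mu>'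
      using \<mu> by (intro radon_eqI) auto
  qed
  then have "?P (pos_part \<nu>)" unfolding pos_part_def by (rule theI')
  then show "pos_part \<nu> \<in> radon" "\<And>\<phi>. \<phi> \<in> Ccp \<Longrightarrow> (\<integral>x. \<phi> x \<partial>pos_part \<nu>) = Sup (\<nu> ` minor_set \<phi>)"
    unfolding iff L_def by auto
qed

lemma signed_radon_uminus:
  fixes \<nu> :: "('a::t2_space \<Rightarrow> real) \<Rightarrow> real"
  assumes "\<nu> \<in> signed_radon" shows "(\<lambda>\<phi>. - \<nu> \<phi>) \<in> signed_radon"
  using assms unfolding signed_radon_def by simp

lemma (in lch) neg_part_radon: "\<nu> \<in> signed_radon \<Longrightarrow> neg_part \<nu> \<in> radon" for \<nu> :: "('b \<Rightarrow> real) \<Rightarrow> real"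
  unfolding neg_part_def by (intro pos_part(1) signed_radon_uminus)

lemma radon_diff_signed:
  fixes P N :: "'a::t2_space measure"
  assumes "P \<in> radon" "N \<in> radon" shows "radon_diff P N \<in> signed_radon"
  unfolding signed_radon_def
proof (intro CollectI conjI allI ballI impI)
  fix \<phi> \<psi> :: "'a \<Rightarrow> real" and b c
  assume "\<phi> \<in> Cc" "\<psi> \<in> Cc"
  then have "integrable P \<phi>" "integrable P \<psi>" "integrable N \<phi>" "integrable N \<psi>" using assms by (auto intro: Cc_integrable)
  then show "radon_diff P N (\<lambda>x. b * \<phi> x + c * \<psi> x) = b * radon_diff P N \<phi> + c * radon_diff P N \<psi>"
    by (simp add: radon_diff_def algebra_simps)
next
  fix K :: "'a set" assume K: "compact K"
  have b: "\<bar>\<integral>x. \<phi> x \<partial>\<mu>\<bar> \<le> measure \<mu> K * (SUP x. \<bar>\<phi> x\<bar>)"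
    if \<mu>: "\<mu> \<in> radon" and \<phi>: "\<phi> \<in> Cc" "\<forall>x. x \<notin> K \<longrightarrow> \<phi> x = 0" for \<mu> and \<phi> :: "'a \<Rightarrow> real"
  proof -
    obtain M where M: "0 < M" "\<And>x. \<bar>\<phi> x\<bar> \<le> M" using \<phi> Cc_bounded by metis
    have up: "\<bar>\<phi> x\<bar> \<le> (SUP x. \<bar>\<phi> x\<bar>)" for x using M by (intro cSUP_upper bdd_aboveI2) auto
    have c: "(\<lambda>x. max (\<phi> x) (- \<phi> x)) \<in> Ccp" using \<phi>(1) by (intro CcpI Cc_max Cc_uminus) (auto simp: max_def)
    have ab: "\<bar>\<phi> x\<bar> = max (\<phi> x) (- \<phi> x)" for x by (simp add: max_def)
    have "\<bar>\<integral>x. \<phi> x \<partial>\<mu>\<bar> \<le> (\<integral>x. \<bar>\<phi> x\<bar> \<partial>\<mu>)" by (rule integral_abs_bound)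
    also have "\<dots> \<le> (SUP x. \<bar>\<phi> x\<bar>) * measure \<mu> K"
      using \<phi>(2) up c unfolding ab by (intro Ccp_integral_le \<mu> K) auto
    finally show ?thesis by (simp add: mult.commute)
  qed
  show "\<exists>C. \<forall>\<phi>\<in>Cc. (\<forall>x. x \<notin> K \<longrightarrow> \<phi> x = 0) \<longrightarrow> \<bar>radon_diff P N \<phi>\<bar> \<le> C * (SUP x. \<bar>\<phi> x\<bar>)"
  proof (intro exI[of _ "measure P K + measure N K"] ballI impI)
    fix \<phi> :: "'a \<Rightarrow> real" assume \<phi>: "\<phi> \<in> Cc" "\<forall>x. x \<notin> K \<longrightarrow> \<phi> x = 0"
    show "\<bar>radon_diff P N \<phi>\<bar> \<le> (measure P K + measure N K) * (SUP x. \<bar>\<phi> x\<bar>)"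
      using b[OF assms(1) \<phi>] b[OF assms(2) \<phi>] unfolding radon_diff_def distrib_right by linarith
  qed
qed

section \<open>Jordan parts of a difference of measures\<close>

definition radon_plus :: "'a::t2_space measure \<Rightarrow> 'a measure \<Rightarrow> 'a measure" where
  "radon_plus \<mu> \<nu> = radon_lincomb UNIV (\<lambda>_. 1) (\<lambda>b. if b then \<mu> else \<nu>)"

lemma radon_plus_radon: "\<mu> \<in> radon \<Longrightarrow> \<nu> \<in> radon \<Longrightarrow> radon_plus \<mu> \<nu> \<in> radon"
  unfolding radon_plus_def by (intro radon_lincomb_radon) auto

lemma Ccp_integral_radon_plus:
  "\<mu> \<in> radon \<Longrightarrow> \<nu> \<in> radon \<Longrightarrow> \<phi> \<in> Ccp \<Longrightarrow> (\<integral>x. \<phi> x \<partial>radon_plus \<mu> \<nu>) = (\<integral>x. \<phi> x \<partial>\<mu>) + (\<integral>x. \<phi> x \<partial>\<nu>)"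
  unfolding radon_plus_def by (subst Ccp_integral_radon_lincomb) (auto simp: UNIV_bool)

context lch
begin

lemma radon_plus_upper:
  fixes \<mu> \<nu> :: "'b measure"
  assumes "\<mu> \<in> radon" "\<nu> \<in> radon" shows "\<mu> \<le> radon_plus \<mu> \<nu>" "\<nu> \<le> radon_plus \<mu> \<nu>"
  using assms by (auto intro!: radon_leI radon_plus_radon simp: Ccp_integral_radon_plus Ccp_integral_nonneg)

text \<open>The last equation expresses p - q = P - N without subtracting measures, whose masses may
  be infinite. The bounds by \<open>P\<close> and \<open>N\<close> let the Jordan parts inherit
  finite energy.\<close>

lemma jordan:
  fixes P N :: "'b measure"
  assumes r: "P \<in> radon" "N \<in> radon"
  defines "p \<equiv> pos_part (radon_diff P N)" and "q \<equiv> neg_part (radon_diff P N)"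
  shows "p \<in> radon" "q \<in> radon" "p \<le> P" "q \<le> N" "radon_plus p N = radon_plus q P"
proof -
  have q: "q = pos_part (radon_diff N P)"
    unfolding q_def neg_part_def radon_diff_def by (rule arg_cong[of _ _ pos_part]) auto
  note d = radon_diff_signed[OF r] radon_diff_signed[OF r(2,1)]
  show pr: "p \<in> radon" "q \<in> radon" unfolding p_def q by (intro pos_part(1) d)+
  have up: "radon_diff A B \<psi> \<le> (\<integral>x. \<phi> x \<partial>pos_part (radon_diff A B))"
    if "A \<in> radon" "B \<in> radon" "\<phi> \<in> Ccp" "\<psi> \<in> minor_set \<phi>" for A B :: "'b measure" and \<phi> \<psi>
    using that pos_part(2,3)[OF radon_diff_signed[OF that(1,2)] that(3)] by (auto intro: cSUP_upper)
  have least: "(\<integral>x. \<phi> x \<partial>pos_part (radon_diff A B)) \<le> d"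
    if "A \<in> radon" "B \<in> radon" "\<phi> \<in> Ccp" "\<And>\<psi>. \<psi> \<in> minor_set \<phi> \<Longrightarrow> radon_diff A B \<psi> \<le> d" for A B :: "'b measure" and \<phi> d
    using that pos_part(2,3)[OF radon_diff_signed[OF that(1,2)] that(3)] zero_minor_set[OF that(3)]
    by (auto intro!: cSUP_least)
  have le: "pos_part (radon_diff A B) \<le> A" if A: "A \<in> radon" "B \<in> radon" for A B :: "'b measure"
  proof (rule radon_leI)
    fix \<phi> :: "'b \<Rightarrow> real" assume \<phi>: "\<phi> \<in> Ccp"
    show "(\<integral>x. \<phi> x \<partial>pos_part (radon_diff A B)) \<le> (\<integral>x. \<phi> x \<partial>A)"
    proof (rule least[OF A \<phi>])
      fix \<psi> assume \<psi>: "\<psi> \<in> minor_set \<phi>"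
      then have "0 \<le> (\<integral>x. \<psi> x \<partial>B)" by (intro Ccp_integral_nonneg CcpI) (auto dest: minor_setD)
      moreover have "(\<integral>x. \<psi> x \<partial>A) \<le> (\<integral>x. \<phi> x \<partial>A)"
        using \<psi> \<phi> A by (intro integral_mono Cc_integrable) (auto dest: minor_setD CcpD)
      ultimately show "radon_diff A B \<psi> \<le> (\<integral>x. \<phi> x \<partial>A)" by (simp add: radon_diff_def)
    qed
  qed (use A pos_part(1)[OF radon_diff_signed] in auto)
  show "p \<le> P" "q \<le> N" unfolding p_def q by (intro le r)+
  \<comment> \<open>Replacing \<open>\<psi>\<close> by \<open>\<phi> - \<psi>\<close> inside
    \<open>minor_set \<phi>\<close> gives one inequality for either order of the two measures; the
    two together are the required equation.\<close>
  have half: "(\<integral>x. \<phi> x \<partial>pos_part (radon_diff A B)) \<le> (\<integral>x. \<phi> x \<partial>A) - (\<integral>x. \<phi> x \<partial>B) + (\<integral>x. \<phi> x \<partial>pos_part (radon_diff B A))"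
    if A: "A \<in> radon" "B \<in> radon" and \<phi>: "\<phi> \<in> Ccp" for A B :: "'b measure" and \<phi>
  proof (rule least[OF A \<phi>])
    fix \<psi> assume \<psi>: "\<psi> \<in> minor_set \<phi>"
    have "(\<lambda>x. \<phi> x - \<psi> x) \<in> minor_set \<phi>"
      using \<psi> \<phi> by (intro minor_setI Cc_diff) (auto dest: minor_setD CcpD)
    then have "radon_diff B A (\<lambda>x. \<phi> x - \<psi> x) \<le> (\<integral>x. \<phi> x \<partial>pos_part (radon_diff B A))" using up A \<phi> by blast
    moreover have "integrable A \<phi>" "integrable A \<psi>" "integrable B \<phi>" "integrable B \<psi>"
      using A \<phi> \<psi> by (auto intro!: Cc_integrable dest: minor_setD CcpD)
    ultimately show "radon_diff A B \<psi> \<le> (\<integral>x. \<phi> x \<partial>A) - (\<integral>x. \<phi> x \<partial>B) + (\<integral>x. \<phi> x \<partial>pos_part (radon_diff B A))"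
      by (simp add: radon_diff_def)
  qed
  show "radon_plus p N = radon_plus q P"
  proof (rule radon_eqI)
    fix \<phi> :: "'b \<Rightarrow> real" assume \<phi>: "\<phi> \<in> Ccp"
    show "(\<integral>x. \<phi> x \<partial>radon_plus p N) = (\<integral>x. \<phi> x \<partial>radon_plus q P)"
      using half[OF r \<phi>] half[OF r(2,1) \<phi>] pr r \<phi> unfolding p_def q by (simp add: Ccp_integral_radon_plus)
  qed (use pr r in \<open>auto intro: radon_plus_radon\<close>)
qed

end

section \<open>Energy\<close>

text \<open>The pointwise identity \<open>(\<psi> + c) + \<psi>\<^sup>- = \<psi>\<^sup>+ + c\<close>
  contains no difference, so it can be integrated in \<open>ennreal\<close>. The integral of the
  negative part is finite, at most \<open>c\<close> times the mass, and can be moved across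
  afterwards.\<close>

lemma eint_shift:
  assumes \<psi>: "\<psi> \<in> borel_measurable M" and c: "0 \<le> c" "\<And>z. - ereal c \<le> \<psi> z" "c = 0 \<or> emeasure M (space M) < top"
  shows "eint M \<psi> = enn2ereal (\<integral>\<^sup>+z. e2ennreal (\<psi> z + ereal c) \<partial>M) - ereal (c * measure M (space M))"
proof (cases "c = 0")
  case True
  then have "0 \<le> \<psi> z" for z using c(2)[of z] by (simp add: zero_ereal_def)
  then have "e2ennreal (- \<psi> z) = 0" for z by (intro e2ennreal_neg) simp
  then show ?thesis using True by (simp add: eint_def zero_ereal_def[symmetric] zero_ennreal.rep_eq)
next
  case False
  then have fin: "emeasure M (space M) < top" using c by simp
  let ?P = "\<integral>\<^sup>+z. e2ennreal (\<psi> z) \<partial>M" and ?Q = "\<integral>\<^sup>+z. e2ennreal (- \<psi> z) \<partial>M" and ?R = "\<integral>\<^sup>+z. e2ennreal (\<psi> z + ereal c) \<partial>M"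
  have pt: "e2ennreal (\<psi> z + ereal c) + e2ennreal (- \<psi> z) = e2ennreal (\<psi> z) + ennreal c" for z
  proof (cases "\<psi> z")
    case (real r)
    have "- c \<le> r" using c(2)[of z] real by simp
    then have "ennreal (r + c) + ennreal (- r) = ennreal r + ennreal c"
      using c(1) by (cases "0 \<le> r") (auto simp: ennreal_neg simp flip: ennreal_plus)
    then show ?thesis using real by simp
  qed (use c(2)[of z] in \<open>auto simp: e2ennreal_neg\<close>)
  have m: "(\<lambda>z. e2ennreal (\<psi> z)) \<in> borel_measurable M" "(\<lambda>z. e2ennreal (- \<psi> z)) \<in> borel_measurable M"
      "(\<lambda>z. e2ennreal (\<psi> z + ereal c)) \<in> borel_measurable M" "(\<lambda>z. ennreal c) \<in> borel_measurable M"
    using \<psi> by (auto intro!: measurable_compose[OF _ measurable_e2ennreal] borel_measurable_ereal_add borel_measurable_uminus_ereal)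
  have "?R + ?Q = (\<integral>\<^sup>+z. e2ennreal (\<psi> z + ereal c) + e2ennreal (- \<psi> z) \<partial>M)"
    using m by (intro nn_integral_add[symmetric])
  also have "\<dots> = ?P + (\<integral>\<^sup>+z. ennreal c \<partial>M)" unfolding pt using m by (intro nn_integral_add)
  also have "(\<integral>\<^sup>+z. ennreal c \<partial>M) = ennreal (c * measure M (space M))"
    using fin c by (simp add: emeasure_eq_ennreal_measure ennreal_mult less_top)
  finally have eq: "?R + ?Q = ?P + ennreal (c * measure M (space M))" .
  have "e2ennreal (- \<psi> z) \<le> ennreal c" for z
  proof -
    have "- \<psi> z \<le> ereal c" using c(2)[of z] by (simp add: ereal_uminus_le_reorder)
    from e2ennreal_mono[OF this] show ?thesis by simp
  qed
  then have "?Q \<le> (\<integral>\<^sup>+z. ennreal c \<partial>M)" by (intro nn_integral_mono)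
  also have "\<dots> < top" using fin c by (simp add: ennreal_mult_less_top)
  finally obtain q where q: "?Q = ennreal q" "0 \<le> q" by (metis ennreal_cases less_irrefl)
  show ?thesis
  proof (cases "?P = top")
    case True
    then have "?R = top" using eq q by (auto simp: ennreal_add_eq_top)
    then show ?thesis using True q by (simp add: eint_def)
  next
    case False
    then obtain p where p: "?P = ennreal p" "0 \<le> p" by (metis ennreal_cases)
    then have "?P + ennreal (c * measure M (space M)) \<noteq> top" by (simp add: ennreal_add_eq_top)
    then have "?R \<noteq> top" using eq by (metis ennreal_add_eq_top)
    then obtain r where r: "?R = ennreal r" "0 \<le> r" by (metis ennreal_cases)
    have "r + q = p + c * measure M (space M)"
      using eq p q r c by (simp flip: ennreal_plus)
    then show ?thesis using p q r by (simp add: eint_def)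
  qed
qed

lemma lsc_shift:
  fixes \<psi> :: "'a::topological_space \<Rightarrow> ereal"
  assumes op: "\<And>a. open {z. a < \<psi> z}" and c: "\<And>z. - ereal c \<le> \<psi> z"
  shows "lsc (\<lambda>z. e2ennreal (\<psi> z + ereal c))"
  unfolding lsc_def
proof
  fix a
  have "a < e2ennreal (\<psi> z + ereal c) \<longleftrightarrow> enn2ereal a - ereal c < \<psi> z" for z
  proof -
    have 0: "0 \<le> \<psi> z + ereal c" using c[of z] by (cases "\<psi> z") auto
    have "a < e2ennreal (\<psi> z + ereal c) \<longleftrightarrow> enn2ereal a < \<psi> z + ereal c"
      using 0 by (simp add: less_ennreal.rep_eq enn2ereal_e2ennreal)
    also have "\<dots> \<longleftrightarrow> enn2ereal a - ereal c < \<psi> z"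
      by (cases "\<psi> z"; cases "enn2ereal a") auto
    finally show ?thesis .
  qed
  then show "open {z. a < e2ennreal (\<psi> z + ereal c)}" using op by simp
qed

text \<open>If \<open>\<psi>\<close> takes a negative value, the space is compact and finitely many
  of the open sets where \<open>\<psi>\<close> exceeds -n cover it; otherwise \<open>c = 0\<close>
  will do.\<close>

lemma Psi_lower_bound:
  fixes \<psi> :: "'a::topological_space \<Rightarrow> ereal"
  assumes "\<psi> \<in> Psi"
  obtains c where "0 \<le> c" "\<And>z. - ereal c \<le> \<psi> z" "c = 0 \<or> compact (UNIV :: 'a set)"
proof (cases "\<forall>z. 0 \<le> \<psi> z")
  case True
  then have "0 \<le> \<psi> z" for z by blast
  then show ?thesis using that[of 0] by (simp add: zero_ereal_def[symmetric])
next
  case False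
  then have C: "compact (UNIV :: 'a set)" using assms by (auto simp: Psi_def)
  have o: "open {z. - ereal (real n) < \<psi> z}" for n using assms by (simp add: Psi_def)
  have "UNIV \<subseteq> (\<Union>n. {z. - ereal (real n) < \<psi> z})"
  proof
    fix z
    have "\<psi> z \<noteq> -\<infinity>" using assms unfolding Psi_def by blast
    then have "- \<psi> z \<noteq> \<infinity>" by (simp add: ereal_uminus_eq_reorder)
    then obtain n :: nat where "- \<psi> z < ereal (real n)"
      using less_PInf_Ex_of_nat[of "- \<psi> z"] by blast
    then show "z \<in> (\<Union>n. {z. - ereal (real n) < \<psi> z})"
      using ereal_uminus_less_reorder[of "ereal (real n)" "\<psi> z"] by blast
  qed
  then obtain D where D: "finite D" "UNIV \<subseteq> (\<Union>n\<in>D. {z. - ereal (real n) < \<psi> z})"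
    using compactE_image[OF C, of UNIV "\<lambda>n. {z. - ereal (real n) < \<psi> z}"] o by auto
  show ?thesis
  \<comment> \<open>Inserting 0 keeps the maximum over a nonempty set.\<close>
  proof (rule that[of "real (Max (insert 0 D))"])
    fix z
    obtain n where n: "n \<in> D" "- ereal (real n) < \<psi> z" using D by blast
    have "n \<le> Max (insert 0 D)" using D n by simp
    then have "- ereal (real (Max (insert 0 D))) \<le> - ereal (real n)" by simp
    then show "- ereal (real (Max (insert 0 D))) \<le> \<psi> z" using n by (meson less_imp_le order_trans)
  qed (use C in auto)
qed

section \<open>The energy form of a positive definite kernel\<close>

locale kernel_space = lch T for T :: "'b::t2_space itself" +
  fixes \<kappa> :: "'b \<times> 'b \<Rightarrow> ereal" and c :: real
  assumes kernel: "is_kernel \<kappa>" and pd: "positive_definite \<kappa>"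
    and c: "0 \<le> c" "\<And>z. - ereal c \<le> \<kappa> z" "c = 0 \<or> compact (UNIV :: 'b set)"
begin

text \<open>Adding \<open>c\<close> makes the kernel nonnegative. A nonzero \<open>c\<close> is only needed on a compact space, where
  all Radon measures are finite and \<open>B\<close> can subtract its contribution again.\<close>

definition K :: "'b \<times> 'b \<Rightarrow> ennreal" where "K z = e2ennreal (\<kappa> z + ereal c)"

definition KE :: "'b measure \<Rightarrow> 'b measure \<Rightarrow> ennreal" where
  "KE \<mu> \<nu> = (\<integral>\<^sup>+x. \<integral>\<^sup>+y. K (x, y) \<partial>\<nu> \<partial>\<mu>)"

text \<open>For an infinite measure \<open>measure\<close> returns 0. The mass matters only on a
  compact space, where it is finite; elsewhere its factor \<open>c\<close>, or the analogous
  constant of an external field, is 0.\<close>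

definition m :: "'b measure \<Rightarrow> real" where "m \<mu> = measure \<mu> UNIV"

text \<open>\<open>enn2real\<close> sends an infinite value to 0, so \<open>B\<close> is the mutual
  energy only where \<open>KE\<close> is finite, which \<open>KE_finite\<close> guarantees on
  \<open>fin_energy\<close>.\<close>

definition B :: "'b measure \<Rightarrow> 'b measure \<Rightarrow> real" where
  "B \<mu> \<nu> = enn2real (KE \<mu> \<nu>) - c * (m \<mu> * m \<nu>)"

definition fin_energy :: "'b measure set" where "fin_energy = {\<mu>\<in>radon. KE \<mu> \<mu> < top}"

lemma feD: "\<mu> \<in> fin_energy \<Longrightarrow> \<mu> \<in> radon" "\<mu> \<in> fin_energy \<Longrightarrow> KE \<mu> \<mu> < top"
  by (auto simp: fin_energy_def)

lemma K_sym: "K (x, y) = K (y, x)"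
  using kernel by (simp add: K_def is_kernel_def)

lemma kernel_open: "open {z. a < \<kappa> z}"
  using kernel by (simp add: is_kernel_def Psi_def)

lemma K_lsc: "lsc K"
  using lsc_shift[OF kernel_open c(2)] by (simp add: K_def[abs_def])

lemma kernel_measurable: "\<kappa> \<in> borel_measurable borel"
  by (intro borel_measurableI_greater) (auto intro: borel_open kernel_open)

lemma section_measurable: "(\<lambda>y. \<kappa> (x, y)) \<in> borel_measurable borel"
proof -
  have "(\<lambda>y. (x, y)) \<in> borel_measurable borel"
    by (intro borel_measurable_continuous_onI continuous_intros)
  from measurable_compose[OF this kernel_measurable] show ?thesis .
qed

lemma K_section_lsc: "lsc (\<lambda>y. K (x, y))"
proof -
  have "open {y. a < K (x, y)}" for a
  proof -
    have "open ((\<lambda>y. (x, y)) -` {z. a < K z})"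
      using K_lsc by (intro continuous_open_vimage) (auto simp: lsc_def intro!: continuous_intros)
    then show ?thesis by (simp add: vimage_def)
  qed
  then show ?thesis by (simp add: lsc_def)
qed

lemma fin: "\<mu> \<in> radon \<Longrightarrow> c = 0 \<or> emeasure \<mu> UNIV < top" for \<mu> :: "'b measure"
  using c(3) radon_compact[of \<mu> UNIV] by (elim disjE) simp_all

text \<open>A nonzero \<open>c\<close> forces the space to be compact. The constant 1 is then in
  \<open>Cc\<close>, and both masses are read off from it.\<close>

lemma prod_mass:
  assumes "\<mu> \<in> radon" "\<nu> \<in> radon" "c \<noteq> 0"
  shows "measure (radon_prod \<mu> \<nu>) UNIV = m \<mu> * m \<nu>" "emeasure (radon_prod \<mu> \<nu>) UNIV < top"
proof -
  have C: "compact (UNIV :: 'b set)" using c(3) assms by simp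
  have C2: "compact (UNIV :: ('b \<times> 'b) set)" using compact_Times[OF C C] by simp
  have 1: "(\<lambda>_. 1) \<in> (Cc :: ('b \<Rightarrow> real) set)" using C by (intro CcI[of _ UNIV]) auto
  have 2: "(\<lambda>_. 1) \<in> (Cc :: ('b \<times> 'b \<Rightarrow> real) set)" using C2 by (intro CcI[of _ UNIV]) auto
  note r = radon_prod(1)[OF assms(1,2)]
  show "emeasure (radon_prod \<mu> \<nu>) UNIV < top" using radon_compact[OF r C2] .
  have "(\<integral>z. 1 \<partial>radon_prod \<mu> \<nu>) = double_int \<mu> \<nu> (\<lambda>_. 1)" using radon_prod(2)[OF assms(1,2) 2] .
  then show "measure (radon_prod \<mu> \<nu>) UNIV = m \<mu> * m \<nu>"
    using r assms(1,2) by (simp add: double_int_def section_int_def m_def mult.commute)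
qed

lemma energy_eq:
  assumes r: "\<mu> \<in> radon" "\<nu> \<in> radon"
  shows "energy \<kappa> \<mu> \<nu> = enn2ereal (KE \<mu> \<nu>) - ereal (c * (m \<mu> * m \<nu>))"
proof -
  note p = radon_prod(1)[OF r]
  have "energy \<kappa> \<mu> \<nu> = enn2ereal (\<integral>\<^sup>+z. K z \<partial>radon_prod \<mu> \<nu>) - ereal (c * measure (radon_prod \<mu> \<nu>) (space (radon_prod \<mu> \<nu>)))"
    unfolding energy_def K_def using c(1,2) prod_mass(2)[OF r] kernel_measurable p
    by (intro eint_shift) (auto simp: radon_borel_measurable)
  also have "(\<integral>\<^sup>+z. K z \<partial>radon_prod \<mu> \<nu>) = KE \<mu> \<nu>"
    unfolding KE_def by (rule nn_integral_radon_prod[OF K_lsc r])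
  finally show ?thesis using p prod_mass(1)[OF r] by (cases "c = 0") auto
qed

lemma potential_eq:
  assumes r: "\<nu> \<in> radon"
  shows "potential \<kappa> \<nu> x = enn2ereal (\<integral>\<^sup>+y. K (x, y) \<partial>\<nu>) - ereal (c * m \<nu>)"
  unfolding potential_def K_def m_def using c(1,2) fin[OF r] section_measurable r
  by (subst eint_shift) (auto simp: radon_borel_measurable)

lemma energy_B:
  assumes "\<mu> \<in> radon" "\<nu> \<in> radon" "KE \<mu> \<nu> < top"
  shows "energy \<kappa> \<mu> \<nu> = ereal (B \<mu> \<nu>)"
  using assms unfolding energy_eq[OF assms(1,2)] B_def
  by (cases "KE \<mu> \<nu>") auto

lemma energy_finite_iff:
  assumes "\<mu> \<in> radon" "\<nu> \<in> radon"
  shows "\<bar>energy \<kappa> \<mu> \<nu>\<bar> \<noteq> \<infinity> \<longleftrightarrow> KE \<mu> \<nu> < top"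
  unfolding energy_eq[OF assms] by (cases "KE \<mu> \<nu>") auto

lemma KE_sym: "\<mu> \<in> radon \<Longrightarrow> \<nu> \<in> radon \<Longrightarrow> KE \<mu> \<nu> = KE \<nu> \<mu>"
  unfolding KE_def by (rule double_int_integral_swap[OF K_lsc K_sym])

lemma KE_mono:
  assumes "\<mu> \<in> radon" "\<nu> \<in> radon" "\<mu>' \<in> radon" "\<nu>' \<in> radon" "\<mu> \<le> \<mu>'" "\<nu> \<le> \<nu>'"
  shows "KE \<mu> \<nu> \<le> KE \<mu>' \<nu>'"
proof -
  have "KE \<mu> \<nu> \<le> KE \<mu> \<nu>'" unfolding KE_def
    using assms by (intro nn_integral_mono radon_nn_integral_mono)
  also have "\<dots> \<le> KE \<mu>' \<nu>'" unfolding KE_def using assms by (intro radon_nn_integral_mono)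
  finally show ?thesis .
qed

lemma KE_radon_lincomb:
  assumes "finite J" "\<And>j. j \<in> J \<Longrightarrow> \<mu> j \<in> radon" "\<nu> \<in> radon"
  shows "KE (radon_lincomb J r \<mu>) \<nu> = (\<Sum>j\<in>J. ennreal (r j) * KE (\<mu> j) \<nu>)"
  unfolding KE_def using assms by (intro nn_integral_radon_lincomb lsc_measurable lsc_potential K_lsc)

lemma KE_radon_plus:
  assumes "\<mu> \<in> radon" "\<mu>' \<in> radon" "\<nu> \<in> radon"
  shows "KE (radon_plus \<mu> \<mu>') \<nu> = KE \<mu> \<nu> + KE \<mu>' \<nu>"
  unfolding radon_plus_def using assms by (subst KE_radon_lincomb) (auto simp: UNIV_bool)

lemma fin_energy_mono: "\<mu> \<in> fin_energy \<Longrightarrow> \<nu> \<in> radon \<Longrightarrow> \<nu> \<le> \<mu> \<Longrightarrow> \<nu> \<in> fin_energy"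
  using KE_mono[of \<nu> \<nu> \<mu> \<mu>] by (auto simp: fin_energy_def)

text \<open>The Jordan parts lie below \<open>P\<close> and \<open>N\<close> and so have finite
  self-energies. An infinite mutual energy would make the signed energy of the difference minus
  infinity, against positive definiteness.\<close>

lemma KE_finite_aux:
  assumes P: "P \<in> fin_energy" and N: "N \<in> fin_energy"
  defines "d \<equiv> radon_diff P N"
  shows "senergy_defined \<kappa> d" "0 \<le> senergy \<kappa> d d" "KE (pos_part d) (neg_part d) < top"
proof -
  note r = feD(1)[OF P] feD(1)[OF N]
  note j = jordan[OF r, folded d_def]
  have pq: "pos_part d \<in> fin_energy" "neg_part d \<in> fin_energy" using j P N fin_energy_mono by blast+
  have e: "energy \<kappa> (pos_part d) (pos_part d) = ereal (B (pos_part d) (pos_part d))"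
    "energy \<kappa> (neg_part d) (neg_part d) = ereal (B (neg_part d) (neg_part d))"
    using pq by (auto intro!: energy_B simp: feD)
  show def: "senergy_defined \<kappa> d" unfolding senergy_defined_def e by simp
  show nn: "0 \<le> senergy \<kappa> d d"
    using pd def radon_diff_signed[OF r] unfolding positive_definite_def d_def by blast
  show "KE (pos_part d) (neg_part d) < top"
  proof (rule ccontr)
    assume "\<not> ?thesis"
    then have "KE (pos_part d) (neg_part d) = top" by (metis top.not_eq_extremum)
    then have "energy \<kappa> (pos_part d) (neg_part d) = \<infinity>" "energy \<kappa> (neg_part d) (pos_part d) = \<infinity>"
      using j KE_sym[OF j(1,2)] by (auto simp: energy_eq)
    then show False using nn unfolding senergy_def e by simp
  qed
qed

text \<open>Finiteness is carried over from the Jordan parts to \<open>P\<close> and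
  \<open>N\<close> by the equation p + N = q + P: it is integrated first against \<open>q\<close>,
  where \<open>KE N q\<close> is at most \<open>KE N N\<close>, and then against
  \<open>P\<close>.\<close>

lemma KE_finite:
  assumes P: "P \<in> fin_energy" and N: "N \<in> fin_energy" shows "KE P N < top"
proof -
  note r = feD(1)[OF P] feD(1)[OF N]
  define p q where "p = pos_part (radon_diff P N)" and "q = neg_part (radon_diff P N)"
  note j = jordan[OF r, folded p_def q_def]
  have pq: "KE p q < top" using KE_finite_aux(3)[OF P N] by (simp add: p_def q_def)
  have "KE N q \<le> KE N N" using j r by (intro KE_mono) auto
  then have Nq: "KE N q < top" using feD(2)[OF N] by auto
  have "KE P q \<le> KE (radon_plus q P) q" using j r by (intro KE_mono radon_plus_radon radon_plus_upper) auto
  also have "\<dots> = KE p q + KE N q" unfolding j(5)[symmetric] using j r by (intro KE_radon_plus)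
  also have "\<dots> < top" using pq Nq by simp
  finally have Pq: "KE q P < top" using KE_sym[of P q] j r by simp
  have "KE N P \<le> KE (radon_plus p N) P" using j r by (intro KE_mono radon_plus_radon radon_plus_upper) auto
  also have "\<dots> = KE q P + KE P P" unfolding j(5) using j r by (intro KE_radon_plus)
  also have "\<dots> < top" using Pq feD(2)[OF P] by simp
  finally show ?thesis using KE_sym[of P N] r by simp
qed

lemma energy_fin_energy: "\<mu> \<in> fin_energy \<Longrightarrow> \<nu> \<in> fin_energy \<Longrightarrow> energy \<kappa> \<mu> \<nu> = ereal (B \<mu> \<nu>)"
  by (intro energy_B KE_finite) (auto simp: feD)

lemma B_sym: "\<mu> \<in> radon \<Longrightarrow> \<nu> \<in> radon \<Longrightarrow> B \<mu> \<nu> = B \<nu> \<mu>"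
  by (simp add: B_def KE_sym[of \<mu> \<nu>] mult.commute)

lemma m_radon_lincomb:
  assumes "finite J" "\<And>j. j \<in> J \<Longrightarrow> \<mu> j \<in> radon" "\<And>j. j \<in> J \<Longrightarrow> 0 \<le> r j" "c \<noteq> 0"
  shows "m (radon_lincomb J r \<mu>) = (\<Sum>j\<in>J. r j * m (\<mu> j))"
proof -
  have e: "emeasure (\<mu> j) UNIV = ennreal (m (\<mu> j))" if "j \<in> J" for j
    using fin[OF assms(2)[OF that]] assms(4) by (simp add: m_def emeasure_eq_ennreal_measure less_top)
  have "emeasure (radon_lincomb J r \<mu>) UNIV = (\<Sum>j\<in>J. ennreal (r j) * ennreal (m (\<mu> j)))"
    using assms e by (subst emeasure_radon_lincomb) auto
  also have "\<dots> = (\<Sum>j\<in>J. ennreal (r j * m (\<mu> j)))" using assms by (intro sum.cong) (auto simp: ennreal_mult m_def)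
  also have "\<dots> = ennreal (\<Sum>j\<in>J. r j * m (\<mu> j))" using assms by (intro sum_ennreal) (auto simp: m_def)
  finally show ?thesis
    unfolding m_def[of "radon_lincomb J r \<mu>"] measure_def using assms by (simp add: sum_nonneg m_def)
qed

lemma B_radon_lincomb:
  assumes J: "finite J" "\<And>j. j \<in> J \<Longrightarrow> \<mu> j \<in> fin_energy" "\<And>j. j \<in> J \<Longrightarrow> 0 \<le> r j" and \<nu>: "\<nu> \<in> fin_energy"
  shows "B (radon_lincomb J r \<mu>) \<nu> = (\<Sum>j\<in>J. r j * B (\<mu> j) \<nu>)"
proof -
  have "KE (radon_lincomb J r \<mu>) \<nu> = (\<Sum>j\<in>J. ennreal (r j) * KE (\<mu> j) \<nu>)"
    using assms by (intro KE_radon_lincomb) (auto simp: feD)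
  also have "\<dots> = (\<Sum>j\<in>J. ennreal (r j * enn2real (KE (\<mu> j) \<nu>)))"
    using assms KE_finite by (intro sum.cong) (auto simp: ennreal_mult)
  also have "\<dots> = ennreal (\<Sum>j\<in>J. r j * enn2real (KE (\<mu> j) \<nu>))"
    using assms by (intro sum_ennreal) auto
  finally have 1: "enn2real (KE (radon_lincomb J r \<mu>) \<nu>) = (\<Sum>j\<in>J. r j * enn2real (KE (\<mu> j) \<nu>))"
    using assms by (simp add: sum_nonneg)
  have 2: "c * (m (radon_lincomb J r \<mu>) * m \<nu>) = (\<Sum>j\<in>J. r j * (c * (m (\<mu> j) * m \<nu>)))"
    using m_radon_lincomb[OF J(1) _ J(3)] J feD by (cases "c = 0") (auto simp: sum_distrib_left sum_distrib_right ac_simps)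
  show ?thesis unfolding B_def 1 2 by (simp add: sum_subtractf right_diff_distrib)
qed

lemma radon_lincomb_fin_energy:
  assumes J: "finite J" "\<And>j. j \<in> J \<Longrightarrow> \<mu> j \<in> fin_energy"
  shows "radon_lincomb J r \<mu> \<in> fin_energy"
proof -
  have r: "\<And>j. j \<in> J \<Longrightarrow> \<mu> j \<in> radon" using J feD by blast
  have R: "radon_lincomb J r \<mu> \<in> radon" using J r by (intro radon_lincomb_radon)
  have "KE (\<mu> j) (radon_lincomb J r \<mu>) < top" if "j \<in> J" for j
    using KE_finite J that r R by (simp add: KE_sym[of "\<mu> j"] KE_radon_lincomb ennreal_mult_less_top)
  then show ?thesis using J r R by (auto simp: fin_energy_def KE_radon_lincomb ennreal_mult_less_top)
qed

lemma B_radon_plus: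
  assumes "\<mu> \<in> fin_energy" "\<mu>' \<in> fin_energy" "\<nu> \<in> fin_energy" shows "B (radon_plus \<mu> \<mu>') \<nu> = B \<mu> \<nu> + B \<mu>' \<nu>"
  unfolding radon_plus_def using assms by (subst B_radon_lincomb) (auto simp: UNIV_bool)

text \<open>The equations relating the Jordan parts to the given measures are integrated against the
  other argument, once in each variable, and bilinearity replaces all four parts. In this form the
  distance of vector measures becomes an expression in \<open>B\<close>.\<close>

lemma senergy_diff:
  assumes P: "P \<in> fin_energy" and N: "N \<in> fin_energy" and P': "P' \<in> fin_energy" and N': "N' \<in> fin_energy"
  shows "senergy \<kappa> (radon_diff P N) (radon_diff P' N') = ereal (B P P' - B P N' - B N P' + B N N')"
proof -
  define p q where "p = pos_part (radon_diff P N)" and "q = neg_part (radon_diff P N)"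
  define p' q' where "p' = pos_part (radon_diff P' N')" and "q' = neg_part (radon_diff P' N')"
  note j = jordan[OF feD(1)[OF P] feD(1)[OF N], folded p_def q_def]
  note j' = jordan[OF feD(1)[OF P'] feD(1)[OF N'], folded p'_def q'_def]
  have f: "p \<in> fin_energy" "q \<in> fin_energy" "p' \<in> fin_energy" "q' \<in> fin_energy" using j j' P N P' N' fin_energy_mono by blast+
  have 1: "B p X - B q X = B P X - B N X" if "X \<in> fin_energy" for X
    using B_radon_plus[OF f(1) N that] B_radon_plus[OF f(2) P that] j(5) by simp
  have 2: "B X p' - B X q' = B X P' - B X N'" if "X \<in> fin_energy" for X
    using B_radon_plus[OF f(3) N' that] B_radon_plus[OF f(4) P' that] j'(5) that f P' N' by (simp add: B_sym[of X] feD)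
  have "senergy \<kappa> (radon_diff P N) (radon_diff P' N') = ereal (B p p' + B q q' - (B p q' + B q p'))"
    unfolding senergy_def p_def[symmetric] q_def[symmetric] p'_def[symmetric] q'_def[symmetric]
    using f by (simp add: energy_fin_energy)
  then show ?thesis
    using 1[OF f(3)] 1[OF f(4)] 2[OF P] 2[OF N] by simp
qed

lemma B_diff_nonneg: "P \<in> fin_energy \<Longrightarrow> N \<in> fin_energy \<Longrightarrow> 0 \<le> B P P - 2 * B P N + B N N"
  using KE_finite_aux(2)[of P N] senergy_diff[of P N P N] B_sym[of P N] by (simp add: feD)

text \<open>The positive and the negative coefficients are collected into two measures
  \<open>P\<close> and \<open>N\<close> of finite energy; the quadratic form is then the energy of
  their difference.\<close>

lemma B_positive:
  assumes J: "finite J" "\<And>j. j \<in> J \<Longrightarrow> \<mu> j \<in> fin_energy"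
  shows "0 \<le> (\<Sum>i\<in>J. \<Sum>j\<in>J. r i * r j * B (\<mu> i) (\<mu> j))"
proof -
  define P N where "P = radon_lincomb J (\<lambda>j. max (r j) 0) \<mu>" and "N = radon_lincomb J (\<lambda>j. max (- r j) 0) \<mu>"
  have PN: "P \<in> fin_energy" "N \<in> fin_energy" unfolding P_def N_def using J by (auto intro: radon_lincomb_fin_energy)
  have X: "B P X - B N X = (\<Sum>j\<in>J. r j * B (\<mu> j) X)" if "X \<in> fin_energy" for X
    unfolding P_def N_def using J that
    by (subst (1 2) B_radon_lincomb) (auto simp: sum_subtractf[symmetric] max_def algebra_simps intro!: sum.cong)
  have "B P P - 2 * B P N + B N N = (B P P - B N P) - (B P N - B N N)"
    using B_sym[of P N] PN by (simp add: feD)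
  also have "\<dots> = (\<Sum>j\<in>J. r j * (B P (\<mu> j) - B N (\<mu> j)))"
    using X[OF PN(1)] X[OF PN(2)] J PN by (simp add: sum_subtractf[symmetric] right_diff_distrib B_sym[of "\<mu> _"] feD)
  also have "\<dots> = (\<Sum>j\<in>J. r j * (\<Sum>i\<in>J. r i * B (\<mu> i) (\<mu> j)))"
    using J X by (intro sum.cong) auto
  also have "\<dots> = (\<Sum>i\<in>J. \<Sum>j\<in>J. r i * r j * B (\<mu> i) (\<mu> j))"
    by (subst sum.swap) (simp add: sum_distrib_left ac_simps)
  finally show ?thesis using B_diff_nonneg[OF PN] by simp
qed

lemma quadratic_nonneg:
  fixes a b d :: real
  assumes "\<And>t. 0 \<le> a + 2 * t * b + t^2 * d" shows "b^2 \<le> a * d"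
proof -
  have a: "0 \<le> a" using assms[of 0] by simp
  consider "d = 0" | "0 < d" | "d < 0" by linarith
  then show ?thesis
  proof cases
    case 1
    have "b = 0"
    proof (rule ccontr)
      assume "b \<noteq> 0"
      \<comment> \<open>At this argument the polynomial takes the value a - (a + 1) = -1.\<close>
      then show False using assms[of "- (a + 1) / (2 * b)"] 1 by (simp add: field_simps)
    qed
    then show ?thesis using 1 by simp
  next
    case 2
    have "0 \<le> a + 2 * (- b / d) * b + (- b / d)^2 * d" by (rule assms)
    also have "\<dots> = a - b^2 / d" using 2 by (simp add: field_simps power2_eq_square)
    finally show ?thesis using 2 by (simp add: field_simps)
  next
    case 3
    \<comment> \<open>Adding the values at t and -t removes the linear term. For
      \<open>t^2 = (a + 1) / - d\<close> the result is -2, so this case cannot occur.\<close>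
    have s: "0 \<le> 2 * a + 2 * t^2 * d" for t using assms[of t] assms[of "-t"] by simp
    have "a * 1 \<le> a * (a + 1)" using a by (intro mult_left_mono) auto
    have "(sqrt ((a + 1) / - d))^2 = (a + 1) / - d" using 3 a by (intro real_sqrt_pow2 divide_nonneg_pos) auto
    then have "0 \<le> 2 * a + 2 * ((a + 1) / - d) * d" using s[of "sqrt ((a + 1) / - d)"] by simp
    then show ?thesis using 3 by (simp add: field_simps)
  qed
qed

text \<open>The form is nonnegative on the combination of \<open>\<mu>\<close>, \<open>\<nu>\<close>
  and \<open>\<zeta>\<close> with coefficients 1, -1 and t, so its discriminant in t is not
  positive. The difference of \<open>\<mu>\<close> and \<open>\<nu>\<close> is written out because
  it is in general not a positive measure.\<close>

lemma B_cauchy_schwarz: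
  assumes f: "\<mu> \<in> fin_energy" "\<nu> \<in> fin_energy" "\<zeta> \<in> fin_energy"
  shows "(B \<mu> \<zeta> - B \<nu> \<zeta>)^2 \<le> (B \<mu> \<mu> - 2 * B \<mu> \<nu> + B \<nu> \<nu>) * B \<zeta> \<zeta>"
proof (rule quadratic_nonneg)
  fix t :: real
  define M where "M k = (if k = 0 then \<mu> else if k = 1 then \<nu> else \<zeta>)" for k :: nat
  define R where "R k = (if k = 0 then 1 else if k = 1 then -1 else t)" for k :: nat
  have "0 \<le> (\<Sum>i\<in>{0,1,2}. \<Sum>j\<in>{0,1,2}. R i * R j * B (M i) (M j))"
    using f by (intro B_positive) (auto simp: M_def)
  also have "\<dots> = (B \<mu> \<mu> - 2 * B \<mu> \<nu> + B \<nu> \<nu>) + 2 * t * (B \<mu> \<zeta> - B \<nu> \<zeta>) + t^2 * B \<zeta> \<zeta>"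
    using B_sym[of \<nu> \<mu>] B_sym[of \<zeta> \<mu>] B_sym[of \<zeta> \<nu>] f
    by (simp add: M_def R_def feD algebra_simps power2_eq_square)
  finally show "0 \<le> (B \<mu> \<mu> - 2 * B \<mu> \<nu> + B \<nu> \<nu>) + 2 * t * (B \<mu> \<zeta> - B \<nu> \<zeta>) + t^2 * B \<zeta> \<zeta>" .
qed

lemma B_nonneg: "\<mu> \<in> fin_energy \<Longrightarrow> 0 \<le> B \<mu> \<mu>"
  using B_positive[of "{()}" "\<lambda>_. \<mu>" "\<lambda>_. 1"] by simp

text \<open>If \<open>Q\<close> were charged, so would be a compact subset \<open>L\<close>. The
  normalized restriction of \<open>\<nu>\<close> to \<open>L\<close> has finite energy and competes
  in the definition of the capacity, which would then be positive.\<close>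

lemma capacity_zero_null:
  assumes \<nu>: "\<nu> \<in> fin_energy" and Q: "Q \<in> sets borel" and cap: "inner_capacity \<kappa> Q = 0"
  shows "emeasure \<nu> Q = 0"
proof (rule ccontr)
  assume "emeasure \<nu> Q \<noteq> 0"
  note \<nu>r = feD(1)[OF \<nu>]
  have "0 < emeasure \<nu> Q" using \<open>emeasure \<nu> Q \<noteq> 0\<close> by (simp add: zero_less_iff_neq_zero)
  then obtain L where L: "compact L" "L \<subseteq> Q" "0 < emeasure \<nu> L"
    unfolding radon_inner[OF \<nu>r Q] less_SUP_iff by auto
  have Ls [measurable]: "L \<in> sets borel" using L by (simp add: borel_compact)
  define a where "a = measure \<nu> L"
  have ea: "emeasure \<nu> L = ennreal a" using L \<nu>r by (simp add: a_def radon_emeasure_compact)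
  have a: "0 < a" using L ea by simp
  define \<rho> where "\<rho> = density \<nu> (indicator L)"
  have \<rho>r: "\<rho> \<in> radon" unfolding \<rho>_def by (rule radon_restrict[OF \<nu>r Ls])
  have em: "emeasure \<rho> A = emeasure \<nu> (L \<inter> A)" if "A \<in> sets borel" for A
    using that Ls \<nu>r unfolding \<rho>_def
    by (subst emeasure_density) (auto simp: radon_borel_measurable nn_integral_indicator simp flip: indicator_inter_arith)
  have "\<rho> \<le> \<nu>"
    using \<nu>r \<rho>r by (subst le_measure) (auto simp: em intro!: emeasure_mono)
  then have \<rho>fin_energy: "\<rho> \<in> fin_energy" using fin_energy_mono[OF \<nu> \<rho>r] by simp
  define \<tau> where "\<tau> = radon_lincomb {()} (\<lambda>_. 1 / a) (\<lambda>_. \<rho>)"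
  have \<tau>fin_energy: "\<tau> \<in> fin_energy" unfolding \<tau>_def using \<rho>fin_energy by (intro radon_lincomb_fin_energy) auto
  have \<tau>em: "emeasure \<tau> A = ennreal (1 / a) * emeasure \<nu> (L \<inter> A)" if "A \<in> sets borel" for A
    unfolding \<tau>_def using that \<rho>r by (subst emeasure_radon_lincomb) (auto simp: em)
  have "carried \<tau> Q"
    unfolding carried_def
  proof (intro allI impI)
    fix S :: "'b set" assume "compact S"
    then have S: "S - Q \<in> sets borel" using sets.Diff[OF borel_compact[of S] Q] by blast
    have "L \<inter> (S - Q) = {}" using L by auto
    then have "emeasure \<tau> (S - Q) = 0" by (simp add: \<tau>em[OF S])
    moreover have "S - Q \<in> sets \<tau>" using S by (simp add: \<tau>_def)
    ultimately have "S - Q \<in> null_sets \<tau>" by (rule null_setsI)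
    then show "S - Q \<in> null_sets (completion \<tau>)" by (rule null_sets_completionI)
  qed
  moreover have "emeasure (completion \<tau>) Q = 1"
  proof -
    have "emeasure (completion \<tau>) Q = emeasure \<tau> Q" 
    proof -
      have "Q \<in> sets \<tau>" using Q by (simp add: \<tau>_def)
      then show ?thesis by (simp add: emeasure_completion main_part_sets sets_completionI_sets)
    qed
    also have "\<dots> = ennreal (1 / a * a)" using Q L a by (simp add: \<tau>em Int_absorb2 ea flip: ennreal_mult)
    finally show ?thesis using a by simp
  qed
  ultimately have mem: "\<tau> \<in> {\<nu> \<in> radon_on Q. \<bar>energy \<kappa> \<nu> \<nu>\<bar> \<noteq> \<infinity> \<and> emeasure (completion \<nu>) Q = 1}" (is "_ \<in> ?S")
    using \<tau>fin_energy by (simp add: radon_on_def feD energy_fin_energy)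
  have "(INF \<nu>\<in>?S. energy \<kappa> \<nu> \<nu>) \<le> ereal (B \<tau> \<tau>)"
    using INF_lower[OF mem, of "\<lambda>\<nu>. energy \<kappa> \<nu> \<nu>"] by (simp only: energy_fin_energy[OF \<tau>fin_energy \<tau>fin_energy])
  moreover have "0 \<le> (INF \<nu>\<in>?S. energy \<kappa> \<nu> \<nu>)"
  proof (rule INF_greatest)
    fix \<nu> assume "\<nu> \<in> ?S"
    then have "\<nu> \<in> fin_energy" using energy_finite_iff[of \<nu> \<nu>] by (auto simp: radon_on_def fin_energy_def)
    then show "0 \<le> energy \<kappa> \<nu> \<nu>" by (simp add: energy_fin_energy B_nonneg)
  qed
  \<comment> \<open>The infimum is a finite nonnegative number. The capacity is infinite if it is 0
    and its reciprocal otherwise, in no case 0.\<close>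
  ultimately obtain x where "(INF \<nu>\<in>?S. energy \<kappa> \<nu> \<nu>) = ereal x" "0 \<le> x"
    by (cases "INF \<nu>\<in>?S. energy \<kappa> \<nu> \<nu>") auto
  then have "inner_capacity \<kappa> Q \<noteq> 0"
    unfolding inner_capacity_def by (cases "x = 0") (auto simp: one_ereal_def zero_ereal_def divide_ereal_def)
  then show False using cap by simp
qed

end

lemma kernel_lower_bound:
  fixes \<kappa> :: "'a::t2_space \<times> 'a \<Rightarrow> ereal"
  assumes "is_kernel \<kappa>"
  obtains c where "0 \<le> c" "\<And>z. - ereal c \<le> \<kappa> z" "c = 0 \<or> compact (UNIV :: 'a set)"
proof -
  obtain c where c: "0 \<le> c" "\<And>z. - ereal c \<le> \<kappa> z" "c = 0 \<or> compact (UNIV :: ('a \<times> 'a) set)"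
    using Psi_lower_bound assms unfolding is_kernel_def by metis
  have "compact (fst ` (UNIV :: ('a \<times> 'a) set))" if "compact (UNIV :: ('a \<times> 'a) set)"
    using that by (intro compact_continuous_image continuous_intros)
  then show ?thesis using c by (intro that[of c]) auto
qed

section \<open>Vague compactness\<close>

lemma compactin_pullback:
  assumes "L \<subseteq> A" "compactin T (f ` L)"
  shows "compactin (pullback_topology A f T) L"
  unfolding compactin_def
proof (intro conjI allI impI)
  show "L \<subseteq> topspace (pullback_topology A f T)"
    using assms compactin_subset_topspace[OF assms(2)] by (auto simp: topspace_pullback_topology)
  fix \<U> assume U: "Ball \<U> (openin (pullback_topology A f T)) \<and> L \<subseteq> \<Union>\<U>"
  then have "\<forall>S\<in>\<U>. \<exists>V. openin T V \<and> S = f -` V \<inter> A" by (auto simp: openin_pullback_topology)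
  then obtain V where V: "\<And>S. S \<in> \<U> \<Longrightarrow> openin T (V S)" "\<And>S. S \<in> \<U> \<Longrightarrow> S = f -` V S \<inter> A" by metis
  have "f ` L \<subseteq> \<Union>(V ` \<U>)"
  proof
    fix y assume "y \<in> f ` L"
    then obtain x where x: "x \<in> L" "y = f x" by auto
    then obtain S where S: "S \<in> \<U>" "x \<in> S" using U by auto
    then show "y \<in> \<Union>(V ` \<U>)" using V(2)[OF S(1)] x by auto
  qed
  moreover have "Ball (V ` \<U>) (openin T)" using V by auto
  ultimately obtain \<F> where F: "finite \<F>" "\<F> \<subseteq> V ` \<U>" "f ` L \<subseteq> \<Union>\<F>"
    using assms(2) unfolding compactin_def by metis
  then obtain \<G> where G: "finite \<G>" "\<G> \<subseteq> \<U>" "\<F> = V ` \<G>" by (metis finite_subset_image)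
  have "L \<subseteq> \<Union>\<G>"
  proof
    fix x assume x: "x \<in> L"
    then obtain S where S: "S \<in> \<G>" "f x \<in> V S" using F G by blast
    then have "S = f -` V S \<inter> A" using V(2) G by blast
    then show "x \<in> \<Union>\<G>" using x S assms(1) by blast
  qed
  then show "\<exists>\<F>. finite \<F> \<and> \<F> \<subseteq> \<U> \<and> L \<subseteq> \<Union>\<F>" using G by blast
qed

lemma topspace_vague [simp]: "topspace (vague_topology :: 'a::t2_space measure topology) = radon"
  unfolding vague_topology_def topspace_pullback_topology by auto

lemma continuous_map_vague:
  fixes \<phi> :: "'a::t2_space \<Rightarrow> real"
  assumes "\<phi> \<in> Cc" shows "continuous_map vague_topology euclideanreal (\<lambda>\<mu>. \<integral>x. \<phi> x \<partial>\<mu>)"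
proof -
  have "continuous_map vague_topology euclideanreal ((\<lambda>l. l \<phi>) o (\<lambda>\<mu>. restrict (\<lambda>\<phi>. \<integral>x. \<phi> x \<partial>\<mu>) Cc))"
    unfolding vague_topology_def using assms
    by (intro continuous_map_pullback continuous_map_product_projection)
  then show ?thesis using assms by (simp add: o_def)
qed

section \<open>Closed conditions and classes of measures on a compact set\<close>

lemma closedin_Collect_ball:
  assumes "\<And>i. i \<in> J \<Longrightarrow> closedin X {x\<in>topspace X. P i x}"
  shows "closedin X {x\<in>topspace X. \<forall>i\<in>J. P i x}"
proof (cases "J = {}")
  case False
  have "{x\<in>topspace X. \<forall>i\<in>J. P i x} = (\<Inter>i\<in>J. {x\<in>topspace X. P i x})" using False by auto
  then show ?thesis using assms False by (auto intro!: closedin_Inter)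
qed simp

lemma closedin_Collect_conj:
  assumes "closedin X {x\<in>topspace X. P x}" "closedin X {x\<in>topspace X. Q x}"
  shows "closedin X {x\<in>topspace X. P x \<and> Q x}"
proof -
  have "{x\<in>topspace X. P x \<and> Q x} = {x\<in>topspace X. P x} \<inter> {x\<in>topspace X. Q x}" by auto
  then show ?thesis using assms by (simp add: closedin_Int)
qed

lemma closedin_Collect_eq:
  assumes "continuous_map X euclideanreal f" "continuous_map X euclideanreal g"
  shows "closedin X {x\<in>topspace X. f x = g x}"
proof -
  have "closedin X {x\<in>topspace X. f x - g x \<in> {0}}"
    using assms by (intro closedin_continuous_map_preimage[where Y = euclideanreal] continuous_map_diff) auto
  then show ?thesis by simp
qed

lemma closedin_Collect_le:
  assumes "continuous_map X euclideanreal f" "continuous_map X euclideanreal g"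
  shows "closedin X {x\<in>topspace X. f x \<le> g x}"
proof -
  have "closedin X {x\<in>topspace X. g x - f x \<in> {0..}}"
    using assms by (intro closedin_continuous_map_preimage[where Y = euclideanreal] continuous_map_diff) auto
  then show ?thesis by simp
qed

text \<open>The flag \<open>b\<close> switches the constraint on, so that constrained and free
  indices share one class. Being carried by the compact set \<open>S\<close> is stated as nullity of
  its open complement, a condition that passes to vague limits.\<close>

definition kclass :: "'a::t2_space set \<Rightarrow> ('a \<Rightarrow> real) \<Rightarrow> real \<Rightarrow> bool \<Rightarrow> 'a measure \<Rightarrow> 'a measure set" where
  "kclass S g a b \<xi> = {\<theta>\<in>radon. emeasure \<theta> (- S) = 0 \<and> (\<integral>\<^sup>+x. ennreal (g x) \<partial>\<theta>) = ennreal a \<and> (b \<longrightarrow> \<theta> \<le> \<xi>)}"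

lemma kclass_AE:
  assumes "\<theta> \<in> kclass S g a b \<xi>" "compact S" shows "AE x in \<theta>. x \<in> S"
proof -
  have r: "\<theta> \<in> radon" using assms by (simp add: kclass_def)
  have "open (- S)" using assms(2) by (simp add: compact_imp_closed open_Compl)
  then have "- S \<in> null_sets \<theta>"
    using assms r by (intro null_setsI) (auto simp: kclass_def)
  from AE_not_in[OF this] show ?thesis by simp
qed

text \<open>On \<open>S\<close> the function \<open>g\<close> has a positive minimum
  \<open>d\<close>, so the masses are at most \<open>a / d\<close>, uniformly in the flag and in the
  constraint.\<close>

lemma kclass_mass:
  fixes S :: "'a::t2_space set"
  assumes S: "compact S" and g: "continuous_on UNIV g" "\<And>x. 0 < g x" and a: "0 \<le> a"
  obtains M where "0 < M" "\<And>\<theta> b \<xi>. \<theta> \<in> kclass S g a b \<xi> \<Longrightarrow> emeasure \<theta> UNIV \<le> ennreal M"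
proof (cases "S = {}")
  case True
  have "emeasure \<theta> UNIV \<le> ennreal 1" if "\<theta> \<in> kclass S g a b \<xi>" for \<theta> b \<xi>
    using that True by (simp add: kclass_def)
  then show ?thesis using that[of 1] by auto
next
  case False
  obtain x0 where x0: "x0 \<in> S" "\<And>x. x \<in> S \<Longrightarrow> g x0 \<le> g x"
    using continuous_attains_inf[OF S False continuous_on_subset[OF g(1) subset_UNIV]] by auto
  define d where "d = g x0"
  have d: "0 < d" using g by (simp add: d_def)
  \<comment> \<open>The summand 1 keeps the bound positive when \<open>a = 0\<close>; later it
    serves as a divisor.\<close>
  have "emeasure \<theta> UNIV \<le> ennreal (a / d + 1)" if \<theta>: "\<theta> \<in> kclass S g a b \<xi>" for \<theta> b \<xi>
  proof -
    have r: "\<theta> \<in> radon" using \<theta> by (simp add: kclass_def)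
    have "ennreal d * emeasure \<theta> UNIV = (\<integral>\<^sup>+x. ennreal d \<partial>\<theta>)" using r by simp
    also have "\<dots> \<le> (\<integral>\<^sup>+x. ennreal (g x) \<partial>\<theta>)"
    proof (rule nn_integral_mono_AE)
      show "AE x in \<theta>. ennreal d \<le> ennreal (g x)"
        using kclass_AE[OF \<theta> S] by eventually_elim (use x0 in \<open>auto simp: d_def intro: ennreal_leI\<close>)
    qed
    also have "\<dots> = ennreal a" using \<theta> by (simp add: kclass_def)
    finally have le: "ennreal d * emeasure \<theta> UNIV \<le> ennreal a" .
    have "emeasure \<theta> UNIV \<noteq> top"
    proof
      assume "emeasure \<theta> UNIV = top"
      then show False using le d by (simp add: ennreal_mult_top top_unique)
    qed
    then obtain t where t: "emeasure \<theta> UNIV = ennreal t" "0 \<le> t" by (metis ennreal_cases)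
    have "d * t \<le> a" using le t d a by (simp flip: ennreal_mult)
    then have "t \<le> a / d + 1" using d by (simp add: field_simps)
    then show ?thesis using t by (simp add: ennreal_leI)
  qed
  then show ?thesis using that[of "a / d + 1"] a d by (simp add: add_nonneg_pos)
qed

context lch
begin

text \<open>A Banach-Alaoglu argument: the functionals given by the class are exactly the points of
  a compact box of \<open>Cc\<close>-indexed coordinates that satisfy the closed conditions
  \<open>P\<close>. The Riesz theorem supplies the measure for each such point.\<close>

lemma kclass_compact:
  fixes S :: "'b set"
  assumes S: "compact S" and g: "continuous_on UNIV g" "\<And>x. 0 < g x" and a: "0 \<le> a" and \<xi>: "b \<Longrightarrow> \<xi> \<in> radon"
  shows "compactin vague_topology (kclass S g a b \<xi>)"
proof -
  define TT where "TT = product_topology (\<lambda>_ :: 'b \<Rightarrow> real. euclideanreal) Cc"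
  define J where "J \<mu> = restrict (\<lambda>\<phi>. \<integral>x. \<phi> x \<partial>\<mu>) Cc" for \<mu> :: "'b measure"
  obtain u Q where u: "u \<in> Ccp" "\<And>x. u x \<le> 1" "\<And>x. x \<in> S \<Longrightarrow> u x = 1" "compact Q" "Q \<subseteq> UNIV" "\<And>x. x \<notin> Q \<Longrightarrow> u x = 0"
    using urysohn[OF S open_UNIV] by auto
  \<comment> \<open>The cutoff \<open>u\<close> is 1 on \<open>S\<close>, so for measures carried by
    \<open>S\<close> the condition on the integral of \<open>g\<close> becomes a condition on a test
    function.\<close>
  have ug: "(\<lambda>x. u x * g x) \<in> Cc" using u g by (intro Cc_mult) (auto dest: CcpD)
  obtain M where M: "0 < M" "\<And>\<theta> b \<xi>. \<theta> \<in> kclass S g a b \<xi> \<Longrightarrow> emeasure \<theta> UNIV \<le> ennreal M"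
    using kclass_mass[OF S g a] by metis
  have "\<exists>B. \<forall>x. \<bar>\<phi> x\<bar> \<le> B" if "\<phi> \<in> Cc" for \<phi> :: "'b \<Rightarrow> real" using Cc_bounded[OF that] by metis
  then obtain Bd where Bd: "\<And>\<phi> x. \<phi> \<in> Cc \<Longrightarrow> \<bar>\<phi> (x::'b)\<bar> \<le> Bd \<phi>" by metis
  define box where "box = (\<Pi>\<^sub>E \<phi>\<in>Cc. {- (M * Bd \<phi>)..M * Bd \<phi>})"
  have boxc: "compactin TT box" unfolding TT_def box_def by (subst compactin_PiE) auto
  \<comment> \<open>Each condition compares finitely many coordinates of \<open>l\<close>, hence is
    closed in the product topology. The last conjunct determines \<open>l\<close> on
    \<open>Cc\<close> from its values on \<open>Ccp\<close>, where the Riesz theorem gives a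
    measure.\<close>
  define P where "P l \<longleftrightarrow>
      (\<forall>\<phi>\<in>Ccp. \<forall>\<psi>\<in>Ccp. l (\<lambda>x. \<phi> x + \<psi> x) = l \<phi> + l \<psi>) \<and>
      (\<forall>\<phi>\<in>Ccp. \<forall>r\<in>{0..}. l (\<lambda>x. r * \<phi> x) = r * l \<phi>) \<and>
      (\<forall>\<phi>\<in>Ccp. 0 \<le> l \<phi>) \<and>
      (\<forall>\<phi>\<in>{\<phi>\<in>Ccp. \<forall>x\<in>S. \<phi> x = 0}. l \<phi> = 0) \<and>
      l (\<lambda>x. u x * g x) = a \<and>
      (\<forall>\<phi>\<in>{\<phi>\<in>Ccp. b}. l \<phi> \<le> (\<integral>x. \<phi> x \<partial>\<xi>)) \<and>
      (\<forall>\<phi>\<in>Cc. l \<phi> = l (\<lambda>x. max (\<phi> x) 0) - l (\<lambda>x. max (- \<phi> x) 0))" for l :: "('b \<Rightarrow> real) \<Rightarrow> real"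
  have pr: "continuous_map TT euclideanreal (\<lambda>l. l \<phi>)" if "\<phi> \<in> Cc" for \<phi>
    unfolding TT_def using that by (rule continuous_map_product_projection)
  have closed: "closedin TT {l\<in>topspace TT. P l}"
    unfolding P_def using ug
    by (intro closedin_Collect_conj closedin_Collect_ball closedin_Collect_eq closedin_Collect_le
        continuous_map_add continuous_map_diff continuous_map_real_mult continuous_map_const[THEN iffD2] pr)
      (auto dest: CcpD intro: Cc_add Cc_scale Cc_max Cc_uminus Cc_zero)
  have "J ` kclass S g a b \<xi> = box \<inter> {l\<in>topspace TT. P l}"
  proof (intro equalityI subsetI)
    fix l assume "l \<in> J ` kclass S g a b \<xi>"
    then obtain \<theta> where \<theta>: "\<theta> \<in> kclass S g a b \<xi>" "l = J \<theta>" by auto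
    then have r: "\<theta> \<in> radon" by (simp add: kclass_def)
    have AES: "AE x in \<theta>. x \<in> S" by (rule kclass_AE[OF \<theta>(1) S])
    have lv: "l \<phi> = (\<integral>x. \<phi> x \<partial>\<theta>)" if "\<phi> \<in> Cc" for \<phi> using that \<theta> by (simp add: J_def)
    have i: "integrable \<theta> \<phi>" if "\<phi> \<in> Cc" for \<phi> using that r by (rule Cc_integrable[rotated])
    have fin: "emeasure \<theta> UNIV \<le> ennreal M" by (rule M(2)[OF \<theta>(1)])
    then have mM: "measure \<theta> UNIV \<le> M" and fin': "emeasure \<theta> UNIV < top"
      using M(1) by (auto simp: measure_def enn2real_leI less_top[symmetric] dest: order.strict_trans1[OF _ ennreal_less_top])
    have bb: "\<bar>\<integral>x. \<phi> x \<partial>\<theta>\<bar> \<le> M * Bd \<phi>" if \<phi>: "\<phi> \<in> Cc" for \<phi>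
    proof -
      have B0: "0 \<le> Bd \<phi>" using Bd[OF \<phi>, of undefined] by linarith
      have "\<bar>\<integral>x. \<phi> x \<partial>\<theta>\<bar> \<le> (\<integral>x. \<bar>\<phi> x\<bar> \<partial>\<theta>)" by (rule integral_abs_bound)
      also have "\<dots> \<le> (\<integral>x. Bd \<phi> \<partial>\<theta>)"
      proof (rule integral_mono)
        show "integrable \<theta> (\<lambda>x. Bd \<phi>)" using fin' r by (intro finite_measure.integrable_const finite_measureI) auto
      qed (use i \<phi> Bd in auto)
      also have "\<dots> = measure \<theta> UNIV * Bd \<phi>" using r by simp
      also have "\<dots> \<le> M * Bd \<phi>" using mM B0 by (rule mult_right_mono)
      finally show ?thesis .
    qed
    have "l \<in> box"
      unfolding box_def \<theta>(2) J_def using bb by (auto simp: abs_le_iff PiE_iff)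
        (smt (verit) minus_le_iff)
    moreover have "l \<in> topspace TT" using \<theta> by (simp add: TT_def J_def)
    moreover have "P l"
      unfolding P_def
    proof (intro conjI ballI)
      fix \<phi> \<psi> :: "'b \<Rightarrow> real" assume "\<phi> \<in> Ccp" "\<psi> \<in> Ccp"
      then show "l (\<lambda>x. \<phi> x + \<psi> x) = l \<phi> + l \<psi>" using i by (simp add: lv Cc_add CcpD)
    next
      fix \<phi> :: "'b \<Rightarrow> real" and r :: real assume "\<phi> \<in> Ccp"
      then show "l (\<lambda>x. r * \<phi> x) = r * l \<phi>" using i by (simp add: lv Cc_scale CcpD)
    next
      fix \<phi> :: "'b \<Rightarrow> real" assume "\<phi> \<in> Ccp"
      then show "0 \<le> l \<phi>" by (simp add: lv CcpD Ccp_integral_nonneg)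
    next
      fix \<phi> :: "'b \<Rightarrow> real" assume \<phi>: "\<phi> \<in> {\<phi>\<in>Ccp. \<forall>x\<in>S. \<phi> x = 0}"
      have "\<phi> \<in> borel_measurable \<theta>"
        using \<phi> i[of \<phi>] CcpD(1)[of \<phi>] by (auto intro: borel_measurable_integrable)
      then have "(\<integral>x. \<phi> x \<partial>\<theta>) = (\<integral>x. 0 \<partial>\<theta>)"
      proof (rule integral_cong_AE)
        show "AE x in \<theta>. \<phi> x = 0" using AES by eventually_elim (use \<phi> in auto)
      qed auto
      then show "l \<phi> = 0" using \<phi> by (simp add: lv CcpD)
    next
      have "(\<integral>x. u x * g x \<partial>\<theta>) = enn2real (\<integral>\<^sup>+x. ennreal (u x * g x) \<partial>\<theta>)"
        using i[OF ug] g u by (intro integral_eq_nn_integral) (auto intro!: mult_nonneg_nonneg dest: CcpD simp: less_imp_le)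
      also have "(\<integral>\<^sup>+x. ennreal (u x * g x) \<partial>\<theta>) = (\<integral>\<^sup>+x. ennreal (g x) \<partial>\<theta>)"
      proof (rule nn_integral_cong_AE)
        show "AE x in \<theta>. ennreal (u x * g x) = ennreal (g x)" using AES by eventually_elim (use u in auto)
      qed
      also have "\<dots> = ennreal a" using \<theta> by (simp add: kclass_def)
      finally show "l (\<lambda>x. u x * g x) = a" using a by (simp add: lv[OF ug])
    next
      fix \<phi> :: "'b \<Rightarrow> real" assume \<phi>: "\<phi> \<in> {\<phi>\<in>Ccp. b}"
      then have x: "\<xi> \<in> radon" "\<theta> \<le> \<xi>" using \<xi> \<theta> by (auto simp: kclass_def)
      have "ennreal (\<integral>x. \<phi> x \<partial>\<theta>) \<le> ennreal (\<integral>x. \<phi> x \<partial>\<xi>)"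
        using \<phi> r x by (simp flip: Ccp_nn_integral add: radon_nn_integral_mono)
      then show "l \<phi> \<le> (\<integral>x. \<phi> x \<partial>\<xi>)" using \<phi> by (simp add: lv CcpD Ccp_integral_nonneg)
    next
      fix \<phi> :: "'b \<Rightarrow> real" assume \<phi>: "\<phi> \<in> Cc"
      have p: "(\<lambda>x. max (\<phi> x) 0) \<in> Cc" "(\<lambda>x. max (- \<phi> x) 0) \<in> Cc"
        using \<phi> by (auto intro!: Cc_max Cc_uminus Cc_zero)
      have "(\<integral>x. max (\<phi> x) 0 \<partial>\<theta>) - (\<integral>x. max (- \<phi> x) 0 \<partial>\<theta>) = (\<integral>x. max (\<phi> x) 0 - max (- \<phi> x) 0 \<partial>\<theta>)"
        by (rule Bochner_Integration.integral_diff[symmetric]) (intro i p)+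
      also have "\<dots> = (\<integral>x. \<phi> x \<partial>\<theta>)" by (intro Bochner_Integration.integral_cong) (auto simp: max_def)
      finally show "l \<phi> = l (\<lambda>x. max (\<phi> x) 0) - l (\<lambda>x. max (- \<phi> x) 0)" using \<phi> p by (simp add: lv)
    qed
    ultimately show "l \<in> box \<inter> {l\<in>topspace TT. P l}" by simp
  next
    fix l assume l: "l \<in> box \<inter> {l\<in>topspace TT. P l}"
    then have Pl: "P l" and ext: "l \<in> extensional Cc" by (auto simp: box_def PiE_def)
    have "\<exists>\<theta>\<in>radon. \<forall>\<phi>\<in>Ccp. (\<integral>x. \<phi> x \<partial>\<theta>) = l \<phi>"
      by (rule riesz[of l]) (use Pl in \<open>auto simp: P_def\<close>)
    then obtain \<theta> where \<theta>: "\<theta> \<in> radon" "\<And>\<phi>. \<phi> \<in> Ccp \<Longrightarrow> (\<integral>x. \<phi> x \<partial>\<theta>) = l \<phi>" by blast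
    have all: "(\<integral>x. \<phi> x \<partial>\<theta>) = l \<phi>" if \<phi>: "\<phi> \<in> Cc" for \<phi>
    proof -
      have p: "(\<lambda>x. max (\<phi> x) 0) \<in> Ccp" "(\<lambda>x. max (- \<phi> x) 0) \<in> Ccp"
        using \<phi> by (auto intro!: CcpI Cc_max Cc_uminus Cc_zero)
      have "(\<integral>x. \<phi> x \<partial>\<theta>) = (\<integral>x. max (\<phi> x) 0 - max (- \<phi> x) 0 \<partial>\<theta>)"
        by (intro Bochner_Integration.integral_cong) (auto simp: max_def)
      also have "\<dots> = (\<integral>x. max (\<phi> x) 0 \<partial>\<theta>) - (\<integral>x. max (- \<phi> x) 0 \<partial>\<theta>)"
        by (rule Bochner_Integration.integral_diff) (intro Cc_integrable \<theta> p[THEN CcpD(1)])+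
      also have "\<dots> = l \<phi>" using Pl \<phi> p by (simp add: \<theta>(2) P_def)
      finally show ?thesis .
    qed
    have "l = J \<theta>" using ext all by (auto simp: J_def extensional_def fun_eq_iff)
    moreover have "\<theta> \<in> kclass S g a b \<xi>"
      unfolding kclass_def
    proof (intro CollectI conjI impI \<theta>(1))
      have oS: "open (- S)" using S by (simp add: compact_imp_closed open_Compl)
      \<comment> \<open>A Urysohn function that is 1 on \<open>L\<close> and vanishes on
        \<open>S\<close> has integral 0 by the support condition in \<open>P\<close>.\<close>
      have "emeasure \<theta> L = 0" if L: "compact L" "L \<subseteq> - S" for L
      proof -
        obtain \<phi> R where \<phi>: "\<phi> \<in> Ccp" "\<And>x. \<phi> x \<le> 1" "\<And>x. x \<in> L \<Longrightarrow> \<phi> x = 1" "compact R" "R \<subseteq> - S" "\<And>x. x \<notin> R \<Longrightarrow> \<phi> x = 0"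
          using urysohn[OF L(1) oS L(2)] by metis
        have "\<phi> \<in> {\<phi>\<in>Ccp. \<forall>x\<in>S. \<phi> x = 0}" using \<phi> by blast
        then have "l \<phi> = 0" using Pl unfolding P_def by blast
        moreover have "1 * measure \<theta> L \<le> (\<integral>x. \<phi> x \<partial>\<theta>)" using \<phi> by (intro Ccp_integral_ge \<theta> L) auto
        ultimately have "measure \<theta> L \<le> 0" using \<theta>(2)[OF \<phi>(1)] by simp
        then show ?thesis using radon_emeasure_compact[OF \<theta>(1) L(1)] by (simp add: ennreal_neg)
      qed
      then show S0: "emeasure \<theta> (- S) = 0"
        using oS by (subst radon_inner[OF \<theta>(1)]) (auto intro!: antisym SUP_least)
      have AES: "AE x in \<theta>. x \<in> S"
      proof -
        have "- S \<in> null_sets \<theta>" using S0 oS \<theta>(1) by (intro null_setsI) auto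
        from AE_not_in[OF this] show ?thesis by simp
      qed
      have "(\<integral>\<^sup>+x. ennreal (g x) \<partial>\<theta>) = (\<integral>\<^sup>+x. ennreal (u x * g x) \<partial>\<theta>)"
      proof (rule nn_integral_cong_AE)
        show "AE x in \<theta>. ennreal (g x) = ennreal (u x * g x)" using AES by eventually_elim (use u in auto)
      qed
      also have "\<dots> = ennreal (\<integral>x. u x * g x \<partial>\<theta>)"
        using ug g u \<theta>(1) by (intro Ccp_nn_integral CcpI) (auto intro!: mult_nonneg_nonneg dest: CcpD simp: less_imp_le)
      also have "\<dots> = ennreal a" using Pl all[OF ug] by (simp add: P_def)
      finally show "(\<integral>\<^sup>+x. ennreal (g x) \<partial>\<theta>) = ennreal a" .
      show "\<theta> \<le> \<xi>" if b
        using Pl that \<theta> \<xi> by (intro radon_leI) (auto simp: P_def)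
    qed
    ultimately show "l \<in> J ` kclass S g a b \<xi>" by blast
  qed
  then have "compactin TT (J ` kclass S g a b \<xi>)"
    using closed_Int_compactin[OF closed boxc] by (simp add: Int_commute)
  then show ?thesis
    unfolding vague_topology_def J_def[abs_def] TT_def
    by (intro compactin_pullback) (auto simp: kclass_def)
qed

end

section \<open>Strong convergence of vaguely convergent nets\<close>

text \<open>Directedness replaces monotonicity of a sequence: the sets where \<open>h\<close>
  exceeds \<open>v - e\<close> cover \<open>S\<close>, and one member of \<open>D\<close> dominates
  the finitely many functions of a subcover.\<close>

lemma dini:
  fixes D :: "('a::t2_space \<Rightarrow> real) set"
  assumes S: "compact S" and v: "continuous_on S v" and D: "directed_fn D"
    and cont: "\<And>h. h \<in> D \<Longrightarrow> continuous_on S h"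
    and sup: "\<And>x d. x \<in> S \<Longrightarrow> 0 < d \<Longrightarrow> \<exists>h\<in>D. v x - d < h x" and e: "0 < (e::real)"
  shows "\<exists>h\<in>D. \<forall>x\<in>S. v x - e < h x"
proof -
  have "\<forall>h\<in>D. \<exists>U. open U \<and> U \<inter> S = {x\<in>S. v x - e < h x}"
  proof
    fix h assume "h \<in> D"
    then have "continuous_on S (\<lambda>x. h x - v x)" using v cont by (intro continuous_on_diff)
    then obtain U where "open U" "U \<inter> S = (\<lambda>x. h x - v x) -` {- e <..} \<inter> S"
      unfolding continuous_on_open_invariant using open_greaterThan by blast
    moreover have "(\<lambda>x. h x - v x) -` {- e <..} \<inter> S = {x\<in>S. v x - e < h x}" by auto
    ultimately show "\<exists>U. open U \<and> U \<inter> S = {x\<in>S. v x - e < h x}" by metis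
  qed
  from bchoice[OF this] obtain U
    where U: "\<And>h. h \<in> D \<Longrightarrow> open (U h)" "\<And>h. h \<in> D \<Longrightarrow> U h \<inter> S = {x\<in>S. v x - e < h x}" by blast
  have "S \<subseteq> (\<Union>h\<in>D. U h)"
  proof
    fix x assume x: "x \<in> S"
    then obtain h where h: "h \<in> D" "v x - e < h x" using sup e by blast
    then have "x \<in> U h \<inter> S" using U(2) x by auto
    then show "x \<in> (\<Union>h\<in>D. U h)" using h by auto
  qed
  then obtain C where C: "C \<subseteq> D" "finite C" "S \<subseteq> (\<Union>h\<in>C. U h)"
    using compactE_image[OF S, of D U] U(1) by metis
  obtain h where h: "h \<in> D" "\<forall>h'\<in>C. h' \<le> h" using directed_fn_finite[OF D C(2,1)] by blast
  have "v x - e < h x" if x: "x \<in> S" for x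
  proof -
    obtain h' where h': "h' \<in> C" "x \<in> U h'" using C x by blast
    then have "x \<in> {x\<in>S. v x - e < h' x}" using U(2)[of h'] C x by blast
    then show ?thesis using h h' by (auto simp: le_fun_def intro: less_le_trans)
  qed
  then show ?thesis using h by blast
qed

lemma fin_continuous_on_real:
  fixes S :: "'a::t2_space set"
  assumes "fin_continuous_on S \<psi>" shows "continuous_on S (\<lambda>x. real_of_ereal (\<psi> x))"
proof -
  have a: "\<bar>\<psi> x\<bar> \<noteq> \<infinity>" if "x \<in> S" for x
    using assms[unfolded fin_continuous_on_def, THEN conjunct2] that by (rule bspec)
  have "continuous_on S \<psi>" using assms by (simp only: fin_continuous_on_def)
  then have "continuous_on S (real_of_ereal \<circ> \<psi>)" using continuous_on_iff_real[of S \<psi>, OF a] by blast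
  then show ?thesis by (simp only: comp_def)
qed

context lch
begin

text \<open>For sums of tensors of test functions the convergence is immediate. The weight
  \<open>w\<close> keeps the remainder small, since its integrals converge and are therefore
  eventually bounded.\<close>

lemma double_int_tendsto:
  fixes h :: "'b \<times> 'b \<Rightarrow> real"
  assumes h: "h \<in> Cc"
    and r: "\<forall>\<^sub>F t in F. \<alpha> t \<in> radon" "\<forall>\<^sub>F t in F. \<beta> t \<in> radon" "\<alpha>' \<in> radon" "\<beta>' \<in> radon"
    and conv: "\<And>\<phi>. \<phi> \<in> Cc \<Longrightarrow> ((\<lambda>t. \<integral>x. \<phi> x \<partial>\<alpha> t) \<longlongrightarrow> (\<integral>x. \<phi> x \<partial>\<alpha>')) F"
      "\<And>\<phi>. \<phi> \<in> Cc \<Longrightarrow> ((\<lambda>t. \<integral>x. \<phi> x \<partial>\<beta> t) \<longlongrightarrow> (\<integral>x. \<phi> x \<partial>\<beta>')) F"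
  shows "((\<lambda>t. double_int (\<alpha> t) (\<beta> t) h) \<longlongrightarrow> double_int \<alpha>' \<beta>' h) F"
proof -
  obtain w where w: "w \<in> Ccp" "\<And>e. 0 < e \<Longrightarrow> \<exists>n \<phi> \<psi>. tensor_sum_approx h w n \<phi> \<psi> e"
    using tensor_approx[OF h] by blast
  have wC: "w \<in> Cc" using w CcpD by auto
  define W where "W = (\<integral>x. w x \<partial>\<alpha>') * (\<integral>x. w x \<partial>\<beta>')"
  have W0: "0 \<le> W" using w by (simp add: W_def Ccp_integral_nonneg)
  show ?thesis
  proof (rule tendstoI)
    fix d :: real assume d: "0 < d"
    \<comment> \<open>Chosen so that the two remainders, \<open>e * (W + 1)\<close> along the filter
      and \<open>e * W\<close> at the limit, cost at most \<open>d / 2\<close> together.\<close>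
    define e where "e = d / (2 * (2 * W + 2))"
    have e: "0 < e" using d W0 by (simp add: e_def)
    obtain n \<phi> \<psi> where t: "tensor_sum_approx h w n \<phi> \<psi> e" using w(2)[OF e] by blast
    define s where "s \<alpha> \<beta> = (\<Sum>k<n. (\<integral>x. \<phi> k x \<partial>\<alpha>) * (\<integral>y. \<psi> k y \<partial>\<beta>))" for \<alpha> \<beta> :: "'b measure"
    have "((\<lambda>t. s (\<alpha> t) (\<beta> t)) \<longlongrightarrow> s \<alpha>' \<beta>') F"
      unfolding s_def using t by (intro tendsto_sum tendsto_mult conv) (auto simp: tensor_sum_approx_def)
    then have 1: "\<forall>\<^sub>F t in F. dist (s (\<alpha> t) (\<beta> t)) (s \<alpha>' \<beta>') < d / 2" using d by (intro tendstoD) auto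
    have "((\<lambda>t. (\<integral>x. w x \<partial>\<alpha> t) * (\<integral>x. w x \<partial>\<beta> t)) \<longlongrightarrow> W) F"
      unfolding W_def by (intro tendsto_mult conv wC)
    then have 2: "\<forall>\<^sub>F t in F. (\<integral>x. w x \<partial>\<alpha> t) * (\<integral>x. w x \<partial>\<beta> t) < W + 1" by (rule order_tendstoD) simp
    show "\<forall>\<^sub>F t in F. dist (double_int (\<alpha> t) (\<beta> t) h) (double_int \<alpha>' \<beta>' h) < d"
      using 1 2 r(1,2)
    proof eventually_elim
      case (elim t')
      have a1: "\<bar>double_int (\<alpha> t') (\<beta> t') h - s (\<alpha> t') (\<beta> t')\<bar> \<le> e * ((\<integral>x. w x \<partial>\<alpha> t') * (\<integral>x. w x \<partial>\<beta> t'))"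
        unfolding s_def by (rule double_int_approx[OF t h wC elim(3,4)])
      have a2: "\<bar>double_int \<alpha>' \<beta>' h - s \<alpha>' \<beta>'\<bar> \<le> e * W"
        unfolding s_def W_def by (rule double_int_approx[OF t h wC r(3,4)])
      have a3: "e * ((\<integral>x. w x \<partial>\<alpha> t') * (\<integral>x. w x \<partial>\<beta> t')) \<le> e * (W + 1)"
        using elim(2) e by (intro mult_left_mono) auto
      have "e * (W + 1) + e * W \<le> e * (2 * W + 2)" using e by (simp add: algebra_simps)
      also have "\<dots> = d / 2" using W0 by (simp add: e_def field_simps)
      finally show ?case using a1 a2 a3 elim(1) unfolding dist_real_def by linarith
    qed
  qed
qed

end

context kernel_space
begin

text \<open>The energy is a uniform limit, on the class, of the vaguely continuous forms \<open>double_int \<theta> \<theta>' h\<close>.\<close>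

definition approx_class :: "'b measure set \<Rightarrow> bool" where
  "approx_class k \<longleftrightarrow> k \<subseteq> fin_energy \<and> (\<forall>e>0. \<exists>h\<in>Cc. \<forall>\<theta>\<in>k. \<forall>\<theta>'\<in>k. \<bar>enn2real (KE \<theta> \<theta>') - double_int \<theta> \<theta>' h\<bar> \<le> e)"

definition sqdist :: "'b measure \<Rightarrow> 'b measure \<Rightarrow> real" where
  "sqdist \<mu> \<nu> = B \<mu> \<mu> - 2 * B \<mu> \<nu> + B \<nu> \<nu>"

text \<open>With the energy replaced by the form given by \<open>h\<close>, the squared distance
  becomes an expression that is continuous under vague convergence and vanishes at the
  limit.\<close>

lemma sqdist_tendsto:
  assumes k: "approx_class k" and \<theta>: "\<forall>\<^sub>F t in F. \<theta> t \<in> k" "\<theta>' \<in> k"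
    and conv: "\<And>\<phi>. \<phi> \<in> Cc \<Longrightarrow> ((\<lambda>t. \<integral>x. \<phi> x \<partial>\<theta> t) \<longlongrightarrow> (\<integral>x. \<phi> x \<partial>\<theta>')) F"
  shows "((\<lambda>t. sqdist (\<theta> t) \<theta>') \<longlongrightarrow> 0) F"
proof (rule tendstoI)
  fix d :: real assume d: "0 < d"
  \<comment> \<open>The squared distance contains four energies counted with multiplicity, so the
    replacement costs at most \<open>d / 2\<close>.\<close>
  obtain h where h: "h \<in> Cc" "\<And>\<theta> \<theta>'. \<theta> \<in> k \<Longrightarrow> \<theta>' \<in> k \<Longrightarrow> \<bar>enn2real (KE \<theta> \<theta>') - double_int \<theta> \<theta>' h\<bar> \<le> d / 8"
    using k d unfolding approx_class_def by (metis zero_less_divide_iff zero_less_numeral)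
  have kr: "\<theta> \<in> radon" if "\<theta> \<in> k" for \<theta> using k that feD by (auto simp: approx_class_def)
  have r: "\<forall>\<^sub>F t in F. \<theta> t \<in> radon" "\<theta>' \<in> radon"
    using \<theta> kr by (auto elim: eventually_mono)
  define G where "G \<mu> \<nu> = double_int \<mu> \<nu> h - c * (m \<mu> * m \<nu>)" for \<mu> \<nu>
  \<comment> \<open>The subtracted mass terms converge as well: if \<open>c\<close> is not 0 the
    space is compact and the constant 1 is a test function.\<close>
  have mconv: "((\<lambda>t. c * (m (\<theta> t) * m (\<theta> t))) \<longlongrightarrow> c * (m \<theta>' * m \<theta>')) F"
    "((\<lambda>t. c * (m (\<theta> t) * m \<theta>')) \<longlongrightarrow> c * (m \<theta>' * m \<theta>')) F"
  proof -
    have "((\<lambda>t. m (\<theta> t)) \<longlongrightarrow> m \<theta>') F" if "c \<noteq> 0"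
    proof -
      have "(\<lambda>_. 1) \<in> (Cc :: ('b \<Rightarrow> real) set)" using c(3) that by (intro CcI[of _ UNIV]) auto
      from conv[OF this] have "((\<lambda>t. measure (\<theta> t) (space (\<theta> t))) \<longlongrightarrow> m \<theta>') F" using r(2) by (simp add: m_def)
      then show ?thesis
        by (rule Lim_transform_eventually) (use r(1) in \<open>auto simp: m_def elim!: eventually_mono\<close>)
    qed
    then show "((\<lambda>t. c * (m (\<theta> t) * m (\<theta> t))) \<longlongrightarrow> c * (m \<theta>' * m \<theta>')) F"
      "((\<lambda>t. c * (m (\<theta> t) * m \<theta>')) \<longlongrightarrow> c * (m \<theta>' * m \<theta>')) F"
      by (cases "c = 0"; auto intro!: tendsto_intros)+
  qed
  have 1: "((\<lambda>t. G (\<theta> t) (\<theta> t)) \<longlongrightarrow> G \<theta>' \<theta>') F"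
    unfolding G_def by (intro tendsto_diff mconv double_int_tendsto h r conv)
  have 2: "((\<lambda>t. G (\<theta> t) \<theta>') \<longlongrightarrow> G \<theta>' \<theta>') F"
    unfolding G_def by (intro tendsto_diff mconv double_int_tendsto h r conv tendsto_const always_eventually allI)
  have "((\<lambda>t. G (\<theta> t) (\<theta> t) - 2 * G (\<theta> t) \<theta>' + G \<theta>' \<theta>') \<longlongrightarrow> G \<theta>' \<theta>' - 2 * G \<theta>' \<theta>' + G \<theta>' \<theta>') F"
    by (intro tendsto_intros 1 2)
  then have "((\<lambda>t. G (\<theta> t) (\<theta> t) - 2 * G (\<theta> t) \<theta>' + G \<theta>' \<theta>') \<longlongrightarrow> 0) F" by simp
  then have "\<forall>\<^sub>F t in F. dist (G (\<theta> t) (\<theta> t) - 2 * G (\<theta> t) \<theta>' + G \<theta>' \<theta>') 0 < d / 2" using d by (intro tendstoD) auto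
  then show "\<forall>\<^sub>F t in F. dist (sqdist (\<theta> t) \<theta>') 0 < d"
    using \<theta>(1)
  proof eventually_elim
    case (elim t)
    have b: "\<bar>B \<mu> \<nu> - G \<mu> \<nu>\<bar> \<le> d / 8" if "\<mu> \<in> k" "\<nu> \<in> k" for \<mu> \<nu>
      using h(2)[OF that] by (simp add: B_def G_def)
    show ?case
      using elim(1) b[OF elim(2) elim(2)] b[OF elim(2) \<theta>(2)] b[OF \<theta>(2) \<theta>(2)]
      unfolding sqdist_def dist_real_def by linarith
  qed
qed

text \<open>Strong convergence implies weak convergence, by Cauchy-Schwarz against the fixed measure
  \<open>\<zeta>\<close>.\<close>

lemma B_tendsto1:
  assumes f: "\<forall>\<^sub>F t in F. \<alpha> t \<in> fin_energy" "\<alpha>' \<in> fin_energy" "\<zeta> \<in> fin_energy" and s: "((\<lambda>t. sqdist (\<alpha> t) \<alpha>') \<longlongrightarrow> 0) F"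
  shows "((\<lambda>t. B (\<alpha> t) \<zeta>) \<longlongrightarrow> B \<alpha>' \<zeta>) F"
proof -
  have "((\<lambda>t. sqrt (sqdist (\<alpha> t) \<alpha>' * B \<zeta> \<zeta>)) \<longlongrightarrow> sqrt (0 * B \<zeta> \<zeta>)) F" by (intro tendsto_intros s)
  then have z: "((\<lambda>t. sqrt (sqdist (\<alpha> t) \<alpha>' * B \<zeta> \<zeta>)) \<longlongrightarrow> 0) F" by simp
  have "((\<lambda>t. B (\<alpha> t) \<zeta> - B \<alpha>' \<zeta>) \<longlongrightarrow> 0) F"
  proof (rule Lim_null_comparison[OF _ z])
    show "\<forall>\<^sub>F t in F. norm (B (\<alpha> t) \<zeta> - B \<alpha>' \<zeta>) \<le> sqrt (sqdist (\<alpha> t) \<alpha>' * B \<zeta> \<zeta>)"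
      using f(1)
    proof eventually_elim
      case (elim t)
      show ?case using B_cauchy_schwarz[OF elim f(2,3)] unfolding sqdist_def by (simp add: real_le_rsqrt)
    qed
  qed
  from tendsto_add[OF this tendsto_const[of "B \<alpha>' \<zeta>"]] show ?thesis by simp
qed

text \<open>The self-energies of \<open>\<beta> t\<close> converge, so the Cauchy-Schwarz bound for
  replacing \<open>\<alpha> t\<close> by its limit tends to 0; the other variable is handled by
  \<open>B_tendsto1\<close>.\<close>

lemma B_tendsto2:
  assumes f: "\<forall>\<^sub>F t in F. \<alpha> t \<in> fin_energy" "\<alpha>' \<in> fin_energy" "\<forall>\<^sub>F t in F. \<beta> t \<in> fin_energy" "\<beta>' \<in> fin_energy"
    and s: "((\<lambda>t. sqdist (\<alpha> t) \<alpha>') \<longlongrightarrow> 0) F" "((\<lambda>t. sqdist (\<beta> t) \<beta>') \<longlongrightarrow> 0) F"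
  shows "((\<lambda>t. B (\<alpha> t) (\<beta> t)) \<longlongrightarrow> B \<alpha>' \<beta>') F"
proof -
  have b1: "((\<lambda>t. B (\<beta> t) \<beta>') \<longlongrightarrow> B \<beta>' \<beta>') F" by (rule B_tendsto1[OF f(3,4,4) s(2)])
  \<comment> \<open>The self-energy is recovered by solving the definition of \<open>sqdist\<close>
    for it.\<close>
  have "((\<lambda>t. sqdist (\<beta> t) \<beta>' + 2 * B (\<beta> t) \<beta>' - B \<beta>' \<beta>') \<longlongrightarrow> 0 + 2 * B \<beta>' \<beta>' - B \<beta>' \<beta>') F"
    by (intro tendsto_intros s b1)
  then have bb: "((\<lambda>t. B (\<beta> t) (\<beta> t)) \<longlongrightarrow> B \<beta>' \<beta>') F" by (simp add: sqdist_def)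
  have "((\<lambda>t. B (\<beta> t) \<alpha>') \<longlongrightarrow> B \<beta>' \<alpha>') F" by (rule B_tendsto1[OF f(3,4,2) s(2)])
  then have "((\<lambda>t. B \<alpha>' (\<beta> t)) \<longlongrightarrow> B \<beta>' \<alpha>') F"
  proof (rule Lim_transform_eventually)
    show "\<forall>\<^sub>F t in F. B (\<beta> t) \<alpha>' = B \<alpha>' (\<beta> t)"
      using f(3) by eventually_elim (use f(2) in \<open>auto intro!: B_sym simp: feD\<close>)
  qed
  then have 1: "((\<lambda>t. B \<alpha>' (\<beta> t)) \<longlongrightarrow> B \<alpha>' \<beta>') F"
    using B_sym[of \<beta>' \<alpha>'] f by (simp add: feD)
  have "((\<lambda>t. sqrt (sqdist (\<alpha> t) \<alpha>' * B (\<beta> t) (\<beta> t))) \<longlongrightarrow> sqrt (0 * B \<beta>' \<beta>')) F" by (intro tendsto_intros s bb)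
  then have z: "((\<lambda>t. sqrt (sqdist (\<alpha> t) \<alpha>' * B (\<beta> t) (\<beta> t))) \<longlongrightarrow> 0) F" by simp
  have "((\<lambda>t. B (\<alpha> t) (\<beta> t) - B \<alpha>' (\<beta> t)) \<longlongrightarrow> 0) F"
  proof (rule Lim_null_comparison[OF _ z])
    show "\<forall>\<^sub>F t in F. norm (B (\<alpha> t) (\<beta> t) - B \<alpha>' (\<beta> t)) \<le> sqrt (sqdist (\<alpha> t) \<alpha>' * B (\<beta> t) (\<beta> t))"
      using f(1,3)
    proof eventually_elim
      case (elim t)
      show ?case using B_cauchy_schwarz[OF elim(1) f(2) elim(2)] unfolding sqdist_def by (simp add: real_le_rsqrt)
    qed
  qed
  from tendsto_add[OF this 1] show ?thesis by simp
qed

section \<open>Uniform approximation of the energy on the classes\<close>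

text \<open>The hypothesis concerns potentials at points of \<open>S\<close>, uniformly over the
  class. Integration against a member of the class, which is carried by \<open>S\<close> and has
  mass at most \<open>M\<close>, multiplies the error by at most \<open>M\<close>.\<close>

lemma approx_from:
  assumes S: "compact S" and M: "0 < M" "\<And>\<theta>. \<theta> \<in> kclass S g a b \<xi> \<Longrightarrow> emeasure \<theta> UNIV \<le> ennreal M"
    and h: "\<And>e. 0 < e \<Longrightarrow> \<exists>h\<in>minorants K. \<forall>\<theta>\<in>kclass S g a b \<xi>. \<forall>x\<in>S. (\<integral>\<^sup>+y. K (x, y) \<partial>\<theta>) \<le> ennreal (section_int \<theta> h x) + ennreal e"
  shows "approx_class (kclass S g a b \<xi>)"
proof -
  let ?k = "kclass S g a b \<xi>"
  have r: "\<theta> \<in> radon" if "\<theta> \<in> ?k" for \<theta> using that by (simp add: kclass_def)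
  have ex: "\<exists>h\<in>Ccp. \<forall>\<theta>\<in>?k. \<forall>\<theta>'\<in>?k. ennreal (double_int \<theta> \<theta>' h) \<le> KE \<theta> \<theta>' \<and> KE \<theta> \<theta>' \<le> ennreal (double_int \<theta> \<theta>' h) + ennreal e" if e: "0 < e" for e
  proof -
    \<comment> \<open>The tolerance \<open>e / M\<close> compensates the mass bound in the outer
      integration.\<close>
    obtain h where h: "h \<in> minorants K" "\<And>\<theta> x. \<theta> \<in> ?k \<Longrightarrow> x \<in> S \<Longrightarrow> (\<integral>\<^sup>+y. K (x, y) \<partial>\<theta>) \<le> ennreal (section_int \<theta> h x) + ennreal (e / M)"
      using h[of "e / M"] e M by auto
    have hC: "h \<in> Ccp" using h by (simp add: minorants_def)
    show ?thesis
    proof (intro bexI ballI conjI)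
      show "h \<in> Ccp" by (rule hC)
      fix \<theta> \<theta>' assume k: "\<theta> \<in> ?k" "\<theta>' \<in> ?k"
      show "ennreal (double_int \<theta> \<theta>' h) \<le> KE \<theta> \<theta>'"
        unfolding KE_def double_int_SUP[OF K_lsc r[OF k(1)] r[OF k(2)]] using h by (intro SUP_upper)
      have "KE \<theta> \<theta>' \<le> (\<integral>\<^sup>+x. ennreal (section_int \<theta>' h x) + ennreal (e / M) \<partial>\<theta>)"
        unfolding KE_def
      proof (rule nn_integral_mono_AE)
        show "AE x in \<theta>. (\<integral>\<^sup>+y. K (x, y) \<partial>\<theta>') \<le> ennreal (section_int \<theta>' h x) + ennreal (e / M)"
          using kclass_AE[OF k(1) S] by eventually_elim (use h k in auto)
      qed
      also have "\<dots> = (\<integral>\<^sup>+x. ennreal (section_int \<theta>' h x) \<partial>\<theta>) + (\<integral>\<^sup>+x. ennreal (e / M) \<partial>\<theta>)"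
        using r k hC by (intro nn_integral_add) (auto simp: radon_borel_measurable intro!: lsc_measurable Ccp_lsc section_int_Ccp)
      also have "(\<integral>\<^sup>+x. ennreal (section_int \<theta>' h x) \<partial>\<theta>) = ennreal (double_int \<theta> \<theta>' h)"
        unfolding double_int_def using r k hC by (intro Ccp_nn_integral section_int_Ccp)
      also have "(\<integral>\<^sup>+x. ennreal (e / M) \<partial>\<theta>) = ennreal (e / M) * emeasure \<theta> UNIV" using r k by simp
      also have "\<dots> \<le> ennreal (e / M) * ennreal M" using M k by (intro mult_left_mono) auto
      also have "\<dots> = ennreal e" using M e by (simp flip: ennreal_mult)
      finally show "KE \<theta> \<theta>' \<le> ennreal (double_int \<theta> \<theta>' h) + ennreal e" by (simp add: add_left_mono)
    qed
  qed
  show ?thesis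
    unfolding approx_class_def
  proof (intro conjI allI impI)
    \<comment> \<open>Tolerance 1 already shows that all self-energies on the class are
      finite.\<close>
    obtain h where h1: "\<And>\<theta>. \<theta> \<in> ?k \<Longrightarrow> KE \<theta> \<theta> \<le> ennreal (double_int \<theta> \<theta> h) + ennreal 1" using ex[OF zero_less_one] by blast
    have "KE \<theta> \<theta> < top" if "\<theta> \<in> ?k" for \<theta>
      using h1[OF that] by (rule le_less_trans) simp
    then show "?k \<subseteq> fin_energy" using r by (auto simp: fin_energy_def)
    fix e :: real assume e: "0 < e"
    then obtain h where h: "h \<in> Ccp" "\<And>\<theta> \<theta>'. \<theta> \<in> ?k \<Longrightarrow> \<theta>' \<in> ?k \<Longrightarrow> ennreal (double_int \<theta> \<theta>' h) \<le> KE \<theta> \<theta>' \<and> KE \<theta> \<theta>' \<le> ennreal (double_int \<theta> \<theta>' h) + ennreal e"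
      using ex by meson
    have "\<bar>enn2real (KE \<theta> \<theta>') - double_int \<theta> \<theta>' h\<bar> \<le> e" if "\<theta> \<in> ?k" "\<theta>' \<in> ?k" for \<theta> \<theta>'
    proof -
      define p where "p = double_int \<theta> \<theta>' h"
      have "0 \<le> p" unfolding p_def double_int_def using that r h by (intro Ccp_integral_nonneg section_int_Ccp)
      then have p: "ennreal (double_int \<theta> \<theta>' h) = ennreal p" "0 \<le> p" by (auto simp: p_def)
      have "KE \<theta> \<theta>' < top" using h(2)[OF that] by (auto intro: le_less_trans)
      then obtain q where q: "KE \<theta> \<theta>' = ennreal q" "0 \<le> q" by (metis ennreal_cases less_irrefl)
      have "p \<le> q" "q \<le> p + e" using h(2)[OF that] p q e by (auto simp flip: ennreal_plus)
      then show ?thesis using q by (simp add: p_def[symmetric])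
    qed
    then show "\<exists>h\<in>Cc. \<forall>\<theta>\<in>?k. \<forall>\<theta>'\<in>?k. \<bar>enn2real (KE \<theta> \<theta>') - double_int \<theta> \<theta>' h\<bar> \<le> e"
      using CcpD(1)[OF h(1)] by blast
  qed
qed

text \<open>Dini's theorem for the potential of \<open>\<xi>\<close> gives one minorant
  \<open>h\<close> for which the integral of \<open>K - h\<close> against \<open>\<xi>\<close> is at
  most \<open>e\<close> at every point of \<open>S\<close>. Since \<open>K - h\<close> is
  nonnegative and \<open>\<theta> \<le> \<xi>\<close>, the same bound holds for all
  \<open>\<theta>\<close> in the class.\<close>

lemma approx_constrained:
  assumes S: "compact S" and g: "continuous_on UNIV g" "\<And>x. 0 < g x" and a: "0 \<le> a" and \<xi>: "\<xi> \<in> radon"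
    and pot: "fin_continuous_on S (potential \<kappa> \<xi>)"
  shows "approx_class (kclass S g a True \<xi>)"
proof -
  obtain M where M: "0 < M" "\<And>\<theta> b \<xi>. \<theta> \<in> kclass S g a b \<xi> \<Longrightarrow> emeasure \<theta> UNIV \<le> ennreal M"
    using kclass_mass[OF S g a] by metis
  define V where "V x = (\<integral>\<^sup>+y. K (x, y) \<partial>\<xi>)" for x
  \<comment> \<open>On \<open>S\<close> this is the real-valued potential of \<open>\<xi>\<close>
    for the shifted kernel. It differs from the given potential by the constant
    \<open>c * m \<xi>\<close>, so it is continuous there.\<close>
  define v where "v x = enn2real (V x)" for x
  have Vv: "V x = ennreal (v x)" "v x = real_of_ereal (potential \<kappa> \<xi> x) + c * m \<xi>" "0 \<le> v x" if "x \<in> S" for x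
  proof -
    have "\<bar>potential \<kappa> \<xi> x\<bar> \<noteq> \<infinity>" using pot that by (auto simp: fin_continuous_on_def)
    then have "V x \<noteq> top" unfolding potential_eq[OF \<xi>] V_def[symmetric] by auto
    then show "V x = ennreal (v x)" by (simp add: v_def less_top)
    then show "v x = real_of_ereal (potential \<kappa> \<xi> x) + c * m \<xi>"
      unfolding potential_eq[OF \<xi>] V_def[symmetric] by (cases "V x") (auto simp: v_def)
  qed (simp add: v_def)
  have "continuous_on S (\<lambda>x. real_of_ereal (potential \<kappa> \<xi> x) + c * m \<xi>)"
    using fin_continuous_on_real[OF pot] by (intro continuous_on_add continuous_on_const)
  then have vc: "continuous_on S v" by (rule continuous_on_eq) (simp add: Vv)
  have dir: "directed_fn (section_int \<xi> ` minorants K)"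
  proof (rule directed_minorants_image)
    fix \<phi> \<psi> assume "\<phi> \<in> minorants K" "\<psi> \<in> minorants K" "\<phi> \<le> \<psi>"
    then show "section_int \<xi> \<phi> \<le> section_int \<xi> \<psi>"
      unfolding section_int_def using \<xi>
      by (auto simp: le_fun_def minorants_def intro!: integral_mono Cc_integrable Cc_section dest: CcpD)
  qed
  show ?thesis
  proof (rule approx_from[OF S M])
    fix e :: real assume e: "0 < e"
    have "\<exists>h\<in>section_int \<xi> ` minorants K. \<forall>x\<in>S. v x - e < h x"
    proof (rule dini[OF S vc dir])
      show "continuous_on S h" if "h \<in> section_int \<xi> ` minorants K" for h
        using that \<xi> by (auto simp: minorants_def intro!: continuous_on_subset[OF CcD_cont[OF section_int_Cc]] dest: CcpD)
      fix x d assume x: "x \<in> S" and d: "0 < (d::real)"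
      show "\<exists>h\<in>section_int \<xi> ` minorants K. v x - d < h x"
      proof (rule ccontr)
        \<comment> \<open>Otherwise all section integrals of minorants stay below
          \<open>v x - d\<close>, and so does their supremum, which is \<open>v x\<close>.\<close>
        assume "\<not> ?thesis"
        then have le: "section_int \<xi> h x \<le> v x - d" if "h \<in> minorants K" for h using that by (auto simp: not_less)
        have "0 \<le> v x - d" using le[OF minorants_zero] by (simp add: section_int_def)
        moreover have "V x \<le> ennreal (v x - d)"
          unfolding V_def lsc_section_integral[OF K_lsc \<xi>] using le by (intro SUP_least ennreal_leI)
        ultimately show False using d Vv[OF x] by simp
      qed
    qed (rule e)
    then obtain h where h: "h \<in> minorants K" "\<And>x. x \<in> S \<Longrightarrow> v x - e < section_int \<xi> h x" by auto
    have hC: "h \<in> Ccp" using h by (simp add: minorants_def)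
    show "\<exists>h\<in>minorants K. \<forall>\<theta>\<in>kclass S g a True \<xi>. \<forall>x\<in>S. (\<integral>\<^sup>+y. K (x, y) \<partial>\<theta>) \<le> ennreal (section_int \<theta> h x) + ennreal e"
    proof (intro bexI[OF _ h(1)] ballI)
      fix \<theta> x assume k: "\<theta> \<in> kclass S g a True \<xi>" and x: "x \<in> S"
      then have \<theta>: "\<theta> \<in> radon" "\<theta> \<le> \<xi>" by (auto simp: kclass_def)
      define k where "k y = K (x, y) - ennreal (h (x, y))" for y
      have Kk: "K (x, y) = ennreal (h (x, y)) + k y" for y
        using h(1) by (auto simp: k_def minorants_def add_diff_inverse_ennreal)
      have hm: "(\<lambda>y. ennreal (h (x, y))) \<in> borel_measurable borel"
        using hC by (intro lsc_measurable Ccp_lsc Ccp_section)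
      have km: "k \<in> borel_measurable borel"
        unfolding k_def[abs_def] using hm lsc_measurable[OF K_section_lsc] by (intro borel_measurable_minus_ennreal)
      have split: "(\<integral>\<^sup>+y. K (x, y) \<partial>\<mu>) = ennreal (section_int \<mu> h x) + (\<integral>\<^sup>+y. k y \<partial>\<mu>)" if \<mu>: "\<mu> \<in> radon" for \<mu>
        unfolding Kk section_int_def using \<mu> hm km hC
        by (subst nn_integral_add) (auto simp: radon_borel_measurable Ccp_nn_integral Ccp_section)
      have "ennreal (section_int \<xi> h x) + (\<integral>\<^sup>+y. k y \<partial>\<xi>) = ennreal (v x)"
        using split[OF \<xi>] Vv[OF x] by (simp add: V_def)
      also have "\<dots> \<le> ennreal (section_int \<xi> h x + e)" using h(2)[OF x] by (intro ennreal_leI) simp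
      also have "\<dots> = ennreal (section_int \<xi> h x) + ennreal e"
        using e hC \<xi> by (intro ennreal_plus) (auto simp: section_int_def intro!: Ccp_integral_nonneg Ccp_section)
      finally have "(\<integral>\<^sup>+y. k y \<partial>\<xi>) \<le> ennreal e" by (simp add: ennreal_add_left_cancel_le)
      moreover have "(\<integral>\<^sup>+y. k y \<partial>\<theta>) \<le> (\<integral>\<^sup>+y. k y \<partial>\<xi>)" using \<theta> \<xi> by (intro radon_nn_integral_mono)
      ultimately show "(\<integral>\<^sup>+y. K (x, y) \<partial>\<theta>) \<le> ennreal (section_int \<theta> h x) + ennreal e"
        unfolding split[OF \<theta>(1)] by (intro add_left_mono) auto
    qed
  qed
qed

text \<open>Here Dini's theorem applies to the kernel itself on \<open>S \<times> S\<close>. It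
  gives \<open>K\<close> at most \<open>h + e / M\<close> there, and members of the class have mass
  at most \<open>M\<close>.\<close>

lemma approx_free:
  assumes S: "compact S" and g: "continuous_on UNIV g" "\<And>x. 0 < g x" and a: "0 \<le> a"
    and ker: "fin_continuous_on (S \<times> S) \<kappa>"
  shows "approx_class (kclass S g a False \<xi>)"
proof -
  interpret P: lch "TYPE('b \<times> 'b)" by (rule prod_lch[OF is_lch])
  obtain M where M: "0 < M" "\<And>\<theta> b \<xi>. \<theta> \<in> kclass S g a b \<xi> \<Longrightarrow> emeasure \<theta> UNIV \<le> ennreal M"
    using kclass_mass[OF S g a] by metis
  define v where "v z = real_of_ereal (\<kappa> z) + c" for z
  have Kv: "K z = ennreal (v z)" "0 \<le> v z" if "z \<in> S \<times> S" for z
  proof -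
    have "\<bar>\<kappa> z\<bar> \<noteq> \<infinity>" 
      using ker[unfolded fin_continuous_on_def, THEN conjunct2] that by (rule bspec)
    then obtain r where r: "\<kappa> z = ereal r" by auto
    then show "K z = ennreal (v z)" "0 \<le> v z" using c(2)[of z] by (auto simp: K_def v_def)
  qed
  have "continuous_on (S \<times> S) (\<lambda>z. real_of_ereal (\<kappa> z) + c)"
    using fin_continuous_on_real[OF ker] by (intro continuous_on_add continuous_on_const)
  then have vc: "continuous_on (S \<times> S) v" by (simp add: v_def[abs_def])
  have dir: "directed_fn (minorants K)"
    using directed_minorants_image[of K "\<lambda>h. h"] by simp
  show ?thesis
  proof (rule approx_from[OF S M])
    fix e :: real assume e: "0 < e"
    have "\<exists>h\<in>minorants K. \<forall>z\<in>S \<times> S. v z - e / M < h z"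
    proof (rule dini[OF compact_Times[OF S S] vc dir])
      show "continuous_on (S \<times> S) h" if "h \<in> minorants K" for h
        using that by (auto simp: minorants_def intro: continuous_on_subset[OF CcD_cont[OF CcpD(1)]])
      fix z d assume z: "z \<in> S \<times> S" and d: "0 < (d::real)"
      show "\<exists>h\<in>minorants K. v z - d < h z"
      proof (rule ccontr)
        assume "\<not> ?thesis"
        then have le: "h z \<le> v z - d" if "h \<in> minorants K" for h using that by (auto simp: not_less)
        have "0 \<le> v z - d" using le[OF minorants_zero] by simp
        moreover have "K z \<le> ennreal (v z - d)"
          unfolding P.lsc_eq_SUP[OF K_lsc, of z] using le by (intro SUP_least ennreal_leI)
        ultimately show False using d Kv[OF z] by simp
      qed
    qed (use e M in simp)
    then obtain h where h: "h \<in> minorants K" "\<And>z. z \<in> S \<times> S \<Longrightarrow> v z - e / M < h z" by auto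
    have hC: "h \<in> Ccp" using h by (simp add: minorants_def)
    show "\<exists>h\<in>minorants K. \<forall>\<theta>\<in>kclass S g a False \<xi>. \<forall>x\<in>S. (\<integral>\<^sup>+y. K (x, y) \<partial>\<theta>) \<le> ennreal (section_int \<theta> h x) + ennreal e"
    proof (intro bexI[OF _ h(1)] ballI)
      fix \<theta> x assume k: "\<theta> \<in> kclass S g a False \<xi>" and x: "x \<in> S"
      then have \<theta>: "\<theta> \<in> radon" by (auto simp: kclass_def)
      have hm: "(\<lambda>y. ennreal (h (x, y))) \<in> borel_measurable borel"
        using hC by (intro lsc_measurable Ccp_lsc Ccp_section)
      have "(\<integral>\<^sup>+y. K (x, y) \<partial>\<theta>) \<le> (\<integral>\<^sup>+y. ennreal (h (x, y)) + ennreal (e / M) \<partial>\<theta>)"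
      proof (rule nn_integral_mono_AE)
        show "AE y in \<theta>. K (x, y) \<le> ennreal (h (x, y)) + ennreal (e / M)"
          using kclass_AE[OF k S]
        proof eventually_elim
          case (elim y)
          then have z: "(x, y) \<in> S \<times> S" using x by simp
          have "K (x, y) \<le> ennreal (h (x, y) + e / M)" unfolding Kv(1)[OF z] using h(2)[OF z] by (intro ennreal_leI) simp
          also have "\<dots> = ennreal (h (x, y)) + ennreal (e / M)" using e M hC by (intro ennreal_plus) (auto dest: CcpD)
          finally show ?case .
        qed
      qed
      also have "\<dots> = ennreal (section_int \<theta> h x) + ennreal (e / M) * emeasure \<theta> UNIV"
        using \<theta> hm hC unfolding section_int_def by (subst nn_integral_add) (auto simp: radon_borel_measurable Ccp_nn_integral Ccp_section)
      also have "\<dots> \<le> ennreal (section_int \<theta> h x) + ennreal (e / M) * ennreal M"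
        using M k by (intro add_left_mono mult_left_mono) auto
      also have "\<dots> = ennreal (section_int \<theta> h x) + ennreal e" using M e by (simp flip: ennreal_mult)
      finally show "(\<integral>\<^sup>+y. K (x, y) \<partial>\<theta>) \<le> ennreal (section_int \<theta> h x) + ennreal e" .
    qed
  qed
qed

end

section \<open>Minimizing Gauss functionals over a compact convex class\<close>

text \<open>External energies may be infinite, so lower semicontinuity of a sum is reduced to real
  thresholds for the two summands.\<close>

lemma ereal_less_add_split:
  fixes a b e :: ereal
  assumes "e < a + b" "a \<noteq> -\<infinity>" "b \<noteq> -\<infinity>"
  obtains r s :: real where "ereal r < a" "ereal s < b" "e \<le> ereal r + ereal s"
proof (cases e)
  case PInf
  then show ?thesis using assms by simp
next
  case MInf
  obtain r s where "ereal r < a" "ereal s < b"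
    using assms(2,3) ereal_dense2[of "-\<infinity>" a] ereal_dense2[of "-\<infinity>" b] by auto
  then show ?thesis using that MInf by simp
next
  case (real q)
  show ?thesis
  proof (cases a)
    case (real x)
    show ?thesis
    proof (cases b)
      case (real y)
      have "q < x + y" using assms \<open>e = ereal q\<close> \<open>a = ereal x\<close> real by simp
      \<comment> \<open>Each summand gives up half of the slack.\<close>
      then show ?thesis using that[of "x - (x + y - q) / 2" "y - (x + y - q) / 2"] \<open>e = ereal q\<close> \<open>a = ereal x\<close> real
        by (simp add: field_simps)
    next
      case PInf
      then show ?thesis using that[of "x - 1" "q - x + 1"] \<open>e = ereal q\<close> \<open>a = ereal x\<close> by simp
    qed (use assms in simp)
  next
    case PInf
    show ?thesis
    proof (cases b)
      case (real y)
      then show ?thesis using that[of "q - y + 1" "y - 1"] \<open>e = ereal q\<close> \<open>a = \<infinity>\<close> by simp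
    next
      case PInf
      then show ?thesis using that[of q 0] \<open>e = ereal q\<close> \<open>a = \<infinity>\<close> by simp
    qed (use assms in simp)
  qed (use assms in simp)
qed

text \<open>In other words, \<open>l\<close> is at most the limes inferior of \<open>u\<close> along
  \<open>F\<close>. Excluding minus infinity keeps sums of such limits meaningful.\<close>

definition lsc_along :: "'t filter \<Rightarrow> ('t \<Rightarrow> ereal) \<Rightarrow> ereal \<Rightarrow> bool" where
  "lsc_along F u l \<longleftrightarrow> l \<noteq> -\<infinity> \<and> (\<forall>e<l. \<forall>\<^sub>F t in F. e < u t)"

lemma lsc_along_add:
  assumes "lsc_along F u l" "lsc_along F v k" shows "lsc_along F (\<lambda>t. u t + v t) (l + k)"
  unfolding lsc_along_def
proof (intro conjI allI impI)
  show "l + k \<noteq> -\<infinity>" using assms by (auto simp: lsc_along_def)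
  fix e assume "e < l + k"
  then obtain r s :: real where rs: "ereal r < l" "ereal s < k" "e \<le> ereal r + ereal s"
    using ereal_less_add_split assms unfolding lsc_along_def by metis
  have "\<forall>\<^sub>F t in F. ereal r < u t" "\<forall>\<^sub>F t in F. ereal s < v t" using rs assms by (auto simp: lsc_along_def)
  then show "\<forall>\<^sub>F t in F. e < u t + v t"
  proof eventually_elim
    case (elim t)
    have "ereal r + ereal s < u t + v t"
      using elim by (cases "u t"; cases "v t") auto
    then show ?case using rs by simp
  qed
qed

lemma lsc_along_tendsto:
  assumes "(u \<longlongrightarrow> l) F" shows "lsc_along F (\<lambda>t. ereal (u t)) (ereal l)"
  unfolding lsc_along_def
proof (intro conjI allI impI)
  fix e assume "e < ereal l"
  moreover have "((\<lambda>t. ereal (u t)) \<longlongrightarrow> ereal l) F" using assms by (intro tendsto_intros)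
  ultimately show "\<forall>\<^sub>F t in F. e < ereal (u t)" using order_tendstoD(1) by blast
qed simp

lemma lsc_along_sum:
  assumes "finite I" "\<And>i. i \<in> I \<Longrightarrow> lsc_along F (u i) (l i)"
  shows "lsc_along F (\<lambda>t. \<Sum>i\<in>I. u i t) (\<Sum>i\<in>I. l i)"
  using assms
proof (induction I rule: finite_induct)
  case empty
  then show ?case using lsc_along_tendsto[of "\<lambda>_. 0" 0 F] by (simp add: zero_ereal_def)
next
  case (insert i I)
  then show ?case by (simp add: lsc_along_add)
qed

lemma continuous_map_nhdsin:
  fixes f :: "'a \<Rightarrow> real"
  assumes "continuous_map X euclideanreal f" "x \<in> topspace X"
  shows "(f \<longlongrightarrow> f x) (nhdsin X x)"
proof (rule topological_tendstoI)
  fix S :: "real set" assume S: "open S" "f x \<in> S"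
  have "openin X {y\<in>topspace X. f y \<in> S}"
    using assms(1) S by (intro openin_continuous_map_preimage) auto
  then show "\<forall>\<^sub>F y in nhdsin X x. f y \<in> S"
    unfolding eventually_nhdsin using assms(2) S by (intro disjI2 exI[of _ "{y\<in>topspace X. f y \<in> S}"]) auto
qed

lemma openin_lsc:
  assumes "\<And>x. x \<in> topspace X \<Longrightarrow> lsc_along (nhdsin X x) u (u x)"
  shows "openin X {x\<in>topspace X. e < u x}"
proof (subst openin_subopen, intro ballI)
  fix x assume x: "x \<in> {x\<in>topspace X. e < u x}"
  then have "\<forall>\<^sub>F y in nhdsin X x. e < u y" using assms unfolding lsc_along_def by blast
  then obtain S where S: "openin X S" "x \<in> S" "\<forall>y\<in>S. e < u y" using x by (auto simp: eventually_nhdsin)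
  then show "\<exists>S. openin X S \<and> x \<in> S \<and> S \<subseteq> {x\<in>topspace X. e < u x}"
    using openin_subset[OF S(1)] by blast
qed

text \<open>If the infimum were not attained, thresholds strictly between it and the values would
  give an open cover by superlevel sets. The least threshold of a finite subcover would be a lower
  bound above the infimum.\<close>

lemma lsc_attains_inf:
  fixes u :: "'a \<Rightarrow> ereal"
  assumes c: "compact_space X" and ne: "topspace X \<noteq> {}" and o: "\<And>e. openin X {x\<in>topspace X. e < u x}"
  shows "\<exists>x\<in>topspace X. u x = (INF y\<in>topspace X. u y)"
proof (rule ccontr)
  assume "\<not> ?thesis"
  then have "(INF y\<in>topspace X. u y) < u x" if "x \<in> topspace X" for x
    using INF_lower[OF that, of u] that by (metis order_le_imp_less_or_eq)
  then have "\<forall>x\<in>topspace X. \<exists>e. (INF y\<in>topspace X. u y) < e \<and> e < u x"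
    using dense by blast
  from bchoice[OF this] obtain e
    where e: "\<And>x. x \<in> topspace X \<Longrightarrow> (INF y\<in>topspace X. u y) < e x" "\<And>x. x \<in> topspace X \<Longrightarrow> e x < u x" by blast
  define Ue where "Ue x = {y\<in>topspace X. e x < u y}" for x
  have "topspace X \<subseteq> \<Union>(Ue ` topspace X)" using e(2) by (auto simp: Ue_def)
  moreover have "\<And>U. U \<in> Ue ` topspace X \<Longrightarrow> openin X U" using o by (auto simp: Ue_def)
  moreover have "compactin X (topspace X)" using c by (simp add: compact_space_def)
  ultimately have "\<exists>\<F>. finite \<F> \<and> \<F> \<subseteq> Ue ` topspace X \<and> topspace X \<subseteq> \<Union>\<F>"
    by (intro compactinD)
  then obtain \<F> where F: "finite \<F>" "\<F> \<subseteq> Ue ` topspace X" "topspace X \<subseteq> \<Union>\<F>" by blast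
  obtain C where C: "C \<subseteq> topspace X" "finite C" "\<F> = Ue ` C"
    using finite_subset_image[OF F(1,2)] by blast
  have "C \<noteq> {}" using F C ne by auto
  have "Min (e ` C) \<le> (INF y\<in>topspace X. u y)"
  proof (rule INF_greatest)
    fix y assume "y \<in> topspace X"
    then obtain x where "x \<in> C" "e x < u y" using F(3) unfolding C(3) Ue_def by blast
    then show "Min (e ` C) \<le> u y" using C by (meson Min_le finite_imageI imageI less_imp_le order_trans)
  qed
  moreover have "Min (e ` C) \<in> e ` C" using C \<open>C \<noteq> {}\<close> by (intro Min_in) auto
  ultimately show False using e(1) C by (auto simp: not_le[symmetric])
qed

text \<open>Directedness makes the tails of the net a filter base, so the infimum of principal
  filters can be tested on a single tail.\<close>

lemma eventually_net_filter:
  assumes "directed_set T le"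
  shows "eventually P (net_filter T le) \<longleftrightarrow> (\<exists>t\<in>T. \<forall>s\<in>T. le t s \<longrightarrow> P s)"
proof -
  have d: "T \<noteq> {}" "\<And>r s. r \<in> T \<Longrightarrow> s \<in> T \<Longrightarrow> \<exists>t\<in>T. le r t \<and> le s t"
    "\<And>r s t. r \<in> T \<Longrightarrow> s \<in> T \<Longrightarrow> t \<in> T \<Longrightarrow> le r s \<Longrightarrow> le s t \<Longrightarrow> le r t"
    using assms unfolding directed_set_def by blast+
  have "eventually P (net_filter T le) \<longleftrightarrow> (\<exists>t\<in>T. eventually P (principal {s \<in> T. le t s}))"
    unfolding net_filter_def
  proof (rule eventually_INF_base)
    fix r s assume rs: "r \<in> T" "s \<in> T"
    then obtain t where t: "t \<in> T" "le r t" "le s t" using d(2) by blast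
    have "{x \<in> T. le t x} \<subseteq> {x \<in> T. le r x} \<inter> {x \<in> T. le s x}"
      using d(3)[OF rs(1) t(1) _ t(2)] d(3)[OF rs(2) t(1) _ t(3)] by blast
    then show "\<exists>t\<in>T. principal {x \<in> T. le t x} \<le> inf (principal {x \<in> T. le r x}) (principal {x \<in> T. le s x})"
      using t(1) by (intro bexI[of _ t]) simp_all
  qed (rule d(1))
  then show ?thesis by (auto simp: eventually_principal)
qed

definition radon_mid :: "'a::t2_space measure \<Rightarrow> 'a measure \<Rightarrow> 'a measure" where
  "radon_mid \<mu> \<nu> = radon_lincomb UNIV (\<lambda>_. 1/2) (\<lambda>b. if b then \<mu> else \<nu>)"

text \<open>A test function with different integrals separates two measures. The compact product
  class is therefore closed, which keeps cluster points inside it.\<close>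

lemma (in lch) Hausdorff_vague: "Hausdorff_space (vague_topology :: 'b measure topology)"
  unfolding Hausdorff_space_def
proof (intro allI impI, elim conjE)
  fix \<mu> \<nu> :: "'b measure" assume "\<mu> \<in> topspace vague_topology" "\<nu> \<in> topspace vague_topology" "\<mu> \<noteq> \<nu>"
  then obtain \<phi> where \<phi>: "\<phi> \<in> Ccp" "(\<integral>x. \<phi> x \<partial>\<mu>) \<noteq> (\<integral>x. \<phi> x \<partial>\<nu>)" and r: "\<mu> \<in> radon" "\<nu> \<in> radon"
    using radon_eqI[of \<mu> \<nu>] by auto
  then obtain U V where UV: "open U" "open V" "(\<integral>x. \<phi> x \<partial>\<mu>) \<in> U" "(\<integral>x. \<phi> x \<partial>\<nu>) \<in> V" "U \<inter> V = {}"
    by (metis hausdorff)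
  let ?p = "\<lambda>W. {\<mu>\<in>topspace vague_topology. (\<integral>x. \<phi> x \<partial>\<mu>) \<in> W}"
  have "openin vague_topology (?p W)" if "open W" for W
    by (rule openin_continuous_map_preimage[OF continuous_map_vague[OF CcpD(1)[OF \<phi>(1)]]]) (use that in simp)
  then have "openin vague_topology (?p U)" "openin vague_topology (?p V)" using UV by blast+
  then show "\<exists>U V. openin vague_topology U \<and> openin vague_topology V \<and> \<mu> \<in> U \<and> \<nu> \<in> V \<and> disjnt U V"
    using UV r by (intro exI[of _ "?p U"] exI[of _ "?p V"]) (auto simp: disjnt_def)
qed

section \<open>The Gauss problem over a product of compact convex classes\<close>

text \<open>Isolates what the minimization uses of the classes and of the external energies, so that
  both cases of external fields are treated at once. In \<open>\<Phi>_lsc\<close> the filter lives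
  on vector measures, the type of the neighbourhood filters in \<open>G_ext_lsc\<close>.\<close>

locale gauss = kernel_space T \<kappa> c for T :: "'b::t2_space itself" and \<kappa> c +
  fixes I :: "'i set" and k :: "'i \<Rightarrow> 'b measure set" and s :: "'i \<Rightarrow> real" and \<Phi> :: "'i \<Rightarrow> 'b measure \<Rightarrow> ereal"
  assumes fin_I: "finite I"
    and k_approx: "\<And>i. i \<in> I \<Longrightarrow> approx_class (k i)"
    and k_compact: "\<And>i. i \<in> I \<Longrightarrow> compactin vague_topology (k i)"
    and k_radon_mid: "\<And>i \<mu> \<nu>. i \<in> I \<Longrightarrow> \<mu> \<in> k i \<Longrightarrow> \<nu> \<in> k i \<Longrightarrow> radon_mid \<mu> \<nu> \<in> k i"
    and \<Phi>_lsc: "\<And>i (F :: ('i \<Rightarrow> 'b measure) filter) \<theta> \<theta>'. i \<in> I \<Longrightarrow> \<forall>\<^sub>F t in F. \<theta> t \<in> k i \<Longrightarrow> \<theta>' \<in> k i \<Longrightarrow>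
        (\<And>\<phi>. \<phi> \<in> Cc \<Longrightarrow> ((\<lambda>t. \<integral>x. \<phi> x \<partial>\<theta> t) \<longlongrightarrow> (\<integral>x. \<phi> x \<partial>\<theta>')) F) \<Longrightarrow> lsc_along F (\<lambda>t. \<Phi> i (\<theta> t)) (\<Phi> i \<theta>')"
    and \<Phi>_radon_mid: "\<And>i \<mu> \<nu>. i \<in> I \<Longrightarrow> \<mu> \<in> k i \<Longrightarrow> \<nu> \<in> k i \<Longrightarrow> \<bar>\<Phi> i \<mu>\<bar> \<noteq> \<infinity> \<Longrightarrow> \<bar>\<Phi> i \<nu>\<bar> \<noteq> \<infinity> \<Longrightarrow>
        \<Phi> i (radon_mid \<mu> \<nu>) = ereal ((real_of_ereal (\<Phi> i \<mu>) + real_of_ereal (\<Phi> i \<nu>)) / 2)"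
begin

definition class_prod :: "('i \<Rightarrow> 'b measure) set" where "class_prod = (\<Pi>\<^sub>E i\<in>I. k i)"
definition feasible :: "('i \<Rightarrow> 'b measure) set" where "feasible = {\<mu>\<in>class_prod. \<forall>i\<in>I. \<bar>\<Phi> i (\<mu> i)\<bar> \<noteq> \<infinity>}"
definition Qform :: "('i \<Rightarrow> 'b measure) \<Rightarrow> ('i \<Rightarrow> 'b measure) \<Rightarrow> real" where
  "Qform \<mu> \<nu> = (\<Sum>i\<in>I. \<Sum>j\<in>I. s i * s j * B (\<mu> i) (\<nu> j))"
definition G :: "('i \<Rightarrow> 'b measure) \<Rightarrow> real" where
  "G \<mu> = Qform \<mu> \<mu> + 2 * (\<Sum>i\<in>I. real_of_ereal (\<Phi> i (\<mu> i)))"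
text \<open>The value infinity is kept, so that the functional is lower semicontinuous on the whole
  compact class. The factor 2 appears as a repeated summand to suit
  \<open>lsc_along_add\<close>.\<close>

definition G_ext :: "('i \<Rightarrow> 'b measure) \<Rightarrow> ereal" where
  "G_ext \<mu> = ereal (Qform \<mu> \<mu>) + ((\<Sum>i\<in>I. \<Phi> i (\<mu> i)) + (\<Sum>i\<in>I. \<Phi> i (\<mu> i)))"

lemma k_fin_energy: "i \<in> I \<Longrightarrow> \<theta> \<in> k i \<Longrightarrow> \<theta> \<in> fin_energy"
  using k_approx by (auto simp: approx_class_def)

lemma class_prod_D: "\<mu> \<in> class_prod \<Longrightarrow> i \<in> I \<Longrightarrow> \<mu> i \<in> k i" "\<mu> \<in> class_prod \<Longrightarrow> i \<in> I \<Longrightarrow> \<mu> i \<in> fin_energy"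
  using k_fin_energy by (auto simp: class_prod_def PiE_iff)

text \<open>The trivial filter \<open>bot\<close> satisfies the hypotheses of
  \<open>\<Phi>_lsc\<close> and extracts the clause on minus infinity in
  \<open>lsc_along\<close>.\<close>

lemma \<Phi>_not_MInf: "i \<in> I \<Longrightarrow> \<theta> \<in> k i \<Longrightarrow> \<Phi> i \<theta> \<noteq> -\<infinity>"
  using \<Phi>_lsc[of i "\<lambda>_. \<theta>" bot \<theta>] by (auto simp: lsc_along_def)

lemma G_ext_feasible: "\<mu> \<in> feasible \<Longrightarrow> G_ext \<mu> = ereal (G \<mu>)"
proof -
  assume "\<mu> \<in> feasible"
  then have "\<Phi> i (\<mu> i) = ereal (real_of_ereal (\<Phi> i (\<mu> i)))" if "i \<in> I" for i
    using that by (simp add: feasible_def ereal_real)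
  then have "(\<Sum>i\<in>I. \<Phi> i (\<mu> i)) = ereal (\<Sum>i\<in>I. real_of_ereal (\<Phi> i (\<mu> i)))"
    by (simp flip: sum_ereal)
  then show ?thesis by (simp add: G_ext_def G_def)
qed

lemma G_ext_finite: "\<mu> \<in> class_prod \<Longrightarrow> G_ext \<mu> < \<infinity> \<Longrightarrow> \<mu> \<in> feasible"
proof -
  assume \<mu>: "\<mu> \<in> class_prod" and "G_ext \<mu> < \<infinity>"
  then have "(\<Sum>i\<in>I. \<Phi> i (\<mu> i)) \<noteq> \<infinity>" by (auto simp: G_ext_def)
  then have "\<Phi> i (\<mu> i) \<noteq> \<infinity>" if "i \<in> I" for i
    using that fin_I by (auto simp: sum_Pinfty)
  then show ?thesis using \<mu> \<Phi>_not_MInf class_prod_D(1)[OF \<mu>] by (auto simp: feasible_def)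
qed

lemma class_prod_compact: "compactin (vec_vague I) class_prod"
  unfolding class_prod_def vec_vague_def using k_compact by (subst compactin_PiE) auto

lemma class_prod_closed: "closedin (vec_vague I) class_prod"
proof (rule compactin_imp_closedin[OF _ class_prod_compact])
  show "Hausdorff_space (vec_vague I :: ('i \<Rightarrow> 'b measure) topology)"
    unfolding vec_vague_def Hausdorff_space_product_topology using Hausdorff_vague by blast
qed

abbreviation XX :: "('i \<Rightarrow> 'b measure) topology" where "XX \<equiv> subtopology (vec_vague I) class_prod"

lemma topspace_Int_class_prod [simp]: "topspace (vec_vague I) \<inter> class_prod = class_prod"
  using compactin_subset_topspace[OF class_prod_compact] by blast

lemma topspace_XX: "topspace XX = class_prod"
  by simp

lemma compact_XX: "compact_space XX"
  using class_prod_compact by (simp add: compact_space_subtopology)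

text \<open>On the class the quadratic form is continuous, because vague convergence of the
  components is convergence in energy; only the external part is merely semicontinuous.\<close>

lemma G_ext_lsc: "openin XX {\<mu>\<in>topspace XX. e < G_ext \<mu>}"
proof (rule openin_lsc)
  fix \<mu> assume "\<mu> \<in> topspace XX"
  then have \<mu>: "\<mu> \<in> class_prod" by simp
  let ?F = "nhdsin XX \<mu>"
  have ev: "\<forall>\<^sub>F \<nu> in ?F. \<nu> \<in> class_prod"
    unfolding eventually_nhdsin using \<mu> openin_topspace[of XX] unfolding topspace_XX by (intro disjI2 exI[of _ class_prod]) auto
  have conv: "((\<lambda>\<nu>. \<integral>x. \<phi> x \<partial>\<nu> i) \<longlongrightarrow> (\<integral>x. \<phi> x \<partial>\<mu> i)) ?F" if "i \<in> I" "\<phi> \<in> Cc" for i \<phi>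
  proof (rule continuous_map_nhdsin)
    have "continuous_map (vec_vague I) vague_topology (\<lambda>\<nu> :: 'i \<Rightarrow> 'b measure. \<nu> i)"
      unfolding vec_vague_def by (rule continuous_map_product_projection[OF that(1)])
    then have "continuous_map (vec_vague I) euclideanreal ((\<lambda>\<mu>. \<integral>x. \<phi> x \<partial>\<mu>) \<circ> (\<lambda>\<nu> :: 'i \<Rightarrow> 'b measure. \<nu> i))"
      using continuous_map_vague[OF that(2)] by (rule continuous_map_compose)
    then show "continuous_map XX euclideanreal (\<lambda>\<nu>. \<integral>x. \<phi> x \<partial>\<nu> i)"
      by (intro continuous_map_from_subtopology) (simp add: o_def)
  qed (use \<mu> in simp)
  have evk: "\<forall>\<^sub>F \<nu> in ?F. \<nu> i \<in> k i" "\<forall>\<^sub>F \<nu> in ?F. \<nu> i \<in> fin_energy" if "i \<in> I" for i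
    using ev that by (auto elim!: eventually_mono simp: class_prod_D)
  have sqdist: "((\<lambda>\<nu>. sqdist (\<nu> i) (\<mu> i)) \<longlongrightarrow> 0) ?F" if "i \<in> I" for i
    using that \<mu> by (intro sqdist_tendsto[OF k_approx evk(1)] conv) (auto simp: class_prod_D)
  have "((\<lambda>\<nu>. Qform \<nu> \<nu>) \<longlongrightarrow> Qform \<mu> \<mu>) ?F"
    unfolding Qform_def using \<mu> by (intro tendsto_sum tendsto_mult tendsto_const B_tendsto2 evk sqdist) (auto simp: class_prod_D)
  moreover have "lsc_along ?F (\<lambda>\<nu>. \<Sum>i\<in>I. \<Phi> i (\<nu> i)) (\<Sum>i\<in>I. \<Phi> i (\<mu> i))"
    using \<mu> by (intro lsc_along_sum fin_I \<Phi>_lsc evk conv) (auto simp: class_prod_D)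
  ultimately show "lsc_along ?F G_ext (G_ext \<mu>)"
    unfolding G_ext_def by (intro lsc_along_add lsc_along_tendsto)
qed

definition inf_G :: ereal where "inf_G = (INF \<mu>\<in>feasible. ereal (G \<mu>))"
definition minimizers :: "('i \<Rightarrow> 'b measure) set" where "minimizers = {\<mu>\<in>feasible. ereal (G \<mu>) = inf_G}"

text \<open>Outside \<open>feasible\<close> the extended functional is infinite, so these points do
  not change the infimum.\<close>

lemma INF_class_prod: "feasible \<noteq> {} \<Longrightarrow> (INF \<mu>\<in>class_prod. G_ext \<mu>) = inf_G"
proof (rule antisym)
  show "(INF \<mu>\<in>class_prod. G_ext \<mu>) \<le> inf_G"
    unfolding inf_G_def by (rule INF_mono) (auto simp: feasible_def G_ext_feasible intro!: bexI)
  show "inf_G \<le> (INF \<mu>\<in>class_prod. G_ext \<mu>)"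
  proof (rule INF_greatest)
    fix \<mu> assume "\<mu> \<in> class_prod"
    show "inf_G \<le> G_ext \<mu>"
    proof (cases "G_ext \<mu> = \<infinity>")
      case False
      then have "\<mu> \<in> feasible" using G_ext_finite \<open>\<mu> \<in> class_prod\<close> by auto
      then show ?thesis unfolding inf_G_def by (subst G_ext_feasible) (auto intro: INF_lower)
    qed simp
  qed
qed

text \<open>As a sublevel set, the set of minimizers is the complement of an open superlevel set in
  the compact class; this is how its compactness is seen.\<close>

lemma minimizers_eq: "feasible \<noteq> {} \<Longrightarrow> minimizers = {\<mu>\<in>class_prod. G_ext \<mu> \<le> inf_G}"
proof -
  assume "feasible \<noteq> {}"
  then obtain \<nu> where \<nu>: "\<nu> \<in> feasible" by blast
  have "inf_G \<le> ereal (G \<nu>)" unfolding inf_G_def using \<nu> by (rule INF_lower)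
  then have "inf_G < \<infinity>" by auto
  then have "\<mu> \<in> feasible" if "\<mu> \<in> class_prod" "G_ext \<mu> \<le> inf_G" for \<mu> using that G_ext_finite[of \<mu>] \<open>inf_G < \<infinity>\<close> by (meson le_less_trans)
  moreover have "inf_G \<le> ereal (G \<mu>)" if "\<mu> \<in> feasible" for \<mu> unfolding inf_G_def using that by (rule INF_lower)
  ultimately have *: "\<mu> \<in> feasible" "G_ext \<mu> = ereal (G \<mu>)" "inf_G \<le> ereal (G \<mu>)" if "\<mu> \<in> class_prod" "G_ext \<mu> \<le> inf_G" for \<mu>
    using that G_ext_feasible by blast+
  show ?thesis
  proof (intro equalityI subsetI)
    fix \<mu> assume "\<mu> \<in> minimizers"
    then show "\<mu> \<in> {\<mu>\<in>class_prod. G_ext \<mu> \<le> inf_G}" using G_ext_feasible[of \<mu>] by (simp add: minimizers_def feasible_def)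
  next
    fix \<mu> assume "\<mu> \<in> {\<mu>\<in>class_prod. G_ext \<mu> \<le> inf_G}"
    then show "\<mu> \<in> minimizers" using *[of \<mu>] by (auto simp: minimizers_def intro: antisym)
  qed
qed

lemma minimizers_nonempty: "feasible \<noteq> {} \<Longrightarrow> minimizers \<noteq> {}"
proof -
  assume A: "feasible \<noteq> {}"
  then have "class_prod \<noteq> {}" by (auto simp: feasible_def)
  then obtain \<mu> where "\<mu> \<in> class_prod" "G_ext \<mu> = (INF y\<in>class_prod. G_ext y)"
    using lsc_attains_inf[OF compact_XX _ G_ext_lsc] by auto
  then show ?thesis using minimizers_eq[OF A] INF_class_prod[OF A] by auto
qed

lemma minimizers_compact: "feasible \<noteq> {} \<Longrightarrow> compactin (vec_vague I) minimizers"
proof -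
  assume A: "feasible \<noteq> {}"
  have "closedin XX (topspace XX - {\<mu>\<in>topspace XX. inf_G < G_ext \<mu>})" by (intro closedin_diff closedin_topspace G_ext_lsc)
  moreover have "topspace XX - {\<mu>\<in>topspace XX. inf_G < G_ext \<mu>} = minimizers" unfolding minimizers_eq[OF A] by (auto simp: not_less)
  ultimately have "compactin XX minimizers" using closedin_compact_space[OF compact_XX] by simp
  then show ?thesis by (simp add: compactin_subtopology)
qed

text \<open>The limit point stays in the closed class. If its value exceeded a threshold above the
  infimum, an open superlevel set around it would be visited arbitrarily late in the net, against
  the convergence of the values.\<close>

lemma cluster_point:
  fixes N :: "'t \<Rightarrow> 'i \<Rightarrow> 'b measure"
  assumes d: "directed_set TT le" and N: "\<And>t. t \<in> TT \<Longrightarrow> N t \<in> feasible"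
    and lim: "((\<lambda>t. ereal (G (N t))) \<longlongrightarrow> inf_G) (net_filter TT le)"
    and y: "y \<in> net_cluster_points (vec_vague I) TT le N"
  shows "y \<in> minimizers"
proof -
  obtain t0 where t0: "t0 \<in> TT" using d by (auto simp: directed_set_def)
  then have A: "feasible \<noteq> {}" using N by blast
  have yt: "y \<in> topspace (vec_vague I)"
    and yU: "\<And>U t. openin (vec_vague I) U \<Longrightarrow> y \<in> U \<Longrightarrow> t \<in> TT \<Longrightarrow> \<exists>s\<in>TT. le t s \<and> N s \<in> U"
    using y unfolding net_cluster_points_def by blast+
  have yC: "y \<in> class_prod"
  proof (rule ccontr)
    assume "y \<notin> class_prod"
    then have "openin (vec_vague I) (topspace (vec_vague I) - class_prod)" "y \<in> topspace (vec_vague I) - class_prod"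
      using class_prod_closed yt by auto
    from yU[OF this t0] N show False by (auto simp: feasible_def)
  qed
  have "G_ext y \<le> inf_G"
  proof (rule ccontr)
    assume "\<not> G_ext y \<le> inf_G"
    then obtain e where e: "inf_G < e" "e < G_ext y" using dense[of inf_G "G_ext y"] by (auto simp: not_le)
    have "\<forall>\<^sub>F t in net_filter TT le. ereal (G (N t)) < e" using order_tendstoD(2)[OF lim e(1)] .
    then obtain t where t: "t \<in> TT" "\<And>s. s \<in> TT \<Longrightarrow> le t s \<Longrightarrow> ereal (G (N s)) < e"
      unfolding eventually_net_filter[OF d] by blast
    obtain U where U: "openin (vec_vague I) U" "{\<mu>\<in>class_prod. e < G_ext \<mu>} = U \<inter> class_prod"
      using G_ext_lsc[of e] unfolding openin_subtopology by auto
    then have "y \<in> U" using yC e by blast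
    from yU[OF U(1) this t(1)] obtain s where s: "s \<in> TT" "le t s" "N s \<in> U" by blast
    then have "N s \<in> U \<inter> class_prod" using N[of s] by (auto simp: feasible_def)
    then have "e < G_ext (N s)" using U by blast
    then show False using t(2)[OF s(1,2)] G_ext_feasible[OF N[OF s(1)]] by simp
  qed
  then show ?thesis using yC minimizers_eq[OF A] by blast
qed

text \<open>\<open>B_positive\<close> is applied over the doubled index set
  \<open>I \<times> UNIV\<close>, where the Boolean selects \<open>\<mu>\<close> with sign
  \<open>s i\<close> or \<open>\<nu>\<close> with the opposite sign.\<close>

lemma Qform_diff_nonneg:
  assumes "\<mu> \<in> class_prod" "\<nu> \<in> class_prod"
  shows "0 \<le> Qform \<mu> \<mu> - Qform \<mu> \<nu> - Qform \<nu> \<mu> + Qform \<nu> \<nu>"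
proof -
  define M where "M p = (if snd p then \<mu> (fst p) else \<nu> (fst p))" for p
  define R where "R p = (if snd p then s (fst p) else - s (fst p))" for p
  have "0 \<le> (\<Sum>p\<in>I \<times> UNIV. \<Sum>q\<in>I \<times> UNIV. R p * R q * B (M p) (M q))"
    using fin_I assms by (intro B_positive) (auto simp: M_def class_prod_D)
  also have "\<dots> = (\<Sum>i\<in>I. \<Sum>b\<in>UNIV. \<Sum>j\<in>I. \<Sum>b'\<in>UNIV. R (i, b) * R (j, b') * B (M (i, b)) (M (j, b')))"
    by (simp only: sum.cartesian_product')
  also have "\<dots> = Qform \<mu> \<mu> - Qform \<mu> \<nu> - Qform \<nu> \<mu> + Qform \<nu> \<nu>"
    unfolding Qform_def by (simp add: UNIV_bool R_def M_def sum.distrib sum_subtractf sum_negf)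
  finally show ?thesis .
qed

lemma B_radon_mid:
  assumes "\<mu> \<in> fin_energy" "\<nu> \<in> fin_energy" "\<zeta> \<in> fin_energy" shows "B (radon_mid \<mu> \<nu>) \<zeta> = (B \<mu> \<zeta> + B \<nu> \<zeta>) / 2"
  unfolding radon_mid_def using assms by (subst B_radon_lincomb) (auto simp: UNIV_bool)

lemma radon_mid_fin_energy: "\<mu> \<in> fin_energy \<Longrightarrow> \<nu> \<in> fin_energy \<Longrightarrow> radon_mid \<mu> \<nu> \<in> fin_energy"
  unfolding radon_mid_def by (intro radon_lincomb_fin_energy) auto

text \<open>The witness is the componentwise midpoint, which stays in the convex class. The external
  energies are affine at midpoints and cancel in the combination on the right, leaving the
  parallelogram law for the quadratic form.\<close>

lemma parallelogram:
  assumes \<mu>: "\<mu> \<in> feasible" and \<nu>: "\<nu> \<in> feasible"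
  shows "\<exists>\<rho>\<in>feasible. Qform \<mu> \<mu> - Qform \<mu> \<nu> - Qform \<nu> \<mu> + Qform \<nu> \<nu> = 2 * G \<mu> + 2 * G \<nu> - 4 * G \<rho>"
proof -
  define \<rho> where "\<rho> = restrict (\<lambda>i. radon_mid (\<mu> i) (\<nu> i)) I"
  have C: "\<mu> \<in> class_prod" "\<nu> \<in> class_prod" using \<mu> \<nu> by (auto simp: feasible_def)
  have ph: "\<Phi> i (\<rho> i) = ereal ((real_of_ereal (\<Phi> i (\<mu> i)) + real_of_ereal (\<Phi> i (\<nu> i))) / 2)" if "i \<in> I" for i
    using that \<mu> \<nu> C by (simp add: \<rho>_def feasible_def \<Phi>_radon_mid class_prod_D)
  have "\<rho> \<in> class_prod" using C by (auto simp: \<rho>_def class_prod_def intro!: k_radon_mid)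
  then have \<rho>: "\<rho> \<in> feasible" by (simp add: feasible_def ph)
  have b: "B (\<rho> i) (\<rho> j) = (B (\<mu> i) (\<mu> j) + B (\<mu> i) (\<nu> j) + B (\<nu> i) (\<mu> j) + B (\<nu> i) (\<nu> j)) / 4"
    if ij: "i \<in> I" "j \<in> I" for i j
  proof -
    note f = class_prod_D(2)[OF C(1) ij(1)] class_prod_D(2)[OF C(2) ij(1)] class_prod_D(2)[OF C(1) ij(2)] class_prod_D(2)[OF C(2) ij(2)]
    have "B (\<rho> i) (\<rho> j) = B (radon_mid (\<mu> i) (\<nu> i)) (radon_mid (\<mu> j) (\<nu> j))" using ij by (simp add: \<rho>_def)
    also have "\<dots> = (B (\<mu> i) (radon_mid (\<mu> j) (\<nu> j)) + B (\<nu> i) (radon_mid (\<mu> j) (\<nu> j))) / 2"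
      using f by (intro B_radon_mid radon_mid_fin_energy)
    also have "\<dots> = (B (radon_mid (\<mu> j) (\<nu> j)) (\<mu> i) + B (radon_mid (\<mu> j) (\<nu> j)) (\<nu> i)) / 2"
      using f radon_mid_fin_energy by (simp add: B_sym feD)
    also have "\<dots> = (B (\<mu> i) (\<mu> j) + B (\<mu> i) (\<nu> j) + B (\<nu> i) (\<mu> j) + B (\<nu> i) (\<nu> j)) / 4"
      using f by (simp add: B_radon_mid B_sym[of "\<mu> j"] B_sym[of "\<nu> j"] feD add_divide_distrib)
    finally show ?thesis .
  qed
  have "4 * Qform \<rho> \<rho> = (\<Sum>i\<in>I. \<Sum>j\<in>I. s i * s j * (B (\<mu> i) (\<mu> j) + B (\<mu> i) (\<nu> j) + B (\<nu> i) (\<mu> j) + B (\<nu> i) (\<nu> j)))"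
    unfolding Qform_def sum_distrib_left by (intro sum.cong refl) (simp add: b)
  also have "\<dots> = Qform \<mu> \<mu> + Qform \<mu> \<nu> + Qform \<nu> \<mu> + Qform \<nu> \<nu>"
    unfolding Qform_def by (simp add: distrib_left sum.distrib)
  finally have 1: "4 * Qform \<rho> \<rho> = Qform \<mu> \<mu> + Qform \<mu> \<nu> + Qform \<nu> \<mu> + Qform \<nu> \<nu>" .
  have "(\<Sum>i\<in>I. real_of_ereal (\<Phi> i (\<rho> i))) = ((\<Sum>i\<in>I. real_of_ereal (\<Phi> i (\<mu> i))) + (\<Sum>i\<in>I. real_of_ereal (\<Phi> i (\<nu> i)))) / 2"
    by (simp add: ph sum.distrib sum_divide_distrib[symmetric])
  then show ?thesis using 1 \<rho> by (intro bexI[of _ \<rho>]) (auto simp: G_def)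
qed

text \<open>The Gauss value of the midpoint is at least the minimum \<open>G \<mu>\<close>, so the
  parallelogram law bounds the squared distance by \<open>2 * G (N t) - 2 * G \<mu>\<close>, which
  tends to 0 for every minimizer \<open>\<mu>\<close>.\<close>

lemma strong_convergence:
  assumes N: "\<And>t. t \<in> TT \<Longrightarrow> N t \<in> feasible" and d: "directed_set TT le"
    and lim: "((\<lambda>t. ereal (G (N t))) \<longlongrightarrow> inf_G) (net_filter TT le)" and \<mu>: "\<mu> \<in> minimizers"
  shows "((\<lambda>t. Qform (N t) (N t) - Qform (N t) \<mu> - Qform \<mu> (N t) + Qform \<mu> \<mu>) \<longlongrightarrow> 0) (net_filter TT le)"
proof -
  have \<mu>A: "\<mu> \<in> feasible" and G\<mu>: "inf_G = ereal (G \<mu>)" using \<mu> by (auto simp: minimizers_def)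
  have Gm: "G \<mu> \<le> G \<rho>" if "\<rho> \<in> feasible" for \<rho>
    using INF_lower[OF that, of "\<lambda>\<mu>. ereal (G \<mu>)"] G\<mu> by (simp add: inf_G_def)
  have "((\<lambda>t. G (N t)) \<longlongrightarrow> G \<mu>) (net_filter TT le)" using lim unfolding G\<mu> by simp
  then have "((\<lambda>t. 2 * G (N t) - 2 * G \<mu>) \<longlongrightarrow> 2 * G \<mu> - 2 * G \<mu>) (net_filter TT le)" by (intro tendsto_intros)
  then have lim0: "((\<lambda>t. 2 * G (N t) - 2 * G \<mu>) \<longlongrightarrow> 0) (net_filter TT le)" by simp
  show ?thesis
  proof (rule Lim_null_comparison[OF _ lim0])
    have "\<forall>t\<in>TT. norm (Qform (N t) (N t) - Qform (N t) \<mu> - Qform \<mu> (N t) + Qform \<mu> \<mu>) \<le> 2 * G (N t) - 2 * G \<mu>"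
    proof
      fix t assume "t \<in> TT"
      then have Nt: "N t \<in> feasible" by (rule N)
      obtain \<rho> where \<rho>: "\<rho> \<in> feasible" "Qform (N t) (N t) - Qform (N t) \<mu> - Qform \<mu> (N t) + Qform \<mu> \<mu> = 2 * G (N t) + 2 * G \<mu> - 4 * G \<rho>"
        using parallelogram[OF Nt \<mu>A] by blast
      have "0 \<le> Qform (N t) (N t) - Qform (N t) \<mu> - Qform \<mu> (N t) + Qform \<mu> \<mu>"
        using Nt \<mu>A by (intro Qform_diff_nonneg) (auto simp: feasible_def)
      then show "norm (Qform (N t) (N t) - Qform (N t) \<mu> - Qform \<mu> (N t) + Qform \<mu> \<mu>) \<le> 2 * G (N t) - 2 * G \<mu>"
        using \<rho>(2) Gm[OF \<rho>(1)] by simp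
    qed
    moreover obtain t0 where "t0 \<in> TT" using d by (auto simp: directed_set_def)
    ultimately show "\<forall>\<^sub>F t in net_filter TT le. norm (Qform (N t) (N t) - Qform (N t) \<mu> - Qform \<mu> (N t) + Qform \<mu> \<mu>) \<le> 2 * G (N t) - 2 * G \<mu>"
      unfolding eventually_net_filter[OF d] by blast
  qed
qed

end

section \<open>The two cases of external fields\<close>

lemma radon_mid_radon: "\<mu> \<in> radon \<Longrightarrow> \<nu> \<in> radon \<Longrightarrow> radon_mid \<mu> \<nu> \<in> radon"
  unfolding radon_mid_def by (intro radon_lincomb_radon) auto

lemma nn_integral_radon_mid:
  assumes "\<mu> \<in> radon" "\<nu> \<in> radon" "u \<in> borel_measurable borel"
  shows "(\<integral>\<^sup>+x. u x \<partial>radon_mid \<mu> \<nu>) = ennreal (1/2) * ((\<integral>\<^sup>+x. u x \<partial>\<mu>) + (\<integral>\<^sup>+x. u x \<partial>\<nu>))"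
  unfolding radon_mid_def using assms by (subst nn_integral_radon_lincomb) (auto simp: UNIV_bool distrib_left)

lemma emeasure_radon_mid:
  assumes "\<mu> \<in> radon" "\<nu> \<in> radon" "A \<in> sets borel"
  shows "emeasure (radon_mid \<mu> \<nu>) A = ennreal (1/2) * (emeasure \<mu> A + emeasure \<nu> A)"
  unfolding radon_mid_def using assms by (subst emeasure_radon_lincomb) (auto simp: UNIV_bool distrib_left)

lemma half_add: "ennreal (1/2) * (x + x) = x"
proof -
  have "ennreal (1/2) * (x + x) = (ennreal (1/2) + ennreal (1/2)) * x" by (simp add: distrib_left distrib_right)
  also have "ennreal (1/2) + ennreal (1/2) = ennreal (1/2 + 1/2)" by (rule ennreal_plus[symmetric]) auto
  finally show ?thesis by simp
qed

lemma half_ennreal: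
  assumes "0 \<le> p" "0 \<le> q" shows "ennreal (1/2) * (ennreal p + ennreal q) = ennreal ((p + q) / 2)"
proof -
  have "ennreal (1/2) * (ennreal p + ennreal q) = ennreal (1/2) * ennreal (p + q)"
    using assms by (simp only: ennreal_plus)
  also have "\<dots> = ennreal (1/2 * (p + q))" using assms by (intro ennreal_mult[symmetric]) auto
  finally show ?thesis by simp
qed

text \<open>Nullity on the complement and the value of the \<open>g\<close>-integral are preserved
  by averages, and so is an upper bound by \<open>\<xi>\<close>. This is the convexity that the
  parallelogram argument relies on.\<close>

lemma kclass_radon_mid:
  fixes S :: "'a::t2_space set"
  assumes "\<mu> \<in> kclass S g a b \<xi>" "\<nu> \<in> kclass S g a b \<xi>" "compact S" "continuous_on UNIV g" "b \<Longrightarrow> \<xi> \<in> radon"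
  shows "radon_mid \<mu> \<nu> \<in> kclass S g a b \<xi>"
proof -
  have r: "\<mu> \<in> radon" "\<nu> \<in> radon" using assms by (auto simp: kclass_def)
  have S: "- S \<in> sets borel" using assms(3) by (auto intro!: borel_open open_Compl compact_imp_closed)
  have g: "(\<lambda>x. ennreal (g x)) \<in> borel_measurable borel" using assms(4) by (intro lsc_measurable lsc_cont)
  have "radon_mid \<mu> \<nu> \<le> \<xi>" if b
  proof -
    have x: "\<xi> \<in> radon" "\<mu> \<le> \<xi>" "\<nu> \<le> \<xi>" using that assms by (auto simp: kclass_def)
    show ?thesis
    proof (subst le_measure)
      show "\<forall>A\<in>sets (radon_mid \<mu> \<nu>). emeasure (radon_mid \<mu> \<nu>) A \<le> emeasure \<xi> A"
      proof
        fix A assume "A \<in> sets (radon_mid \<mu> \<nu>)"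
        then have A: "A \<in> sets borel" using radon_mid_radon[OF r] by simp
        have "emeasure (radon_mid \<mu> \<nu>) A \<le> ennreal (1/2) * (emeasure \<xi> A + emeasure \<xi> A)"
          unfolding emeasure_radon_mid[OF r A] using r x by (intro mult_left_mono add_mono radon_emeasure_mono) auto
        then show "emeasure (radon_mid \<mu> \<nu>) A \<le> emeasure \<xi> A" by (simp only: half_add)
      qed
    qed (use radon_mid_radon[OF r] x in simp)
  qed
  moreover have "(\<integral>\<^sup>+x. ennreal (g x) \<partial>\<mu>) = ennreal a" "(\<integral>\<^sup>+x. ennreal (g x) \<partial>\<nu>) = ennreal a"
    using assms by (auto simp: kclass_def)
  then have "(\<integral>\<^sup>+x. ennreal (g x) \<partial>radon_mid \<mu> \<nu>) = ennreal a"
    by (simp only: nn_integral_radon_mid[OF r g] half_add)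
  moreover have "emeasure (radon_mid \<mu> \<nu>) (- S) = 0"
    using assms by (simp add: emeasure_radon_mid[OF r S] kclass_def)
  ultimately show ?thesis using radon_mid_radon[OF r] by (simp add: kclass_def)
qed

lemma eint_integrable:
  fixes w :: "'a \<Rightarrow> real"
  assumes "integrable M w" "AE x in M. \<psi> x = ereal (w x)"
  shows "eint M \<psi> = ereal (\<integral>x. w x \<partial>M)"
proof -
  have 1: "(\<integral>\<^sup>+x. e2ennreal (\<psi> x) \<partial>M) = (\<integral>\<^sup>+x. ennreal (w x) \<partial>M)"
    using assms(2) by (intro nn_integral_cong_AE) (auto elim!: eventually_mono)
  have 2: "(\<integral>\<^sup>+x. e2ennreal (- \<psi> x) \<partial>M) = (\<integral>\<^sup>+x. ennreal (- w x) \<partial>M)"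
    using assms(2) by (intro nn_integral_cong_AE) (auto elim!: eventually_mono)
  have "(\<integral>\<^sup>+x. ennreal (w x) \<partial>M) < top" "(\<integral>\<^sup>+x. ennreal (- w x) \<partial>M) < top"
    using integrableD[OF assms(1)] by (auto simp: less_top)
  then obtain p q where "(\<integral>\<^sup>+x. ennreal (w x) \<partial>M) = ennreal p" "0 \<le> p" "(\<integral>\<^sup>+x. ennreal (- w x) \<partial>M) = ennreal q" "0 \<le> q"
    by (metis ennreal_cases less_irrefl)
  then show ?thesis unfolding eint_def 1 2 real_lebesgue_integral_def[OF assms(1)] by simp
qed

context kernel_space
begin

lemma mass_tendsto:
  assumes C: "compact (UNIV :: 'b set)" and r: "\<forall>\<^sub>F t in F. \<theta> t \<in> radon" "\<theta>' \<in> radon"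
    and conv: "\<And>\<phi>. \<phi> \<in> Cc \<Longrightarrow> ((\<lambda>t. \<integral>x. \<phi> x \<partial>\<theta> t) \<longlongrightarrow> (\<integral>x. \<phi> x \<partial>\<theta>')) F"
  shows "((\<lambda>t. m (\<theta> t)) \<longlongrightarrow> m \<theta>') F"
proof -
  have "(\<lambda>_. 1) \<in> (Cc :: ('b \<Rightarrow> real) set)" using C by (intro CcI[of _ UNIV]) auto
  from conv[OF this] have "((\<lambda>t. measure (\<theta> t) (space (\<theta> t))) \<longlongrightarrow> m \<theta>') F" using r(2) by (simp add: m_def)
  then show ?thesis
    by (rule Lim_transform_eventually) (use r(1) in \<open>auto simp: m_def elim!: eventually_mono\<close>)
qed

text \<open>Separates the field into a lower semicontinuous nonnegative part and a multiple of the
  mass, which is vaguely continuous on a compact space.\<close>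

lemma Psi_eint:
  fixes f :: "'b \<Rightarrow> ereal"
  assumes f: "f \<in> Psi"
  obtains u d where "lsc u" "\<And>\<theta>. \<theta> \<in> radon \<Longrightarrow> eint \<theta> f = enn2ereal (\<integral>\<^sup>+x. u x \<partial>\<theta>) - ereal (d * m \<theta>)"
    "0 \<le> d" "d = 0 \<or> compact (UNIV :: 'b set)"
proof -
  obtain d where d: "0 \<le> d" "\<And>z. - ereal d \<le> f z" "d = 0 \<or> compact (UNIV :: 'b set)"
    using Psi_lower_bound[OF f] by blast
  have o: "open {z. a < f z}" for a using f by (simp add: Psi_def)
  have fm: "f \<in> borel_measurable borel" using o by (intro borel_measurableI_greater) auto
  show ?thesis
  proof (rule that[of "\<lambda>z. e2ennreal (f z + ereal d)" d])
    show "lsc (\<lambda>z. e2ennreal (f z + ereal d))" using o d(2) by (rule lsc_shift)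
    fix \<theta> :: "'b measure" assume \<theta>: "\<theta> \<in> radon"
    have "d = 0 \<or> emeasure \<theta> (space \<theta>) < top" using d(3) radon_compact[OF \<theta>, of UNIV] \<theta> by auto
    then show "eint \<theta> f = enn2ereal (\<integral>\<^sup>+x. e2ennreal (f x + ereal d) \<partial>\<theta>) - ereal (d * m \<theta>)"
      using eint_shift[of f \<theta> d] fm d \<theta> by (simp add: radon_borel_measurable m_def)
  qed (use d in auto)
qed

text \<open>The integral of \<open>u\<close> is a supremum of integrals of test functions, each of
  which converges; the subtracted mass converges whenever its coefficient is not 0.\<close>

lemma Psi_lsc_along:
  fixes f :: "'b \<Rightarrow> ereal"
  assumes f: "f \<in> Psi" and r: "\<forall>\<^sub>F t in F. \<theta> t \<in> radon" "\<theta>' \<in> radon"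
    and conv: "\<And>\<phi>. \<phi> \<in> Cc \<Longrightarrow> ((\<lambda>t. \<integral>x. \<phi> x \<partial>\<theta> t) \<longlongrightarrow> (\<integral>x. \<phi> x \<partial>\<theta>')) F"
  shows "lsc_along F (\<lambda>t. eint (\<theta> t) f) (eint \<theta>' f)"
proof -
  obtain u d where u: "lsc u" "\<And>\<theta>. \<theta> \<in> radon \<Longrightarrow> eint \<theta> f = enn2ereal (\<integral>\<^sup>+x. u x \<partial>\<theta>) - ereal (d * m \<theta>)"
    "0 \<le> d" "d = 0 \<or> compact (UNIV :: 'b set)" using Psi_eint[OF f] by metis
  have "((\<lambda>t. - (d * m (\<theta> t))) \<longlongrightarrow> - (d * m \<theta>')) F"
    using u(4) mass_tendsto[OF _ r conv] by (cases "d = 0") (auto intro!: tendsto_intros)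
  then have 1: "lsc_along F (\<lambda>t. ereal (- (d * m (\<theta> t)))) (ereal (- (d * m \<theta>')))" by (rule lsc_along_tendsto)
  have 2: "lsc_along F (\<lambda>t. enn2ereal (\<integral>\<^sup>+x. u x \<partial>\<theta> t)) (enn2ereal (\<integral>\<^sup>+x. u x \<partial>\<theta>'))"
    unfolding lsc_along_def
  proof (intro conjI allI impI)
    fix e assume e: "e < enn2ereal (\<integral>\<^sup>+x. u x \<partial>\<theta>')"
    show "\<forall>\<^sub>F t in F. e < enn2ereal (\<integral>\<^sup>+x. u x \<partial>\<theta> t)"
    \<comment> \<open>Negative thresholds are exceeded by every nonnegative integral; the others
      survive the passage through \<open>e2ennreal\<close>.\<close>
    proof (cases "e < 0")
      case True
      then show ?thesis by (intro always_eventually allI) (auto intro: less_le_trans)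
    next
      case False
      then have e0: "enn2ereal (e2ennreal e) = e" by (simp add: enn2ereal_e2ennreal)
      then have "e2ennreal e < (\<integral>\<^sup>+x. u x \<partial>\<theta>')" using e by (simp add: less_ennreal.rep_eq)
      then obtain \<phi> where \<phi>: "\<phi> \<in> minorants u" "e2ennreal e < ennreal (\<integral>x. \<phi> x \<partial>\<theta>')"
        unfolding radon_lsc_integral[OF r(2) u(1)] less_SUP_iff by blast
      have "\<phi> \<in> Cc" using \<phi> by (auto simp: minorants_def dest: CcpD)
      then have "((\<lambda>t. ennreal (\<integral>x. \<phi> x \<partial>\<theta> t)) \<longlongrightarrow> ennreal (\<integral>x. \<phi> x \<partial>\<theta>')) F" by (intro tendsto_ennrealI conv)
      then have "\<forall>\<^sub>F t in F. e2ennreal e < ennreal (\<integral>x. \<phi> x \<partial>\<theta> t)" using \<phi>(2) by (rule order_tendstoD)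
      then show ?thesis using r(1)
      proof eventually_elim
        case (elim t)
        have "ennreal (\<integral>x. \<phi> x \<partial>\<theta> t) \<le> (\<integral>\<^sup>+x. u x \<partial>\<theta> t)"
          unfolding radon_lsc_integral[OF elim(2) u(1)] using \<phi>(1) by (rule SUP_upper)
        then have "e2ennreal e < (\<integral>\<^sup>+x. u x \<partial>\<theta> t)" using elim(1) by simp
        then show ?case using e0 by (simp add: less_ennreal.rep_eq)
      qed
    qed
  qed simp
  have "lsc_along F (\<lambda>t. enn2ereal (\<integral>\<^sup>+x. u x \<partial>\<theta> t) + ereal (- (d * m (\<theta> t)))) (enn2ereal (\<integral>\<^sup>+x. u x \<partial>\<theta>') + ereal (- (d * m \<theta>')))"
    using 2 1 by (rule lsc_along_add)
  then have 3: "lsc_along F (\<lambda>t. enn2ereal (\<integral>\<^sup>+x. u x \<partial>\<theta> t) + ereal (- (d * m (\<theta> t)))) (eint \<theta>' f)"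
    unfolding u(2)[OF r(2)] minus_ereal_def by simp
  show ?thesis
    unfolding lsc_along_def
  proof (intro conjI allI impI)
    show "eint \<theta>' f \<noteq> -\<infinity>" using 3 by (simp add: lsc_along_def)
    fix e assume "e < eint \<theta>' f"
    then have "\<forall>\<^sub>F t in F. e < enn2ereal (\<integral>\<^sup>+x. u x \<partial>\<theta> t) + ereal (- (d * m (\<theta> t)))" using 3 by (simp add: lsc_along_def)
    then show "\<forall>\<^sub>F t in F. e < eint (\<theta> t) f"
      using r(1) by eventually_elim (simp add: u(2) minus_ereal_def)
  qed
qed

lemma m_radon_mid:
  assumes "compact (UNIV :: 'b set)" "\<mu> \<in> radon" "\<nu> \<in> radon" shows "m (radon_mid \<mu> \<nu>) = (m \<mu> + m \<nu>) / 2"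
proof -
  have e: "emeasure \<theta> UNIV = ennreal (m \<theta>)" if "\<theta> \<in> radon" for \<theta> :: "'b measure"
    unfolding m_def using that assms(1) by (rule radon_emeasure_compact)
  have "ennreal (m (radon_mid \<mu> \<nu>)) = ennreal (1/2) * (ennreal (m \<mu>) + ennreal (m \<nu>))"
    using emeasure_radon_mid[OF assms(2,3), of UNIV] assms by (simp add: e radon_mid_radon)
  also have "\<dots> = ennreal ((m \<mu> + m \<nu>) / 2)"
    by (rule half_ennreal) (auto simp: m_def)
  finally show ?thesis by (simp add: m_def)
qed

lemma Psi_radon_mid:
  fixes f :: "'b \<Rightarrow> ereal"
  assumes f: "f \<in> Psi" and r: "\<mu> \<in> radon" "\<nu> \<in> radon" and fin: "\<bar>eint \<mu> f\<bar> \<noteq> \<infinity>" "\<bar>eint \<nu> f\<bar> \<noteq> \<infinity>"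
  shows "eint (radon_mid \<mu> \<nu>) f = ereal ((real_of_ereal (eint \<mu> f) + real_of_ereal (eint \<nu> f)) / 2)"
proof -
  obtain u d where u: "lsc u" "\<And>\<theta>. \<theta> \<in> radon \<Longrightarrow> eint \<theta> f = enn2ereal (\<integral>\<^sup>+x. u x \<partial>\<theta>) - ereal (d * m \<theta>)"
    "0 \<le> d" "d = 0 \<or> compact (UNIV :: 'b set)" using Psi_eint[OF f] by metis
  have "(\<integral>\<^sup>+x. u x \<partial>\<mu>) \<noteq> top" "(\<integral>\<^sup>+x. u x \<partial>\<nu>) \<noteq> top" using fin unfolding u(2)[OF r(1)] u(2)[OF r(2)] by auto
  then obtain p q where pq: "(\<integral>\<^sup>+x. u x \<partial>\<mu>) = ennreal p" "0 \<le> p" "(\<integral>\<^sup>+x. u x \<partial>\<nu>) = ennreal q" "0 \<le> q"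
    by (metis ennreal_cases)
  have "(\<integral>\<^sup>+x. u x \<partial>radon_mid \<mu> \<nu>) = ennreal (1/2) * (ennreal p + ennreal q)"
    using nn_integral_radon_mid[OF r lsc_measurable[OF u(1)]] pq by simp
  also have "\<dots> = ennreal ((p + q) / 2)" using pq(2,4) by (rule half_ennreal)
  finally have 1: "(\<integral>\<^sup>+x. u x \<partial>radon_mid \<mu> \<nu>) = ennreal ((p + q) / 2)" .
  have 2: "d * m (radon_mid \<mu> \<nu>) = (d * m \<mu> + d * m \<nu>) / 2"
    using u(4) m_radon_mid[OF _ r] by (cases "d = 0") (auto simp: field_simps)
  show ?thesis
    unfolding u(2)[OF r(1)] u(2)[OF r(2)] u(2)[OF radon_mid_radon[OF r]] 1 2 pq
    using pq(2,4) by (simp add: field_simps)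
qed

text \<open>The iterated integral \<open>KE \<theta> \<zeta>\<close> is finite by
  \<open>KE_finite\<close>. Hence the potential of \<open>\<zeta>\<close> is integrable for
  \<open>\<theta>\<close> and finite off a \<open>\<theta>\<close>-null set.\<close>

lemma potential_integral:
  assumes \<theta>: "\<theta> \<in> fin_energy" and \<zeta>: "\<zeta> \<in> fin_energy"
  defines "v \<equiv> \<lambda>x. real_of_ereal (potential \<kappa> \<zeta> x)"
  shows "integrable \<theta> v" "(\<integral>x. v x \<partial>\<theta>) = B \<theta> \<zeta>" "AE x in \<theta>. \<bar>potential \<kappa> \<zeta> x\<bar> \<noteq> \<infinity>"
proof -
  note r = feD(1)[OF \<theta>] feD(1)[OF \<zeta>]
  let ?U = "\<lambda>x. \<integral>\<^sup>+y. K (x, y) \<partial>\<zeta>"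
  have Um: "?U \<in> borel_measurable \<theta>"
    using lsc_measurable[OF lsc_potential[OF K_lsc r(2)]] r by (simp add: radon_borel_measurable)
  have fin: "(\<integral>\<^sup>+x. ?U x \<partial>\<theta>) < top" using KE_finite[OF \<theta> \<zeta>] by (simp add: KE_def)
  have AEf: "AE x in \<theta>. ?U x \<noteq> top" using nn_integral_PInf_AE[OF Um] fin by (auto simp: less_top)
  have pv: "potential \<kappa> \<zeta> x = ereal (enn2real (?U x) - c * m \<zeta>)" if "?U x \<noteq> top" for x
    using that unfolding potential_eq[OF r(2)] by (cases "?U x") auto
  have AEv: "AE x in \<theta>. potential \<kappa> \<zeta> x = ereal (enn2real (?U x) - c * m \<zeta>)"
    using AEf by eventually_elim (rule pv)
  then show "AE x in \<theta>. \<bar>potential \<kappa> \<zeta> x\<bar> \<noteq> \<infinity>"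
    by eventually_elim simp
  have Ui: "integrable \<theta> (\<lambda>x. enn2real (?U x))"
  proof (rule integrableI_nonneg)
    show "(\<lambda>x. enn2real (?U x)) \<in> borel_measurable \<theta>" using Um by simp
    have "(\<integral>\<^sup>+x. ennreal (enn2real (?U x)) \<partial>\<theta>) \<le> (\<integral>\<^sup>+x. ?U x \<partial>\<theta>)"
      by (intro nn_integral_mono) (simp add: ennreal_enn2real_if)
    then show "(\<integral>\<^sup>+x. ennreal (enn2real (?U x)) \<partial>\<theta>) < \<infinity>" using fin by auto
  qed simp
  have UI: "(\<integral>x. enn2real (?U x) \<partial>\<theta>) = enn2real (KE \<theta> \<zeta>)"
  proof -
    have "(\<integral>x. enn2real (?U x) \<partial>\<theta>) = enn2real (\<integral>\<^sup>+x. ennreal (enn2real (?U x)) \<partial>\<theta>)"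
      using Ui by (intro integral_eq_nn_integral) auto
    also have "(\<integral>\<^sup>+x. ennreal (enn2real (?U x)) \<partial>\<theta>) = (\<integral>\<^sup>+x. ?U x \<partial>\<theta>)"
    proof (rule nn_integral_cong_AE)
      show "AE x in \<theta>. ennreal (enn2real (?U x)) = ?U x" using AEf by eventually_elim (simp add: less_top)
    qed
    finally show ?thesis by (simp add: KE_def)
  qed
  have ci: "integrable \<theta> (\<lambda>x. c * m \<zeta>)" "(\<integral>x. c * m \<zeta> \<partial>\<theta>) = c * (m \<theta> * m \<zeta>)"
  proof -
    show "integrable \<theta> (\<lambda>x. c * m \<zeta>)"
    proof (cases "c = 0")
      case False
      then have "finite_measure \<theta>" using kernel_space.fin[OF kernel_space_axioms r(1)] r by (intro finite_measureI) auto
      then show ?thesis by (rule finite_measure.integrable_const)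
    qed simp
    show "(\<integral>x. c * m \<zeta> \<partial>\<theta>) = c * (m \<theta> * m \<zeta>)" using r by (simp add: m_def)
  qed
  have i: "integrable \<theta> (\<lambda>x. enn2real (?U x) - c * m \<zeta>)" using Ui ci(1) by (rule Bochner_Integration.integrable_diff)
  have ae: "AE x in \<theta>. enn2real (?U x) - c * m \<zeta> = v x" using AEv by eventually_elim (simp add: v_def)
  have vm: "v \<in> borel_measurable \<theta>"
  proof -
    have "(\<lambda>x. enn2ereal (?U x)) \<in> borel_measurable \<theta>"
      by (rule measurable_compose[OF Um measurable_enn2ereal])
    then have "(\<lambda>x. enn2ereal (?U x) - ereal (c * m \<zeta>)) \<in> borel_measurable \<theta>"
      by (intro borel_measurable_ereal_diff borel_measurable_const)
    then have "(\<lambda>x. real_of_ereal (enn2ereal (?U x) - ereal (c * m \<zeta>))) \<in> borel_measurable \<theta>"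
      by (rule borel_measurable_real_of_ereal)
    then show ?thesis unfolding v_def by (simp add: potential_eq[OF r(2)])
  qed
  show "integrable \<theta> v"
    using i by (rule integrable_cong_AE_imp) (use vm ae in auto)
  have "(\<integral>x. v x \<partial>\<theta>) = (\<integral>x. enn2real (?U x) - c * m \<zeta> \<partial>\<theta>)"
    using vm i ae by (intro integral_cong_AE) (auto elim!: eventually_mono)
  also have "\<dots> = B \<theta> \<zeta>" using Ui ci UI by (simp add: B_def)
  finally show "(\<integral>x. v x \<partial>\<theta>) = B \<theta> \<zeta>" .
qed

text \<open>Almost everywhere for \<open>\<theta>\<close> both potentials are finite, and there
  \<open>f\<close> is their signed difference; the points where its value is not prescribed form a
  null set.\<close>

lemma case_II_eint:
  assumes \<theta>: "\<theta> \<in> fin_energy" and \<zeta>: "\<zeta>p \<in> fin_energy" "\<zeta>n \<in> fin_energy"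
    and f: "\<And>x. \<bar>potential \<kappa> \<zeta>p x\<bar> \<noteq> \<infinity> \<or> \<bar>potential \<kappa> \<zeta>n x\<bar> \<noteq> \<infinity> \<Longrightarrow>
        f x = ereal \<sigma> * (potential \<kappa> \<zeta>p x - potential \<kappa> \<zeta>n x)"
  shows "eint \<theta> f = ereal (\<sigma> * (B \<theta> \<zeta>p - B \<theta> \<zeta>n))"
proof -
  let ?v = "\<lambda>\<zeta> x. real_of_ereal (potential \<kappa> \<zeta> x)"
  note p = potential_integral[OF \<theta> \<zeta>(1)] and n = potential_integral[OF \<theta> \<zeta>(2)]
  have "AE x in \<theta>. f x = ereal (\<sigma> * (?v \<zeta>p x - ?v \<zeta>n x))"
    using p(3) n(3)
  proof eventually_elim
    case (elim x)
    then have "f x = ereal \<sigma> * (potential \<kappa> \<zeta>p x - potential \<kappa> \<zeta>n x)" by (intro f) simp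
    then show ?case using elim by (cases "potential \<kappa> \<zeta>p x"; cases "potential \<kappa> \<zeta>n x") auto
  qed
  then have "eint \<theta> f = ereal (\<integral>x. \<sigma> * (?v \<zeta>p x - ?v \<zeta>n x) \<partial>\<theta>)"
    using p(1) n(1) by (intro eint_integrable Bochner_Integration.integrable_mult_right Bochner_Integration.integrable_diff)
  then show ?thesis using p n by simp
qed

text \<open>No energy is minus infinity. If a self-energy of a Jordan part were infinite, the signed
  energy would be infinite too, also when infinity is subtracted, by the convention of
  \<open>ereal\<close>.\<close>

lemma finite_energy_parts:
  assumes \<zeta>: "\<zeta> \<in> finite_energy \<kappa>" shows "pos_part \<zeta> \<in> fin_energy" "neg_part \<zeta> \<in> fin_energy"
proof -
  have z: "\<zeta> \<in> signed_radon" "\<bar>senergy \<kappa> \<zeta> \<zeta>\<bar> \<noteq> \<infinity>" using \<zeta> by (auto simp: finite_energy_def)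
  define p q where "p = pos_part \<zeta>" and "q = neg_part \<zeta>"
  have r: "p \<in> radon" "q \<in> radon" unfolding p_def q_def using z by (auto intro: pos_part(1) neg_part_radon)
  have nm: "energy \<kappa> \<mu> \<nu> \<noteq> -\<infinity>" if "\<mu> \<in> radon" "\<nu> \<in> radon" for \<mu> \<nu>
    unfolding energy_eq[OF that] by (cases "KE \<mu> \<nu>") auto
  have "energy \<kappa> p p \<noteq> \<infinity> \<and> energy \<kappa> q q \<noteq> \<infinity>"
    using z(2) nm[OF r(1,1)] nm[OF r(2,2)] nm[OF r] nm[OF r(2,1)]
    unfolding senergy_def p_def[symmetric] q_def[symmetric]
    by (cases "energy \<kappa> p p"; cases "energy \<kappa> q q"; cases "energy \<kappa> p q"; cases "energy \<kappa> q p") auto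
  then show "pos_part \<zeta> \<in> fin_energy" "neg_part \<zeta> \<in> fin_energy"
    using r nm[OF r(1,1)] nm[OF r(2,2)] energy_finite_iff[OF r(1,1)] energy_finite_iff[OF r(2,2)]
    unfolding fin_energy_def p_def[symmetric] q_def[symmetric] by auto
qed

lemma fin_energy_nearly_compact_null:
  assumes "\<theta> \<in> fin_energy" "nearly_compact_via \<kappa> A S" "A \<in> sets borel"
  shows "emeasure \<theta> ((A - S) \<union> (S - A)) = 0"
proof -
  have S: "compact S" "inner_capacity \<kappa> ((A - S) \<union> (S - A)) = 0" using assms(2) by (auto simp: nearly_compact_via_def)
  have "S \<in> sets borel" using S(1) by (rule borel_compact)
  then have "(A - S) \<union> (S - A) \<in> sets borel" using assms(3) by (intro sets.Un sets.Diff)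
  then show ?thesis using S(2) by (rule capacity_zero_null[OF assms(1)])
qed

end

text \<open>\<open>carried\<close> speaks only of compact pieces of the complement; inner regularity
  passes from these to the whole complement.\<close>

lemma radon_on_null:
  assumes "\<theta> \<in> radon_on A" "A \<in> sets borel" shows "emeasure \<theta> (- A) = 0"
proof -
  have r: "\<theta> \<in> radon" and c: "carried \<theta> A" using assms by (auto simp: radon_on_def)
  have A: "- A \<in> sets borel" using assms(2) by (rule borel_comp)
  have "emeasure \<theta> K = 0" if K: "compact K" "K \<subseteq> - A" for K
  proof -
    have "K - A \<in> null_sets (completion \<theta>)" using c K by (simp add: carried_def)
    moreover have "K - A = K" using K by auto
    moreover have "K \<in> sets \<theta>" using r K by (simp add: borel_compact)
    ultimately show ?thesis by (auto simp: null_sets_completion_iff)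
  qed
  then show ?thesis by (subst radon_inner[OF r A]) (auto intro!: antisym SUP_least)
qed

lemma null_radon_on:
  assumes "\<theta> \<in> radon" "emeasure \<theta> (- A) = 0" "A \<in> sets borel" shows "\<theta> \<in> radon_on A"
  unfolding radon_on_def carried_def
proof (intro CollectI conjI allI impI assms(1) null_sets_completionI)
  fix K :: "'a set" assume K: "compact K"
  have "K - A \<in> sets borel" using sets.Diff[OF borel_compact[OF K] assms(3)] .
  moreover have "emeasure \<theta> (K - A) \<le> emeasure \<theta> (- A)" using assms by (intro emeasure_mono) auto
  ultimately show "K - A \<in> null_sets \<theta>" using assms by (intro null_setsI) auto
qed

section \<open>The constrained problem\<close>

lemma lsc_along_cong:
  assumes "lsc_along F u l" "\<forall>\<^sub>F t in F. u t = v t" shows "lsc_along F v l"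
  unfolding lsc_along_def
proof (intro conjI allI impI)
  show "l \<noteq> -\<infinity>" using assms by (simp add: lsc_along_def)
  fix e assume "e < l"
  then have "\<forall>\<^sub>F t in F. e < u t" using assms by (simp add: lsc_along_def)
  then show "\<forall>\<^sub>F t in F. e < v t" using assms(2) by eventually_elim simp
qed

lemma eint_pos_eq_iff:
  assumes "\<And>x. 0 < g x" "0 < a"
  shows "eint \<theta> (\<lambda>x. ereal (g x)) = ereal a \<longleftrightarrow> (\<integral>\<^sup>+x. ennreal (g x) \<partial>\<theta>) = ennreal a"
proof -
  have "e2ennreal (- ereal (g x)) = 0" for x using assms(1)[of x] by (intro e2ennreal_neg) simp
  then have "eint \<theta> (\<lambda>x. ereal (g x)) = enn2ereal (\<integral>\<^sup>+x. ennreal (g x) \<partial>\<theta>)"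
    by (simp add: eint_def zero_ennreal.rep_eq)
  also have "\<dots> = ereal a \<longleftrightarrow> (\<integral>\<^sup>+x. ennreal (g x) \<partial>\<theta>) = ennreal a"
    using assms(2) by (cases "\<integral>\<^sup>+x. ennreal (g x) \<partial>\<theta>") auto
  finally show ?thesis .
qed

lemma isign_cases: "isign I1 i = 1 \<or> isign I1 i = -1"
  by (simp add: isign_def)

lemma isign_mult_finite_iff: "\<bar>ereal (isign I1 i * isign I1 j) * x\<bar> \<noteq> \<infinity> \<longleftrightarrow> \<bar>x\<bar> \<noteq> \<infinity>"
  using isign_cases[of I1 i] isign_cases[of I1 j] by (cases x) auto

lemma eventually_in_net:
  assumes "directed_set T le" shows "\<forall>\<^sub>F t in net_filter T le. t \<in> T"
proof -
  obtain t where "t \<in> T" using assms by (auto simp: directed_set_def)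
  then show ?thesis unfolding eventually_net_filter[OF assms] by blast
qed

context kernel_space
begin

text \<open>Rewrites the external energy through the form \<open>B\<close>, where continuity under
  energy convergence and the behaviour at midpoints are immediate.\<close>

lemma case_II_field:
  assumes f: "case_II \<kappa> I1 I2 f"
  obtains p q where "p \<in> fin_energy" "q \<in> fin_energy"
    "\<And>i \<theta>. i \<in> I1 \<union> I2 \<Longrightarrow> \<theta> \<in> fin_energy \<Longrightarrow> eint \<theta> (f i) = ereal (isign I1 i * (B \<theta> p - B \<theta> q))"
proof -
  obtain \<zeta> where \<zeta>: "\<zeta> \<in> finite_energy \<kappa>" and fz: "\<forall>i\<in>I1 \<union> I2. \<forall>x.
      \<bar>potential \<kappa> (pos_part \<zeta>) x\<bar> \<noteq> \<infinity> \<or> \<bar>potential \<kappa> (neg_part \<zeta>) x\<bar> \<noteq> \<infinity> \<longrightarrow>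
        f i x = ereal (isign I1 i) * (potential \<kappa> (pos_part \<zeta>) x - potential \<kappa> (neg_part \<zeta>) x)"
    using f unfolding case_II_def by (elim bexE)
  note fi = fz[THEN bspec, THEN spec, THEN mp]
  show ?thesis
  proof (rule that[OF finite_energy_parts[OF \<zeta>]])
    fix i \<theta> assume "i \<in> I1 \<union> I2" "\<theta> \<in> fin_energy"
    then show "eint \<theta> (f i) = ereal (isign I1 i * (B \<theta> (pos_part \<zeta>) - B \<theta> (neg_part \<zeta>)))"
      using finite_energy_parts[OF \<zeta>] fi by (intro case_II_eint)
  qed
qed

text \<open>The external energy is even continuous here: on the class, vague convergence is
  convergence in energy, and \<open>B_tendsto1\<close> applies to both parts of the field.\<close>

lemma case_II_lsc_along:
  assumes p: "p \<in> fin_energy" and q: "q \<in> fin_energy" and \<Phi>: "\<And>\<theta>. \<theta> \<in> fin_energy \<Longrightarrow> \<Phi> \<theta> = ereal (\<sigma> * (B \<theta> p - B \<theta> q))"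
    and k: "approx_class k" and \<theta>: "\<forall>\<^sub>F t in F. \<theta> t \<in> k" "\<theta>' \<in> k"
    and conv: "\<And>\<phi>. \<phi> \<in> Cc \<Longrightarrow> ((\<lambda>t. \<integral>x. \<phi> x \<partial>\<theta> t) \<longlongrightarrow> (\<integral>x. \<phi> x \<partial>\<theta>')) F"
  shows "lsc_along F (\<lambda>t. \<Phi> (\<theta> t)) (\<Phi> \<theta>')"
proof -
  have fin_energy: "\<forall>\<^sub>F t in F. \<theta> t \<in> fin_energy" "\<theta>' \<in> fin_energy"
    using \<theta> k by (auto simp: approx_class_def elim!: eventually_mono)
  have sqdist: "((\<lambda>t. sqdist (\<theta> t) \<theta>') \<longlongrightarrow> 0) F" using k \<theta> conv by (rule sqdist_tendsto)
  have "((\<lambda>t. \<sigma> * (B (\<theta> t) p - B (\<theta> t) q)) \<longlongrightarrow> \<sigma> * (B \<theta>' p - B \<theta>' q)) F"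
    using fin_energy sqdist p q by (intro tendsto_intros B_tendsto1)
  then have "lsc_along F (\<lambda>t. ereal (\<sigma> * (B (\<theta> t) p - B (\<theta> t) q))) (\<Phi> \<theta>')"
    unfolding \<Phi>[OF fin_energy(2)] by (rule lsc_along_tendsto)
  then show ?thesis
    by (rule lsc_along_cong) (use fin_energy(1) in \<open>eventually_elim, simp add: \<Phi>\<close>)
qed

lemma case_II_radon_mid:
  assumes p: "p \<in> fin_energy" and q: "q \<in> fin_energy" and \<Phi>: "\<And>\<theta>. \<theta> \<in> fin_energy \<Longrightarrow> \<Phi> \<theta> = ereal (\<sigma> * (B \<theta> p - B \<theta> q))"
    and f: "\<mu> \<in> fin_energy" "\<nu> \<in> fin_energy"
  shows "\<Phi> (radon_mid \<mu> \<nu>) = ereal ((real_of_ereal (\<Phi> \<mu>) + real_of_ereal (\<Phi> \<nu>)) / 2)"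
proof -
  have m: "radon_mid \<mu> \<nu> \<in> fin_energy" unfolding radon_mid_def using f by (intro radon_lincomb_fin_energy) auto
  have b: "B (radon_mid \<mu> \<nu>) z = (B \<mu> z + B \<nu> z) / 2" if "z \<in> fin_energy" for z
    unfolding radon_mid_def using f that by (subst B_radon_lincomb) (auto simp: UNIV_bool)
  show ?thesis unfolding \<Phi>[OF m] \<Phi>[OF f(1)] \<Phi>[OF f(2)] by (simp add: b p q field_simps)
qed

end

theorem theorem6p5:
  fixes \<kappa> :: "'a::t2_space \<times> 'a \<Rightarrow> ereal"
    and I1 I2 I I0 :: "'i set"
    and A Ac :: "'i \<Rightarrow> 'a set"
    and a :: "'i \<Rightarrow> real"
    and g :: "'i \<Rightarrow> 'a \<Rightarrow> real"
    and f :: "'i \<Rightarrow> 'a \<Rightarrow> ereal"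
    and \<xi> :: "'i \<Rightarrow> 'a measure"
  assumes "locally_compact_space (euclidean :: 'a topology)"
    and "is_kernel \<kappa>" and "positive_definite \<kappa>"
    and "I = I1 \<union> I2" and "generalized_condenser I1 I2 A"
    and "\<forall>i\<in>I. 0 < a i"
    and "\<forall>i\<in>I. continuous_on UNIV (g i) \<and> (\<forall>x. 0 < g i x)"
    and "\<forall>i\<in>I. universally_measurable (f i)"
    and "I0 \<subseteq> I"
    and "\<forall>i\<in>I0. \<xi> i \<in> radon_on (A i) \<and> ereal (a i) < eint (\<xi> i) (\<lambda>x. ereal (g i x))"
    and "admissible \<kappa> I1 I2 A a g f I0 \<xi> \<noteq> {}"
    and "countable_at_infinity TYPE('a) \<or> (\<forall>i\<in>I. 0 < (INF x\<in>A i. g i x))"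
    and "case_I I f \<or> case_II \<kappa> I1 I2 f"
    and "finite I"
    and "\<forall>i\<in>I. nearly_compact_via \<kappa> (A i) (Ac i)"
    and "regular_kernel \<kappa>"
    and "\<forall>i\<in>I0. fin_continuous_on (Ac i) (potential \<kappa> (\<xi> i))"
    and "\<forall>i\<in>I - I0. fin_continuous_on (Ac i \<times> Ac i) \<kappa>"
  shows "solutions \<kappa> I1 I2 A a g f I0 \<xi> \<noteq> {} \<and>
      compactin (vec_vague I) (solutions \<kappa> I1 I2 A a g f I0 \<xi>) \<and>
      solutions \<kappa> I1 I2 A a g f I0 \<xi> =
        (\<Union>(T :: 't set, le, \<nu>) \<in> minimizing_nets \<kappa> I1 I2 A a g f I0 \<xi>.
           net_cluster_points (vec_vague I) T le \<nu>) \<and>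
      (\<forall>(T :: 't set, le, \<nu>) \<in> minimizing_nets \<kappa> I1 I2 A a g f I0 \<xi>.
         \<forall>\<mu>\<in>solutions \<kappa> I1 I2 A a g f I0 \<xi>.
           ((\<lambda>t. vec_dist \<kappa> I1 I2 (\<nu> t) \<mu>) \<longlongrightarrow> 0) (net_filter T le))"
proof -
  obtain c where c: "0 \<le> c" "\<And>z. - ereal c \<le> \<kappa> z" "c = 0 \<or> compact (UNIV :: 'a set)"
    using kernel_lower_bound[OF assms(2)] by blast
  interpret KS: kernel_space "TYPE('a)" \<kappa> c
    using assms(1-3) c by unfold_locales auto
  \<comment> \<open>The flag is the truth value of \<open>i \<in> I0\<close>, so constrained and
    free indices enter through the same family.\<close>
  define k where "k i = kclass (Ac i) (g i) (a i) (i \<in> I0) (\<xi> i)" for i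
  define \<Phi> where "\<Phi> i \<theta> = eint \<theta> (f i)" for i \<theta>
  have Ac: "compact (Ac i)" and Ab: "A i \<in> sets borel" and gi: "continuous_on UNIV (g i)" "\<And>x. 0 < g i x"
    and ai: "0 < a i" "0 \<le> a i" if "i \<in> I" for i
    using that assms(4,5,6,7,15) by (auto simp: nearly_compact_via_def generalized_condenser_def less_imp_le)
  have \<xi>r: "\<xi> i \<in> radon" if "i \<in> I0" for i using that assms(10) by (auto simp: radon_on_def)
  have k_approx: "KS.approx_class (k i)" if i: "i \<in> I" for i
  proof (cases "i \<in> I0")
    case True
    have "KS.approx_class (kclass (Ac i) (g i) (a i) True (\<xi> i))"
      using True assms(17) by (intro KS.approx_constrained Ac gi ai i \<xi>r) auto
    then show ?thesis using True by (simp add: k_def)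
  next
    case False
    have "KS.approx_class (kclass (Ac i) (g i) (a i) False (\<xi> i))"
      using False assms(18) i by (intro KS.approx_free Ac gi ai i) auto
    then show ?thesis using False by (simp add: k_def)
  qed
  have kr: "\<theta> \<in> radon" if "\<theta> \<in> k i" for i \<theta> using that by (simp add: k_def kclass_def)
  have kfe: "\<theta> \<in> KS.fin_energy" if "i \<in> I" "\<theta> \<in> k i" for i \<theta> using k_approx that by (auto simp: KS.approx_class_def)
  have \<Phi>: "lsc_along F (\<lambda>t. \<Phi> i (\<theta> t)) (\<Phi> i \<theta>')"
    if i: "i \<in> I" and \<theta>: "\<forall>\<^sub>F t in F. \<theta> t \<in> k i" "\<theta>' \<in> k i"
      and conv: "\<And>\<phi>. \<phi> \<in> Cc \<Longrightarrow> ((\<lambda>t. \<integral>x. \<phi> x \<partial>\<theta> t) \<longlongrightarrow> (\<integral>x. \<phi> x \<partial>\<theta>')) F"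
    for i \<theta>' and F :: "('i \<Rightarrow> 'a measure) filter" and \<theta>
    using assms(13)
  proof
    assume "case_I I f"
    then have "f i \<in> Psi" using i by (simp add: case_I_def)
    moreover have "\<forall>\<^sub>F t in F. \<theta> t \<in> radon" using \<theta>(1) by eventually_elim (rule kr)
    ultimately show ?thesis unfolding \<Phi>_def using kr[OF \<theta>(2)] conv by (intro KS.Psi_lsc_along)
  next
    assume "case_II \<kappa> I1 I2 f"
    then obtain p q where pq: "p \<in> KS.fin_energy" "q \<in> KS.fin_energy"
      "\<And>i \<theta>. i \<in> I1 \<union> I2 \<Longrightarrow> \<theta> \<in> KS.fin_energy \<Longrightarrow> eint \<theta> (f i) = ereal (isign I1 i * (KS.B \<theta> p - KS.B \<theta> q))"
      using KS.case_II_field by metis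
    then show ?thesis
      using i assms(4) by (intro KS.case_II_lsc_along[OF pq(1,2) _ k_approx[OF i] \<theta> conv]) (auto simp: \<Phi>_def)
  qed
  have \<Phi>m: "\<Phi> i (radon_mid \<mu> \<nu>) = ereal ((real_of_ereal (\<Phi> i \<mu>) + real_of_ereal (\<Phi> i \<nu>)) / 2)"
    if i: "i \<in> I" and \<mu>: "\<mu> \<in> k i" "\<nu> \<in> k i" and fin: "\<bar>\<Phi> i \<mu>\<bar> \<noteq> \<infinity>" "\<bar>\<Phi> i \<nu>\<bar> \<noteq> \<infinity>" for i \<mu> \<nu>
    using assms(13)
  proof
    assume "case_I I f"
    then have "f i \<in> Psi" using i by (simp add: case_I_def)
    then show ?thesis using kr \<mu> fin unfolding \<Phi>_def by (intro KS.Psi_radon_mid)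
  next
    assume "case_II \<kappa> I1 I2 f"
    then obtain p q where pq: "p \<in> KS.fin_energy" "q \<in> KS.fin_energy"
      "\<And>i \<theta>. i \<in> I1 \<union> I2 \<Longrightarrow> \<theta> \<in> KS.fin_energy \<Longrightarrow> eint \<theta> (f i) = ereal (isign I1 i * (KS.B \<theta> p - KS.B \<theta> q))"
      using KS.case_II_field by metis
    then show ?thesis
      using i assms(4) kfe[OF i] \<mu> by (intro KS.case_II_radon_mid[OF pq(1,2)]) (auto simp: \<Phi>_def)
  qed
  interpret GS: gauss "TYPE('a)" \<kappa> c I k "isign I1" \<Phi>
  proof
    show "finite I" by (rule assms(14))
    fix i assume i: "i \<in> I"
    show "KS.approx_class (k i)" by (rule k_approx[OF i])
    show "compactin vague_topology (k i)"
      unfolding k_def by (rule KS.kclass_compact[OF Ac[OF i] gi[OF i] ai(2)[OF i] \<xi>r])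
    show "radon_mid \<mu> \<nu> \<in> k i" if "\<mu> \<in> k i" "\<nu> \<in> k i" for \<mu> \<nu>
      using that \<xi>r unfolding k_def by (intro kclass_radon_mid Ac gi i)
  qed (rule \<Phi> \<Phi>m; assumption)+
  have adm: "admissible \<kappa> I1 I2 A a g f I0 \<xi> = GS.feasible"
  proof (intro equalityI subsetI)
    fix \<mu> assume "\<mu> \<in> admissible \<kappa> I1 I2 A a g f I0 \<xi>"
    then have \<mu>: "\<mu> \<in> vec_measures I A" "\<And>i j. i \<in> I \<Longrightarrow> j \<in> I \<Longrightarrow> \<bar>energy_term \<kappa> I1 \<mu> (i, j)\<bar> \<noteq> \<infinity>"
      "\<And>i. i \<in> I \<Longrightarrow> eint (\<mu> i) (\<lambda>x. ereal (g i x)) = ereal (a i)" "\<And>i. i \<in> I0 \<Longrightarrow> \<mu> i \<le> \<xi> i"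
      "\<And>i. i \<in> I \<Longrightarrow> \<bar>\<Phi> i (\<mu> i)\<bar> \<noteq> \<infinity>"
      unfolding admissible_def vec_finite_energy_def series_finite_def assms(4) \<Phi>_def by auto
    have "\<mu> i \<in> k i" if i: "i \<in> I" for i
    proof -
      have on: "\<mu> i \<in> radon_on (A i)" using \<mu>(1) i by (auto simp: vec_measures_def)
      then have r: "\<mu> i \<in> radon" by (simp add: radon_on_def)
      \<comment> \<open>Up to a sign, the diagonal terms of the energy series are the self-energies
        of the components.\<close>
      have "\<bar>energy \<kappa> (\<mu> i) (\<mu> i)\<bar> \<noteq> \<infinity>"
        using \<mu>(2)[OF i i] unfolding energy_term_def prod.case isign_mult_finite_iff .
      then have "\<mu> i \<in> KS.fin_energy" using KS.energy_finite_iff[OF r r] r by (simp add: KS.fin_energy_def)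
      then have n1: "emeasure (\<mu> i) ((A i - Ac i) \<union> (Ac i - A i)) = 0"
        using assms(15) i Ab[OF i] by (intro KS.fin_energy_nearly_compact_null) auto
      have n2: "emeasure (\<mu> i) (- A i) = 0" by (rule radon_on_null[OF on Ab[OF i]])
      have S: "A i \<in> sets (\<mu> i)" "Ac i \<in> sets (\<mu> i)" using r Ab[OF i] borel_compact[OF Ac[OF i]] by auto
      \<comment> \<open>The complement of \<open>Ac i\<close> is covered by the symmetric
        difference, null by zero capacity, and by the complement of \<open>A i\<close>, null because
        \<open>\<mu> i\<close> is carried by \<open>A i\<close>.\<close>
      have "emeasure (\<mu> i) (- Ac i) \<le> emeasure (\<mu> i) (((A i - Ac i) \<union> (Ac i - A i)) \<union> - A i)"
        using S r by (intro emeasure_mono) (auto intro!: sets.Un sets.Diff borel_comp)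
      also have "\<dots> \<le> emeasure (\<mu> i) ((A i - Ac i) \<union> (Ac i - A i)) + emeasure (\<mu> i) (- A i)"
        using S r by (intro emeasure_subadditive) (auto intro!: sets.Un sets.Diff borel_comp)
      finally have "emeasure (\<mu> i) (- Ac i) = 0" using n1 n2 by simp
      then show ?thesis
        using r \<mu>(3)[OF i] \<mu>(4)[of i] eint_pos_eq_iff[of "g i", OF gi(2)[OF i] ai(1)[OF i]] by (simp add: k_def kclass_def)
    qed
    then show "\<mu> \<in> GS.feasible"
      using \<mu>(1,5) by (auto simp: GS.feasible_def GS.class_prod_def vec_measures_def PiE_iff)
  next
    fix \<mu> assume \<mu>: "\<mu> \<in> GS.feasible"
    then have C: "\<mu> \<in> GS.class_prod" and fin: "\<And>i. i \<in> I \<Longrightarrow> \<bar>\<Phi> i (\<mu> i)\<bar> \<noteq> \<infinity>" by (auto simp: GS.feasible_def)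
    have ki: "\<mu> i \<in> k i" "\<mu> i \<in> KS.fin_energy" if "i \<in> I" for i using GS.class_prod_D[OF C that] by auto
    have "\<mu> i \<in> radon_on (A i)" if i: "i \<in> I" for i
    proof -
      have r: "\<mu> i \<in> radon" using kr ki i by blast
      have n1: "emeasure (\<mu> i) ((A i - Ac i) \<union> (Ac i - A i)) = 0"
        using assms(15) i Ab[OF i] by (intro KS.fin_energy_nearly_compact_null ki) auto
      have n2: "emeasure (\<mu> i) (- Ac i) = 0" using ki[OF i] by (simp add: k_def kclass_def)
      have S: "A i \<in> sets (\<mu> i)" "Ac i \<in> sets (\<mu> i)" using r Ab[OF i] borel_compact[OF Ac[OF i]] by auto
      have "emeasure (\<mu> i) (- A i) \<le> emeasure (\<mu> i) (((A i - Ac i) \<union> (Ac i - A i)) \<union> - Ac i)"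
        using S r by (intro emeasure_mono) (auto intro!: sets.Un sets.Diff borel_comp)
      also have "\<dots> \<le> emeasure (\<mu> i) ((A i - Ac i) \<union> (Ac i - A i)) + emeasure (\<mu> i) (- Ac i)"
        using S r by (intro emeasure_subadditive) (auto intro!: sets.Un sets.Diff borel_comp)
      finally show ?thesis using n1 n2 r Ab[OF i] by (intro null_radon_on) auto
    qed
    then have "\<mu> \<in> vec_measures I A" using C by (auto simp: vec_measures_def GS.class_prod_def PiE_iff)
    \<comment> \<open>Membership in the classes controls the self-energies; the mixed terms are
      finite by \<open>KE_finite\<close>, which is behind \<open>energy_fin_energy\<close>.\<close>
    moreover have "\<bar>energy_term \<kappa> I1 \<mu> z\<bar> \<noteq> \<infinity>" if zI: "z \<in> I \<times> I" for z
    proof -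
      obtain i j where z: "z = (i, j)" "i \<in> I" "j \<in> I" using zI by (rule SigmaE)
      show ?thesis unfolding z(1) energy_term_def prod.case isign_mult_finite_iff
        using ki z by (simp add: KS.energy_fin_energy)
    qed
    moreover have "eint (\<mu> i) (\<lambda>x. ereal (g i x)) = ereal (a i)" if i: "i \<in> I" for i
      unfolding eint_pos_eq_iff[of "g i", OF gi(2)[OF i] ai(1)[OF i]] using ki[OF i] by (simp add: k_def kclass_def)
    moreover have "\<mu> i \<le> \<xi> i" if "i \<in> I0" for i
      using ki[of i] that assms(9) by (auto simp: k_def kclass_def)
    ultimately show "\<mu> \<in> admissible \<kappa> I1 I2 A a g f I0 \<xi>"
      unfolding admissible_def vec_finite_energy_def series_finite_def assms(4)[symmetric]
      using fin assms(14) by (auto simp: \<Phi>_def intro!: summable_on_finite)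
  qed
  have ne: "GS.feasible \<noteq> {}" using assms(11) adm by simp
  have Gauss: "Gauss \<kappa> I1 I2 f \<mu> = GS.G \<mu>" if \<mu>: "\<mu> \<in> GS.feasible" for \<mu>
  proof -
    have ki: "\<mu> i \<in> KS.fin_energy" if "i \<in> I" for i using GS.class_prod_D(2) \<mu> that by (auto simp: GS.feasible_def)
    have "vec_energy \<kappa> I1 I2 \<mu> = (\<Sum>z\<in>I \<times> I. real_of_ereal (energy_term \<kappa> I1 \<mu> z))"
      unfolding vec_energy_def series_sum_def assms(4)[symmetric] using assms(14) by (intro infsum_finite) auto
    also have "\<dots> = (\<Sum>(i, j)\<in>I \<times> I. isign I1 i * isign I1 j * KS.B (\<mu> i) (\<mu> j))"
      using ki by (intro sum.cong) (auto simp: energy_term_def KS.energy_fin_energy)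
    also have "\<dots> = GS.Qform \<mu> \<mu>" unfolding GS.Qform_def by (rule sum.cartesian_product[symmetric])
    finally show ?thesis
      unfolding Gauss_def GS.G_def series_sum_def assms(4)[symmetric] \<Phi>_def using assms(14) by simp
  qed
  have dist: "vec_dist \<kappa> I1 I2 \<nu> \<mu> = sqrt (GS.Qform \<nu> \<nu> - GS.Qform \<nu> \<mu> - GS.Qform \<mu> \<nu> + GS.Qform \<mu> \<mu>)"
    if \<mu>: "\<mu> \<in> GS.feasible" "\<nu> \<in> GS.feasible" for \<mu> \<nu>
  proof -
    have ki: "\<mu> i \<in> KS.fin_energy" "\<nu> i \<in> KS.fin_energy" if "i \<in> I" for i using GS.class_prod_D(2) \<mu> that by (auto simp: GS.feasible_def)
    have "series_sum (\<lambda>(i, j). ereal (isign I1 i * isign I1 j) * senergy \<kappa> (radon_diff (\<nu> i) (\<mu> i)) (radon_diff (\<nu> j) (\<mu> j))) (I \<times> I)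
      = (\<Sum>z\<in>I \<times> I. real_of_ereal ((\<lambda>(i, j). ereal (isign I1 i * isign I1 j) * senergy \<kappa> (radon_diff (\<nu> i) (\<mu> i)) (radon_diff (\<nu> j) (\<mu> j))) z))"
      unfolding series_sum_def using assms(14) by (intro infsum_finite) auto
    also have "\<dots> = (\<Sum>(i, j)\<in>I \<times> I. isign I1 i * isign I1 j * (KS.B (\<nu> i) (\<nu> j) - KS.B (\<nu> i) (\<mu> j) - KS.B (\<mu> i) (\<nu> j) + KS.B (\<mu> i) (\<mu> j)))"
      using ki by (intro sum.cong) (auto simp: KS.senergy_diff)
    also have "\<dots> = GS.Qform \<nu> \<nu> - GS.Qform \<nu> \<mu> - GS.Qform \<mu> \<nu> + GS.Qform \<mu> \<mu>"
      unfolding GS.Qform_def sum.cartesian_product[symmetric]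
      by (simp add: distrib_left right_diff_distrib sum.distrib sum_subtractf)
    finally show ?thesis unfolding vec_dist_def assms(4)[symmetric] by simp
  qed
  have inf: "Gauss_inf \<kappa> I1 I2 A a g f I0 \<xi> = GS.inf_G"
    unfolding Gauss_inf_def GS.inf_G_def adm using Gauss by (intro INF_cong) auto
  have sol: "solutions \<kappa> I1 I2 A a g f I0 \<xi> = GS.minimizers"
    unfolding solutions_def GS.minimizers_def adm inf using Gauss by auto
  have mn: "directed_set T le" "\<And>t. t \<in> T \<Longrightarrow> \<nu> t \<in> GS.feasible" "((\<lambda>t. ereal (GS.G (\<nu> t))) \<longlongrightarrow> GS.inf_G) (net_filter T le)"
    if "(T, le, \<nu>) \<in> minimizing_nets \<kappa> I1 I2 A a g f I0 \<xi>" for T :: "'t set" and le \<nu>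
  proof -
    show d: "directed_set T le" and N: "\<And>t. t \<in> T \<Longrightarrow> \<nu> t \<in> GS.feasible"
      using that by (auto simp: minimizing_nets_def adm)
    have "((\<lambda>t. ereal (Gauss \<kappa> I1 I2 f (\<nu> t))) \<longlongrightarrow> GS.inf_G) (net_filter T le)"
      using that by (auto simp: minimizing_nets_def inf)
    \<comment> \<open>The two functionals agree on \<open>feasible\<close>, hence on the index set
      of the net, hence eventually.\<close>
    moreover have "\<forall>\<^sub>F t in net_filter T le. ereal (Gauss \<kappa> I1 I2 f (\<nu> t)) = ereal (GS.G (\<nu> t))"
      using eventually_in_net[OF d] by eventually_elim (simp add: N Gauss)
    ultimately show "((\<lambda>t. ereal (GS.G (\<nu> t))) \<longlongrightarrow> GS.inf_G) (net_filter T le)"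
      by (rule Lim_transform_eventually)
  qed
  have union: "GS.minimizers = (\<Union>(T :: 't set, le, \<nu>) \<in> minimizing_nets \<kappa> I1 I2 A a g f I0 \<xi>. net_cluster_points (vec_vague I) T le \<nu>)"
  proof (intro equalityI subsetI)
    fix \<mu> assume \<mu>: "\<mu> \<in> GS.minimizers"
    \<comment> \<open>A constant net over a one-point index set. Such a set exists in every type, so
      the equation holds for an arbitrary index type \<open>'t\<close>.\<close>
    let ?T = "{undefined :: 't}" and ?le = "\<lambda>_ _ :: 't. True" and ?\<nu> = "\<lambda>_ :: 't. \<mu>"
    have "\<mu> \<in> GS.feasible" "ereal (GS.G \<mu>) = GS.inf_G" using \<mu> by (auto simp: GS.minimizers_def)
    then have "(?T, ?le, ?\<nu>) \<in> minimizing_nets \<kappa> I1 I2 A a g f I0 \<xi>"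
      by (simp add: minimizing_nets_def directed_set_def adm inf Gauss)
    moreover have "\<mu> \<in> topspace (vec_vague I)"
      using compactin_subset_topspace[OF GS.minimizers_compact[OF ne]] \<mu> by blast
    then have "\<mu> \<in> net_cluster_points (vec_vague I) ?T ?le ?\<nu>" by (simp add: net_cluster_points_def)
    ultimately show "\<mu> \<in> (\<Union>(T :: 't set, le, \<nu>) \<in> minimizing_nets \<kappa> I1 I2 A a g f I0 \<xi>. net_cluster_points (vec_vague I) T le \<nu>)"
      by blast
  next
    fix \<mu> assume "\<mu> \<in> (\<Union>(T :: 't set, le, \<nu>) \<in> minimizing_nets \<kappa> I1 I2 A a g f I0 \<xi>. net_cluster_points (vec_vague I) T le \<nu>)"
    then obtain T :: "'t set" and le \<nu> where n: "(T, le, \<nu>) \<in> minimizing_nets \<kappa> I1 I2 A a g f I0 \<xi>"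
      "\<mu> \<in> net_cluster_points (vec_vague I) T le \<nu>" by blast
    show "\<mu> \<in> GS.minimizers" using GS.cluster_point[OF mn(1,2,3)[OF n(1)] n(2)] by blast
  qed
  have strong: "((\<lambda>t. vec_dist \<kappa> I1 I2 (\<nu> t) \<mu>) \<longlongrightarrow> 0) (net_filter T le)"
    if n: "(T, le, \<nu>) \<in> minimizing_nets \<kappa> I1 I2 A a g f I0 \<xi>" and \<mu>: "\<mu> \<in> GS.minimizers" for T :: "'t set" and le \<nu> \<mu>
  proof -
    note N = mn[OF n]
    have "((\<lambda>t. sqrt (GS.Qform (\<nu> t) (\<nu> t) - GS.Qform (\<nu> t) \<mu> - GS.Qform \<mu> (\<nu> t) + GS.Qform \<mu> \<mu>)) \<longlongrightarrow> sqrt 0) (net_filter T le)"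
      using N \<mu> by (intro tendsto_real_sqrt GS.strong_convergence)
    moreover have "\<mu> \<in> GS.feasible" using \<mu> by (simp add: GS.minimizers_def)
    then have "\<forall>\<^sub>F t in net_filter T le. sqrt (GS.Qform (\<nu> t) (\<nu> t) - GS.Qform (\<nu> t) \<mu> - GS.Qform \<mu> (\<nu> t) + GS.Qform \<mu> \<mu>) = vec_dist \<kappa> I1 I2 (\<nu> t) \<mu>"
      using eventually_in_net[OF N(1)] by (auto simp: N(2) dist elim: eventually_mono)
    ultimately have "((\<lambda>t. vec_dist \<kappa> I1 I2 (\<nu> t) \<mu>) \<longlongrightarrow> sqrt 0) (net_filter T le)" by (rule Lim_transform_eventually)
    then show ?thesis by simp
  qed
  show ?thesis
    unfolding sol using GS.minimizers_nonempty[OF ne] GS.minimizers_compact[OF ne] union strong by blast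
qed

end
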